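(* Let $n\geq 1$ be an integer, let $c_0,\dots,c_{n-1}$ be non-zero integers and let $m_0,\dots,m_n\geq 2$ be integers. Assume that $$\sum_{\substack{0\leq i\leq n\\ i\neq j}}\frac{1}{m_i(m_i+1)}\geq 1$$ for some $j\in\{0,\dots,n\}$. Then there exist constants $c\geq 0$ and $\eta>0$ such that, for $B\geq 1$, $$N(\mathbb{P}^{n-1},\Delta;B)=c\,B^{\sum_{i=0}^n\frac{1}{m_i}-1}+O\left(B^{\sum_{i=0}^n\frac{1}{m_i}-1-\eta}\right),$$ where the implied constant depends only on $m_0,\dots,m_n$, $n$ and $c_0,\dots,c_{n-1}$.
   Context: A non-zero integer $x$ is called $m$-full if $p^m\mid x$ for every prime $p$ dividing $x$. For $\mathbf{x}=(x_0,\dots,x_n)$ write $|\mathbf{x}|=\max_{0\leq i\leq n}|x_i|$. The counting function is $$N(\mathbb{P}^{n-1},\Delta;B)=\frac{1}{2}\#\left\{\mathbf{x}\in(\mathbb{Z}\setminus\{0\})^{n+1}: \gcd(x_0,\dots,x_{n-1})=1,\ |\mathbf{x}|\leq B,\ x_i \text{ is } m_i\text{-full for all } 0\leq i\leq n,\ c_0x_0+\dots+c_{n-1}x_{n-1}=x_n\right\}.$$ (This counts rational points $(x_0:\dots:x_{n-1})\in\mathbb{P}^{n-1}(\mathbb{Q})$ of height $\max|x_i|$ at most $B$ that are Campana points of the orbifold $(\mathbb{P}^{n-1},\Delta)$, $\Delta=\sum_{i=0}^n(1-1/m_i)D_i$, with $D_i=\{x_i=0\}$ for $i<n$ and $D_n=\{c_0x_0+\dots+c_{n-1}x_{n-1}=0\}$.)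 *)

theory Defs
  imports Complex_Main "HOL-Library.FuncSet" "HOL-Computational_Algebra.Primes"
begin

definition m_full :: "nat \<Rightarrow> int \<Rightarrow> bool" where
  "m_full m x \<longleftrightarrow> x \<noteq> 0 \<and> (\<forall>p::int. prime p \<longrightarrow> p dvd x \<longrightarrow> p ^ m dvd x)"

definition max_abs :: "nat \<Rightarrow> (nat \<Rightarrow> int) \<Rightarrow> int" where
  "max_abs n x = Max ((\<lambda>i. \<bar>x i\<bar>) ` {..n})"

text \<open>
  A vector \<open>(x\<^sub>0, \<dots>, x\<^sub>n)\<close> is a function on the index set \<open>{..n}\<close>. Extensionality (via \<open>PiE\<close>)
  fixes its values outside that set, so that distinct elements are distinct vectors.
  The gcd condition only involves \<open>x\<^sub>0, \<dots>, x\<^sub>n\<^sub>-\<^sub>1\<close>.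
\<close>
definition campana_vectors ::
    "nat \<Rightarrow> (nat \<Rightarrow> int) \<Rightarrow> (nat \<Rightarrow> nat) \<Rightarrow> real \<Rightarrow> (nat \<Rightarrow> int) set" where
  "campana_vectors n c m B =
     {x \<in> {..n} \<rightarrow>\<^sub>E (UNIV - {0}).
        Gcd (x ` {..<n}) = 1 \<and>
        real_of_int (max_abs n x) \<le> B \<and>
        (\<forall>i\<le>n. m_full (m i) (x i)) \<and>
        (\<Sum>i<n. c i * x i) = x n}"

definition N_campana :: "nat \<Rightarrow> (nat \<Rightarrow> int) \<Rightarrow> (nat \<Rightarrow> nat) \<Rightarrow> real \<Rightarrow> real" where
  "N_campana n c m B = (1 / 2) * real (card (campana_vectors n c m B))"

end

theory Submission
  imports Defs "HOL-Analysis.Analysis" "HOL-Number_Theory.Cong" "HOL-Computational_Algebra.Computational_Algebra"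
begin

text \<open>
  The points are counted by the circle method. A congruence version of decoupling for the moment
  curve, in which \<open>p\<close>-adic discs play the role of intervals, gives Vinogradov's mean value theorem, and
  from it the sharp mean value of order \<open>m (m + 1)\<close> for the exponential sum over \<open>m\<close>-full numbers; by
  Hoelder's inequality the hypothesis on \<open>\<Sum> 1 / (m\<^sub>i (m\<^sub>i + 1))\<close> then makes the minor arcs negligible, since
  Weyl's inequality still saves a power in the sum with index \<open>j\<close>.

  No singular series is evaluated. All Fourier analysis takes place modulo an integer \<open>Q\<close>
  proportional to \<open>B\<close>; the major arcs for \<open>B\<close> and for \<open>B' \<in> [B, 2 B]\<close> correspond to each other, and the normalised
  sums at corresponding points differ by a power of \<open>B\<close>. Hence the normalised counting function is a
  Cauchy sequence with a polynomial rate. The condition on the gcd is removed by Moebius inversion,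
  all estimates being uniform in the square-free modulus \<open>d\<close> with a saving \<open>d\<^sup>-\<^sup>3\<^sup>/\<^sup>2\<close>.
\<close>

section \<open>Averages over finite sets\<close>

text \<open>The order \<open>m (m + 1)\<close> is exactly what a sum over \<open>m\<close>-full
  numbers tolerates. For fixed \<open>w\<close> in \<open>x = u^m w\<close> the mean value of that
  order is about \<open>(B / w)^m\<close>, with root \<open>(B / w)^(1 / (m + 1))\<close>; as
  \<open>w\<close> runs over \<open>(m + 1)\<close>-full numbers these roots add up to
  \<open>B^(1 / (m + 1))\<close> up to \<open>B^\<epsilon>\<close>, so Minkowski's inequality over
  \<open>w\<close> loses nothing. Decoupling in degree \<open>k\<close> is a bootstrap in the
  exponent \<eta> of the constant. For two discs that are incongruent modulo a fixed prime
  \<open>p > k\<close>, frequencies can be translated along polynomials that are constant on one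
  disc and look like a moment curve of degree \<open>l < k\<close> on the other; the theorem in
  degree \<open>l\<close> then splits the second disc without touching the first. Alternating this
  with a Hoelder inequality that exchanges the discs lowers \<eta> by a fixed amount as long as
  \<eta> stays above a positive bound, so the infimum of the admissible exponents cannot be
  positive. The comparison of \<open>B\<close> with \<open>B'\<close> works because the major arcs
  are indexed by a set independent of \<open>B\<close>, and because the full numbers in a
  progression have a main term \<open>\<kappa> y^(1 / m)\<close> whose \<kappa>, never evaluated, is
  the same for all \<open>y\<close>.\<close>

lemma weighted_arith_geo_mean:
  fixes y \<theta> :: "'a \<Rightarrow> real"
  assumes "finite I" "\<And>i. i \<in> I \<Longrightarrow> 0 < \<theta> i" "(\<Sum>i\<in>I. \<theta> i) = 1" "\<And>i. i \<in> I \<Longrightarrow> 0 \<le> y i"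
  shows "(\<Prod>i\<in>I. y i powr \<theta> i) \<le> (\<Sum>i\<in>I. \<theta> i * y i)"
proof (cases "\<exists>i\<in>I. y i = 0")
  case True
  then have "(\<Prod>i\<in>I. y i powr \<theta> i) = 0" using assms(1) by (auto intro!: prod_zero)
  moreover have "0 \<le> (\<Sum>i\<in>I. \<theta> i * y i)" using assms by (intro sum_nonneg) (auto simp: less_imp_le)
  ultimately show ?thesis by simp
next
  case False
  have ne: "I \<noteq> {}" using assms(3) by auto
  have pos: "0 < y i" if "i \<in> I" for i using False assms(4)[OF that] that by force
  have "(\<Prod>i\<in>I. y i powr \<theta> i) = exp (\<Sum>i\<in>I. \<theta> i * ln (y i))"
    using pos assms(1) by (simp add: exp_sum powr_def less_imp_neq[symmetric] cong: prod.cong)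
  also have "\<dots> = exp (\<Sum>i\<in>I. \<theta> i *\<^sub>R ln (y i))" by simp
  also have "\<dots> \<le> (\<Sum>i\<in>I. \<theta> i * exp (ln (y i)))"
    using convex_on_sum[OF assms(1) ne exp_convex assms(3), of "\<lambda>i. ln (y i)"] assms(2) by (simp add: less_imp_le)
  also have "\<dots> = (\<Sum>i\<in>I. \<theta> i * y i)" using pos by (intro sum.cong) auto
  finally show ?thesis .
qed

text \<open>Each \<open>f i\<close> is divided by its sum over \<open>S\<close>; the weighted
  arithmetic-geometric mean inequality at every point then sums to 1. If one of these sums is 0,
  that factor vanishes on \<open>S\<close> and the left side is 0.\<close>

lemma Holder_inequality_sum:
  fixes f :: "'a \<Rightarrow> 'b \<Rightarrow> real"
  assumes "finite I" "\<And>i. i \<in> I \<Longrightarrow> 0 < \<theta> i" "(\<Sum>i\<in>I. \<theta> i) = 1"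
    and nn: "\<And>i x. i \<in> I \<Longrightarrow> x \<in> S \<Longrightarrow> 0 \<le> f i x" and "finite S"
  shows "(\<Sum>x\<in>S. \<Prod>i\<in>I. f i x powr \<theta> i) \<le> (\<Prod>i\<in>I. (\<Sum>x\<in>S. f i x) powr \<theta> i)"
proof (cases "\<exists>i\<in>I. (\<Sum>x\<in>S. f i x) = 0")
  case True
  then obtain i where i: "i \<in> I" "(\<Sum>x\<in>S. f i x) = 0" by auto
  then have "\<forall>x\<in>S. f i x = 0" using sum_nonneg_eq_0_iff[OF \<open>finite S\<close>, of "f i"] nn by auto
  then have "(\<Sum>x\<in>S. \<Prod>i\<in>I. f i x powr \<theta> i) = 0"
    using i assms(1) by (intro sum.neutral ballI prod_zero) auto
  then show ?thesis by (simp add: prod_nonneg)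
next
  case False
  define F where "F i = (\<Sum>x\<in>S. f i x)" for i
  have Fpos: "0 < F i" if "i \<in> I" for i
    using False that nn[OF that] sum_nonneg[of S "f i"] unfolding F_def by fastforce
  have "(\<Sum>x\<in>S. \<Prod>i\<in>I. f i x powr \<theta> i) = (\<Sum>x\<in>S. (\<Prod>i\<in>I. F i powr \<theta> i) * (\<Prod>i\<in>I. (f i x / F i) powr \<theta> i))"
  proof (intro sum.cong refl)
    fix x assume "x \<in> S"
    have "f i x powr \<theta> i = F i powr \<theta> i * (f i x / F i) powr \<theta> i" if "i \<in> I" for i
      using Fpos[OF that] nn[OF that \<open>x \<in> S\<close>] by (simp add: powr_divide)
    then show "(\<Prod>i\<in>I. f i x powr \<theta> i) = (\<Prod>i\<in>I. F i powr \<theta> i) * (\<Prod>i\<in>I. (f i x / F i) powr \<theta> i)"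
      by (simp add: prod.distrib[symmetric] cong: prod.cong)
  qed
  also have "\<dots> \<le> (\<Sum>x\<in>S. (\<Prod>i\<in>I. F i powr \<theta> i) * (\<Sum>i\<in>I. \<theta> i * (f i x / F i)))"
    using assms(1,2,3) Fpos nn
    by (intro sum_mono mult_left_mono weighted_arith_geo_mean prod_nonneg) (auto simp: less_imp_le)
  also have "\<dots> = (\<Prod>i\<in>I. F i powr \<theta> i) * (\<Sum>i\<in>I. \<theta> i * (F i / F i))"
  proof -
    have "(\<Sum>x\<in>S. \<Sum>i\<in>I. \<theta> i * (f i x / F i)) = (\<Sum>i\<in>I. \<theta> i * (F i / F i))"
      by (subst sum.swap) (simp only: F_def sum_distrib_left[symmetric] sum_divide_distrib[symmetric])
    then show ?thesis by (simp only: sum_distrib_left[symmetric])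
  qed
  also have "(\<Sum>i\<in>I. \<theta> i * (F i / F i)) = 1"
  proof -
    have "(\<Sum>i\<in>I. \<theta> i * (F i / F i)) = (\<Sum>i\<in>I. \<theta> i)"
      by (intro sum.cong refl) (metis Fpos less_irrefl divide_self mult.right_neutral)
    then show ?thesis using assms(3) by simp
  qed
  finally show ?thesis by (simp add: F_def)
qed

lemma convex_on_power_nonneg: "convex_on {0::real..} (\<lambda>x. x ^ n)"
  using convex_power_even[of n] convex_power_odd[of n] convex_on_subset by (cases "even n") blast+

text \<open>This is the triangle inequality in \<open>L^n\<close> with weight \<open>w\<close>, kept
  in \<open>n\<close>-th powers: Jensen's inequality for \<open>t ^ n\<close> with the weights
  \<open>N j / T\<close>, where \<open>T\<close> is the sum of the \<open>N j\<close>. It serves to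
  move an average past a sum over discs or over kernels.\<close>

lemma Minkowski_inequality_power_sum:
  fixes X :: "'a \<Rightarrow> 'b \<Rightarrow> real" and w :: "'b \<Rightarrow> real"
  assumes "finite J" "finite S" and n: "n \<ge> 1"
    and w: "\<And>x. x \<in> S \<Longrightarrow> 0 \<le> w x" and X: "\<And>j x. j \<in> J \<Longrightarrow> x \<in> S \<Longrightarrow> 0 \<le> X j x"
    and N: "\<And>j. j \<in> J \<Longrightarrow> 0 \<le> N j"
    and le: "\<And>j. j \<in> J \<Longrightarrow> (\<Sum>x\<in>S. w x * X j x ^ n) \<le> N j ^ n"
  shows "(\<Sum>x\<in>S. w x * (\<Sum>j\<in>J. X j x) ^ n) \<le> (\<Sum>j\<in>J. N j) ^ n"
proof -
  \<comment> \<open>Indices with \<open>N j = 0\<close> are split off, because the weights below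
    involve division by \<open>N j\<close>; for them \<open>w x * X j x ^ n\<close> vanishes on all
    of \<open>S\<close>.\<close>
  define J' where "J' = {j\<in>J. N j > 0}"
  have fin: "finite J'" using assms(1) by (simp add: J'_def)
  have zero: "w x * X j x ^ n = 0" if "j \<in> J - J'" "x \<in> S" for j x
  proof -
    have "N j = 0" using that N[of j] by (auto simp: J'_def)
    then have "(\<Sum>x\<in>S. w x * X j x ^ n) = 0"
      using le[of j] that n w X by (intro antisym sum_nonneg) (auto simp: power_0_left)
    then show ?thesis
      using sum_nonneg_eq_0_iff[OF assms(2), of "\<lambda>x. w x * X j x ^ n"] that w X by auto
  qed
  have red: "w x * (\<Sum>j\<in>J. X j x) ^ n = w x * (\<Sum>j\<in>J'. X j x) ^ n" if "x \<in> S" for x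
  proof (cases "w x = 0")
    case False
    then have "X j x = 0" if "j \<in> J - J'" for j using zero[OF that \<open>x \<in> S\<close>] n by simp
    then have "(\<Sum>j\<in>J. X j x) = (\<Sum>j\<in>J'. X j x)"
      using assms(1) by (intro sum.mono_neutral_right) (auto simp: J'_def)
    then show ?thesis by simp
  qed simp
  have sumN: "(\<Sum>j\<in>J. N j) = (\<Sum>j\<in>J'. N j)"
    using assms(1) N by (intro sum.mono_neutral_right) (force simp: J'_def)+
  show ?thesis
  proof (cases "J' = {}")
    case True
    then have "(\<Sum>x\<in>S. w x * (\<Sum>j\<in>J. X j x) ^ n) = 0"
      using n red by (intro sum.neutral) (simp add: power_0_left)
    then show ?thesis using True sumN by (simp add: power_0_left)
  next
    case False
    define T where "T = (\<Sum>j\<in>J'. N j)"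
    have T: "T > 0" unfolding T_def using False fin by (intro sum_pos) (auto simp: J'_def)
    have pw: "(\<Sum>j\<in>J'. X j x) ^ n \<le> (\<Sum>j\<in>J'. N j / T * (X j x * T / N j) ^ n)" if "x \<in> S" for x
    proof -
      have "(\<Sum>j\<in>J'. X j x) = (\<Sum>j\<in>J'. (N j / T) *\<^sub>R (X j x * T / N j))"
        using T by (intro sum.cong) (auto simp: J'_def)
      then show ?thesis
        using convex_on_sum[OF fin False convex_on_power_nonneg[of n], of "\<lambda>j. N j / T" "\<lambda>j. X j x * T / N j"]
          T that X by (auto simp: J'_def T_def sum_divide_distrib[symmetric])
    qed
    have "(\<Sum>x\<in>S. w x * (\<Sum>j\<in>J. X j x) ^ n) = (\<Sum>x\<in>S. w x * (\<Sum>j\<in>J'. X j x) ^ n)"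
      by (intro sum.cong refl red)
    also have "\<dots> \<le> (\<Sum>x\<in>S. w x * (\<Sum>j\<in>J'. N j / T * (X j x * T / N j) ^ n))"
      by (intro sum_mono mult_left_mono pw w)
    also have "\<dots> = (\<Sum>j\<in>J'. \<Sum>x\<in>S. w x * (N j / T * (X j x * T / N j) ^ n))"
      by (simp add: sum_distrib_left) (rule sum.swap)
    also have "\<dots> = (\<Sum>j\<in>J'. N j / T * (T / N j) ^ n * (\<Sum>x\<in>S. w x * X j x ^ n))"
      by (simp add: sum_distrib_left sum_divide_distrib power_mult_distrib power_divide mult_ac)
    also have "\<dots> \<le> (\<Sum>j\<in>J'. N j / T * (T / N j) ^ n * N j ^ n)"
      using T le by (intro sum_mono mult_left_mono) (auto simp: J'_def)
    also have "\<dots> = (\<Sum>j\<in>J'. N j / T * T ^ n)"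
      by (intro sum.cong) (auto simp: J'_def power_divide)
    also have "\<dots> = T ^ n" using T by (simp add: sum_distrib_right[symmetric] sum_divide_distrib[symmetric] T_def[symmetric])
    finally show ?thesis by (simp add: sumN T_def)
  qed
qed

text \<open>The mean over the empty set is \<open>0\<close>.\<close>
definition avg :: "'a set \<Rightarrow> ('a \<Rightarrow> real) \<Rightarrow> real" where
  "avg S F = (\<Sum>x\<in>S. F x) / real (card S)"

lemma avg_nonneg: "(\<And>x. x \<in> S \<Longrightarrow> 0 \<le> F x) \<Longrightarrow> 0 \<le> avg S F"
  by (simp add: avg_def sum_nonneg)

lemma avg_mono: "(\<And>x. x \<in> S \<Longrightarrow> F x \<le> G x) \<Longrightarrow> avg S F \<le> avg S G"
  by (simp add: avg_def sum_mono divide_right_mono)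

lemma avg_cong: "S = T \<Longrightarrow> (\<And>x. x \<in> T \<Longrightarrow> F x = G x) \<Longrightarrow> avg S F = avg T G"
  by (simp add: avg_def)

lemma avg_const: "finite S \<Longrightarrow> S \<noteq> {} \<Longrightarrow> avg S (\<lambda>_. c) = c"
  by (simp add: avg_def)

lemma avg_add: "avg S (\<lambda>x. F x + G x) = avg S F + avg S G"
  by (simp add: avg_def sum.distrib add_divide_distrib)

lemma avg_cmult: "avg S (\<lambda>x. c * F x) = c * avg S F"
  by (simp add: avg_def sum_distrib_left)

lemma avg_sum: "avg S (\<lambda>x. \<Sum>i\<in>I. F i x) = (\<Sum>i\<in>I. avg S (F i))"
  by (simp add: avg_def sum_divide_distrib) (rule sum.swap)

lemma avg_swap: "avg S (\<lambda>x. avg T (F x)) = avg T (\<lambda>y. avg S (\<lambda>x. F x y))"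
  by (simp add: avg_def sum_divide_distrib[symmetric] sum.swap[of F T S] mult.commute)

lemma avg_Minkowski:
  fixes X :: "'a \<Rightarrow> 'b \<Rightarrow> real"
  assumes "finite J" "finite S" "n \<ge> 1"
    and "\<And>x. x \<in> S \<Longrightarrow> 0 \<le> w x" "\<And>j x. j \<in> J \<Longrightarrow> x \<in> S \<Longrightarrow> 0 \<le> X j x"
    and "\<And>j. j \<in> J \<Longrightarrow> 0 \<le> N j" "\<And>j. j \<in> J \<Longrightarrow> avg S (\<lambda>x. w x * X j x ^ n) \<le> N j ^ n"
  shows "avg S (\<lambda>x. w x * (\<Sum>j\<in>J. X j x) ^ n) \<le> (\<Sum>j\<in>J. N j) ^ n"
proof -
  have *: "avg S (\<lambda>x. w x * F x) = (\<Sum>x\<in>S. (w x / card S) * F x)" for F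
    by (simp add: avg_def sum_divide_distrib)
  show ?thesis
    unfolding * using assms unfolding * by (intro Minkowski_inequality_power_sum) auto
qed

lemma avg_Holder:
  fixes f :: "'a \<Rightarrow> 'b \<Rightarrow> real"
  assumes "finite I" "\<And>i. i \<in> I \<Longrightarrow> 0 < \<theta> i" "(\<Sum>i\<in>I. \<theta> i) = 1"
    and nn: "\<And>i x. i \<in> I \<Longrightarrow> x \<in> S \<Longrightarrow> 0 \<le> f i x" and "finite S"
  shows "avg S (\<lambda>x. \<Prod>i\<in>I. f i x powr \<theta> i) \<le> (\<Prod>i\<in>I. avg S (f i) powr \<theta> i)"
proof (cases "S = {}")
  case False
  then have c: "0 < real (card S)" using assms by (simp add: card_gt_0_iff)
  have "(\<Prod>i\<in>I. avg S (f i) powr \<theta> i) = (\<Prod>i\<in>I. (\<Sum>x\<in>S. f i x) powr \<theta> i / real (card S) powr \<theta> i)"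
    using nn by (intro prod.cong refl) (simp add: avg_def powr_divide sum_nonneg)
  also have "\<dots> = (\<Prod>i\<in>I. (\<Sum>x\<in>S. f i x) powr \<theta> i) / (\<Prod>i\<in>I. real (card S) powr \<theta> i)"
    by (simp add: prod_dividef)
  also have "(\<Prod>i\<in>I. real (card S) powr \<theta> i) = real (card S)"
    using assms(1,3) c by (simp add: powr_sum[symmetric])
  finally show ?thesis
    using Holder_inequality_sum[OF assms] c by (simp add: avg_def divide_right_mono)
qed (simp add: avg_def prod_nonneg)

text \<open>Hoelder's inequality with exponents \<open>(a + b) / a\<close> and
  \<open>(a + b) / b\<close>, written without roots so that the integer identities between critical
  exponents can be inserted directly. The cases \<open>a = 0\<close> and \<open>b = 0\<close> are
  separate because the weights in \<open>avg_Holder\<close> must be positive.\<close>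

lemma avg_Holder2:
  assumes "finite S" and nn: "\<And>x. x \<in> S \<Longrightarrow> 0 \<le> F x" "\<And>x. x \<in> S \<Longrightarrow> 0 \<le> G x" "\<And>x. x \<in> S \<Longrightarrow> 0 \<le> H x"
    and le: "\<And>x. x \<in> S \<Longrightarrow> F x ^ (a + b) \<le> G x ^ a * H x ^ b" and ab: "a + b > 0"
  shows "avg S F ^ (a + b) \<le> avg S G ^ a * avg S H ^ b"
proof -
  consider "a = 0" | "b = 0" | "a > 0" "b > 0" by linarith
  then show ?thesis
  proof cases
    case 1
    have "F x \<le> H x" if "x \<in> S" for x using le[OF that] 1 ab nn[OF that] power_mono_iff[of "F x" "H x" b] by simp
    then show ?thesis using 1 nn by (auto intro!: power_mono avg_mono avg_nonneg)
  next
    case 2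
    have "F x \<le> G x" if "x \<in> S" for x using le[OF that] 2 ab nn[OF that] power_mono_iff[of "F x" "G x" a] by simp
    then show ?thesis using 2 nn by (auto intro!: power_mono avg_mono avg_nonneg)
  next
    case 3
    define c where "c = real (a + b)"
    have c: "c > 0" using 3 by (simp add: c_def)
    have rt: "x \<le> (y powr (real a / c)) * (z powr (real b / c))" if "x \<ge> 0" "y \<ge> 0" "z \<ge> 0" "x ^ (a + b) \<le> y ^ a * z ^ b" for x y z :: real
    proof -
      have "x = (x ^ (a + b)) powr (1 / c)"
      proof (cases "x = 0")
        case False
        then have "x ^ (a + b) = x powr c" using that unfolding c_def by (subst powr_realpow) auto
        then show ?thesis using c that False by (simp add: powr_powr)
      qed (use 3 in simp)
      also have "\<dots> \<le> (y ^ a * z ^ b) powr (1 / c)" using that c by (intro powr_mono2) auto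
      also have "\<dots> = (y ^ a) powr (1 / c) * (z ^ b) powr (1 / c)" by (simp add: powr_mult that)
      also have "(y ^ a) powr (1 / c) = y powr (real a / c)"
        using that 3 by (cases "y = 0") (simp_all add: powr_powr powr_realpow[symmetric])
      also have "(z ^ b) powr (1 / c) = z powr (real b / c)"
        using that 3 by (cases "z = 0") (simp_all add: powr_powr powr_realpow[symmetric])
      finally show ?thesis .
    qed
    have "avg S F \<le> avg S (\<lambda>x. \<Prod>i\<in>(UNIV::bool set). (if i then G x else H x) powr ((if i then real a else real b) / c))"
      using nn le by (intro avg_mono) (simp add: UNIV_bool mult.commute, simp add: rt mult.commute)
    also have "\<dots> \<le> (\<Prod>i\<in>(UNIV::bool set). avg S (\<lambda>x. if i then G x else H x) powr ((if i then real a else real b) / c))"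
      using c 3 nn assms(1) by (intro avg_Holder) (auto simp: UNIV_bool c_def add_divide_distrib[symmetric] add.commute)
    also have "\<dots> = avg S G powr (real a / c) * avg S H powr (real b / c)" by (simp add: UNIV_bool mult.commute)
    finally have "avg S F ^ (a + b) \<le> (avg S G powr (real a / c) * avg S H powr (real b / c)) ^ (a + b)"
      using nn by (intro power_mono avg_nonneg) auto
    also have "\<dots> = avg S G ^ a * avg S H ^ b"
    proof -
      have "(x powr (real i / c)) ^ (a + b) = x ^ i" if "x \<ge> 0" "i > 0" for x i
      proof (cases "x = 0")
        case False
        then have "(x powr (real i / c)) ^ (a + b) = x powr (real i / c * c)"
          using that by (simp add: powr_realpow[symmetric] powr_powr c_def)
        then show ?thesis using c that False by (simp add: powr_realpow)
      qed (use that 3 in \<open>simp add: power_0_left\<close>)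
      then show ?thesis using 3 nn by (simp add: power_mult_distrib avg_nonneg)
    qed
    finally show ?thesis .
  qed
qed

section \<open>Decoupling for the moment curve modulo prime powers\<close>

definition ee :: "real \<Rightarrow> complex" where
  "ee x = cis (2 * pi * x)"

lemma ee_add: "ee (x + y) = ee x * ee y"
  by (simp add: ee_def cis_mult distrib_left)

lemma norm_ee [simp]: "norm (ee x) = 1"
  by (simp add: ee_def)

lemma ee_0 [simp]: "ee 0 = 1"
  by (simp add: ee_def)

lemma ee_of_int [simp]: "ee (of_int n) = 1"
  by (simp add: ee_def cis_multiple_2pi)

lemma ee_minus: "ee (- x) = cnj (ee x)"
  by (simp add: ee_def cis_cnj)

definition em :: "int \<Rightarrow> int \<Rightarrow> complex" where
  "em q x = ee (of_int x / of_int q)"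

lemma em_add: "em q (x + y) = em q x * em q y"
  by (simp add: em_def add_divide_distrib ee_add)

lemma norm_em [simp]: "norm (em q x) = 1"
  by (simp add: em_def)

lemma em_0 [simp]: "em q 0 = 1"
  by (simp add: em_def)

lemma em_minus: "em q (- x) = cnj (em q x)"
  by (simp add: em_def ee_minus)

lemma em_cong:
  assumes "[x = y] (mod q)"
  shows "em q x = em q y"
proof (cases "q = 0")
  case False
  obtain k where "x = y + q * k" using assms by (metis cong_iff_lin cong_sym)
  then have "(of_int x / of_int q :: real) = of_int y / of_int q + of_int k"
    using False by (simp add: field_simps)
  then show ?thesis by (simp add: em_def ee_add)
qed (use assms in \<open>simp add: em_def\<close>)

lemma em_mult_cancel: "c \<noteq> 0 \<Longrightarrow> em (c * q) (c * x) = em q x"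
  by (simp add: em_def)

definition pv :: "nat \<Rightarrow> (nat \<Rightarrow> int) \<Rightarrow> int \<Rightarrow> int" where
  "pv k \<alpha> x = (\<Sum>j=1..k. \<alpha> j * x ^ j)"

lemma pv_add: "pv k (\<lambda>j. \<alpha> j + \<beta> j) x = pv k \<alpha> x + pv k \<beta> x"
  by (simp add: pv_def sum.distrib distrib_right)

lemma pv_cong: "(\<And>j. j \<in> {1..k} \<Longrightarrow> [\<alpha> j = \<beta> j] (mod q)) \<Longrightarrow> [pv k \<alpha> x = pv k \<beta> x] (mod q)"
  unfolding pv_def by (intro cong_sum cong_mult cong_refl)

lemma pv_coeff: "degree P \<le> k \<Longrightarrow> pv k (coeff P) x = poly P x - coeff P 0"
proof -
  assume d: "degree P \<le> k"
  have "poly P x = (\<Sum>j\<le>k. coeff P j * x ^ j)"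
    unfolding poly_altdef using d by (intro sum.mono_neutral_left) (auto simp: coeff_eq_0)
  also have "{..k} = insert 0 {1..k}" by auto
  finally show ?thesis by (simp add: pv_def)
qed

definition Box :: "nat \<Rightarrow> int \<Rightarrow> (nat \<Rightarrow> int) set" where
  "Box k q = PiE {1..k} (\<lambda>_. {0..<q})"

lemma finite_Box [simp]: "finite (Box k q)"
  by (simp add: Box_def finite_PiE)

lemma Box_ne: "q > 0 \<Longrightarrow> Box k q \<noteq> {}"
  by (auto simp: Box_def PiE_eq_empty_iff)

text \<open>Frequencies are arbitrary integer vectors rather than residues, so that coefficient
  vectors of polynomials can be added to them without reduction; functions on the box are the
  periodic ones.\<close>

definition box_periodic :: "nat \<Rightarrow> int \<Rightarrow> ((nat \<Rightarrow> int) \<Rightarrow> 'a) \<Rightarrow> bool" where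
  "box_periodic k q F \<longleftrightarrow> (\<forall>\<alpha> \<beta>. (\<forall>j\<in>{1..k}. [\<alpha> j = \<beta> j] (mod q)) \<longrightarrow> F \<alpha> = F \<beta>)"

text \<open>Translation invariance of the uniform measure on the group \<open>(Z / q)^k\<close>;
  every gain in the decoupling argument starts from it.\<close>

lemma avg_Box_shift:
  assumes "q > 0" "box_periodic k q F"
  shows "avg (Box k q) (\<lambda>\<alpha>. F (\<lambda>j. \<alpha> j + \<beta> j)) = avg (Box k q) F"
proof -
  have per: "F \<alpha> = F \<gamma>" if "\<And>j. j \<in> {1..k} \<Longrightarrow> [\<alpha> j = \<gamma> j] (mod q)" for \<alpha> \<gamma>
    using assms(2) that by (auto simp: box_periodic_def)
  have "(\<Sum>\<alpha>\<in>Box k q. F (\<lambda>j. \<alpha> j + \<beta> j)) = sum F (Box k q)"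
    by (rule sum.reindex_bij_witness[of _
          "\<lambda>\<alpha>. restrict (\<lambda>j. (\<alpha> j - \<beta> j) mod q) {1..k}" "\<lambda>\<alpha>. restrict (\<lambda>j. (\<alpha> j + \<beta> j) mod q) {1..k}"])
       (use assms(1) in \<open>auto simp: Box_def PiE_iff extensional_def mod_simps intro!: ext per simp: cong_def\<close>)
  then show ?thesis by (simp add: avg_def)
qed

definition es :: "nat \<Rightarrow> int \<Rightarrow> int set \<Rightarrow> (int \<Rightarrow> complex) \<Rightarrow> (nat \<Rightarrow> int) \<Rightarrow> complex" where
  "es k q X a \<alpha> = (\<Sum>x\<in>X. a x * em q (pv k \<alpha> x))"

lemma es_cong:
  "(\<And>j. j \<in> {1..k} \<Longrightarrow> [\<alpha> j = \<beta> j] (mod q)) \<Longrightarrow> es k q X a \<alpha> = es k q X a \<beta>"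
  unfolding es_def by (intro sum.cong refl arg_cong2[where f="(*)"] em_cong pv_cong)

text \<open>For \<open>q = p ^ e\<close> this is the part of \<open>X\<close> in the p-adic disc of
  radius \<open>p^(-e)\<close> about \<open>c\<close>.\<close>

definition cls :: "int \<Rightarrow> int \<Rightarrow> int set \<Rightarrow> int set" where
  "cls q c X = {x \<in> X. [x = c] (mod q)}"

lemma finite_cls [simp]: "finite X \<Longrightarrow> finite (cls q c X)"
  by (simp add: cls_def)

text \<open>Half the critical exponent \<open>k (k + 1)\<close>.\<close>
definition crit :: "nat \<Rightarrow> nat" where
  "crit k = k * (k + 1) div 2"

lemma two_crit: "2 * crit k = k * (k + 1)"
  by (simp add: crit_def)

lemma crit_pos: "k \<ge> 1 \<Longrightarrow> crit k \<ge> 1"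
  using two_crit[of k] by (cases k) auto

text \<open>\<open>K\<close> is the decoupling constant raised to the critical exponent.\<close>
definition Dec :: "int \<Rightarrow> nat \<Rightarrow> nat \<Rightarrow> real \<Rightarrow> bool" where
  "Dec p k d K \<longleftrightarrow> (\<forall>X a. finite X \<longrightarrow>
     avg (Box k (p ^ (k * d))) (\<lambda>\<alpha>. norm (es k (p ^ (k * d)) X a \<alpha>) ^ (2 * crit k))
     \<le> K * (\<Sum>c\<in>{0..<p ^ d}. root (crit k)
          (avg (Box k (p ^ (k * d))) (\<lambda>\<alpha>. norm (es k (p ^ (k * d)) (cls (p ^ d) c X) a \<alpha>) ^ (2 * crit k)))) ^ crit k)"

section \<open>Decoupling inside one disc\<close>

text \<open>The average over \<alpha> does not change if \<alpha> is translated along the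
  coefficient vectors of the \<open>G i\<close>. On the disc about \<open>x0\<close> such a
  translation acts as a frequency of the degree \<open>l\<close> moment curve in the coordinate
  \<open>z\<close>, modulo \<open>p ^ (l * d)\<close>, so \<open>Dec p l d\<close> applies to the
  translation parameters. The weight \<open>w\<close> is constant along these directions and may
  therefore contain other discs.\<close>

lemma local_decoupling:
  fixes G :: "nat \<Rightarrow> int poly"
  assumes dec: "Dec p l d K" and K: "K \<ge> 0" and l: "l \<ge> 1" and p: "p > 1" and X: "finite X" and M: "l * d \<le> M"
    and deg: "\<And>i. i \<in> {1..l} \<Longrightarrow> degree (G i) \<le> k"
    and G: "\<And>i z. i \<in> {1..l} \<Longrightarrow> [poly (G i) (x0 + p ^ e * z) = C i + p ^ (M - l * d) * z ^ i] (mod p ^ M)"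
    and per: "box_periodic k (p ^ M) w" and w: "\<And>\<alpha>. 0 \<le> w \<alpha>"
    and inv: "\<And>\<alpha> i. i \<in> {1..l} \<Longrightarrow> w (\<lambda>j. \<alpha> j + coeff (G i) j) = w \<alpha>"
  shows "avg (Box k (p ^ M)) (\<lambda>\<alpha>. w \<alpha> * norm (es k (p ^ M) (cls (p ^ e) x0 X) a \<alpha>) ^ (2 * crit l))
    \<le> K * (\<Sum>c\<in>{0..<p ^ d}. root (crit l) (avg (Box k (p ^ M))
        (\<lambda>\<alpha>. w \<alpha> * norm (es k (p ^ M) (cls (p ^ (e + d)) (x0 + p ^ e * c) X) a \<alpha>) ^ (2 * crit l)))) ^ crit l"
proof -
  define T where "T = Box l (p ^ (l * d))"
  \<comment> \<open>Adding \<open>h u\<close> to the frequency multiplies the term at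
    \<open>x\<close> by the character of the sum of
    \<open>u i * (poly (G i) x - coeff (G i) 0)\<close>.\<close>
  define h where "h u j = (\<Sum>i=1..l. u i * coeff (G i) j)" for u and j :: nat
  define A where "A = Box k (p ^ M)"
  have pM: "p ^ M > 0" and T: "finite T" "T \<noteq> {}" using p by (auto simp: T_def Box_ne)
  have wn: "w (\<lambda>j. \<alpha> j + int n * coeff (G i) j) = w \<alpha>" if "i \<in> {1..l}" for \<alpha> i n
  proof (induction n)
    case (Suc n)
    then show ?case using inv[OF that, of "\<lambda>j. \<alpha> j + int n * coeff (G i) j"] by (simp add: algebra_simps)
  qed simp
  have wI: "w (\<lambda>j. \<alpha> j + (\<Sum>i\<in>I. u i * coeff (G i) j)) = w \<alpha>"
    if "I \<subseteq> {1..l}" "\<And>i. i \<in> {1..l} \<Longrightarrow> 0 \<le> u i" for \<alpha> u I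
  proof -
    have "finite I" using that(1) finite_subset by blast
    then show ?thesis using that(1)
    proof (induction I)
      case (insert i I)
      have "w (\<lambda>j. (\<alpha> j + (\<Sum>i\<in>I. u i * coeff (G i) j)) + int (nat (u i)) * coeff (G i) j) = w \<alpha>"
        using insert wn[of i "\<lambda>j. \<alpha> j + (\<Sum>i\<in>I. u i * coeff (G i) j)" "nat (u i)"] by simp
      then show ?case using insert that(2)[of i] by (simp add: algebra_simps)
    qed simp
  qed
  have wh: "w (\<lambda>j. \<alpha> j + h u j) = w \<alpha>" if "u \<in> T" for \<alpha> u
    unfolding h_def using that by (intro wI) (auto simp: T_def Box_def PiE_iff)
  have average: "avg A (\<lambda>\<alpha>. w \<alpha> * H \<alpha>) = avg A (\<lambda>\<alpha>. w \<alpha> * avg T (\<lambda>u. H (\<lambda>j. \<alpha> j + h u j)))"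
    if "box_periodic k (p ^ M) H" for H :: "(nat \<Rightarrow> int) \<Rightarrow> real"
  proof -
    have "box_periodic k (p ^ M) (\<lambda>\<alpha>. w \<alpha> * H \<alpha>)"
      using per that unfolding box_periodic_def by metis
    then have shift: "avg A (\<lambda>\<alpha>. w (\<lambda>j. \<alpha> j + h u j) * H (\<lambda>j. \<alpha> j + h u j)) = avg A (\<lambda>\<alpha>. w \<alpha> * H \<alpha>)" for u
      unfolding A_def using avg_Box_shift[OF pM, where F = "\<lambda>\<alpha>. w \<alpha> * H \<alpha>"] by blast
    have "avg A (\<lambda>\<alpha>. w \<alpha> * H (\<lambda>j. \<alpha> j + h u j)) = avg A (\<lambda>\<alpha>. w \<alpha> * H \<alpha>)" if "u \<in> T" for u
      using shift[of u] by (simp only: wh[OF that])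
    then have "avg T (\<lambda>u. avg A (\<lambda>\<alpha>. w \<alpha> * H (\<lambda>j. \<alpha> j + h u j))) = avg T (\<lambda>u. avg A (\<lambda>\<alpha>. w \<alpha> * H \<alpha>))"
      by (rule avg_cong[OF refl])
    also have "\<dots> = avg A (\<lambda>\<alpha>. w \<alpha> * H \<alpha>)" using T by (simp add: avg_const)
    finally show ?thesis by (subst (asm) avg_swap) (simp add: avg_cmult)
  qed
  define g where "g z = x0 + p ^ e * z" for z
  define Z where "Z = g -` X"
  have injg: "inj_on g S" for S using p by (auto simp: g_def inj_on_def)
  have Z: "finite Z" unfolding Z_def using X injg by (rule finite_vimageI)
  \<comment> \<open>The phases belonging to \<alpha> are absorbed into the coefficients: for fixed
    \<alpha> only \<open>u\<close> varies, and \<open>Dec\<close> holds for arbitrary complex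
    coefficients.\<close>
  define b where "b \<alpha> z = a (g z) * em (p ^ M) (pv k \<alpha> (g z))" for \<alpha> z
  have phase: "em (p ^ M) (pv k (h u) (g z)) = em (p ^ M) (\<Sum>i=1..l. u i * (C i - coeff (G i) 0)) * em (p ^ (l * d)) (pv l u z)" for u z
  proof -
    have "pv k (h u) (g z) = (\<Sum>i=1..l. u i * pv k (coeff (G i)) (g z))"
      unfolding pv_def h_def sum_distrib_left sum_distrib_right by (subst sum.swap) (simp add: mult_ac)
    also have "\<dots> = (\<Sum>i=1..l. u i * (poly (G i) (g z) - coeff (G i) 0))"
      by (intro sum.cong refl) (simp add: pv_coeff deg)
    also have "[\<dots> = (\<Sum>i=1..l. u i * ((C i + p ^ (M - l * d) * z ^ i) - coeff (G i) 0))] (mod p ^ M)"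
      by (intro cong_sum cong_mult cong_diff cong_refl) (simp add: g_def G)
    also have "(\<Sum>i=1..l. u i * ((C i + p ^ (M - l * d) * z ^ i) - coeff (G i) 0))
        = (\<Sum>i=1..l. u i * (C i - coeff (G i) 0)) + p ^ (M - l * d) * pv l u z"
      by (simp add: pv_def sum_distrib_left sum.distrib[symmetric] algebra_simps)
    finally have "em (p ^ M) (pv k (h u) (g z)) = em (p ^ M) (\<Sum>i=1..l. u i * (C i - coeff (G i) 0)) * em (p ^ M) (p ^ (M - l * d) * pv l u z)"
      by (simp add: em_cong em_add)
    also have "em (p ^ M) (p ^ (M - l * d) * pv l u z) = em (p ^ (l * d)) (pv l u z)"
      using em_mult_cancel[of "p ^ (M - l * d)" "p ^ (l * d)" "pv l u z"] p M by (simp flip: power_add)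
    finally show ?thesis .
  qed
  have es_eq: "norm (es k (p ^ M) (g ` Y) a (\<lambda>j. \<alpha> j + h u j)) = norm (es l (p ^ (l * d)) Y (b \<alpha>) u)" for Y \<alpha> u
  proof -
    have "es k (p ^ M) (g ` Y) a (\<lambda>j. \<alpha> j + h u j) = em (p ^ M) (\<Sum>i=1..l. u i * (C i - coeff (G i) 0)) * es l (p ^ (l * d)) Y (b \<alpha>) u"
      unfolding es_def by (simp add: sum.reindex[OF injg] pv_add em_add phase b_def sum_distrib_left mult_ac)
    then show ?thesis by (simp add: norm_mult)
  qed
  have img: "cls (p ^ e) x0 X = g ` Z"
  proof -
    have "x \<in> g ` Z" if x: "x \<in> X" "[x = x0] (mod p ^ e)" for x
    proof -
      obtain z where "x = g z" using x(2) unfolding g_def by (metis cong_iff_lin cong_sym)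
      then show ?thesis using x(1) by (auto simp: Z_def)
    qed
    then show ?thesis by (auto simp: cls_def Z_def g_def cong_def)
  qed
  have img2: "cls (p ^ (e + d)) (x0 + p ^ e * c) X = g ` cls (p ^ d) c Z" for c
  proof -
    have "[g z = g c] (mod p ^ (e + d)) \<longleftrightarrow> [z = c] (mod p ^ d)" for z
      using p by (simp add: g_def power_add cong_iff_dvd_diff flip: right_diff_distrib)
    moreover have "x \<in> g ` Z" if "x \<in> X" "[x = g c] (mod p ^ (e + d))" for x
    proof -
      have "[x = g c] (mod p ^ e)" using that(2) by (meson cong_dvd_modulus le_imp_power_dvd le_add1)
      then have "[x = x0] (mod p ^ e)" by (simp add: g_def cong_def)
      then show ?thesis using that(1) img by (auto simp: cls_def)
    qed
    ultimately show ?thesis unfolding g_def[symmetric] cls_def Z_def by fast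
  qed
  define I where "I \<alpha> = norm (es k (p ^ M) (cls (p ^ e) x0 X) a \<alpha>) ^ (2 * crit l)" for \<alpha>
  define J where "J c \<alpha> = norm (es k (p ^ M) (cls (p ^ (e + d)) (x0 + p ^ e * c) X) a \<alpha>) ^ (2 * crit l)" for c \<alpha>
  have perI: "box_periodic k (p ^ M) I" and perJ: "box_periodic k (p ^ M) (J c)" for c
    unfolding box_periodic_def I_def J_def by (metis es_cong)+
  have s: "crit l > 0" using crit_pos[OF l] by simp
  have "avg A (\<lambda>\<alpha>. w \<alpha> * I \<alpha>) = avg A (\<lambda>\<alpha>. w \<alpha> * avg T (\<lambda>u. I (\<lambda>j. \<alpha> j + h u j)))"
    by (rule average[OF perI])
  also have "\<dots> \<le> avg A (\<lambda>\<alpha>. w \<alpha> * (K * (\<Sum>c\<in>{0..<p ^ d}. root (crit l) (avg T (\<lambda>u. J c (\<lambda>j. \<alpha> j + h u j)))) ^ crit l))"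
    using dec Z unfolding Dec_def I_def J_def img img2 es_eq T_def
    by (intro avg_mono mult_left_mono w) auto
  also have "\<dots> = K * avg A (\<lambda>\<alpha>. w \<alpha> * (\<Sum>c\<in>{0..<p ^ d}. root (crit l) (avg T (\<lambda>u. J c (\<lambda>j. \<alpha> j + h u j)))) ^ crit l)"
    by (subst avg_cmult[symmetric]) (simp add: mult_ac)
  \<comment> \<open>The average over \<alpha> is carried inside the sum over \<open>c\<close> by the
    triangle inequality in \<open>L^(crit l)\<close> with weight \<open>w\<close>.\<close>
  also have "\<dots> \<le> K * (\<Sum>c\<in>{0..<p ^ d}. root (crit l) (avg A (\<lambda>\<alpha>. w \<alpha> * J c \<alpha>))) ^ crit l"
  proof (intro mult_left_mono K avg_Minkowski)
    fix c
    have "root (crit l) (avg T (\<lambda>u. J c (\<lambda>j. \<alpha> j + h u j))) ^ crit l = avg T (\<lambda>u. J c (\<lambda>j. \<alpha> j + h u j))" for \<alpha>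
      using s by (intro real_root_pow_pos2 avg_nonneg) (auto simp: J_def)
    moreover have "root (crit l) (avg A (\<lambda>\<alpha>. w \<alpha> * J c \<alpha>)) ^ crit l = avg A (\<lambda>\<alpha>. w \<alpha> * J c \<alpha>)"
      using s w by (intro real_root_pow_pos2 avg_nonneg) (auto simp: J_def)
    ultimately show "avg A (\<lambda>\<alpha>. w \<alpha> * root (crit l) (avg T (\<lambda>u. J c (\<lambda>j. \<alpha> j + h u j))) ^ crit l)
        \<le> root (crit l) (avg A (\<lambda>\<alpha>. w \<alpha> * J c \<alpha>)) ^ crit l"
      using average[OF perJ, of c] by simp
  qed (use s w in \<open>auto simp: A_def J_def intro!: avg_nonneg real_root_ge_zero\<close>)
  finally show ?thesis by (simp add: A_def I_def J_def)
qed

section \<open>Polynomials adapted to two incongruent points\<close>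

lemma poly_truncate:
  fixes h :: "int poly"
  obtains R where "\<And>y. poly h y = (\<Sum>n\<le>l. coeff h n * y ^ n) + y ^ (l + 1) * poly R y"
proof -
  define T where "T = (\<Sum>n\<le>l. monom (coeff h n) n)"
  have "coeff (h - T) n = 0" if "n < l + 1" for n
    using that by (simp add: T_def coeff_sum coeff_monom if_distrib cong: if_cong)
  then have "monom 1 (l + 1) dvd h - T" by (simp add: monom_1_dvd_iff')
  then obtain R where "h - T = monom 1 (l + 1) * R" by (rule dvdE)
  then have hT: "h = T + monom 1 (l + 1) * R" by (simp add: algebra_simps)
  have "poly h y = (\<Sum>n\<le>l. coeff h n * y ^ n) + y ^ (l + 1) * poly R y" for y
  proof -
    have "poly h y = poly T y + poly (monom 1 (l + 1) * R) y"
      using arg_cong[OF hT, of "\<lambda>q. poly q y"] by (simp only: poly_add)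
    then show ?thesis by (simp add: T_def poly_sum poly_monom)
  qed
  then show ?thesis by (rule that)
qed

text \<open>\<open>g\<close> is an antiderivative of a multiple of \<open>X\<^sup>m (X - x\<^sub>0)\<^sup>i\<^sup>-\<^sup>1\<close>.\<close>
lemma beta_poly:
  fixes p x0 :: int
  assumes p: "prime p" "\<not> p dvd x0" "int (m + l) < p" and i: "i \<in> {1..l}"
  obtains g h :: "int poly" where "degree g \<le> m + l" "monom 1 (m + 1) dvd g"
    "\<And>y. poly g (x0 + y) = poly h y" "\<not> p dvd coeff h i" "\<And>n. 0 < n \<Longrightarrow> n < i \<Longrightarrow> coeff h n = 0"
proof -
  define k where "k = m + l"
  define D :: "int poly" where "D = monom 1 m * [:- x0, 1:] ^ (i - 1)"
  have degD: "degree D \<le> m + (i - 1)"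
    unfolding D_def using degree_mult_le[of "monom 1 m" "[:- x0, 1:] ^ (i - 1)"]
      degree_monom_le[of "1::int" m] by (simp add: degree_linear_power)
  \<comment> \<open>The degrees \<open>n + 1\<close> are at most \<open>k = m + l\<close>, so
    \<open>fact k\<close> clears the denominators of the antiderivative, while \<open>p > k\<close>
    keeps it a unit modulo \<open>p\<close>.\<close>
  define g where "g = (\<Sum>n\<le>m + (i - 1). monom (coeff D n * (fact k div int (n + 1))) (n + 1))"
  have cg: "coeff g n = (if n = 0 \<or> n > m + i then 0 else coeff D (n - 1) * (fact k div int n))" for n
  proof -
    have "coeff g n = (\<Sum>q\<le>m + (i - 1). if n = q + 1 then coeff D (n - 1) * (fact k div int n) else 0)"
      unfolding g_def coeff_sum by (intro sum.cong) (auto simp: coeff_monom)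
    also have "\<dots> = (if n = 0 \<or> n > m + i then 0 else coeff D (n - 1) * (fact k div int n))"
    proof (cases n)
      case (Suc n')
      then show ?thesis using i by auto
    qed simp
    finally show ?thesis .
  qed
  have dg: "pderiv g = smult (fact k) D"
  proof (rule poly_eqI)
    fix n
    show "coeff (pderiv g) n = coeff (smult (fact k) D) n"
    proof (cases "n + 1 > m + i")
      case True
      then have "coeff D n = 0" using degD i by (intro coeff_eq_0) auto
      then show ?thesis using True by (simp add: coeff_pderiv cg)
    next
      case False
      then have "n + 1 dvd fact k" using i by (intro dvd_fact) (auto simp: k_def)
      then have "int (n + 1) dvd fact k" by (metis of_nat_dvd_iff of_nat_fact)
      then show ?thesis using False by (auto simp: coeff_pderiv cg add.commute)
    qed
  qed
  define h where "h = pcompose g [:x0, 1:]"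
  \<comment> \<open>Around \<open>x0\<close> the derivative becomes \<open>fact k\<close> times
    \<open>y^(i - 1) (x0 + y)^m\<close>. Hence \<open>h\<close> has no terms of degree between 1 and
    \<open>i - 1\<close>, and \<open>i\<close> times its coefficient at \<open>y^i\<close> is
    \<open>fact k * x0 ^ m\<close>, a unit.\<close>
  have "pderiv h = smult (fact k) (pcompose D [:x0, 1:])"
    by (simp add: h_def pderiv_pcompose dg pcompose_smult pderiv_pCons)
  also have "pcompose D [:x0, 1:] = [:x0, 1:] ^ m * monom 1 (i - 1)"
  proof -
    have pw: "pcompose (P ^ n) [:x0, 1:] = pcompose P [:x0, 1:] ^ n" for P n
      by (induction n) (simp_all add: pcompose_mult pcompose_1)
    show ?thesis by (simp add: D_def pcompose_mult pw monom_altdef pcompose_pCons)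
  qed
  finally have ph: "pderiv h = smult (fact k) (monom 1 (i - 1) * [:x0, 1:] ^ m)" by (simp only: mult.commute)
  have dh: "int (n + 1) * coeff h (n + 1) = fact k * (if n < i - 1 then 0 else coeff ([:x0, 1:] ^ m) (n - (i - 1)))" for n
  proof -
    have "int (n + 1) * coeff h (n + 1) = coeff (pderiv h) n" by (simp only: coeff_pderiv Suc_eq_plus1)
    then show ?thesis by (simp add: ph coeff_monom_mult)
  qed
  show ?thesis
  proof
    show "degree g \<le> m + l" using i by (intro degree_le) (auto simp: cg)
    show "monom 1 (m + 1) dvd g"
      by (auto simp: monom_1_dvd_iff' cg D_def coeff_monom_mult)
    show "poly g (x0 + y) = poly h y" for y by (simp add: h_def poly_pcompose)
    show "coeff h n = 0" if n: "0 < n" "n < i" for n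
    proof -
      obtain n' where n': "n = n' + 1" using n by (metis Suc_eq_plus1 gr0_implies_Suc)
      then have "int (n' + 1) * coeff h (n' + 1) = 0" using n by (subst dh) simp
      then show ?thesis by (simp add: n')
    qed
    obtain i' where i': "i = i' + 1" using i by (metis Suc_eq_plus1 atLeastAtMost_iff gr0_implies_Suc zero_less_one order_less_le_trans)
    have "int (i' + 1) * coeff h (i' + 1) = fact k * x0 ^ m" by (subst dh) (simp add: i' coeff_0_power)
    moreover have "\<not> p dvd fact k" 
    proof -
      obtain q where q: "p = int q" using p(1) prime_ge_0_int by (metis int_nat_eq)
      have "prime q" "k < q" using p by (simp_all add: q k_def)
      then have "\<not> q dvd fact k" by (simp add: prime_dvd_fact_iff)
      then show ?thesis unfolding q by (metis of_nat_dvd_iff of_nat_fact)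
    qed
    moreover have "\<not> p dvd x0 ^ m" using p by (metis prime_dvd_power)
    ultimately have "\<not> p dvd int (i' + 1) * coeff h (i' + 1)" using p(1) by (simp only: prime_dvd_mult_iff simp_thms)
    then show "\<not> p dvd coeff h i" unfolding i' by (metis dvd_mult)
  qed
qed

text \<open>Hermite interpolation over \<open>Z / p^M\<close>: vanishing to order
  \<open>m + 1\<close> at 0 and prescribed Taylor coefficients of degree 1 to \<open>l\<close> at
  \<open>x0\<close>. By descending induction on \<open>i\<close>: the polynomial from
  \<open>beta_poly\<close> starts with a unit times \<open>y ^ i\<close>, its terms of degree
  between \<open>i + 1\<close> and \<open>l\<close> are removed by the polynomials already built,
  and the unit is inverted modulo \<open>p ^ M\<close>.\<close>

lemma two_point_poly:
  fixes p x0 :: int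
  assumes p: "prime p" "\<not> p dvd x0" "int (m + l) < p" and i: "i \<in> {1..l}"
  shows "\<exists>B c R. degree B \<le> m + l \<and> monom 1 (m + 1) dvd B \<and>
    (\<forall>y. [poly B (x0 + y) = c + y ^ i + y ^ (l + 1) * poly R y] (mod p ^ M))"
  using i
proof (induction "l - i" arbitrary: i rule: less_induct)
  case less
  have "\<forall>j\<in>{i<..l}. \<exists>B c R. degree B \<le> m + l \<and> monom 1 (m + 1) dvd B \<and>
    (\<forall>y. [poly B (x0 + y) = c + y ^ j + y ^ (l + 1) * poly R y] (mod p ^ M))"
    using less by auto
  then obtain B c R where B: "\<And>j. j \<in> {i<..l} \<Longrightarrow> degree (B j) \<le> m + l" "\<And>j. j \<in> {i<..l} \<Longrightarrow> monom 1 (m + 1) dvd B j"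
    and Bv: "\<And>j y. j \<in> {i<..l} \<Longrightarrow> [poly (B j) (x0 + y) = c j + y ^ j + y ^ (l + 1) * poly (R j) y] (mod p ^ M)"
    by metis
  obtain g h where g: "degree g \<le> m + l" "monom 1 (m + 1) dvd g" "\<And>y. poly g (x0 + y) = poly h y"
    "\<not> p dvd coeff h i" "\<And>n. 0 < n \<Longrightarrow> n < i \<Longrightarrow> coeff h n = 0"
    using beta_poly[OF p less.prems] by metis
  obtain S where S: "\<And>y. poly h y = (\<Sum>n\<le>l. coeff h n * y ^ n) + y ^ (l + 1) * poly S y"
    using poly_truncate by blast
  have "coprime (coeff h i) (p ^ M)"
    using g(4) p(1) by (simp add: prime_imp_coprime coprime_commute)
  then obtain u where u: "[coeff h i * u = 1] (mod p ^ M)"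
    using cong_solve_coprime_int by blast
  have split: "(\<Sum>n\<le>l. coeff h n * y ^ n) = coeff h 0 + coeff h i * y ^ i + (\<Sum>j\<in>{i<..l}. coeff h j * y ^ j)" for y
  proof -
    have "(\<Sum>n\<le>l. coeff h n * y ^ n) = (\<Sum>n\<in>{0, i} \<union> {i<..l}. coeff h n * y ^ n)"
      using less.prems g(5) by (intro sum.mono_neutral_right) (force simp: not_less le_less)+
    also have "\<dots> = (\<Sum>n\<in>{0, i}. coeff h n * y ^ n) + (\<Sum>j\<in>{i<..l}. coeff h j * y ^ j)"
      using less.prems by (intro sum.union_disjoint) auto
    finally show ?thesis using less.prems by simp
  qed
  define E where "E = smult u (g - (\<Sum>j\<in>{i<..l}. smult (coeff h j) (B j)))"
  define C where "C = u * (coeff h 0 - (\<Sum>j\<in>{i<..l}. coeff h j * c j))"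
  define Q where "Q = smult u (S - (\<Sum>j\<in>{i<..l}. smult (coeff h j) (R j)))"
  have "degree E \<le> m + l"
    unfolding E_def using g(1) B(1)
    by (intro order.trans[OF degree_smult_le] degree_diff_le degree_sum_le) (auto intro: order.trans[OF degree_smult_le])
  moreover have "monom 1 (m + 1) dvd E"
    unfolding E_def using g(2) B(2) by (intro dvd_smult dvd_diff dvd_sum) auto
  moreover have "[poly E (x0 + y) = C + y ^ i + y ^ (l + 1) * poly Q y] (mod p ^ M)" for y
  proof -
    have "poly E (x0 + y) = u * (poly h y - (\<Sum>j\<in>{i<..l}. coeff h j * poly (B j) (x0 + y)))"
      by (simp add: E_def poly_sum g(3))
    also have "[\<dots> = u * (poly h y - (\<Sum>j\<in>{i<..l}. coeff h j * (c j + y ^ j + y ^ (l + 1) * poly (R j) y)))] (mod p ^ M)"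
      by (intro cong_mult cong_diff cong_sum cong_refl Bv)
    also have "u * (poly h y - (\<Sum>j\<in>{i<..l}. coeff h j * (c j + y ^ j + y ^ (l + 1) * poly (R j) y)))
      = C + (coeff h i * u) * y ^ i + y ^ (l + 1) * poly Q y"
      unfolding S split C_def Q_def poly_smult poly_diff poly_sum
      by (simp add: algebra_simps sum.distrib sum_distrib_left)
    also have "[\<dots> = C + 1 * y ^ i + y ^ (l + 1) * poly Q y] (mod p ^ M)"
      by (intro cong_add cong_mult cong_refl u)
    finally show ?thesis by simp
  qed
  ultimately show ?case by blast
qed

text \<open>\<open>two_point_poly\<close>, moved to the points \<open>x1\<close> and
  \<open>x0 - x1\<close> and scaled by a power of \<open>p\<close>. The three conditions on
  exponents make the Taylor remainder at \<open>x0\<close> vanish modulo \<open>p ^ M\<close>, make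
  the zero of order \<open>k - l + 1\<close> at \<open>x1\<close> vanish on the disc of radius
  \<open>p^(-b)\<close>, and keep the scaling exponent nonnegative.\<close>

lemma transverse_poly:
  fixes p x0 x1 :: int
  assumes p: "prime p" "\<not> [x0 = x1] (mod p)" "int k < p" and l: "1 \<le> l" "l < k" and i: "i \<in> {1..l}"
    and e: "l * d \<le> e" "l * (e + d) \<le> (k - l + 1) * b" "l * (e + d) \<le> M"
  shows "\<exists>G C C'. degree G \<le> k \<and> (\<forall>z. [poly G (x0 + p ^ e * z) = C + p ^ (M - l * d) * z ^ i] (mod p ^ M))
     \<and> (\<forall>z. [poly G (x1 + p ^ b * z) = C'] (mod p ^ M))"
proof -
  define m where "m = k - l"
  have ml: "m + l = k" using l by (simp add: m_def)
  have nd: "\<not> p dvd x0 - x1" using p(2) by (simp add: cong_iff_dvd_diff)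
  obtain B c R where B: "degree B \<le> k" "monom 1 (m + 1) dvd B"
    "\<And>y. [poly B (x0 - x1 + y) = c + y ^ i + y ^ (l + 1) * poly R y] (mod p ^ M)"
    using two_point_poly[OF p(1) nd _ i, of m M] p(3) ml by (metis)
  obtain Q where Q: "B = monom 1 (m + 1) * Q" using B(2) by (rule dvdE)
  have ei: "e * i + l * d \<le> l * (e + d)" using i by (simp add: algebra_simps)
  \<comment> \<open>On the disc \<open>y = p ^ e * z\<close>, so this scaling gives
    \<open>y ^ i\<close> the coefficient \<open>p ^ (M - l * d)\<close>.\<close>
  define r where "r = M - l * d - e * i"
  have r: "r + e * i = M - l * d" using ei e(3) by (simp add: r_def)
  define G where "G = smult (p ^ r) (pcompose B [:- x1, 1:])"
  have "degree (pcompose B [:- x1, 1:]) \<le> k" using B(1) by (simp add: degree_pcompose)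
  then have "degree G \<le> k" unfolding G_def using order.trans[OF degree_smult_le] by blast
  moreover have "[poly G (x0 + p ^ e * z) = p ^ r * c + p ^ (M - l * d) * z ^ i] (mod p ^ M)" for z
  proof -
    have "poly G (x0 + p ^ e * z) = p ^ r * poly B (x0 - x1 + p ^ e * z)"
      by (simp add: G_def poly_pcompose algebra_simps)
    also have "[\<dots> = p ^ r * (c + (p ^ e * z) ^ i + (p ^ e * z) ^ (l + 1) * poly R (p ^ e * z))] (mod p ^ M)"
      by (intro cong_mult cong_refl B)
    also have "p ^ r * (c + (p ^ e * z) ^ i + (p ^ e * z) ^ (l + 1) * poly R (p ^ e * z))
      = (p ^ r * c + p ^ (r + e * i) * z ^ i) + p ^ (r + e * (l + 1)) * (z ^ (l + 1) * poly R (p ^ e * z))"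
      by (simp add: algebra_simps power_mult_distrib power_add power_mult)
    also have "[\<dots> = (p ^ r * c + p ^ (r + e * i) * z ^ i) + 0] (mod p ^ M)"
    proof (intro cong_add cong_refl)
      have "e * i + e \<le> e * (l + 1)" using i by (simp add: algebra_simps)
      then have "M \<le> r + e * (l + 1)" using r e by linarith
      then show "[p ^ (r + e * (l + 1)) * (z ^ (l + 1) * poly R (p ^ e * z)) = 0] (mod p ^ M)"
        by (simp add: cong_0_iff le_imp_power_dvd)
    qed
    finally show ?thesis by (simp add: r)
  qed
  moreover have "[poly G (x1 + p ^ b * z) = 0] (mod p ^ M)" for z
  proof -
    have "poly G (x1 + p ^ b * z) = p ^ (r + b * (m + 1)) * (z ^ (m + 1) * poly Q (p ^ b * z))"
      by (simp add: G_def poly_pcompose Q poly_monom power_mult_distrib power_add power_mult)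
    moreover have "M \<le> r + b * (m + 1)"
      using e(2) ei r unfolding m_def by (simp add: mult.commute)
    ultimately show ?thesis by (simp add: cong_0_iff le_imp_power_dvd)
  qed
  ultimately show ?thesis by blast
qed

text \<open>The polynomials of \<open>transverse_poly\<close> are constant on the disc about
  \<open>x1\<close>, so translating along them only multiplies that exponential sum by a number of
  modulus 1. Any power of it is an admissible weight in \<open>local_decoupling\<close>.\<close>

lemma transverse_decoupling:
  assumes p: "prime p" "\<not> [x0 = x1] (mod p)" "int k < p" and l: "1 \<le> l" "l < k"
    and e: "l * d \<le> e" "l * (e + d) \<le> (k - l + 1) * b" "l * (e + d) \<le> M"
    and dec: "Dec p l d K" and K: "K \<ge> 0" and X: "finite X"
  shows "avg (Box k (p ^ M)) (\<lambda>\<alpha>. norm (es k (p ^ M) (cls (p ^ b) x1 X) a \<alpha>) ^ t * norm (es k (p ^ M) (cls (p ^ e) x0 X) a \<alpha>) ^ (2 * crit l))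
    \<le> K * (\<Sum>c\<in>{0..<p ^ d}. root (crit l) (avg (Box k (p ^ M))
        (\<lambda>\<alpha>. norm (es k (p ^ M) (cls (p ^ b) x1 X) a \<alpha>) ^ t * norm (es k (p ^ M) (cls (p ^ (e + d)) (x0 + p ^ e * c) X) a \<alpha>) ^ (2 * crit l)))) ^ crit l"
proof -
  have "\<forall>i\<in>{1..l}. \<exists>G C C'. degree G \<le> k \<and> (\<forall>z. [poly G (x0 + p ^ e * z) = C + p ^ (M - l * d) * z ^ i] (mod p ^ M))
     \<and> (\<forall>z. [poly G (x1 + p ^ b * z) = C'] (mod p ^ M))"
    using transverse_poly[OF p l _ e] by blast
  then obtain G C C' where G: "\<And>i. i \<in> {1..l} \<Longrightarrow> degree (G i) \<le> k"
    "\<And>i z. i \<in> {1..l} \<Longrightarrow> [poly (G i) (x0 + p ^ e * z) = C i + p ^ (M - l * d) * z ^ i] (mod p ^ M)"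
    "\<And>i z. i \<in> {1..l} \<Longrightarrow> [poly (G i) (x1 + p ^ b * z) = C' i] (mod p ^ M)"
    by metis
  show ?thesis
  proof (rule local_decoupling[OF dec K l(1) _ X _ G(1,2)])
    show "p > 1" using p(1) by (rule prime_gt_1_int)
    show "l * d \<le> M" using e(3) by (simp add: algebra_simps)
    show "box_periodic k (p ^ M) (\<lambda>\<alpha>. norm (es k (p ^ M) (cls (p ^ b) x1 X) a \<alpha>) ^ t)"
      unfolding box_periodic_def by (metis es_cong)
    fix \<alpha> i assume i: "i \<in> {1..l}"
    have "em (p ^ M) (pv k (coeff (G i)) x) = em (p ^ M) (C' i - coeff (G i) 0)" if x: "x \<in> cls (p ^ b) x1 X" for x
    proof -
      have "[x1 = x] (mod p ^ b)" using x by (simp add: cls_def cong_sym)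
      then obtain z where "x = x1 + p ^ b * z" by (metis cong_iff_lin)
      then have "[pv k (coeff (G i)) x = C' i - coeff (G i) 0] (mod p ^ M)"
        using G(1,3)[OF i] by (simp add: pv_coeff cong_diff)
      then show ?thesis by (rule em_cong)
    qed
    then have "es k (p ^ M) (cls (p ^ b) x1 X) a (\<lambda>j. \<alpha> j + coeff (G i) j) = em (p ^ M) (C' i - coeff (G i) 0) * es k (p ^ M) (cls (p ^ b) x1 X) a \<alpha>"
      unfolding es_def sum_distrib_left by (intro sum.cong refl) (simp add: pv_add em_add)
    then show "norm (es k (p ^ M) (cls (p ^ b) x1 X) a (\<lambda>j. \<alpha> j + coeff (G i) j)) ^ t = norm (es k (p ^ M) (cls (p ^ b) x1 X) a \<alpha>) ^ t"
      by (simp add: norm_mult)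
  qed auto
qed

section \<open>Bilinear averages over two discs\<close>

text \<open>The square of the norm in \<open>L^(2 crit k)\<close>; squares are what
  \<open>l^2\<close> decoupling adds up.\<close>

definition nrm :: "int \<Rightarrow> nat \<Rightarrow> nat \<Rightarrow> int set \<Rightarrow> (int \<Rightarrow> complex) \<Rightarrow> real" where
  "nrm p k N X a = root (crit k) (avg (Box k (p ^ (k * N))) (\<lambda>\<alpha>. norm (es k (p ^ (k * N)) X a \<alpha>) ^ (2 * crit k)))"

lemma nrm_nonneg [simp]: "k \<ge> 1 \<Longrightarrow> 0 \<le> nrm p k N X a"
  unfolding nrm_def by (intro real_root_ge_zero avg_nonneg) auto

text \<open>The square function side of decoupling for the disc of radius \<open>p^(-e)\<close>
  about \<open>x0\<close>, cut into discs of the final radius \<open>p^(-N)\<close>. Being linear in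
  the pieces, it is additive over the discs of any intermediate radius.\<close>

definition lsum :: "int \<Rightarrow> nat \<Rightarrow> nat \<Rightarrow> nat \<Rightarrow> int \<Rightarrow> int set \<Rightarrow> (int \<Rightarrow> complex) \<Rightarrow> real" where
  "lsum p k N e x0 X a = (\<Sum>c\<in>{0..<p ^ (N - e)}. nrm p k N (cls (p ^ N) (x0 + p ^ e * c) X) a)"

lemma lsum_nonneg [simp]: "k \<ge> 1 \<Longrightarrow> 0 \<le> lsum p k N e x0 X a"
  unfolding lsum_def by (intro sum_nonneg) simp

lemma sum_mixed_radix:
  fixes p :: int
  assumes "p > 0"
  shows "(\<Sum>c\<in>{0..<p ^ (d + f)}. F c) = (\<Sum>c\<in>{0..<p ^ d}. \<Sum>c'\<in>{0..<p ^ f}. F (c + p ^ d * c'))"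
proof -
  have "c + p ^ d * c' < p ^ d * p ^ f" if "c < p ^ d" "c' < p ^ f" for c c'
  proof -
    have "p ^ d * (c' + 1) \<le> p ^ d * p ^ f" using that assms by (intro mult_left_mono) auto
    then show ?thesis using that by (simp add: algebra_simps)
  qed
  moreover have "x div p ^ d < p ^ f" if "x < p ^ d * p ^ f" "0 \<le> x" for x
  proof -
    have "p ^ d * (x div p ^ d) \<le> x"
    proof -
      have "0 \<le> x mod p ^ d" using assms by simp
      then show ?thesis by (simp flip: minus_mod_eq_mult_div)
    qed
    then have "p ^ d * (x div p ^ d) < p ^ d * p ^ f" using that(1) by (rule le_less_trans)
    then show ?thesis using assms by (simp only: mult_less_cancel_left_pos zero_less_power)
  qed
  ultimately show ?thesis
    unfolding sum.cartesian_product power_add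
    by (intro sum.reindex_bij_witness[of _ "\<lambda>(c, c'). c + p ^ d * c'" "\<lambda>x. (x mod p ^ d, x div p ^ d)"])
       (use assms in \<open>auto simp: pos_imp_zdiv_nonneg_iff\<close>)
qed

lemma lsum_split:
  assumes "p > 0" "e + d \<le> N"
  shows "lsum p k N e x0 X a = (\<Sum>c\<in>{0..<p ^ d}. lsum p k N (e + d) (x0 + p ^ e * c) X a)"
proof -
  have "N - e = d + (N - (e + d))" using assms by simp
  then show ?thesis
    unfolding lsum_def by (simp only: sum_mixed_radix[OF assms(1)]) (simp add: algebra_simps power_add)
qed

text \<open>Affine rescaling maps the disc of radius \<open>p^(-e)\<close> onto the whole line,
  leaving \<open>N - e\<close> scales. In \<open>local_decoupling\<close> it is realised by
  multiples of \<open>(X - x0)^i\<close>, with trivial weight.\<close>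

lemma Dec_rescale:
  assumes dec: "Dec p k (N - e) K" and K: "K \<ge> 0" and k: "k \<ge> 1" and e: "e \<le> N" and p: "p > 1" and X: "finite X"
  shows "avg (Box k (p ^ (k * N))) (\<lambda>\<alpha>. norm (es k (p ^ (k * N)) (cls (p ^ e) x0 X) a \<alpha>) ^ (2 * crit k))
    \<le> K * lsum p k N e x0 X a ^ crit k"
proof -
  define G where "G i = smult (p ^ (k * e - e * i)) ([:- x0, 1:] ^ i)" for i
  have "avg (Box k (p ^ (k * N))) (\<lambda>\<alpha>. 1 * norm (es k (p ^ (k * N)) (cls (p ^ e) x0 X) a \<alpha>) ^ (2 * crit k))
    \<le> K * (\<Sum>c\<in>{0..<p ^ (N - e)}. root (crit k) (avg (Box k (p ^ (k * N)))
        (\<lambda>\<alpha>. 1 * norm (es k (p ^ (k * N)) (cls (p ^ (e + (N - e))) (x0 + p ^ e * c) X) a \<alpha>) ^ (2 * crit k)))) ^ crit k"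
  proof (rule local_decoupling[OF dec K k p X, where G = G and C = "\<lambda>_. 0"])
    fix i assume i: "i \<in> {1..k}"
    show "degree (G i) \<le> k"
      unfolding G_def using i by (intro order.trans[OF degree_smult_le]) (simp add: degree_linear_power)
    have "k * e - e * i + e * i = k * N - k * (N - e)"
      using i e by (simp add: diff_mult_distrib2 mult.commute)
    then have "p ^ (k * N - k * (N - e)) = p ^ (k * e - e * i) * (p ^ e) ^ i" by (metis power_add power_mult)
    then show "[poly (G i) (x0 + p ^ e * z) = 0 + p ^ (k * N - k * (N - e)) * z ^ i] (mod p ^ (k * N))" for z
      by (simp add: G_def power_mult_distrib mult.assoc)
  qed (auto simp: box_periodic_def)
  then show ?thesis using e by (simp add: lsum_def nrm_def)
qed

lemma crit_mono: "l \<le> k \<Longrightarrow> crit l \<le> crit k"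
  unfolding crit_def by (intro div_le_mono mult_le_mono) auto

lemma crit_0 [simp]: "crit 0 = 0"
  by (simp add: crit_def)

text \<open>\<open>V\<close> bounds a bilinear constant for discs of radii \<open>p^(-e)\<close> and
  \<open>p^(-b)\<close> about points incongruent modulo \<open>p\<close>. The total exponent is
  critical for degree \<open>k\<close>, while the share of the disc about \<open>x0\<close> is
  critical for degree \<open>l\<close>, which is the exponent at which
  \<open>transverse_decoupling\<close> can split it.\<close>

definition Mb :: "int \<Rightarrow> nat \<Rightarrow> nat \<Rightarrow> nat \<Rightarrow> nat \<Rightarrow> nat \<Rightarrow> real \<Rightarrow> bool" where
  "Mb p k N l e b V \<longleftrightarrow> (\<forall>X a x0 x1. finite X \<longrightarrow> \<not> [x0 = x1] (mod p) \<longrightarrow>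
     avg (Box k (p ^ (k * N))) (\<lambda>\<alpha>. norm (es k (p ^ (k * N)) (cls (p ^ b) x1 X) a \<alpha>) ^ (2 * (crit k - crit l))
        * norm (es k (p ^ (k * N)) (cls (p ^ e) x0 X) a \<alpha>) ^ (2 * crit l))
     \<le> V * lsum p k N e x0 X a ^ crit l * lsum p k N b x1 X a ^ (crit k - crit l))"

lemma Mb_mono:
  assumes "Mb p k N l e b V" "V \<le> W" "k \<ge> 1"
  shows "Mb p k N l e b W"
  unfolding Mb_def
proof (intro allI impI)
  fix X :: "int set" and a x0 x1
  assume "finite X" "\<not> [x0 = x1] (mod p)"
  then have "avg (Box k (p ^ (k * N))) (\<lambda>\<alpha>. norm (es k (p ^ (k * N)) (cls (p ^ b) x1 X) a \<alpha>) ^ (2 * (crit k - crit l))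
        * norm (es k (p ^ (k * N)) (cls (p ^ e) x0 X) a \<alpha>) ^ (2 * crit l))
     \<le> V * lsum p k N e x0 X a ^ crit l * lsum p k N b x1 X a ^ (crit k - crit l)"
    using assms(1) unfolding Mb_def by blast
  also have "\<dots> \<le> W * lsum p k N e x0 X a ^ crit l * lsum p k N b x1 X a ^ (crit k - crit l)"
    using assms(2,3) by (intro mult_right_mono) auto
  finally show "avg (Box k (p ^ (k * N))) (\<lambda>\<alpha>. norm (es k (p ^ (k * N)) (cls (p ^ b) x1 X) a \<alpha>) ^ (2 * (crit k - crit l))
        * norm (es k (p ^ (k * N)) (cls (p ^ e) x0 X) a \<alpha>) ^ (2 * crit l))
     \<le> W * lsum p k N e x0 X a ^ crit l * lsum p k N b x1 X a ^ (crit k - crit l)" .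
qed

lemma Dec_mono:
  assumes "Dec p k d K" "K \<le> L" "k \<ge> 1"
  shows "Dec p k d L"
  unfolding Dec_def
proof (intro allI impI)
  fix X :: "int set" and a
  assume "finite X"
  then have "avg (Box k (p ^ (k * d))) (\<lambda>\<alpha>. norm (es k (p ^ (k * d)) X a \<alpha>) ^ (2 * crit k))
     \<le> K * (\<Sum>c\<in>{0..<p ^ d}. root (crit k)
          (avg (Box k (p ^ (k * d))) (\<lambda>\<alpha>. norm (es k (p ^ (k * d)) (cls (p ^ d) c X) a \<alpha>) ^ (2 * crit k)))) ^ crit k"
    using assms(1) unfolding Dec_def by blast
  also have "\<dots> \<le> L * (\<Sum>c\<in>{0..<p ^ d}. root (crit k)
          (avg (Box k (p ^ (k * d))) (\<lambda>\<alpha>. norm (es k (p ^ (k * d)) (cls (p ^ d) c X) a \<alpha>) ^ (2 * crit k)))) ^ crit k"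
    using assms(2) by (intro mult_right_mono zero_le_power sum_nonneg real_root_ge_zero avg_nonneg) auto
  finally show "avg (Box k (p ^ (k * d))) (\<lambda>\<alpha>. norm (es k (p ^ (k * d)) X a \<alpha>) ^ (2 * crit k))
     \<le> L * (\<Sum>c\<in>{0..<p ^ d}. root (crit k)
          (avg (Box k (p ^ (k * d))) (\<lambda>\<alpha>. norm (es k (p ^ (k * d)) (cls (p ^ d) c X) a \<alpha>) ^ (2 * crit k)))) ^ crit k" .
qed

text \<open>Decoupling in degree \<open>l\<close> passes from radius \<open>p^(-e)\<close> to
  \<open>p^(-(e + d))\<close> at the cost \<open>K\<close>. After the root of order
  \<open>crit l\<close> the bound on each smaller disc is linear in its \<open>lsum\<close>, so
  \<open>lsum_split\<close> reassembles the sum.\<close>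

lemma Mb_refine:
  assumes p: "prime p" "int k < p" and l: "1 \<le> l" "l < k" and dec: "Dec p l d K" and K: "K \<ge> 0" and V: "V \<ge> 0"
    and e: "1 \<le> e" "l * d \<le> e" "l * (e + d) \<le> (k - l + 1) * b" "e + d \<le> N"
    and M: "Mb p k N l (e + d) b V"
  shows "Mb p k N l e b (K * V)"
  unfolding Mb_def
proof (intro allI impI)
  fix X :: "int set" and a x0 x1
  assume X: "finite X" and x: "\<not> [x0 = x1] (mod p)"
  define t where "t = crit k - crit l"
  define s where "s = crit l"
  have s: "s > 0" using crit_pos[OF l(1)] by (simp add: s_def)
  define A where "A = lsum p k N b x1 X a"
  have A: "A \<ge> 0" using l by (simp add: A_def)
  have "l * (e + d) \<le> k * N" using l e(4) by (intro mult_le_mono) auto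
  from transverse_decoupling[OF p(1) x p(2) l e(2,3) this dec K X, of a "2 * t"]
  have "avg (Box k (p ^ (k * N))) (\<lambda>\<alpha>. norm (es k (p ^ (k * N)) (cls (p ^ b) x1 X) a \<alpha>) ^ (2 * t) * norm (es k (p ^ (k * N)) (cls (p ^ e) x0 X) a \<alpha>) ^ (2 * s))
    \<le> K * (\<Sum>c\<in>{0..<p ^ d}. root s (avg (Box k (p ^ (k * N)))
        (\<lambda>\<alpha>. norm (es k (p ^ (k * N)) (cls (p ^ b) x1 X) a \<alpha>) ^ (2 * t) * norm (es k (p ^ (k * N)) (cls (p ^ (e + d)) (x0 + p ^ e * c) X) a \<alpha>) ^ (2 * s)))) ^ s"
    by (simp add: s_def)
  also have "\<dots> \<le> K * (\<Sum>c\<in>{0..<p ^ d}. root s (V * A ^ t) * lsum p k N (e + d) (x0 + p ^ e * c) X a) ^ s"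
  proof (intro mult_left_mono K power_mono sum_mono sum_nonneg)
    fix c
    \<comment> \<open>Since \<open>e \<ge> 1\<close>, the centres of the smaller discs stay
      incongruent to \<open>x1\<close>.\<close>
    have "[x0 + p ^ e * c = x0] (mod p)" using e(1) by (simp add: cong_iff_dvd_diff dvd_power)
    then have "\<not> [x0 + p ^ e * c = x1] (mod p)" using x by (metis cong_sym cong_trans)
    then have "avg (Box k (p ^ (k * N)))
        (\<lambda>\<alpha>. norm (es k (p ^ (k * N)) (cls (p ^ b) x1 X) a \<alpha>) ^ (2 * t) * norm (es k (p ^ (k * N)) (cls (p ^ (e + d)) (x0 + p ^ e * c) X) a \<alpha>) ^ (2 * s))
      \<le> V * lsum p k N (e + d) (x0 + p ^ e * c) X a ^ s * A ^ t"
      using M X unfolding Mb_def t_def s_def A_def by blast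
    then have "root s (avg (Box k (p ^ (k * N)))
        (\<lambda>\<alpha>. norm (es k (p ^ (k * N)) (cls (p ^ b) x1 X) a \<alpha>) ^ (2 * t) * norm (es k (p ^ (k * N)) (cls (p ^ (e + d)) (x0 + p ^ e * c) X) a \<alpha>) ^ (2 * s)))
      \<le> root s ((V * A ^ t) * lsum p k N (e + d) (x0 + p ^ e * c) X a ^ s)"
      using s by (intro real_root_le_mono) (auto simp: mult_ac)
    also have "\<dots> = root s (V * A ^ t) * lsum p k N (e + d) (x0 + p ^ e * c) X a"
      using s l by (simp add: real_root_mult real_root_power_cancel)
    finally show "root s (avg (Box k (p ^ (k * N)))
        (\<lambda>\<alpha>. norm (es k (p ^ (k * N)) (cls (p ^ b) x1 X) a \<alpha>) ^ (2 * t) * norm (es k (p ^ (k * N)) (cls (p ^ (e + d)) (x0 + p ^ e * c) X) a \<alpha>) ^ (2 * s)))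
      \<le> root s (V * A ^ t) * lsum p k N (e + d) (x0 + p ^ e * c) X a" .
  qed (intro real_root_ge_zero avg_nonneg, simp)
  also have "(\<Sum>c\<in>{0..<p ^ d}. root s (V * A ^ t) * lsum p k N (e + d) (x0 + p ^ e * c) X a)
     = root s (V * A ^ t) * lsum p k N e x0 X a"
    using lsum_split[of p e d N k x0 X a] e(4) prime_gt_0_int[OF p(1)] by (simp add: sum_distrib_left)
  also have "K * (root s (V * A ^ t) * lsum p k N e x0 X a) ^ s = K * V * lsum p k N e x0 X a ^ s * A ^ t"
    using s V A by (simp add: power_mult_distrib real_root_pow_pos2 mult_ac)
  finally show "avg (Box k (p ^ (k * N))) (\<lambda>\<alpha>. norm (es k (p ^ (k * N)) (cls (p ^ b) x1 X) a \<alpha>) ^ (2 * (crit k - crit l))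
        * norm (es k (p ^ (k * N)) (cls (p ^ e) x0 X) a \<alpha>) ^ (2 * crit l))
     \<le> K * V * lsum p k N e x0 X a ^ crit l * lsum p k N b x1 X a ^ (crit k - crit l)"
    by (simp add: s_def t_def A_def)
qed

text \<open>With weights 1 and \<open>k - l\<close>, the exponents of the pair \<open>k - l\<close>
  with discs exchanged and of the pair \<open>l - 1\<close> average to those of the pair
  \<open>l\<close>. These identities between triangular numbers are the exponents in
  \<open>Mb_Holder\<close>.\<close>

lemma crit_exchange:
  assumes "1 \<le> l" "l < k"
  shows "crit l * (k - l + 1) = (crit k - crit (k - l)) + crit (l - 1) * (k - l)"
    and "(crit k - crit l) * (k - l + 1) = crit (k - l) + (crit k - crit (l - 1)) * (k - l)"
proof -
  obtain l' where l': "l = l' + 1" using assms by (metis Suc_eq_plus1 not0_implies_Suc not_one_le_zero)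
  obtain m where m: "k = l + m" using assms less_imp_add_positive by blast
  have c: "2 * int (crit x) = int x * (int x + 1)" for x
    using two_crit[of x] by (metis of_nat_1 of_nat_add of_nat_mult of_nat_numeral)
  have le: "crit l \<le> crit k" "crit (k - l) \<le> crit k" "crit (l - 1) \<le> crit k" using assms by (auto intro: crit_mono)
  have "2 * int (crit l * (k - l + 1)) = 2 * int ((crit k - crit (k - l)) + crit (l - 1) * (k - l))"
    using le c[of l] c[of k] c[of m] c[of l'] by (simp add: of_nat_diff l' m) algebra
  then show "crit l * (k - l + 1) = (crit k - crit (k - l)) + crit (l - 1) * (k - l)"
    by (metis of_nat_eq_iff mult_cancel_left zero_neq_numeral)
  have "2 * int ((crit k - crit l) * (k - l + 1)) = 2 * int (crit (k - l) + (crit k - crit (l - 1)) * (k - l))"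
    using le c[of l] c[of k] c[of m] c[of l'] by (simp add: of_nat_diff l' m) algebra
  then show "(crit k - crit l) * (k - l + 1) = crit (k - l) + (crit k - crit (l - 1)) * (k - l)"
    by (metis of_nat_eq_iff mult_cancel_left zero_neq_numeral)
qed

text \<open>Hoelder's inequality interpolates between a bilinear average with the two discs
  exchanged and one of lower index. The first brings the gain already known at the other scale, the
  second is the induction on \<open>l\<close>.\<close>

lemma Mb_Holder:
  assumes l: "1 \<le> l" "l < k" and M1: "Mb p k N (k - l) b e V1" and M2: "Mb p k N (l - 1) e b V2"
    and V: "V1 \<ge> 0" "V2 \<ge> 0" "V \<ge> 0" "V1 * V2 ^ (k - l) \<le> V ^ (k - l + 1)"
  shows "Mb p k N l e b V"
  unfolding Mb_def
proof (intro allI impI)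
  fix X :: "int set" and a x0 x1
  assume X: "finite X" and x: "\<not> [x0 = x1] (mod p)"
  define u where "u \<alpha> = norm (es k (p ^ (k * N)) (cls (p ^ e) x0 X) a \<alpha>)" for \<alpha>
  define v where "v \<alpha> = norm (es k (p ^ (k * N)) (cls (p ^ b) x1 X) a \<alpha>)" for \<alpha>
  define A where "A = lsum p k N e x0 X a"
  define B where "B = lsum p k N b x1 X a"
  define S where "S = Box k (p ^ (k * N))"
  have nn: "A \<ge> 0" "B \<ge> 0" using l by (auto simp: A_def B_def)
  have e1: "2 * crit l * (k - l + 1) = 2 * (crit k - crit (k - l)) + 2 * crit (l - 1) * (k - l)"
    and e2: "2 * (crit k - crit l) * (k - l + 1) = 2 * crit (k - l) + 2 * (crit k - crit (l - 1)) * (k - l)"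
    using arg_cong[OF crit_exchange(1)[OF l], of "\<lambda>x. 2 * x"] arg_cong[OF crit_exchange(2)[OF l], of "\<lambda>x. 2 * x"]
    by (simp_all only: distrib_left mult.assoc)
  have ave1: "avg S (\<lambda>\<alpha>. u \<alpha> ^ (2 * (crit k - crit (k - l))) * v \<alpha> ^ (2 * crit (k - l))) \<le> V1 * B ^ crit (k - l) * A ^ (crit k - crit (k - l))"
  proof -
    have "\<not> [x1 = x0] (mod p)" using x cong_sym by blast
    from M1[unfolded Mb_def, rule_format, OF X this, of a] show ?thesis
      by (simp only: u_def v_def A_def B_def S_def)
  qed
  have ave2: "avg S (\<lambda>\<alpha>. v \<alpha> ^ (2 * (crit k - crit (l - 1))) * u \<alpha> ^ (2 * crit (l - 1))) \<le> V2 * A ^ crit (l - 1) * B ^ (crit k - crit (l - 1))"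
    using M2 X x unfolding Mb_def u_def v_def A_def B_def S_def by blast
  define F where "F = (\<lambda>\<alpha>. v \<alpha> ^ (2 * (crit k - crit l)) * u \<alpha> ^ (2 * crit l))"
  have Fn: "0 \<le> F \<alpha>" for \<alpha> by (simp add: F_def u_def v_def)
  have "avg S F ^ (1 + (k - l)) \<le> avg S (\<lambda>\<alpha>. u \<alpha> ^ (2 * (crit k - crit (k - l))) * v \<alpha> ^ (2 * crit (k - l))) ^ 1
      * avg S (\<lambda>\<alpha>. v \<alpha> ^ (2 * (crit k - crit (l - 1))) * u \<alpha> ^ (2 * crit (l - 1))) ^ (k - l)"
  proof (rule avg_Holder2)
    fix \<alpha>
    have "F \<alpha> ^ (1 + (k - l)) = v \<alpha> ^ (2 * (crit k - crit l) * (k - l + 1)) * u \<alpha> ^ (2 * crit l * (k - l + 1))"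
      unfolding F_def power_mult_distrib by (simp only: power_mult[symmetric] add.commute)
    also have "\<dots> = (u \<alpha> ^ (2 * (crit k - crit (k - l))) * v \<alpha> ^ (2 * crit (k - l))) ^ 1
      * (v \<alpha> ^ (2 * (crit k - crit (l - 1))) * u \<alpha> ^ (2 * crit (l - 1))) ^ (k - l)"
      unfolding e1 e2 power_add power_mult power_mult_distrib by (simp add: mult_ac)
    finally show "F \<alpha> ^ (1 + (k - l)) \<le> (u \<alpha> ^ (2 * (crit k - crit (k - l))) * v \<alpha> ^ (2 * crit (k - l))) ^ 1
      * (v \<alpha> ^ (2 * (crit k - crit (l - 1))) * u \<alpha> ^ (2 * crit (l - 1))) ^ (k - l)" by simp
  qed (auto simp: S_def F_def u_def v_def)
  also have "\<dots> \<le> (V1 * B ^ crit (k - l) * A ^ (crit k - crit (k - l))) ^ 1 * (V2 * A ^ crit (l - 1) * B ^ (crit k - crit (l - 1))) ^ (k - l)"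
    using ave1 ave2 nn V by (intro mult_mono power_mono) (auto simp: u_def v_def intro!: avg_nonneg zero_le_power mult_nonneg_nonneg)
  also have "\<dots> = (V1 * V2 ^ (k - l)) * (A ^ (crit k - crit (k - l) + crit (l - 1) * (k - l)) * B ^ (crit (k - l) + (crit k - crit (l - 1)) * (k - l)))"
    by (simp add: power_mult_distrib power_add power_mult[symmetric] mult_ac)
  also have "\<dots> = (V1 * V2 ^ (k - l)) * (A ^ (crit l * (k - l + 1)) * B ^ ((crit k - crit l) * (k - l + 1)))"
    by (simp only: crit_exchange[OF l])
  also have "\<dots> \<le> V ^ (k - l + 1) * (A ^ (crit l * (k - l + 1)) * B ^ ((crit k - crit l) * (k - l + 1)))"
    using nn V by (intro mult_right_mono) auto
  also have "\<dots> = (V * A ^ crit l * B ^ (crit k - crit l)) ^ (1 + (k - l))"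
    unfolding power_mult_distrib power_mult by (simp only: mult.assoc add.commute)
  finally have "avg S F \<le> V * A ^ crit l * B ^ (crit k - crit l)"
    using nn V by (subst (asm) power_mono_iff) (auto intro!: avg_nonneg Fn)
  then show "avg (Box k (p ^ (k * N))) (\<lambda>\<alpha>. norm (es k (p ^ (k * N)) (cls (p ^ b) x1 X) a \<alpha>) ^ (2 * (crit k - crit l))
        * norm (es k (p ^ (k * N)) (cls (p ^ e) x0 X) a \<alpha>) ^ (2 * crit l))
     \<le> V * lsum p k N e x0 X a ^ crit l * lsum p k N b x1 X a ^ (crit k - crit l)"
    by (simp add: S_def F_def u_def v_def A_def B_def)
qed

lemma Mb_0:
  assumes "Dec p k (N - b) K" "K \<ge> 0" "k \<ge> 1" "b \<le> N" "p > 1"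
  shows "Mb p k N 0 e b K"
  unfolding Mb_def using Dec_rescale[OF assms] by simp

text \<open>Hoelder's inequality and linear decoupling of either disc; this has no gain and starts
  the iteration in \<open>bilinear_saving\<close>.\<close>

lemma Mb_trivial:
  assumes "Dec p k (N - e) V" "Dec p k (N - b) V" "V \<ge> 0" "k \<ge> 1" "e \<le> N" "b \<le> N" "p > 1" "l \<le> k"
  shows "Mb p k N l e b V"
  unfolding Mb_def
proof (intro allI impI)
  fix X :: "int set" and a x0 x1
  assume X: "finite X" and x: "\<not> [x0 = x1] (mod p)"
  define u where "u \<alpha> = norm (es k (p ^ (k * N)) (cls (p ^ e) x0 X) a \<alpha>)" for \<alpha>
  define v where "v \<alpha> = norm (es k (p ^ (k * N)) (cls (p ^ b) x1 X) a \<alpha>)" for \<alpha>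
  define A where "A = lsum p k N e x0 X a"
  define B where "B = lsum p k N b x1 X a"
  define S where "S = Box k (p ^ (k * N))"
  define t where "t = crit k - crit l"
  define s where "s = crit l"
  have st: "s + t = crit k" using crit_mono[OF assms(8)] by (simp add: s_def t_def)
  have st0: "s + t > 0" using st crit_pos[OF assms(4)] by simp
  have nn: "A \<ge> 0" "B \<ge> 0" using assms by (auto simp: A_def B_def)
  define F where "F = (\<lambda>\<alpha>. v \<alpha> ^ (2 * t) * u \<alpha> ^ (2 * s))"
  have Fn: "0 \<le> F \<alpha>" for \<alpha> by (simp add: F_def u_def v_def)
  have ua: "avg S (\<lambda>\<alpha>. u \<alpha> ^ (2 * (s + t))) \<le> V * A ^ (s + t)"
    using Dec_rescale[OF assms(1,3,4,5,7) X] by (simp add: st u_def S_def A_def)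
  have va: "avg S (\<lambda>\<alpha>. v \<alpha> ^ (2 * (s + t))) \<le> V * B ^ (s + t)"
    using Dec_rescale[OF assms(2,3,4,6,7) X] by (simp add: st v_def S_def B_def)
  have "avg S F ^ (s + t) \<le> avg S (\<lambda>\<alpha>. u \<alpha> ^ (2 * (s + t))) ^ s * avg S (\<lambda>\<alpha>. v \<alpha> ^ (2 * (s + t))) ^ t"
    by (rule avg_Holder2[OF _ _ _ _ _ st0])
      (auto simp: S_def F_def u_def v_def power_mult_distrib power_mult[symmetric] mult_ac)
  also have "\<dots> \<le> (V * A ^ (s + t)) ^ s * (V * B ^ (s + t)) ^ t"
    using ua va nn assms(3) by (intro mult_mono power_mono) (auto simp: u_def v_def intro!: avg_nonneg zero_le_power mult_nonneg_nonneg)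
  also have "\<dots> = (V * A ^ s * B ^ t) ^ (s + t)"
    by (simp add: power_mult_distrib power_add power_mult[symmetric] mult_ac)
  finally have "avg S F \<le> V * A ^ s * B ^ t"
    using nn assms(3) st0 by (subst (asm) power_mono_iff) (auto intro!: avg_nonneg Fn)
  then show "avg (Box k (p ^ (k * N))) (\<lambda>\<alpha>. norm (es k (p ^ (k * N)) (cls (p ^ b) x1 X) a \<alpha>) ^ (2 * (crit k - crit l))
        * norm (es k (p ^ (k * N)) (cls (p ^ e) x0 X) a \<alpha>) ^ (2 * crit l))
     \<le> V * lsum p k N e x0 X a ^ crit l * lsum p k N b x1 X a ^ (crit k - crit l)"
    by (simp add: S_def F_def u_def v_def A_def B_def s_def t_def)
qed

text \<open>One application of \<open>Mb_refine\<close> allows only \<open>d \<le> e / l\<close>, so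
  a large step is a chain of such steps. The constant \<open>C\<close> of each step except the last
  is at most \<open>P powr (\<epsilon> * d)\<close>, because \<open>d \<ge> d0\<close>; this doubles
  \<epsilon> and leaves a single factor \<open>C\<close>.\<close>

lemma Mb_refine_iterate:
  fixes P :: real
  assumes p: "prime p" "int k < p" and l: "1 \<le> l" "l < k" and P: "P = real_of_int p"
    and dec: "\<And>d. Dec p l d (C * P powr (\<epsilon> * real d))" and C: "C \<ge> 1" and eps: "\<epsilon> > 0"
    and d0: "1 \<le> d0" "C \<le> P powr (\<epsilon> * real d0)"
    and e: "l * d0 \<le> e" "e \<le> e'" "l * e' \<le> (k - l + 1) * b" "e' \<le> N"
    and M: "Mb p k N l e' b V" and V: "V \<ge> 0"
  shows "Mb p k N l e b (C * P powr (2 * \<epsilon> * real (e' - e)) * V)"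
  using e(1,2)
proof (induction "e' - e" arbitrary: e rule: less_induct)
  case less
  have P1: "P > 1" using prime_gt_1_int[OF p(1)] by (simp add: P)
  have e1: "1 \<le> e" using less.prems(1) l d0(1) by (metis One_nat_def Suc_leI le_trans mult_eq_0_iff neq0_conv not_one_le_zero)
  show ?case
  proof (cases "l * (e' - e) \<le> e")
    case True
    have "Mb p k N l e b (C * P powr (\<epsilon> * real (e' - e)) * V)"
      using l less.prems e M C V e1 True
      by (intro Mb_refine[OF p l dec]) auto
    moreover have "C * P powr (\<epsilon> * real (e' - e)) * V \<le> C * P powr (2 * \<epsilon> * real (e' - e)) * V"
      using C V P1 eps by (intro mult_right_mono mult_left_mono powr_mono) auto
    ultimately show ?thesis by (rule Mb_mono) (use l in simp)
  next
    case False
    \<comment> \<open>The largest step that \<open>l * d \<le> e\<close> permits; it is at least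
      \<open>d0\<close>.\<close>
    define d where "d = e div l"
    have dd0: "d0 \<le> d" unfolding d_def using less.prems(1) l(1) by (simp add: less_eq_div_iff_mult_less_eq mult.commute)
    have ld: "l * d \<le> e" by (simp add: d_def)
    have de: "e + d \<le> e'" using False ld l by (metis add.commute le_diff_conv2 less.prems(2) mult_le_cancel1 nat_le_linear order_trans)
    have IH: "Mb p k N l (e + d) b (C * P powr (2 * \<epsilon> * real (e' - (e + d))) * V)"
      using less.hyps[of "e + d"] dd0 d0(1) de less.prems by auto
    have "l * (e + d) \<le> l * e'" using de by simp
    then have "l * (e + d) \<le> (k - l + 1) * b" using e(3) by linarith
    then have "Mb p k N l e b ((C * P powr (\<epsilon> * real d)) * (C * P powr (2 * \<epsilon> * real (e' - (e + d))) * V))"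
      using C V e1 ld de e(4) by (intro Mb_refine[OF p l dec _ _ _ _ _ _ IH]) auto
    moreover have "(C * P powr (\<epsilon> * real d)) * (C * P powr (2 * \<epsilon> * real (e' - (e + d))) * V) \<le> C * P powr (2 * \<epsilon> * real (e' - e)) * V"
    proof -
      have "C \<le> P powr (\<epsilon> * real d)"
        using d0(2) dd0 eps P1 by (smt (verit) mult_left_mono of_nat_mono powr_mono)
      then have "(C * P powr (\<epsilon> * real d)) * (C * P powr (2 * \<epsilon> * real (e' - (e + d))) * V) \<le>
        (P powr (\<epsilon> * real d) * P powr (\<epsilon> * real d)) * (C * P powr (2 * \<epsilon> * real (e' - (e + d))) * V)"
        using C V by (intro mult_right_mono) auto
      also have "\<dots> = C * (P powr (\<epsilon> * real d) * P powr (\<epsilon> * real d) * P powr (2 * \<epsilon> * real (e' - (e + d)))) * V" by simp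
      also have "P powr (\<epsilon> * real d) * P powr (\<epsilon> * real d) * P powr (2 * \<epsilon> * real (e' - (e + d))) = P powr (2 * \<epsilon> * real (e' - e))"
        using de by (simp add: powr_add[symmetric] of_nat_diff algebra_simps)
      finally show ?thesis .
    qed
    ultimately show ?thesis by (rule Mb_mono) (use l in simp)
  qed
qed

text \<open>Each round of the induction on \<open>n\<close> adds the gain
  \<open>\<mu> l (k - l) b\<close> to the exponent. The shape \<open>l (k - l)\<close> is reproduced
  by the Hoelder exchange, and the surplus comes from the case \<open>l = 0\<close>, where starting
  from radius \<open>p^(-b)\<close> saves \<open>\<eta> b\<close> outright. A round may replace
  \<open>b\<close> by a value up to \<open>k * b\<close>, hence
  \<open>k ^ (n + 1) * b \<le> N\<close>; the condition \<open>b \<le> k * e\<close> keeps the two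
  radii comparable.\<close>

lemma bilinear_saving:
  fixes p :: int and k :: nat and \<eta> C0 P :: real
  assumes p: "prime p" "int k < p" and k: "k \<ge> 2" and P: "P = real_of_int p"
    and IH: "\<And>l \<epsilon>. 1 \<le> l \<Longrightarrow> l < k \<Longrightarrow> \<epsilon> > 0 \<Longrightarrow> \<exists>C. \<forall>d. Dec p l d (C * P powr (\<epsilon> * real d))"
    and H: "\<And>N. Dec p k N (C0 * P powr (\<eta> * real N))" and eta: "\<eta> > 0" and C0: "C0 \<ge> 0"
    and lam: "\<mu> = \<eta> / (2 * real k ^ 2)"
  shows "\<exists>C b0. C \<ge> 0 \<and> (\<forall>l b N e. 1 \<le> l \<longrightarrow> l < k \<longrightarrow> b0 \<le> b \<longrightarrow> k ^ (n + 1) * b \<le> N \<longrightarrow> b \<le> k * e \<longrightarrow>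
     l * e \<le> (k - l + 1) * b \<longrightarrow>
     Mb p k N l e b (C * P powr (\<eta> * real N - real n * \<mu> * real l * real (k - l) * real b)))"
proof (induction n)
  case 0
  have P1: "P > 1" using prime_gt_1_int[OF p(1)] by (simp add: P)
  have "Mb p k N l e b (C0 * P powr (\<eta> * real N))"
    if "1 \<le> l" "l < k" "k * b \<le> N" "l * e \<le> (k - l + 1) * b" for l b N e
  proof -
    have "(k - l + 1) * b \<le> k * b" using that by (intro mult_le_mono) auto
    moreover have "e \<le> l * e" using that by simp
    ultimately have eN: "e \<le> N" using that by linarith
    have bN: "b \<le> N" using that k by (metis le_trans mult_le_mono1 nat_mult_1 one_le_numeral)
    have "Dec p k (N - f) (C0 * P powr (\<eta> * real N))" if "f \<le> N" for f
      by (rule Dec_mono[OF H]) (use C0 eta P1 k that in \<open>auto intro!: mult_left_mono powr_mono\<close>)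
    then show ?thesis using eN bN k C0 prime_gt_1_int[OF p(1)] that by (intro Mb_trivial) auto
  qed
  then show ?case using C0 by (intro exI[of _ C0] exI[of _ 0]) auto
next
  case (Suc n)
  then obtain Cn bn where Cn: "Cn \<ge> 0" and Mn: "\<And>l b N e. 1 \<le> l \<Longrightarrow> l < k \<Longrightarrow> bn \<le> b \<Longrightarrow> k ^ (n + 1) * b \<le> N \<Longrightarrow> b \<le> k * e \<Longrightarrow>
     l * e \<le> (k - l + 1) * b \<Longrightarrow> Mb p k N l e b (Cn * P powr (\<eta> * real N - real n * \<mu> * real l * real (k - l) * real b))"
    by blast
  have P1: "P > 1" using prime_gt_1_int[OF p(1)] by (simp add: P)
  have lam0: "\<mu> > 0" using eta k by (simp add: lam)
  have etal: "\<eta> / real k = 2 * real k * \<mu>" using k by (simp add: lam power2_eq_square)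
  define \<sigma> where "\<sigma> = real n * \<mu>"
  have sig0: "\<sigma> \<ge> 0" using lam0 by (simp add: \<sigma>_def)
  \<comment> \<open>Inner induction on \<open>l\<close> for one round: the old gain
    \<open>\<sigma> l (k - l)\<close>, the new term \<open>\<eta> / k * (k - l)\<close>, which for
    \<open>l = 0\<close> is the full \<eta>, and a loss \<mu> for each refinement made on the
    way.\<close>
  have Q: "\<exists>C b0. C \<ge> 0 \<and> (\<forall>b N e. b0 \<le> b \<longrightarrow> k ^ (n + 2) * b \<le> N \<longrightarrow> (1 \<le> l \<longrightarrow> b \<le> k * e \<and> l * e \<le> (k - l + 1) * b) \<longrightarrow> e \<le> N \<longrightarrow>
     Mb p k N l e b (C * P powr (\<eta> * real N - (\<sigma> * real l * real (k - l) + \<eta> / real k * real (k - l) - real l * \<mu>) * real b)))"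
    if "l < k" for l
    using that
  proof (induction l)
    case 0
    have "Mb p k N 0 e b (C0 * P powr (\<eta> * real N - (\<eta> / real k * real k) * real b))"
      if "k ^ (n + 2) * b \<le> N" for b N e
    proof -
      have "1 \<le> k ^ (n + 2)" using k by simp
      then have "b \<le> k ^ (n + 2) * b" by simp
      then have "b \<le> N" using that by linarith
      moreover have "C0 * P powr (\<eta> * real N - (\<eta> / real k * real k) * real b) = C0 * P powr (\<eta> * real (N - b))"
        using k \<open>b \<le> N\<close> by (simp add: of_nat_diff algebra_simps)
      ultimately show ?thesis
        using H[of "N - b"] C0 k prime_gt_1_int[OF p(1)] by (auto intro!: Mb_0)
    qed
    then show ?case using C0 by (intro exI[of _ C0] exI[of _ 0]) auto
  next
    case (Suc l')
    define l where "l = Suc l'"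
    have l: "1 \<le> l" "l < k" using Suc.prems by (auto simp: l_def)
    from Suc obtain C2 b2 where C2: "C2 \<ge> 0" and M2: "\<And>b N e. b2 \<le> b \<Longrightarrow> k ^ (n + 2) * b \<le> N \<Longrightarrow> (1 \<le> l' \<Longrightarrow> b \<le> k * e \<and> l' * e \<le> (k - l' + 1) * b) \<Longrightarrow> e \<le> N \<Longrightarrow>
     Mb p k N l' e b (C2 * P powr (\<eta> * real N - (\<sigma> * real l' * real (k - l') + \<eta> / real k * real (k - l') - real l' * \<mu>) * real b))"
      by (metis Suc_lessD)
    \<comment> \<open>The refinement from \<open>e\<close> to \<open>e' \<le> k * b\<close> costs
      the exponent \<open>2 \<epsilon> k b\<close>, which is \<open>\<mu> b\<close>.\<close>
    define \<epsilon> where "\<epsilon> = \<mu> / (2 * real k)"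
    have eps: "\<epsilon> > 0" using lam0 k by (simp add: \<epsilon>_def)
    obtain CL where CL: "\<And>d. Dec p l d (CL * P powr (\<epsilon> * real d))" using IH[OF l eps] by blast
    define C1 where "C1 = max CL 1"
    have C1: "C1 \<ge> 1" by (simp add: C1_def)
    have dec: "Dec p l d (C1 * P powr (\<epsilon> * real d))" for d
      by (rule Dec_mono[OF CL]) (use l in \<open>auto simp: C1_def intro!: mult_right_mono\<close>)
    have "P powr \<epsilon> > 1" using P1 eps by (rule gr_one_powr)
    then obtain d1 where d1: "C1 < (P powr \<epsilon>) ^ d1" using real_arch_pow by blast
    define d0 where "d0 = Suc d1"
    have d0: "1 \<le> d0" "C1 \<le> P powr (\<epsilon> * real d0)"
    proof -
      have "(P powr \<epsilon>) ^ d1 = P powr (\<epsilon> * real d1)" using P1 by (simp add: powr_powr flip: powr_realpow)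
      also have "\<dots> \<le> P powr (\<epsilon> * real d0)" using P1 eps by (intro powr_mono) (auto simp: d0_def)
      finally show "C1 \<le> P powr (\<epsilon> * real d0)" using d1 by simp
    qed (simp add: d0_def)
    \<comment> \<open>The power of \<open>P\<close> pays for the rounding of \<open>e'\<close>
      below.\<close>
    define C3 where "C3 = max (Cn * P powr (\<sigma> * real (k - l) * real l)) C2"
    have C3: "C3 \<ge> 0" using C2 by (simp add: C3_def)
    define b0 where "b0 = b2 + k * bn + k * (l * d0) + k"
    have main: "Mb p k N l e b (C1 * C3 * P powr (\<eta> * real N - (\<sigma> * real l * real (k - l) + \<eta> / real k * real (k - l) - real l * \<mu>) * real b))"
      if b: "b0 \<le> b" and bN: "k ^ (n + 2) * b \<le> N" and be: "b \<le> k * e" "l * e \<le> (k - l + 1) * b" for b N e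
    proof -
      \<comment> \<open>The finest radius allowed by \<open>l * e' \<le> (k - l + 1) * b\<close>. Up
        to rounding this is an equality, so the exchanged pair gains about
        \<open>\<sigma> (k - l) (k - l + 1) b\<close>.\<close>
      define e' where "e' = (k - l + 1) * b div l"
      have f1: "l * e' \<le> (k - l + 1) * b" by (simp add: e'_def)
      have f2: "(k - l + 1) * b < l * e' + l" using dividend_less_times_div[of l "(k - l + 1) * b"] l by (simp add: e'_def)
      have f3: "e \<le> e'" unfolding e'_def using be(2) l by (simp add: less_eq_div_iff_mult_less_eq mult.commute)
      have "(k - l + 1) * b \<le> k * b" using l by (intro mult_le_mono) auto
      then have f4: "e' \<le> k * b" unfolding e'_def by (meson div_le_dividend le_trans)
      have "k ^ 1 \<le> k ^ (n + 2)" using k by (intro power_increasing) auto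
      then have "k * b \<le> k ^ (n + 2) * b" by (intro mult_le_mono) auto
      then have f5: "k * b \<le> N" using bN by linarith
      have "k * bn \<le> k * e" using b be(1) unfolding b0_def by linarith
      then have f6: "bn \<le> e'" using f3 k by simp
      have "k ^ (n + 1) * e' \<le> k ^ (n + 1) * (k * b)" using f4 by (rule mult_le_mono2)
      moreover have "k ^ (n + 1) * (k * b) = k ^ (n + 2) * b" by (simp add: mult_ac)
      ultimately have f7: "k ^ (n + 1) * e' \<le> N" using bN by linarith
      have "(k - l) * b + b < l * e' + l" using f2 by simp
      moreover have "l \<le> b" using b l by (simp add: b0_def)
      ultimately have f8: "(k - l) * b \<le> (k - (k - l) + 1) * e'" using l by simp
      have "k * (l * d0) \<le> k * e" using b be(1) unfolding b0_def by linarith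
      then have f9: "l * d0 \<le> e" using k by simp
      \<comment> \<open>The outer hypothesis is used with the discs exchanged and
        \<open>k - l\<close> in place of \<open>l\<close>; \<open>f4\<close> and \<open>f8\<close>
        are its two conditions relating the radii.\<close>
      define V1 where "V1 = Cn * P powr (\<eta> * real N - real n * \<mu> * real (k - l) * real (k - (k - l)) * real e')"
      have M1: "Mb p k N (k - l) b e' V1"
        unfolding V1_def using l f6 f7 f4 f8 by (intro Mn) auto
      define x where "x = \<sigma> * real l' * real (k - l') + \<eta> / real k * real (k - l') - real l' * \<mu>"
      define V2 where "V2 = C2 * P powr (\<eta> * real N - x * real b)"
      have "Mb p k N l' e' b V2"
        unfolding V2_def x_def
      proof (rule M2)
        show "b2 \<le> b" using b by (simp add: b0_def)
        show "b \<le> k * e' \<and> l' * e' \<le> (k - l' + 1) * b"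
        proof
          show "b \<le> k * e'" using be(1) f3 by (meson le_trans mult_le_mono2)
          have "l' * e' \<le> l * e'" by (simp add: l_def)
          moreover have "(k - l + 1) * b \<le> (k - l' + 1) * b" by (intro mult_le_mono) (auto simp: l_def)
          ultimately show "l' * e' \<le> (k - l' + 1) * b" using f1 by linarith
        qed
        show "e' \<le> N" using f4 f5 by simp
      qed (rule bN)
      then have M2': "Mb p k N (l - 1) e' b V2" by (simp add: l_def)
      define j where "j = real (k - l)"
      define y where "y = \<sigma> * real l * j + \<eta> / real k * j - real l' * \<mu>"
      define V where "V = C3 * P powr (\<eta> * real N - y * real b)"
      have kl': "real (k - l') = j + 1" using l by (simp add: j_def l_def of_nat_diff)
      have rl: "real l = real l' + 1" by (simp add: l_def)
      have "V1 \<le> C3 * P powr (\<eta> * real N - \<sigma> * j * (j + 1) * real b)"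
      proof -
        have "real ((k - l + 1) * b) \<le> real (l * e' + l)" using f2 by (simp only: of_nat_le_iff less_imp_le)
        then have "(j + 1) * real b \<le> real l * real e' + real l"
          by (simp only: of_nat_mult of_nat_add of_nat_1 j_def)
        then have "\<sigma> * j * ((j + 1) * real b) \<le> \<sigma> * j * (real l * real e' + real l)"
          using sig0 by (intro mult_left_mono) (auto simp: j_def)
        then have "\<eta> * real N - real n * \<mu> * real (k - l) * real (k - (k - l)) * real e' \<le> \<sigma> * real (k - l) * real l + (\<eta> * real N - \<sigma> * j * (j + 1) * real b)"
          using l by (simp add: \<sigma>_def j_def algebra_simps)
        then have "V1 \<le> Cn * P powr (\<sigma> * real (k - l) * real l + (\<eta> * real N - \<sigma> * j * (j + 1) * real b))"
          unfolding V1_def using Cn P1 by (intro mult_left_mono powr_mono) auto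
        also have "\<dots> = (Cn * P powr (\<sigma> * real (k - l) * real l)) * P powr (\<eta> * real N - \<sigma> * j * (j + 1) * real b)"
          by (simp add: powr_add)
        also have "\<dots> \<le> C3 * P powr (\<eta> * real N - \<sigma> * j * (j + 1) * real b)"
          by (intro mult_right_mono) (auto simp: C3_def)
        finally show ?thesis .
      qed
      moreover have "V2 ^ (k - l) \<le> (C3 * P powr (\<eta> * real N - x * real b)) ^ (k - l)"
        unfolding V2_def using C2 by (intro power_mono mult_right_mono) (auto simp: C3_def)
      ultimately have "V1 * V2 ^ (k - l) \<le> (C3 * P powr (\<eta> * real N - \<sigma> * j * (j + 1) * real b)) * (C3 * P powr (\<eta> * real N - x * real b)) ^ (k - l)"
        using C2 C3 by (intro mult_mono) (auto simp: V2_def)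
      also have "\<dots> = C3 ^ (k - l + 1) * P powr ((\<eta> * real N - \<sigma> * j * (j + 1) * real b) + j * (\<eta> * real N - x * real b))"
        using P1 by (simp add: power_mult_distrib powr_add powr_powr j_def mult.commute flip: powr_realpow)
      also have "\<dots> \<le> C3 ^ (k - l + 1) * P powr ((j + 1) * (\<eta> * real N - y * real b))"
      proof (intro mult_left_mono powr_mono)
        \<comment> \<open>The Hoelder average of the two gains reproduces
          \<open>\<sigma> l (k - l) + \<eta> / k * (k - l)\<close>; the inherited loss even shrinks
          by the factor \<open>j / (j + 1)\<close>.\<close>
        have "(\<sigma> * j * (j + 1) + j * x) - (j + 1) * y = real l' * \<mu>"
          unfolding x_def y_def kl' rl by (simp add: algebra_simps)
        then have "(j + 1) * y \<le> \<sigma> * j * (j + 1) + j * x" using lam0 by (smt (verit) mult_nonneg_nonneg of_nat_0_le_iff)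
        then have "(j + 1) * y * real b \<le> (\<sigma> * j * (j + 1) + j * x) * real b" by (intro mult_right_mono) auto
        then show "(\<eta> * real N - \<sigma> * j * (j + 1) * real b) + j * (\<eta> * real N - x * real b) \<le> (j + 1) * (\<eta> * real N - y * real b)"
          by (simp add: algebra_simps)
      qed (use P1 C3 in auto)
      also have "\<dots> = V ^ (k - l + 1)"
      proof -
        have "(P powr Y) ^ q = P powr (real q * Y)" for Y and q :: nat
          using P1 by (simp add: powr_powr mult.commute flip: powr_realpow)
        then show ?thesis by (simp only: V_def power_mult_distrib of_nat_add of_nat_1 j_def)
      qed
      finally have VV: "V1 * V2 ^ (k - l) \<le> V ^ (k - l + 1)" .
      have "Mb p k N l e' b V"
        by (rule Mb_Holder[OF l M1 M2' _ _ _ VV]) (use Cn C2 C3 in \<open>auto simp: V1_def V2_def V_def\<close>)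
      then have "Mb p k N l e b (C1 * P powr (2 * \<epsilon> * real (e' - e)) * V)"
        using f4 f5 C3
        by (intro Mb_refine_iterate[OF p l P dec C1 eps d0 f9 f3 f1]) (auto simp: V_def)
      moreover have "C1 * P powr (2 * \<epsilon> * real (e' - e)) * V \<le> C1 * C3 * P powr (\<eta> * real N - (\<sigma> * real l * real (k - l) + \<eta> / real k * real (k - l) - real l * \<mu>) * real b)"
      proof -
        have "real (e' - e) \<le> real (k * b)" using f4 by (simp only: of_nat_le_iff)
        then have "2 * \<epsilon> * real (e' - e) \<le> 2 * \<epsilon> * (real k * real b)" using eps by (intro mult_left_mono) auto
        also have "\<dots> = \<mu> * real b" using k by (simp add: \<epsilon>_def)
        finally have "2 * \<epsilon> * real (e' - e) + (\<eta> * real N - y * real b) \<le> \<eta> * real N - (\<sigma> * real l * real (k - l) + \<eta> / real k * real (k - l) - real l * \<mu>) * real b"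
          unfolding y_def j_def rl by (simp add: algebra_simps)
        then have "P powr (2 * \<epsilon> * real (e' - e)) * P powr (\<eta> * real N - y * real b) \<le> P powr (\<eta> * real N - (\<sigma> * real l * real (k - l) + \<eta> / real k * real (k - l) - real l * \<mu>) * real b)"
          unfolding powr_add[symmetric] using P1 by (intro powr_mono) auto
        then have "(C1 * C3) * (P powr (2 * \<epsilon> * real (e' - e)) * P powr (\<eta> * real N - y * real b)) \<le> (C1 * C3) * P powr (\<eta> * real N - (\<sigma> * real l * real (k - l) + \<eta> / real k * real (k - l) - real l * \<mu>) * real b)"
          using C1 C3 by (intro mult_left_mono) auto
        then show ?thesis by (simp add: V_def mult_ac)
      qed
      ultimately show ?thesis by (rule Mb_mono) (use k in simp)
    qed
    then show ?case unfolding l_def[symmetric] using C1 C3 l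
      by (intro exI[of _ "C1 * C3"] exI[of _ b0]) auto
  qed
  then obtain Cf bf where Cf: "\<And>l. l < k \<Longrightarrow> Cf l \<ge> 0" and Mf: "\<And>l b N e. l < k \<Longrightarrow> bf l \<le> b \<Longrightarrow> k ^ (n + 2) * b \<le> N \<Longrightarrow> (1 \<le> l \<Longrightarrow> b \<le> k * e \<and> l * e \<le> (k - l + 1) * b) \<Longrightarrow> e \<le> N \<Longrightarrow>
     Mb p k N l e b (Cf l * P powr (\<eta> * real N - (\<sigma> * real l * real (k - l) + \<eta> / real k * real (k - l) - real l * \<mu>) * real b))"
    by metis
  define C where "C = (\<Sum>l<k. Cf l)"
  define b0 where "b0 = (\<Sum>l<k. bf l)"
  have "Mb p k N l e b (C * P powr (\<eta> * real N - real (Suc n) * \<mu> * real l * real (k - l) * real b))"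
    if l: "1 \<le> l" "l < k" and b: "b0 \<le> b" and N: "k ^ (Suc n + 1) * b \<le> N" and e: "b \<le> k * e" "l * e \<le> (k - l + 1) * b" for l b N e
  proof -
    have Cl: "Cf l \<le> C" unfolding C_def using l Cf by (intro member_le_sum) auto
    have "bf l \<le> b0" unfolding b0_def using l by (intro member_le_sum) auto
    then have bl: "bf l \<le> b" using b by simp
    have N2: "k ^ (n + 2) * b \<le> N" using N by simp
    have "k ^ 1 \<le> k ^ (n + 2)" using k by (intro power_increasing) auto
    then have "k * b \<le> k ^ (n + 2) * b" by (intro mult_le_mono) auto
    moreover have "(k - l + 1) * b \<le> k * b" using l by (intro mult_le_mono) auto
    moreover have "e \<le> l * e" using l by simp
    ultimately have eN: "e \<le> N" using e N2 by linarith
    define j where "j = real (k - l)"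
    have j: "j \<ge> 1" using l by (simp add: j_def)
    have kl: "real l \<le> real k" using l by simp
    \<comment> \<open>By \<open>etal\<close> the new term is \<open>2 k \<mu> j\<close>. It pays for
      the loss \<open>l \<mu>\<close> and for a further \<open>\<mu> l j\<close>, which is the
      reason for the choice of \<mu>.\<close>
    have "real l * j + real l \<le> real k * j + real k * j"
    proof (intro add_mono)
      show "real l * j \<le> real k * j" using j kl by (intro mult_right_mono) auto
      have "real k * 1 \<le> real k * j" using j by (intro mult_left_mono) auto
      then show "real l \<le> real k * j" using kl by simp
    qed
    then have "(real l * j + real l) * \<mu> \<le> (real k * j + real k * j) * \<mu>" using lam0 by (intro mult_right_mono) auto
    then have "real (Suc n) * \<mu> * real l * j \<le> \<sigma> * real l * j + \<eta> / real k * j - real l * \<mu>"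
      unfolding etal \<sigma>_def by (simp add: algebra_simps)
    then have "real (Suc n) * \<mu> * real l * j * real b \<le> (\<sigma> * real l * j + \<eta> / real k * j - real l * \<mu>) * real b"
      by (intro mult_right_mono) auto
    then have "P powr (\<eta> * real N - (\<sigma> * real l * j + \<eta> / real k * j - real l * \<mu>) * real b) \<le> P powr (\<eta> * real N - real (Suc n) * \<mu> * real l * j * real b)"
      using P1 by (intro powr_mono) auto
    then have le: "Cf l * P powr (\<eta> * real N - (\<sigma> * real l * j + \<eta> / real k * j - real l * \<mu>) * real b) \<le> C * P powr (\<eta> * real N - real (Suc n) * \<mu> * real l * j * real b)"
      using Cl Cf[OF l(2)] by (intro mult_mono) auto
    have Ml: "Mb p k N l e b (Cf l * P powr (\<eta> * real N - (\<sigma> * real l * j + \<eta> / real k * j - real l * \<mu>) * real b))"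
      unfolding j_def by (rule Mf[OF l(2) bl N2 _ eN]) (use e in simp)
    have "1 \<le> k" using k by simp
    from Mb_mono[OF Ml le this] show ?thesis by (simp only: j_def)
  qed
  moreover have "C \<ge> 0" unfolding C_def using Cf by (intro sum_nonneg) auto
  ultimately show ?case by (intro exI[of _ C] exI[of _ b0]) auto
qed

section \<open>Reduction of linear to bilinear averages\<close>

lemma power_sum_le_sum_power:
  fixes y :: "'a \<Rightarrow> real"
  assumes "finite S" "\<And>c. c \<in> S \<Longrightarrow> 0 \<le> y c" "m > 0"
  shows "(\<Sum>c\<in>S. y c) ^ m \<le> real (card S) ^ m * (\<Sum>c\<in>S. y c ^ m)"
proof (cases "S = {}")
  case False
  define M where "M = Max (y ` S)"
  have "M \<in> y ` S" unfolding M_def using assms False by (intro Max_in) auto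
  then obtain c where c: "c \<in> S" "M = y c" by auto
  have "(\<Sum>c\<in>S. y c) \<le> real (card S) * M"
    using assms False by (intro sum_bounded_above) (auto simp: M_def)
  then have "(\<Sum>c\<in>S. y c) ^ m \<le> (real (card S) * M) ^ m"
    using assms by (intro power_mono sum_nonneg) auto
  also have "\<dots> \<le> real (card S) ^ m * (\<Sum>c\<in>S. y c ^ m)"
    unfolding power_mult_distrib c(2) using assms c by (intro mult_left_mono member_le_sum) auto
  finally show ?thesis .
qed (use assms in \<open>simp add: power_0_left\<close>)

lemma sum_power_le_power_sum:
  fixes y :: "'a \<Rightarrow> real"
  assumes "finite S" "\<And>c. c \<in> S \<Longrightarrow> 0 \<le> y c" "m > 0"
  shows "(\<Sum>c\<in>S. y c ^ m) \<le> (\<Sum>c\<in>S. y c) ^ m"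
proof -
  obtain n where n: "m = Suc n" using assms(3) gr0_implies_Suc by blast
  have "(\<Sum>c\<in>S. y c ^ m) \<le> (\<Sum>c\<in>S. y c * (\<Sum>c\<in>S. y c) ^ n)"
    unfolding n power_Suc using assms by (intro sum_mono mult_left_mono power_mono member_le_sum) auto
  then show ?thesis by (simp add: n sum_distrib_right)
qed

text \<open>Let \<open>F j\<close> be the largest term. Either all others are smaller by the factor
  \<open>card I * T\<close>, and the sum is at most \<open>(1 + 1 / T)\<close> times
  \<open>F j\<close>; or some \<open>F i\<close> is comparable with it and may replace two of the
  \<open>2 * s\<close> factors. The exponents \<open>2 * (s - 1)\<close> and 2 are those of the
  bilinear average with index 1.\<close>

lemma broad_narrow:
  fixes F :: "'a \<Rightarrow> complex"
  assumes "finite I" "T > 0" "s \<ge> 1"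
  shows "norm (\<Sum>i\<in>I. F i) ^ (2 * s) \<le> (1 + 1 / T) ^ (2 * s) * (\<Sum>i\<in>I. norm (F i) ^ (2 * s))
    + real (card I) ^ (2 * s + 2) * T\<^sup>2 * (\<Sum>j\<in>I. \<Sum>i\<in>I - {j}. norm (F j) ^ (2 * (s - 1)) * norm (F i) ^ 2)"
proof (cases "I = {}")
  case False
  define M where "M = Max ((\<lambda>i. norm (F i)) ` I)"
  have "M \<in> (\<lambda>i. norm (F i)) ` I" unfolding M_def using assms False by (intro Max_in) auto
  then obtain j where j: "j \<in> I" "M = norm (F j)" by auto
  have le: "norm (F i) \<le> norm (F j)" if "i \<in> I" for i
    unfolding j(2)[symmetric] M_def using assms that by auto
  have n0: "real (card I) > 0" using False assms by (simp add: card_gt_0_iff)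
  show ?thesis
  proof (cases "\<forall>i\<in>I - {j}. norm (F i) \<le> norm (F j) / (card I * T)")
    case True
    have "norm (\<Sum>i\<in>I. F i) \<le> norm (F j) + norm (\<Sum>i\<in>I - {j}. F i)"
      using assms j by (simp add: sum.remove[of I j] norm_triangle_ineq)
    also have "norm (\<Sum>i\<in>I - {j}. F i) \<le> (\<Sum>i\<in>I - {j}. norm (F j) / (card I * T))"
      using True by (intro sum_norm_le) auto
    also have "\<dots> = real (card (I - {j})) * (norm (F j) / (card I * T))" by simp
    also have "\<dots> \<le> real (card I) * (norm (F j) / (card I * T))"
      using assms by (intro mult_right_mono) (auto simp: card_mono)
    also have "\<dots> = norm (F j) / T" using n0 by simp
    finally have "norm (\<Sum>i\<in>I. F i) \<le> (1 + 1 / T) * norm (F j)" by (simp add: algebra_simps)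
    then have "norm (\<Sum>i\<in>I. F i) ^ (2 * s) \<le> ((1 + 1 / T) * norm (F j)) ^ (2 * s)" by (intro power_mono) auto
    also have "\<dots> \<le> (1 + 1 / T) ^ (2 * s) * (\<Sum>i\<in>I. norm (F i) ^ (2 * s))"
      unfolding power_mult_distrib using assms j member_le_sum[of j I "\<lambda>i. norm (F i) ^ (2 * s)"]
      by (intro mult_left_mono) auto
    finally show ?thesis by (rule order.trans) (simp add: sum_nonneg)
  next
    case False
    then obtain i where i: "i \<in> I - {j}" "norm (F j) / (card I * T) < norm (F i)" by force
    have 1: "norm (\<Sum>i\<in>I. F i) \<le> real (card I) * norm (F j)"
      using le by (intro order.trans[OF norm_sum] sum_bounded_above) auto
    have 2: "norm (F j) \<le> real (card I) * T * norm (F i)"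
      using i(2) n0 assms by (simp add: field_simps)
    have "norm (\<Sum>i\<in>I. F i) ^ (2 * s) \<le> (real (card I) * norm (F j)) ^ (2 * s)"
      using 1 by (intro power_mono) auto
    also have "\<dots> = real (card I) ^ (2 * s) * (norm (F j) ^ (2 * (s - 1)) * norm (F j) ^ 2)"
    proof -
      have "2 * s = 2 * (s - 1) + 2" using assms by simp
      then have "norm (F j) ^ (2 * s) = norm (F j) ^ (2 * (s - 1)) * norm (F j) ^ 2" by (metis power_add)
      then show ?thesis by (simp only: power_mult_distrib)
    qed
    also have "\<dots> \<le> real (card I) ^ (2 * s) * (norm (F j) ^ (2 * (s - 1)) * (real (card I) * T * norm (F i)) ^ 2)"
      using 2 by (intro mult_left_mono power_mono) auto
    also have "\<dots> = real (card I) ^ (2 * s + 2) * T\<^sup>2 * (norm (F j) ^ (2 * (s - 1)) * norm (F i) ^ 2)"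
      by (simp add: power_mult_distrib power_add mult_ac power2_eq_square)
    also have "\<dots> \<le> real (card I) ^ (2 * s + 2) * T\<^sup>2 * (\<Sum>i\<in>I - {j}. norm (F j) ^ (2 * (s - 1)) * norm (F i) ^ 2)"
      using i assms by (intro mult_left_mono member_le_sum) auto
    also have "\<dots> \<le> real (card I) ^ (2 * s + 2) * T\<^sup>2 * (\<Sum>j\<in>I. \<Sum>i\<in>I - {j}. norm (F j) ^ (2 * (s - 1)) * norm (F i) ^ 2)"
      using j assms by (intro mult_left_mono member_le_sum[of j I "\<lambda>j. \<Sum>i\<in>I - {j}. norm (F j) ^ (2 * (s - 1)) * norm (F i) ^ 2"])
        (auto intro!: sum_nonneg)
    finally show ?thesis using assms by (simp add: sum_nonneg add_increasing)
  qed
qed (use assms in \<open>simp add: power_0_left\<close>)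

lemma es_split:
  assumes "finite X" "p > 0"
  shows "es k q (cls (p ^ e) x0 X) a \<alpha> = (\<Sum>c\<in>{0..<p ^ d}. es k q (cls (p ^ (e + d)) (x0 + p ^ e * c) X) a \<alpha>)"
proof -
  have dis: "c = c'" if "c \<in> {0..<p ^ d}" "c' \<in> {0..<p ^ d}" "[x0 + p ^ e * c = x0 + p ^ e * c'] (mod p ^ (e + d))" for c c'
  proof -
    have "[c = c'] (mod p ^ d)" using that(3) assms(2) by (simp add: power_add cong_iff_dvd_diff flip: right_diff_distrib)
    then show ?thesis using that by (simp add: cong_def)
  qed
  have un: "cls (p ^ e) x0 X = (\<Union>c\<in>{0..<p ^ d}. cls (p ^ (e + d)) (x0 + p ^ e * c) X)"
  proof (intro equalityI subsetI)
    fix x assume x: "x \<in> cls (p ^ e) x0 X"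
    then have "[x0 = x] (mod p ^ e)" by (simp add: cls_def cong_sym)
    then obtain z where z: "x = x0 + p ^ e * z" by (metis cong_iff_lin)
    have "[x = x0 + p ^ e * (z mod p ^ d)] (mod p ^ (e + d))"
      using assms(2) by (simp add: z power_add cong_iff_dvd_diff minus_mod_eq_mult_div flip: right_diff_distrib)
    then show "x \<in> (\<Union>c\<in>{0..<p ^ d}. cls (p ^ (e + d)) (x0 + p ^ e * c) X)"
      using x assms(2) by (intro UN_I[of "z mod p ^ d"]) (auto simp: cls_def)
  next
    fix x assume "x \<in> (\<Union>c\<in>{0..<p ^ d}. cls (p ^ (e + d)) (x0 + p ^ e * c) X)"
    then obtain c where c: "x \<in> X" "[x = x0 + p ^ e * c] (mod p ^ (e + d))" by (auto simp: cls_def)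
    then have "[x = x0 + p ^ e * c] (mod p ^ e)" by (meson cong_dvd_modulus le_imp_power_dvd le_add1)
    then show "x \<in> cls (p ^ e) x0 X" using c(1) by (simp add: cls_def cong_def)
  qed
  have "cls (p ^ (e + d)) (x0 + p ^ e * c) X \<inter> cls (p ^ (e + d)) (x0 + p ^ e * c') X = {}"
    if "c \<in> {0..<p ^ d}" "c' \<in> {0..<p ^ d}" "c \<noteq> c'" for c c'
    using dis[OF that(1,2)] that(3) by (auto simp: cls_def dest: cong_sym cong_trans)
  then show ?thesis unfolding es_def un using assms by (intro sum.UNION_disjoint) auto
qed

text \<open>\<open>broad_narrow\<close> for the residue classes modulo \<open>p\<close>. The narrow
  part is one class, rescaled to \<open>N - 1\<close> scales with a factor close to 1. In the broad
  part the two classes are cut into discs of radius \<open>p^(-b)\<close> by the triangle inequality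
  alone, at the cost \<open>P ^ (2 * crit k * b)\<close>, and paired by \<open>Mb\<close> with index
  1.\<close>

lemma Dec_step:
  assumes p: "p > 1" and k: "k \<ge> 2" and P: "P = real_of_int p" and N: "N \<ge> 1"
    and K: "Dec p k (N - 1) K" "K \<ge> 0" and M: "Mb p k N 1 b b V" "V \<ge> 0" and b: "1 \<le> b" "b \<le> N" and T: "T > 0"
  shows "Dec p k N ((1 + 1 / T) ^ (2 * crit k) * K + P ^ (2 * crit k + 2) * T\<^sup>2 * (P ^ (2 * crit k * b) * V))"
  unfolding Dec_def
proof (intro allI impI)
  fix X :: "int set" and a
  assume X: "finite X"
  define s where "s = crit k"
  have s: "s \<ge> 2"
  proof -
    have "2 * 2 \<le> k * (k + 1)" using k by (intro mult_le_mono) auto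
    then show ?thesis using two_crit[of k] unfolding s_def by linarith
  qed
  have c1: "crit 1 = 1" by (simp add: crit_def)
  define S where "S = Box k (p ^ (k * N))"
  define F where "F c \<alpha> = es k (p ^ (k * N)) (cls p c X) a \<alpha>" for c \<alpha>
  define A where "A c = lsum p k N 1 c X a" for c
  have A0: "A c \<ge> 0" for c using k by (simp add: A_def)
  define L where "L = lsum p k N 0 0 X a"
  have cls1: "cls 1 0 X = X" by (auto simp: cls_def)
  have LA: "L = (\<Sum>c\<in>{0..<p}. A c)"
    unfolding L_def A_def using lsum_split[of p 0 1 N k 0 X a] p N by simp
  have esF: "es k (p ^ (k * N)) X a \<alpha> = (\<Sum>c\<in>{0..<p}. F c \<alpha>)" for \<alpha>
    unfolding F_def using es_split[OF X, of p k "p ^ (k * N)" 0 0 a \<alpha> 1] p by (simp add: cls1)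
  have narrow: "avg S (\<lambda>\<alpha>. norm (F c \<alpha>) ^ (2 * s)) \<le> K * A c ^ s" for c
    using Dec_rescale[OF K _ N p X] k by (simp add: F_def S_def A_def s_def)
  have broad: "avg S (\<lambda>\<alpha>. norm (F j \<alpha>) ^ (2 * (s - 1)) * norm (F i \<alpha>) ^ 2) \<le> P ^ (2 * s * b) * V * A i * A j ^ (s - 1)"
    if ij: "i \<in> {0..<p}" "j \<in> {0..<p}" "i \<noteq> j" for i j
  proof -
    define J where "J = {0..<p ^ (b - 1)}"
    define f where "f x c \<alpha> = norm (es k (p ^ (k * N)) (cls (p ^ b) (x + p * c) X) a \<alpha>)" for x c \<alpha>
    have cJ: "real (card J) = P ^ (b - 1)" using p by (simp add: J_def P)
    have Fle: "norm (F x \<alpha>) \<le> (\<Sum>c\<in>J. f x c \<alpha>)" for x \<alpha>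
    proof -
      have "F x \<alpha> = (\<Sum>c\<in>J. es k (p ^ (k * N)) (cls (p ^ b) (x + p * c) X) a \<alpha>)"
        unfolding F_def J_def using es_split[OF X, of p k "p ^ (k * N)" 1 x a \<alpha> "b - 1"] p b by simp
      then show ?thesis unfolding f_def by (simp add: norm_sum)
    qed
    have pw: "norm (F x \<alpha>) ^ m \<le> (P ^ (b - 1)) ^ m * (\<Sum>c\<in>J. f x c \<alpha> ^ m)" if "m > 0" for x \<alpha> m
    proof -
      have "norm (F x \<alpha>) ^ m \<le> (\<Sum>c\<in>J. f x c \<alpha>) ^ m" using Fle by (intro power_mono) auto
      also have "\<dots> \<le> (P ^ (b - 1)) ^ m * (\<Sum>c\<in>J. f x c \<alpha> ^ m)"
        unfolding cJ[symmetric] using that by (intro power_sum_le_sum_power) (auto simp: J_def f_def)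
      finally show ?thesis .
    qed
    have P0: "P \<ge> 1" using p by (simp add: P)
    have "avg S (\<lambda>\<alpha>. norm (F j \<alpha>) ^ (2 * (s - 1)) * norm (F i \<alpha>) ^ 2)
      \<le> avg S (\<lambda>\<alpha>. ((P ^ (b - 1)) ^ (2 * (s - 1)) * (\<Sum>c\<in>J. f j c \<alpha> ^ (2 * (s - 1)))) * ((P ^ (b - 1)) ^ 2 * (\<Sum>c\<in>J. f i c \<alpha> ^ 2)))"
      using s P0 by (intro avg_mono mult_mono pw) (auto simp: f_def intro!: sum_nonneg mult_nonneg_nonneg)
    also have "\<dots> = ((P ^ (b - 1)) ^ (2 * (s - 1)) * (P ^ (b - 1)) ^ 2) * avg S (\<lambda>\<alpha>. \<Sum>c\<in>J. \<Sum>c'\<in>J. f j c \<alpha> ^ (2 * (s - 1)) * f i c' \<alpha> ^ 2)"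
    proof -
      have "(A * x) * (B * y) = (A * B) * (x * y)" for A B x y :: real by simp
      then show ?thesis by (simp only: avg_cmult sum_product)
    qed
    also have "\<dots> = ((P ^ (b - 1)) ^ (2 * (s - 1)) * (P ^ (b - 1)) ^ 2) * (\<Sum>c\<in>J. \<Sum>c'\<in>J. avg S (\<lambda>\<alpha>. f j c \<alpha> ^ (2 * (s - 1)) * f i c' \<alpha> ^ 2))"
      by (simp only: avg_sum)
    also have "(P ^ (b - 1)) ^ (2 * (s - 1)) * (P ^ (b - 1)) ^ 2 = (P ^ (b - 1)) ^ (2 * s)"
    proof -
      have "2 * s = 2 * (s - 1) + 2" using s by simp
      then show ?thesis by (metis power_add)
    qed
    also have "\<dots> * (\<Sum>c\<in>J. \<Sum>c'\<in>J. avg S (\<lambda>\<alpha>. f j c \<alpha> ^ (2 * (s - 1)) * f i c' \<alpha> ^ 2))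
       \<le> (P ^ b) ^ (2 * s) * (\<Sum>c\<in>J. \<Sum>c'\<in>J. V * lsum p k N b (i + p * c') X a * lsum p k N b (j + p * c) X a ^ (s - 1))"
    proof (intro mult_mono power_mono sum_mono power_increasing)
      fix c c'
      have "\<not> [i = j] (mod p)" using ij by (auto simp: cong_def)
      moreover have "[i + p * c' = i] (mod p)" "[j + p * c = j] (mod p)" by (auto simp: cong_def)
      ultimately have nc: "\<not> [i + p * c' = j + p * c] (mod p)" by (metis cong_sym cong_trans)
      have "avg S (\<lambda>\<alpha>. f j c \<alpha> ^ (2 * (s - 1)) * f i c' \<alpha> ^ (2 * 1)) \<le> V * lsum p k N b (i + p * c') X a ^ 1 * lsum p k N b (j + p * c) X a ^ (s - 1)"
        using M(1)[unfolded Mb_def, rule_format, OF X nc, of a] by (simp only: f_def S_def s_def c1)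
      then show "avg S (\<lambda>\<alpha>. f j c \<alpha> ^ (2 * (s - 1)) * f i c' \<alpha> ^ 2) \<le> V * lsum p k N b (i + p * c') X a * lsum p k N b (j + p * c) X a ^ (s - 1)"
        by simp
    qed (use P0 in \<open>auto simp: f_def intro!: sum_nonneg avg_nonneg\<close>)
    also have "\<dots> = (P ^ b) ^ (2 * s) * V * (\<Sum>c'\<in>J. lsum p k N b (i + p * c') X a) * (\<Sum>c\<in>J. lsum p k N b (j + p * c) X a ^ (s - 1))"
      by (simp add: sum_product sum_distrib_left mult_ac) (rule sum.swap)
    also have "\<dots> \<le> (P ^ b) ^ (2 * s) * V * (\<Sum>c'\<in>J. lsum p k N b (i + p * c') X a) * (\<Sum>c\<in>J. lsum p k N b (j + p * c) X a) ^ (s - 1)"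
      using s k P0 M(2) by (intro mult_left_mono sum_power_le_power_sum mult_nonneg_nonneg sum_nonneg) (auto simp: J_def)
    finally have *: "avg S (\<lambda>\<alpha>. norm (F j \<alpha>) ^ (2 * (s - 1)) * norm (F i \<alpha>) ^ 2)
      \<le> (P ^ b) ^ (2 * s) * V * (\<Sum>c'\<in>J. lsum p k N b (i + p * c') X a) * (\<Sum>c\<in>J. lsum p k N b (j + p * c) X a) ^ (s - 1)" .
    have AJ: "(\<Sum>c'\<in>J. lsum p k N b (x + p * c') X a) = A x" for x
      unfolding A_def J_def using lsum_split[of p 1 "b - 1" N k x X a] p b by simp
    have "(P ^ b) ^ (2 * s) = P ^ (2 * s * b)" by (simp only: power_mult[symmetric] mult.commute)
    with * show ?thesis by (simp only: AJ)
  qed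
  define c2 where "c2 = P ^ (2 * s + 2) * T\<^sup>2"
  have c20: "c2 \<ge> 0" using p by (simp add: c2_def P)
  have "avg S (\<lambda>\<alpha>. norm (es k (p ^ (k * N)) X a \<alpha>) ^ (2 * s)) \<le>
    avg S (\<lambda>\<alpha>. (1 + 1 / T) ^ (2 * s) * (\<Sum>i\<in>{0..<p}. norm (F i \<alpha>) ^ (2 * s))
      + c2 * (\<Sum>j\<in>{0..<p}. \<Sum>i\<in>{0..<p} - {j}. norm (F j \<alpha>) ^ (2 * (s - 1)) * norm (F i \<alpha>) ^ 2))"
    unfolding esF using broad_narrow[of "{0..<p}" T s] T s p by (intro avg_mono) (simp add: c2_def P)
  also have "\<dots> = (1 + 1 / T) ^ (2 * s) * (\<Sum>i\<in>{0..<p}. avg S (\<lambda>\<alpha>. norm (F i \<alpha>) ^ (2 * s)))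
      + c2 * (\<Sum>j\<in>{0..<p}. \<Sum>i\<in>{0..<p} - {j}. avg S (\<lambda>\<alpha>. norm (F j \<alpha>) ^ (2 * (s - 1)) * norm (F i \<alpha>) ^ 2))"
    by (simp only: avg_add avg_cmult avg_sum)
  also have "\<dots> \<le> (1 + 1 / T) ^ (2 * s) * (\<Sum>i\<in>{0..<p}. K * A i ^ s)
      + c2 * (\<Sum>j\<in>{0..<p}. \<Sum>i\<in>{0..<p} - {j}. P ^ (2 * s * b) * V * A i * A j ^ (s - 1))"
    using T c20 by (intro add_mono mult_left_mono sum_mono narrow broad) auto
  also have "\<dots> \<le> (1 + 1 / T) ^ (2 * s) * (\<Sum>i\<in>{0..<p}. K * A i ^ s)
      + c2 * (\<Sum>j\<in>{0..<p}. \<Sum>i\<in>{0..<p}. P ^ (2 * s * b) * V * A i * A j ^ (s - 1))"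
    using c20 p M(2) A0 by (intro add_mono mult_left_mono sum_mono sum_mono2 order_refl) (auto simp: P)
  also have "(\<Sum>i\<in>{0..<p}. K * A i ^ s) = K * (\<Sum>i\<in>{0..<p}. A i ^ s)" by (simp add: sum_distrib_left)
  also have "(\<Sum>j\<in>{0..<p}. \<Sum>i\<in>{0..<p}. P ^ (2 * s * b) * V * A i * A j ^ (s - 1)) = P ^ (2 * s * b) * V * L * (\<Sum>j\<in>{0..<p}. A j ^ (s - 1))"
    by (simp add: LA sum_distrib_left sum_distrib_right mult_ac) (rule sum.swap)
  also have "(1 + 1 / T) ^ (2 * s) * (K * (\<Sum>i\<in>{0..<p}. A i ^ s)) + c2 * (P ^ (2 * s * b) * V * L * (\<Sum>j\<in>{0..<p}. A j ^ (s - 1)))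
    \<le> (1 + 1 / T) ^ (2 * s) * (K * L ^ s) + c2 * (P ^ (2 * s * b) * V * L * L ^ (s - 1))"
    unfolding LA using T c20 K(2) M(2) s p A0
    by (intro add_mono mult_left_mono sum_power_le_power_sum mult_nonneg_nonneg sum_nonneg) (auto simp: P)
  also have "\<dots> = ((1 + 1 / T) ^ (2 * s) * K + c2 * (P ^ (2 * s * b) * V)) * L ^ s"
    using s by (simp add: algebra_simps power_eq_if[of L s])
  finally show "avg (Box k (p ^ (k * N))) (\<lambda>\<alpha>. norm (es k (p ^ (k * N)) X a \<alpha>) ^ (2 * crit k))
     \<le> ((1 + 1 / T) ^ (2 * crit k) * K + P ^ (2 * crit k + 2) * T\<^sup>2 * (P ^ (2 * crit k * b) * V))
       * (\<Sum>c\<in>{0..<p ^ N}. root (crit k) (avg (Box k (p ^ (k * N))) (\<lambda>\<alpha>. norm (es k (p ^ (k * N)) (cls (p ^ N) c X) a \<alpha>) ^ (2 * crit k)))) ^ crit k"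
    by (simp add: s_def S_def c2_def L_def lsum_def nrm_def)
qed

section \<open>Orthogonality and the base case of degree 1\<close>

lemma em_eq_1_iff:
  assumes "q > 0"
  shows "em q h = 1 \<longleftrightarrow> q dvd h"
proof
  assume "em q h = 1"
  then have "exp (\<i> * of_real (2 * pi * (of_int h / of_int q))) = 1" by (simp add: em_def ee_def cis_conv_exp)
  then obtain n :: int where "2 * pi * (of_int h / of_int q) = of_int (2 * n) * pi" by (auto simp: exp_eq_1)
  then have "real_of_int h = of_int (q * n)" using assms by (simp add: field_simps)
  then have "h = q * n" by (simp only: of_int_eq_iff)
  then show "q dvd h" by simp
next
  assume "q dvd h"
  then have "[h = 0] (mod q)" by (simp add: cong_0_iff)
  then show "em q h = 1" using em_cong by fastforce
qed

lemma sum_em: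
  assumes "q > 0"
  shows "(\<Sum>r\<in>{0..<q}. em q (r * h)) = (if q dvd h then of_int q else 0)"
proof (cases "q dvd h")
  case True
  then have "em q (r * h) = 1" for r using assms by (simp add: em_eq_1_iff)
  then show ?thesis using True assms by simp
next
  case False
  have "(\<Sum>r\<in>{0..<q}. em q (r * h)) = (\<Sum>r\<in>{0..<q}. em q ((r + 1) * h))"
  proof (rule sum.reindex_bij_witness[of _ "\<lambda>r. (r + 1) mod q" "\<lambda>r. (r - 1) mod q"])
    fix r assume "r \<in> {0..<q}"
    show "em q (((r - 1) mod q + 1) * h) = em q (r * h)"
      by (intro em_cong cong_mult cong_refl) (simp add: cong_def mod_simps)
  qed (use assms in \<open>auto simp: mod_simps\<close>)
  also have "\<dots> = (\<Sum>r\<in>{0..<q}. em q (r * h)) * em q h"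
    by (simp add: distrib_right em_add sum_distrib_right)
  finally have "(\<Sum>r\<in>{0..<q}. em q (r * h)) * (em q h - 1) = 0" by (simp add: algebra_simps)
  then show ?thesis using False assms by (simp add: em_eq_1_iff)
qed

lemma sum_Box_em:
  assumes "q > 0"
  shows "(\<Sum>\<alpha>\<in>Box k q. em q (\<Sum>j=1..k. \<alpha> j * h j)) = (if \<forall>j\<in>{1..k}. q dvd h j then of_nat (card (Box k q)) else 0)"
proof -
  have em_sum: "em q (\<Sum>j\<in>J. f j) = (\<Prod>j\<in>J. em q (f j))" if "finite J" for J :: "nat set" and f
    using that by induction (auto simp: em_add)
  have "(\<Sum>\<alpha>\<in>Box k q. em q (\<Sum>j=1..k. \<alpha> j * h j)) = (\<Prod>j=1..k. \<Sum>r\<in>{0..<q}. em q (r * h j))"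
    unfolding Box_def by (subst prod_sum_PiE) (simp_all add: em_sum)
  also have "\<dots> = (\<Prod>j=1..k. if q dvd h j then of_int q else 0)"
    by (intro prod.cong refl sum_em assms)
  also have "\<dots> = (if \<forall>j\<in>{1..k}. q dvd h j then of_nat (card (Box k q)) else 0)"
  proof (cases "\<forall>j\<in>{1..k}. q dvd h j")
    case True
    then have "(\<Prod>j=1..k. if q dvd h j then of_int q else 0) = (\<Prod>j=1..k. (of_int q :: complex))" by (intro prod.cong) auto
    also have "\<dots> = of_nat (card (Box k q))" using assms by (simp add: Box_def card_PiE)
    finally show ?thesis unfolding if_P[OF True] .
  qed (auto intro!: prod_zero)
  finally show ?thesis .
qed

text \<open>Here \<open>crit 1 = 1\<close>: the phase depends only on the class modulo
  \<open>p ^ d\<close>, and Parseval's identity gives equality.\<close>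

lemma Dec_1:
  assumes p: "p > 1"
  shows "Dec p 1 d 1"
  unfolding Dec_def
proof (intro allI impI)
  fix X :: "int set" and a :: "int \<Rightarrow> complex"
  assume X: "finite X"
  define q where "q = p ^ d"
  have q: "q > 0" using p by (simp add: q_def)
  define S where "S c = (\<Sum>x\<in>cls q c X. a x)" for c
  have ph: "es 1 q (cls q c X) a \<alpha> = em q (\<alpha> 1 * c) * S c" for c \<alpha>
  proof -
    have "em q (pv 1 \<alpha> x) = em q (\<alpha> 1 * c)" if "x \<in> cls q c X" for x
      using that by (intro em_cong) (auto simp: pv_def cls_def intro!: cong_mult)
    then show ?thesis by (simp add: es_def S_def sum_distrib_right mult.commute)
  qed
  have "es 1 q X a \<alpha> = (\<Sum>c\<in>{0..<q}. em q (\<alpha> 1 * c) * S c)" for \<alpha>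
    using es_split[OF X, of p 1 q 0 0 a \<alpha> d] p by (simp add: cls_def[of 1] ph[unfolded One_nat_def] flip: q_def)
  moreover have "complex_of_real ((norm z)\<^sup>2) = z * cnj z" for z by (rule complex_norm_square)
  ultimately have exp: "complex_of_real ((norm (es 1 q X a \<alpha>))\<^sup>2) = (\<Sum>c\<in>{0..<q}. \<Sum>c'\<in>{0..<q}. S c * cnj (S c') * em q (\<Sum>j=1..1. \<alpha> j * (c - c')))" for \<alpha>
    by (simp add: sum_product mult_ac em_minus[symmetric] left_diff_distrib right_diff_distrib em_add[symmetric])
  have "complex_of_real (\<Sum>\<alpha>\<in>Box 1 q. (norm (es 1 q X a \<alpha>))\<^sup>2)
    = (\<Sum>c\<in>{0..<q}. \<Sum>c'\<in>{0..<q}. S c * cnj (S c') * (\<Sum>\<alpha>\<in>Box 1 q. em q (\<Sum>j=1..1. \<alpha> j * (c - c'))))"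
    unfolding of_real_sum exp sum_distrib_left
    by (subst sum.swap, intro sum.cong refl, rule sum.swap)
  also have "\<dots> = (\<Sum>c\<in>{0..<q}. \<Sum>c'\<in>{0..<q}. if c = c' then S c * cnj (S c) * of_nat (card (Box 1 q)) else 0)"
  proof (intro sum.cong refl)
    fix c c' assume "c \<in> {0..<q}" "c' \<in> {0..<q}"
    then have "q dvd c - c' \<longleftrightarrow> c = c'" by (metis atLeastLessThan_iff mod_eq_dvd_iff mod_pos_pos_trivial)
    then show "S c * cnj (S c') * (\<Sum>\<alpha>\<in>Box 1 q. em q (\<Sum>j=1..1. \<alpha> j * (c - c'))) = (if c = c' then S c * cnj (S c) * of_nat (card (Box 1 q)) else 0)"
      by (subst sum_Box_em[OF q]) auto
  qed
  also have "\<dots> = complex_of_real ((\<Sum>c\<in>{0..<q}. (norm (S c))\<^sup>2) * real (card (Box 1 q)))"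
    by (simp add: complex_norm_square[symmetric] sum_distrib_right)
  finally have "(\<Sum>\<alpha>\<in>Box 1 q. (norm (es 1 q X a \<alpha>))\<^sup>2) = (\<Sum>c\<in>{0..<q}. (norm (S c))\<^sup>2) * real (card (Box 1 q))"
    by (simp only: of_real_eq_iff)
  moreover have "real (card (Box 1 q)) > 0" using Box_ne[OF q] by (simp add: card_gt_0_iff)
  ultimately have "avg (Box 1 q) (\<lambda>\<alpha>. (norm (es 1 q X a \<alpha>))\<^sup>2) = (\<Sum>c\<in>{0..<q}. (norm (S c))\<^sup>2)"
    using Box_ne[OF q, of 1] by (simp add: avg_def)
  also have "\<dots> = (\<Sum>c\<in>{0..<q}. avg (Box 1 q) (\<lambda>\<alpha>. (norm (es 1 q (cls q c X) a \<alpha>))\<^sup>2))"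
    using Box_ne[OF q, of 1] by (simp add: ph[unfolded One_nat_def] norm_mult avg_const)
  finally show "avg (Box 1 (p ^ (1 * d))) (\<lambda>\<alpha>. norm (es 1 (p ^ (1 * d)) X a \<alpha>) ^ (2 * crit 1))
     \<le> 1 * (\<Sum>c\<in>{0..<p ^ d}. root (crit 1)
          (avg (Box 1 (p ^ (1 * d))) (\<lambda>\<alpha>. norm (es 1 (p ^ (1 * d)) (cls (p ^ d) c X) a \<alpha>) ^ (2 * crit 1)))) ^ crit 1"
    by (simp add: crit_def q_def)
qed

section \<open>Lowering the decoupling exponent\<close>

lemma Dec_trivial:
  assumes p: "p > 1" and k: "k \<ge> 1" and P: "P = real_of_int p"
  shows "Dec p k d (P powr (real (2 * crit k) * real d))"
  unfolding Dec_def
proof (intro allI impI)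
  fix X :: "int set" and a
  assume X: "finite X"
  define q where "q = p ^ (k * d)"
  define s where "s = crit k"
  have s: "s > 0" using crit_pos[OF k] by (simp add: s_def)
  define F where "F c \<alpha> = norm (es k q (cls (p ^ d) c X) a \<alpha>)" for c \<alpha>
  have P1: "P > 1" using p by (simp add: P)
  have cd: "real (card {0..<p ^ d}) = P ^ d" using p by (simp add: P)
  have "norm (es k q X a \<alpha>) ^ (2 * s) \<le> (P ^ d) ^ (2 * s) * (\<Sum>c\<in>{0..<p ^ d}. F c \<alpha> ^ (2 * s))" for \<alpha>
  proof -
    have "es k q X a \<alpha> = (\<Sum>c\<in>{0..<p ^ d}. es k q (cls (p ^ d) c X) a \<alpha>)"
      using es_split[OF X, of p k q 0 0 a \<alpha> d] p by (simp add: cls_def[of 1])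
    then have "norm (es k q X a \<alpha>) ^ (2 * s) \<le> (\<Sum>c\<in>{0..<p ^ d}. F c \<alpha>) ^ (2 * s)"
      unfolding F_def by (intro power_mono) (auto simp: norm_sum)
    also have "\<dots> \<le> (P ^ d) ^ (2 * s) * (\<Sum>c\<in>{0..<p ^ d}. F c \<alpha> ^ (2 * s))"
      unfolding cd[symmetric] using s by (intro power_sum_le_sum_power) (auto simp: F_def)
    finally show ?thesis .
  qed
  then have "avg (Box k q) (\<lambda>\<alpha>. norm (es k q X a \<alpha>) ^ (2 * s)) \<le> avg (Box k q) (\<lambda>\<alpha>. (P ^ d) ^ (2 * s) * (\<Sum>c\<in>{0..<p ^ d}. F c \<alpha> ^ (2 * s)))"
    by (intro avg_mono)
  also have "\<dots> = (P ^ d) ^ (2 * s) * (\<Sum>c\<in>{0..<p ^ d}. avg (Box k q) (\<lambda>\<alpha>. F c \<alpha> ^ (2 * s)))"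
    by (simp only: avg_cmult avg_sum)
  also have "(\<Sum>c\<in>{0..<p ^ d}. avg (Box k q) (\<lambda>\<alpha>. F c \<alpha> ^ (2 * s))) = (\<Sum>c\<in>{0..<p ^ d}. root s (avg (Box k q) (\<lambda>\<alpha>. F c \<alpha> ^ (2 * s))) ^ s)"
    using s by (intro sum.cong refl real_root_pow_pos2[symmetric] avg_nonneg) (auto simp: F_def)
  also have "(P ^ d) ^ (2 * s) * \<dots> \<le> (P ^ d) ^ (2 * s) * (\<Sum>c\<in>{0..<p ^ d}. root s (avg (Box k q) (\<lambda>\<alpha>. F c \<alpha> ^ (2 * s)))) ^ s"
    using P1 s by (intro mult_left_mono sum_power_le_power_sum real_root_ge_zero avg_nonneg) (auto simp: F_def)
  also have "(P ^ d) ^ (2 * s) = P powr (real (2 * s) * real d)"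
    using P1 by (subst powr_realpow[symmetric]) (simp_all add: powr_powr mult.commute flip: powr_realpow)
  finally show "avg (Box k (p ^ (k * d))) (\<lambda>\<alpha>. norm (es k (p ^ (k * d)) X a \<alpha>) ^ (2 * crit k))
     \<le> P powr (real (2 * crit k) * real d) * (\<Sum>c\<in>{0..<p ^ d}. root (crit k)
          (avg (Box k (p ^ (k * d))) (\<lambda>\<alpha>. norm (es k (p ^ (k * d)) (cls (p ^ d) c X) a \<alpha>) ^ (2 * crit k)))) ^ crit k"
    by (simp add: F_def q_def s_def)
qed

text \<open>The improvement \<kappa> depends on the lower bound \<open>\<eta>0\<close> and not on
  the current exponent \<eta>; the infimum argument that follows relies on this uniformity.\<close>

lemma Dec_improve:
  fixes p :: int and k :: nat and \<eta>0 P :: real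
  assumes p: "prime p" "int k < p" and k: "k \<ge> 2" and P: "P = real_of_int p" and eta0: "\<eta>0 > 0"
    and IH: "\<And>l \<epsilon>. 1 \<le> l \<Longrightarrow> l < k \<Longrightarrow> \<epsilon> > 0 \<Longrightarrow> \<exists>C. \<forall>d. Dec p l d (C * P powr (\<epsilon> * real d))"
  obtains \<kappa> where "\<kappa> > 0" "\<kappa> \<le> \<eta>0 / 2"
    "\<And>\<eta> C0. \<eta> \<ge> \<eta>0 \<Longrightarrow> C0 \<ge> 0 \<Longrightarrow> (\<And>N. Dec p k N (C0 * P powr (\<eta> * real N))) \<Longrightarrow>
       \<exists>C\<ge>0. \<forall>N. Dec p k N (C * P powr ((\<eta> - \<kappa>) * real N))"
proof -
  have P1: "P > 1" using prime_gt_1_int[OF p(1)] by (simp add: P)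
  define s where "s = crit k"
  have s0: "s > 0" using crit_pos[of k] k by (simp add: s_def)
  define m0 where "m0 = \<eta>0 / (2 * real k ^ 2)"
  have m0: "m0 > 0" using eta0 k by (simp add: m0_def)
  \<comment> \<open>Enough rounds for the gain \<open>n \<mu> (k - 1) b\<close> to beat the loss
    \<open>P^(2 s b)\<close> in \<open>Dec_step\<close> and still leave
    \<open>P^(-b)\<close>.\<close>
  obtain n :: nat where n: "real (2 * s + 1) < real n * m0" using reals_Archimedean3[OF m0] by blast
  define D where "D = k ^ (n + 1)"
  have D: "D \<ge> 1" using k by (simp add: D_def)
  \<comment> \<open>\<open>bilinear_saving\<close> allows \<open>b\<close> up to
    \<open>N / D\<close>, so a saving of \<open>P^(-b)\<close> is worth \<open>1 / D\<close> in the
    exponent; the bound by half of \<open>\<eta>0\<close> leaves room for the narrow part.\<close>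
  define \<kappa> where "\<kappa> = min (1 / real D) (\<eta>0 / 2)"
  show ?thesis
  proof (rule that)
    show "\<kappa> > 0" "\<kappa> \<le> \<eta>0 / 2" using D eta0 by (auto simp: \<kappa>_def)
    fix \<eta> C0 :: real
    assume eta: "\<eta> \<ge> \<eta>0" and C0: "C0 \<ge> 0" and H: "\<And>N. Dec p k N (C0 * P powr (\<eta> * real N))"
    define m where "m = \<eta> / (2 * real k ^ 2)"
    have mm: "m0 \<le> m" unfolding m_def m0_def using eta by (intro divide_right_mono) auto
    have eta': "\<eta> > 0" using eta eta0 by simp
    obtain C b0 where C: "C \<ge> 0" and Mb: "\<And>l b N e. 1 \<le> l \<Longrightarrow> l < k \<Longrightarrow> b0 \<le> b \<Longrightarrow> k ^ (n + 1) * b \<le> N \<Longrightarrow> b \<le> k * e \<Longrightarrow>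
       l * e \<le> (k - l + 1) * b \<Longrightarrow> Mb p k N l e b (C * P powr (\<eta> * real N - real n * m * real l * real (k - l) * real b))"
      using bilinear_saving[OF p k P IH H eta' C0 m_def, of n] by blast
    define N0 where "N0 = D * (b0 + 1)"
    \<comment> \<open>\<open>T\<close> is chosen such that the narrow factor
      \<open>x ^ (2 * s)\<close> is \<open>P powr (\<eta>0 / 4)\<close>. Passing from
      \<open>N\<close> to \<open>N - 1\<close> gains at least \<open>P powr (\<eta>0 / 2)\<close>,
      so the recursion contracts with the ratio \<open>r\<close> below.\<close>
    define x where "x = P powr (\<eta>0 / (8 * real s))"
    have x1: "x > 1" unfolding x_def using P1 eta0 s0 by (intro gr_one_powr) auto
    define T where "T = 1 / (x - 1)"
    have T: "T > 0" "1 + 1 / T = x" using x1 by (auto simp: T_def)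
    have xs: "x ^ (2 * s) = P powr (\<eta>0 / 4)"
      using P1 s0 unfolding x_def by (simp add: powr_powr flip: powr_realpow)
    define CT where "CT = P ^ (2 * s + 2) * T\<^sup>2 * (C * P)"
    have CT: "CT \<ge> 0" using P1 C by (simp add: CT_def)
    define r where "r = P powr (- (\<eta>0 / 4))"
    have r: "r < 1" unfolding r_def using P1 eta0 by (simp add: powr_less_one)
    \<comment> \<open>The first entry covers \<open>N < N0\<close>; the second makes
      \<open>C' * r + CT \<le> C'\<close>, so that the recursion preserves the constant.\<close>
    define C' where "C' = max (C0 * P powr (\<kappa> * real N0)) (CT / (1 - r))"
    have C': "C' \<ge> 0" using C0 by (simp add: C'_def le_max_iff_disj)
    have kap: "\<eta> - \<kappa> \<ge> \<eta>0 / 2" "\<kappa> \<le> 1 / real D" "\<kappa> > 0" using eta eta0 D by (auto simp: \<kappa>_def min_def)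
    have "Dec p k N (C' * P powr ((\<eta> - \<kappa>) * real N))" for N
    proof (induction N)
      case 0
      have "C0 \<le> C0 * P powr (\<kappa> * real N0)" using C0 P1 kap by (simp add: mult_le_cancel_left1 ge_one_powr_ge_zero)
      then have "C0 \<le> C'" by (simp add: C'_def)
      then show ?case using Dec_mono[OF H[of 0], of C'] k P1 by simp
    next
      case (Suc N)
      show ?case
      proof (cases "Suc N < N0")
        case True
        have "C0 * P powr (\<eta> * real (Suc N)) \<le> C' * P powr ((\<eta> - \<kappa>) * real (Suc N))"
        proof -
          have "\<kappa> * real (Suc N) \<le> \<kappa> * real N0" using kap True by (intro mult_left_mono) auto
          then have "\<eta> * real (Suc N) \<le> \<kappa> * real N0 + (\<eta> - \<kappa>) * real (Suc N)" by (simp add: algebra_simps)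
          then have "C0 * P powr (\<eta> * real (Suc N)) \<le> C0 * P powr (\<kappa> * real N0 + (\<eta> - \<kappa>) * real (Suc N))"
            using C0 P1 by (intro mult_left_mono powr_mono) auto
          also have "\<dots> = (C0 * P powr (\<kappa> * real N0)) * P powr ((\<eta> - \<kappa>) * real (Suc N))" by (simp add: powr_add)
          also have "\<dots> \<le> C' * P powr ((\<eta> - \<kappa>) * real (Suc N))" by (intro mult_right_mono) (auto simp: C'_def)
          finally show ?thesis .
        qed
        then show ?thesis using Dec_mono[OF H[of "Suc N"]] k by simp
      next
        case False
        define M where "M = Suc N"
        define b where "b = M div D"
        have b1: "b0 + 1 \<le> b" using False D by (simp add: b_def M_def N0_def less_eq_div_iff_mult_less_eq mult.commute)
        have Db: "D * b \<le> M" by (simp add: b_def)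
        have "M < D + D * b" using dividend_less_times_div[of D M] D by (simp add: b_def)
        then have "real M \<le> real (D + D * b)" by (simp only: of_nat_le_iff less_imp_le)
        then have bge: "real M / real D - 1 \<le> real b" using D by (simp add: field_simps)
        define V where "V = C * P powr (\<eta> * real M - real n * m * real 1 * real (k - 1) * real b)"
        have "1 * b \<le> D * b" using D by (rule mult_le_mono1)
        then have bM: "b \<le> M" using Db by linarith
        have MV: "Mb p k M 1 b b V" unfolding V_def
          using k b1 Db by (intro Mb) (auto simp: D_def)
        have step: "Dec p k M ((1 + 1 / T) ^ (2 * s) * (C' * P powr ((\<eta> - \<kappa>) * real (M - 1))) + P ^ (2 * s + 2) * T\<^sup>2 * (P ^ (2 * s * b) * V))"
          unfolding s_def
          by (rule Dec_step[OF _ k P _ _ _ MV]) (use P1 Suc C' C b1 bM T in \<open>auto simp: M_def V_def P\<close>)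
        have "P ^ (2 * s * b) * V \<le> C * P * P powr ((\<eta> - \<kappa>) * real M)"
        proof -
          have "real n * m0 \<le> real n * m * real (k - 1)"
          proof -
            have "real n * m0 * 1 \<le> real n * m * real (k - 1)" using mm m0 k by (intro mult_mono) auto
            then show ?thesis by simp
          qed
          then have "real (2 * s + 1) \<le> real n * m * real (k - 1)" using n by linarith
          then have "real (2 * s + 1) * real b \<le> (real n * m * real (k - 1)) * real b"
            by (rule mult_right_mono) simp
          moreover have "\<kappa> * real M \<le> 1 / real D * real M" using kap by (intro mult_right_mono) auto
          ultimately have "real (2 * s * b) + (\<eta> * real M - real n * m * real 1 * real (k - 1) * real b) \<le> 1 + (\<eta> - \<kappa>) * real M"
            using bge by (simp add: algebra_simps)
          then have "P powr (real (2 * s * b) + (\<eta> * real M - real n * m * real 1 * real (k - 1) * real b)) \<le> P powr (1 + (\<eta> - \<kappa>) * real M)"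
            using P1 by (intro powr_mono) auto
          then have "C * (P powr real (2 * s * b) * P powr (\<eta> * real M - real n * m * real 1 * real (k - 1) * real b)) \<le> C * (P powr 1 * P powr ((\<eta> - \<kappa>) * real M))"
            unfolding powr_add using C by (intro mult_left_mono) auto
          moreover have "P powr real (2 * s * b) = P ^ (2 * s * b)" using P1 by (intro powr_realpow) auto
          ultimately show ?thesis using P1 by (simp add: V_def mult_ac)
        qed
        then have "P ^ (2 * s + 2) * T\<^sup>2 * (P ^ (2 * s * b) * V) \<le> P ^ (2 * s + 2) * T\<^sup>2 * (C * P * P powr ((\<eta> - \<kappa>) * real M))"
          using P1 by (intro mult_left_mono) auto
        then have part2: "P ^ (2 * s + 2) * T\<^sup>2 * (P ^ (2 * s * b) * V) \<le> CT * P powr ((\<eta> - \<kappa>) * real M)"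
          by (simp add: CT_def mult_ac)
        have "P powr (\<eta>0 / 4) * P powr ((\<eta> - \<kappa>) * real (M - 1)) = P powr (\<eta>0 / 4 - (\<eta> - \<kappa>)) * P powr ((\<eta> - \<kappa>) * real M)"
          by (simp add: powr_add[symmetric] M_def algebra_simps)
        also have "\<dots> \<le> r * P powr ((\<eta> - \<kappa>) * real M)"
          unfolding r_def using P1 kap by (intro mult_right_mono powr_mono) auto
        finally have "C' * (P powr (\<eta>0 / 4) * P powr ((\<eta> - \<kappa>) * real (M - 1))) \<le> C' * (r * P powr ((\<eta> - \<kappa>) * real M))"
          using C' by (rule mult_left_mono)
        then have part1: "(1 + 1 / T) ^ (2 * s) * (C' * P powr ((\<eta> - \<kappa>) * real (M - 1))) \<le> C' * r * P powr ((\<eta> - \<kappa>) * real M)"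
          unfolding T(2) xs by (simp add: mult_ac)
        have "CT / (1 - r) \<le> C'" by (simp add: C'_def)
        then have "CT \<le> C' * (1 - r)" using r by (simp add: pos_divide_le_eq)
        then have "(C' * r + CT) * P powr ((\<eta> - \<kappa>) * real M) \<le> C' * P powr ((\<eta> - \<kappa>) * real M)"
          by (intro mult_right_mono) (auto simp: algebra_simps)
        then have "(1 + 1 / T) ^ (2 * s) * (C' * P powr ((\<eta> - \<kappa>) * real (M - 1))) + P ^ (2 * s + 2) * T\<^sup>2 * (P ^ (2 * s * b) * V) \<le> C' * P powr ((\<eta> - \<kappa>) * real M)"
          using part1 part2 by (simp add: algebra_simps)
        then show ?thesis using Dec_mono[OF step] k by (simp add: M_def)
      qed
    qed
    then show "\<exists>C\<ge>0. \<forall>N. Dec p k N (C * P powr ((\<eta> - \<kappa>) * real N))" using C' by blast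
  qed
qed

text \<open>If \<epsilon> fails in degree \<open>k\<close>, all admissible exponents are at least
  \<epsilon>, and \<open>Dec_improve\<close> lowers each of them by the same \<kappa>; an exponent
  within \<kappa> of the infimum then yields one below it. \<open>Dec_trivial\<close> makes the set
  of admissible exponents nonempty.\<close>

theorem decoupling_moment_curve:
  assumes p: "prime p" and P: "P = real_of_int p"
  shows "1 \<le> k \<Longrightarrow> int k < p \<Longrightarrow> \<epsilon> > 0 \<Longrightarrow> \<exists>C. \<forall>d. Dec p k d (C * P powr (\<epsilon> * real d))"
proof (induction k arbitrary: \<epsilon> rule: less_induct)
  case (less k)
  have p1: "p > 1" using p by (rule prime_gt_1_int)
  have P1: "P > 1" using p1 by (simp add: P)
  show ?case
  proof (cases "k = 1")
    case True
    have "Dec p k d (1 * P powr (\<epsilon> * real d))" for d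
      unfolding True by (rule Dec_mono[OF Dec_1[OF p1]]) (use P1 less.prems in \<open>auto intro: ge_one_powr_ge_zero\<close>)
    then show ?thesis by blast
  next
    case False
    then have k: "k \<ge> 2" using less.prems by simp
    have IH: "\<exists>C. \<forall>d. Dec p l d (C * P powr (\<delta> * real d))" if "1 \<le> l" "l < k" "\<delta> > 0" for l \<delta>
      using less.IH[OF that(2,1) _ that(3)] that less.prems by simp
    define E where "E = {\<eta>. \<eta> > 0 \<and> (\<exists>C\<ge>0. \<forall>N. Dec p k N (C * P powr (\<eta> * real N)))}"
    show ?thesis
    proof (rule ccontr)
      assume no: "\<nexists>C. \<forall>d. Dec p k d (C * P powr (\<epsilon> * real d))"
      have lb: "\<epsilon> \<le> \<eta>" if e: "\<eta> \<in> E" for \<eta>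
      proof (rule ccontr)
        assume "\<not> \<epsilon> \<le> \<eta>"
        obtain C where C: "C \<ge> 0" "\<And>N. Dec p k N (C * P powr (\<eta> * real N))" using e by (auto simp: E_def)
        have "Dec p k N (C * P powr (\<epsilon> * real N))" for N
          by (rule Dec_mono[OF C(2)]) (use C(1) P1 k \<open>\<not> \<epsilon> \<le> \<eta>\<close> in \<open>auto intro!: mult_left_mono powr_mono mult_right_mono\<close>)
        then show False using no by blast
      qed
      have "real (2 * crit k) \<in> E"
        using Dec_trivial[OF p1 less.prems(1) P] crit_pos[OF less.prems(1)] unfolding E_def
        by (auto intro!: exI[of _ 1])
      then have ne: "E \<noteq> {}" by blast
      have bdd: "bdd_below E" using lb by (intro bdd_belowI)
      obtain \<kappa> where kap: "\<kappa> > 0" "\<kappa> \<le> \<epsilon> / 2"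
        "\<And>\<eta> C0. \<eta> \<ge> \<epsilon> \<Longrightarrow> C0 \<ge> 0 \<Longrightarrow> (\<And>N. Dec p k N (C0 * P powr (\<eta> * real N))) \<Longrightarrow>
          \<exists>C\<ge>0. \<forall>N. Dec p k N (C * P powr ((\<eta> - \<kappa>) * real N))"
        by (rule Dec_improve[OF p less.prems(2) k P less.prems(3)]) (use IH in blast)+
      have "Inf E < Inf E + \<kappa>" using kap by simp
      then obtain \<eta> where eta: "\<eta> \<in> E" "\<eta> < Inf E + \<kappa>" using cInf_less_iff[OF ne bdd] by blast
      obtain C where "C \<ge> 0" "\<And>N. Dec p k N (C * P powr (\<eta> * real N))" using eta(1) by (auto simp: E_def)
      then have "\<exists>C\<ge>0. \<forall>N. Dec p k N (C * P powr ((\<eta> - \<kappa>) * real N))" using kap(3) lb[OF eta(1)] by blast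
      then have "\<eta> - \<kappa> \<in> E" using lb[OF eta(1)] kap(2) less.prems(3) by (auto simp: E_def)
      then have "Inf E \<le> \<eta> - \<kappa>" using bdd by (rule cInf_lower)
      then show False using eta(2) by simp
    qed
  qed
qed

section \<open>Vinogradov's mean value and Hua's mean value\<close>

lemma em_sum: "finite J \<Longrightarrow> em q (\<Sum>j\<in>J. f j) = (\<Prod>j\<in>J. em q (f j))"
  by (induction J rule: finite_induct) (auto simp: em_add)

lemma norm_power_even_complex: "complex_of_real (norm z ^ (2 * s)) = z ^ s * cnj (z ^ s)"
proof -
  have "complex_of_real (norm z ^ (2 * s)) = (complex_of_real ((norm z)\<^sup>2)) ^ s" by (simp add: power_mult)
  then show ?thesis by (simp only: complex_norm_square power_mult_distrib complex_cnj_power)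
qed

lemma exponential_sum_power_expand:
  assumes "finite X"
  shows "complex_of_real (norm (\<Sum>x\<in>X. em q (g x)) ^ (2 * s))
    = (\<Sum>x\<in>PiE {..<s} (\<lambda>_. X). \<Sum>y\<in>PiE {..<s} (\<lambda>_. X). em q ((\<Sum>i<s. g (x i)) - (\<Sum>i<s. g (y i))))"
proof -
  have 1: "(\<Sum>x\<in>X. em q (g x)) ^ s = (\<Sum>x\<in>PiE {..<s} (\<lambda>_. X). em q (\<Sum>i<s. g (x i)))"
    using prod_sum_PiE[of "{..<s}" "\<lambda>_. X" "\<lambda>_ x. em q (g x)"] assms by (simp add: em_sum)
  show ?thesis
    unfolding norm_power_even_complex 1 cnj_sum sum_product em_minus[symmetric] em_add[symmetric] by simp
qed

lemma avg_exponential_sum_power: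
  assumes "finite X" "q > 0"
  shows "avg {0..<q} (\<lambda>r. norm (\<Sum>x\<in>X. em q (r * g x)) ^ (2 * s))
    = card {(x, y). x \<in> PiE {..<s} (\<lambda>_. X) \<and> y \<in> PiE {..<s} (\<lambda>_. X) \<and> q dvd (\<Sum>i<s. g (x i)) - (\<Sum>i<s. g (y i))}"
proof -
  define T where "T = PiE {..<s} (\<lambda>_. X)"
  have T: "finite T" unfolding T_def using assms by (intro finite_PiE) auto
  define D where "D = {(x, y). x \<in> T \<and> y \<in> T \<and> q dvd (\<Sum>i<s. g (x i)) - (\<Sum>i<s. g (y i))}"
  have "complex_of_real (\<Sum>r\<in>{0..<q}. norm (\<Sum>x\<in>X. em q (r * g x)) ^ (2 * s))
     = (\<Sum>r\<in>{0..<q}. \<Sum>x\<in>T. \<Sum>y\<in>T. em q (r * ((\<Sum>i<s. g (x i)) - (\<Sum>i<s. g (y i)))))"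
    unfolding of_real_sum exponential_sum_power_expand[OF assms(1)] T_def
    by (simp add: sum_distrib_left right_diff_distrib)
  also have "\<dots> = (\<Sum>x\<in>T. \<Sum>y\<in>T. \<Sum>r\<in>{0..<q}. em q (r * ((\<Sum>i<s. g (x i)) - (\<Sum>i<s. g (y i)))))"
    by (subst sum.swap, intro sum.cong refl, rule sum.swap)
  also have "\<dots> = (\<Sum>x\<in>T. \<Sum>y\<in>T. if q dvd (\<Sum>i<s. g (x i)) - (\<Sum>i<s. g (y i)) then of_int q else 0)"
    by (intro sum.cong refl sum_em assms)
  also have "\<dots> = (\<Sum>z\<in>T \<times> T. if z \<in> D then of_int q else 0)"
    unfolding sum.cartesian_product by (intro sum.cong) (auto simp: D_def split: if_splits)
  also have "\<dots> = of_nat (card D) * of_int q"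
    using T by (subst sum.If_cases) (auto simp: D_def intro!: arg_cong[where f = card])
  also have "\<dots> = complex_of_real (real (card D) * of_int q)" by simp
  finally have "(\<Sum>r\<in>{0..<q}. norm (\<Sum>x\<in>X. em q (r * g x)) ^ (2 * s)) = real (card D) * of_int q"
    by (simp only: of_real_eq_iff)
  then show ?thesis using assms(2) by (simp add: avg_def D_def T_def)
qed

text \<open>The equations are relaxed to congruences modulo \<open>q\<close>, and the shift
  \<open>h\<close> only contributes a factor of modulus 1. The bound is therefore uniform in
  \<open>h\<close>, as the passage to a single power will require.\<close>

lemma card_system_le_avg:
  fixes X :: "int set"
  assumes X: "finite X" and q: "q > 0"
  shows "real (card {(x, y). x \<in> PiE {..<s} (\<lambda>_. X) \<and> y \<in> PiE {..<s} (\<lambda>_. X) \<and> (\<forall>j\<in>{1..k}. (\<Sum>i<s. x i ^ j) - (\<Sum>i<s. y i ^ j) = h j)})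
    \<le> avg (Box k q) (\<lambda>\<alpha>. norm (es k q X (\<lambda>_. 1) \<alpha>) ^ (2 * s))"
proof -
  define T where "T = PiE {..<s} (\<lambda>_. X)"
  have T: "finite T" unfolding T_def using assms by (intro finite_PiE) auto
  define H where "H x y j = (\<Sum>i<s. x i ^ j) - (\<Sum>i<s. y i ^ j) - h j" for x y and j :: nat
  define D where "D = {(x, y). x \<in> T \<and> y \<in> T \<and> (\<forall>j\<in>{1..k}. q dvd H x y j)}"
  have finD: "finite D" using T by (intro finite_subset[of D "T \<times> T"]) (auto simp: D_def)
  have c: "real (card (Box k q)) > 0" using Box_ne[OF q] by (simp add: card_gt_0_iff)
  have ex: "complex_of_real (norm (es k q X (\<lambda>_. 1) \<alpha>) ^ (2 * s)) * em q (- (\<Sum>j=1..k. \<alpha> j * h j))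
      = (\<Sum>x\<in>T. \<Sum>y\<in>T. em q (\<Sum>j=1..k. \<alpha> j * H x y j))" for \<alpha>
  proof -
    have "(\<Sum>i<s. pv k \<alpha> (x i)) - (\<Sum>i<s. pv k \<alpha> (y i)) + - (\<Sum>j=1..k. \<alpha> j * h j) = (\<Sum>j=1..k. \<alpha> j * H x y j)" for x y :: "nat \<Rightarrow> int"
    proof -
      have "(\<Sum>i<s. pv k \<alpha> (z i)) = (\<Sum>j=1..k. \<alpha> j * (\<Sum>i<s. z i ^ j))" for z :: "nat \<Rightarrow> int"
        unfolding pv_def sum_distrib_left by (rule sum.swap)
      then show ?thesis by (simp add: H_def right_diff_distrib sum_subtractf)
    qed
    then show ?thesis
      unfolding es_def mult_1 exponential_sum_power_expand[OF X] T_def[symmetric] sum_distrib_right em_add[symmetric] by simp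
  qed
  have "(\<Sum>\<alpha>\<in>Box k q. complex_of_real (norm (es k q X (\<lambda>_. 1) \<alpha>) ^ (2 * s)) * em q (- (\<Sum>j=1..k. \<alpha> j * h j)))
     = (\<Sum>x\<in>T. \<Sum>y\<in>T. \<Sum>\<alpha>\<in>Box k q. em q (\<Sum>j=1..k. \<alpha> j * H x y j))"
    unfolding ex by (rule trans[OF sum.swap], rule sum.cong[OF refl], rule sum.swap)
  also have "\<dots> = (\<Sum>x\<in>T. \<Sum>y\<in>T. if \<forall>j\<in>{1..k}. q dvd H x y j then of_nat (card (Box k q)) else 0)"
    by (intro sum.cong refl sum_Box_em q)
  also have "\<dots> = (\<Sum>z\<in>T \<times> T. if z \<in> D then of_nat (card (Box k q)) else 0)"
    unfolding sum.cartesian_product by (intro sum.cong) (auto simp: D_def split: if_splits)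
  also have "\<dots> = of_nat (card D) * of_nat (card (Box k q))"
    using T by (subst sum.If_cases) (auto simp: D_def intro!: arg_cong[where f = card])
  finally have eq: "of_nat (card D) * of_nat (card (Box k q)) = (\<Sum>\<alpha>\<in>Box k q. complex_of_real (norm (es k q X (\<lambda>_. 1) \<alpha>) ^ (2 * s)) * em q (- (\<Sum>j=1..k. \<alpha> j * h j)))" ..
  have "real (card D) * real (card (Box k q)) = norm (of_nat (card D) * of_nat (card (Box k q)) :: complex)"
    by (simp add: norm_mult)
  also have "\<dots> \<le> (\<Sum>\<alpha>\<in>Box k q. norm (es k q X (\<lambda>_. 1) \<alpha>) ^ (2 * s))"
    unfolding eq by (rule sum_norm_le) (simp add: norm_mult norm_power)
  finally have "real (card D) \<le> avg (Box k q) (\<lambda>\<alpha>. norm (es k q X (\<lambda>_. 1) \<alpha>) ^ (2 * s))"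
    using c by (simp add: avg_def pos_le_divide_eq)
  moreover have "card {(x, y). x \<in> T \<and> y \<in> T \<and> (\<forall>j\<in>{1..k}. (\<Sum>i<s. x i ^ j) - (\<Sum>i<s. y i ^ j) = h j)} \<le> card D"
    using finD by (intro card_mono) (auto simp: D_def H_def)
  ultimately show ?thesis by (simp add: T_def)
qed

lemma Vinogradov_mean_value:
  assumes k: "k \<ge> 1" and eps: "\<epsilon> > 0"
  obtains C where "C > 0" "\<And>U h. U \<ge> 1 \<Longrightarrow>
    real (card {(x, y). x \<in> PiE {..<crit k} (\<lambda>_. {1..int U}) \<and> y \<in> PiE {..<crit k} (\<lambda>_. {1..int U}) \<and>
      (\<forall>j\<in>{1..k}. (\<Sum>i<crit k. x i ^ j) - (\<Sum>i<crit k. y i ^ j) = h j)}) \<le> C * real U powr (real (crit k) + \<epsilon>)"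
proof -
  obtain p' :: nat where p': "prime p'" "k < p'" using bigger_prime by blast
  define p where "p = int p'"
  have p: "prime p" "int k < p" "p > 1" using p' prime_gt_1_nat[of p'] by (auto simp: p_def)
  define P where "P = real_of_int p"
  have P1: "P > 1" using p by (simp add: P_def)
  obtain C0 where C0: "\<And>d. Dec p k d (C0 * P powr (\<epsilon> * real d))"
    using decoupling_moment_curve[OF p(1) P_def k p(2) eps] by blast
  define C where "C = max C0 1"
  have C: "C \<ge> 1" by (simp add: C_def)
  have dec: "Dec p k d (C * P powr (\<epsilon> * real d))" for d
    by (rule Dec_mono[OF C0]) (use k in \<open>auto simp: C_def intro!: mult_right_mono\<close>)
  show ?thesis
  proof (rule that)
    show "C * P powr \<epsilon> > 0" using C P1 by simp
    fix U :: nat and h assume U: "U \<ge> 1"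
    define X where "X = {1..int U}"
    define s where "s = crit k"
    have s: "s > 0" using crit_pos[OF k] by (simp add: s_def)
    \<comment> \<open>With \<open>p' ^ N\<close> between \<open>U\<close> and \<open>P * U\<close>,
      a class modulo \<open>p ^ N\<close> contains at most one of the points 1 to \<open>U\<close>,
      so the right side of decoupling is at most \<open>U ^ s\<close>, while the constant costs only
      a power \<epsilon> of \<open>U\<close>.\<close>
    obtain N where N: "U \<le> p' ^ N" "real (p' ^ N) \<le> P * real U"
    proof -
      define N where "N = (LEAST N. U \<le> p' ^ N)"
      have ex: "U \<le> p' ^ U" using p'(1) prime_gt_1_nat by (metis less_imp_le self_le_ge2_pow Suc_1 Suc_leI)
      have 1: "U \<le> p' ^ N" unfolding N_def by (rule LeastI[of _ U]) (rule ex)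
      have "real (p' ^ N) \<le> P * real U"
      proof (cases N)
        case 0
        have "1 * 1 \<le> P * real U" using U P1 by (intro mult_mono) auto
        then show ?thesis using 0 by simp
      next
        case (Suc n)
        then have "\<not> U \<le> p' ^ n" using not_less_Least[of n "\<lambda>N. U \<le> p' ^ N"] by (simp add: N_def)
        then have "real (p' ^ n) \<le> real U" by (simp only: of_nat_le_iff)
        then have "P * real (p' ^ n) \<le> P * real U" using P1 by (intro mult_left_mono) auto
        then show ?thesis using Suc by (simp add: P_def p_def)
      qed
      with 1 show ?thesis using that by blast
    qed
    define q where "q = p ^ (k * N)"
    have q: "q > 0" using p by (simp add: q_def)
    define B where "B c = root s (avg (Box k q) (\<lambda>\<alpha>. norm (es k q (cls (p ^ N) c X) (\<lambda>_. 1) \<alpha>) ^ (2 * s)))" for c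
    have UN: "int U \<le> p ^ N" using N(1) unfolding p_def by (metis of_nat_le_iff of_nat_power)
    have one: "cls (p ^ N) c X \<subseteq> {x}" if "x \<in> cls (p ^ N) c X" for x c
    proof
      fix y assume "y \<in> cls (p ^ N) c X"
      then have "[y = x] (mod p ^ N)" "x \<in> X" "y \<in> X" using that by (auto simp: cls_def dest: cong_sym cong_trans)
      then have "p ^ N dvd y - x" "\<bar>y - x\<bar> < p ^ N" using UN by (auto simp: cong_iff_dvd_diff X_def)
      then have "y - x = 0" by (metis dvd_imp_le_int abs_le_D1 abs_ge_self leD abs_dvd_iff abs_abs p(3) zero_less_power order.strict_trans zero_less_one abs_of_pos)
      then show "y \<in> {x}" by simp
    qed
    have B1: "B c \<le> (if cls (p ^ N) c X = {} then 0 else 1)" for c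
    proof (cases "cls (p ^ N) c X = {}")
      case True
      then show ?thesis using s by (simp add: B_def es_def avg_def power_0_left)
    next
      case False
      then obtain x where "x \<in> cls (p ^ N) c X" by blast
      then have "cls (p ^ N) c X = {x}" using one by blast
      then have "B c = 1" using s Box_ne[OF q] by (simp add: B_def es_def avg_const)
      then show ?thesis using False by simp
    qed
    have "(\<Sum>c\<in>{0..<p ^ N}. B c) \<le> (\<Sum>c\<in>{0..<p ^ N}. real (card (cls (p ^ N) c X)))"
    proof (rule sum_mono)
      fix c
      have "finite (cls (p ^ N) c X)" by (simp add: X_def)
      then have "cls (p ^ N) c X \<noteq> {} \<Longrightarrow> card (cls (p ^ N) c X) \<ge> 1" by (simp add: Suc_le_eq card_gt_0_iff)
      then show "B c \<le> real (card (cls (p ^ N) c X))" using B1[of c] by (cases "cls (p ^ N) c X = {}") auto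
    qed
    also have "\<dots> = real (card (\<Union>c\<in>{0..<p ^ N}. cls (p ^ N) c X))"
    proof -
      have "cls (p ^ N) c X \<inter> cls (p ^ N) c' X = {}" if "c \<in> {0..<p ^ N}" "c' \<in> {0..<p ^ N}" "c \<noteq> c'" for c c'
        using that by (auto simp: cls_def cong_def)
      then show ?thesis by (subst card_UN_disjoint) (auto simp: X_def)
    qed
    also have "\<dots> \<le> real (card X)" by (intro of_nat_mono card_mono) (auto simp: X_def cls_def)
    finally have sB: "(\<Sum>c\<in>{0..<p ^ N}. B c) \<le> real U" by (simp add: X_def)
    have B0: "B c \<ge> 0" for c unfolding B_def by (intro real_root_ge_zero avg_nonneg) auto
    have "avg (Box k q) (\<lambda>\<alpha>. norm (es k q X (\<lambda>_. 1) \<alpha>) ^ (2 * s)) \<le> C * P powr (\<epsilon> * real N) * (\<Sum>c\<in>{0..<p ^ N}. B c) ^ s"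
      using dec[of N, unfolded Dec_def, rule_format, of X "\<lambda>_. 1"] by (simp add: X_def s_def q_def B_def)
    also have "\<dots> \<le> C * P powr (\<epsilon> * real N) * real U ^ s"
      using sB B0 C by (intro mult_left_mono power_mono sum_nonneg) auto
    also have "P powr (\<epsilon> * real N) = real (p' ^ N) powr \<epsilon>"
      using P1 by (simp add: P_def p_def powr_powr mult.commute flip: powr_realpow)
    also have "C * real (p' ^ N) powr \<epsilon> * real U ^ s \<le> C * (P * real U) powr \<epsilon> * real U ^ s"
      using C N(2) eps by (intro mult_left_mono mult_right_mono powr_mono2) auto
    also have "\<dots> = C * P powr \<epsilon> * real U powr (real s + \<epsilon>)"
      using U P1 by (simp add: powr_mult powr_add powr_realpow)
    finally have "avg (Box k q) (\<lambda>\<alpha>. norm (es k q X (\<lambda>_. 1) \<alpha>) ^ (2 * s)) \<le> C * P powr \<epsilon> * real U powr (real s + \<epsilon>)" .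
    then show "real (card {(x, y). x \<in> PiE {..<crit k} (\<lambda>_. {1..int U}) \<and> y \<in> PiE {..<crit k} (\<lambda>_. {1..int U}) \<and>
      (\<forall>j\<in>{1..k}. (\<Sum>i<crit k. x i ^ j) - (\<Sum>i<crit k. y i ^ j) = h j)}) \<le> C * P powr \<epsilon> * real U powr (real (crit k) + \<epsilon>)"
      using card_system_le_avg[of X q s k h] q by (simp add: X_def s_def)
  qed
qed

lemma card_fiber_union_le:
  assumes "finite H" "\<And>h. h \<in> H \<Longrightarrow> finite (D h)" "S \<subseteq> (\<Union>h\<in>H. D h)" "\<And>h. h \<in> H \<Longrightarrow> real (card (D h)) \<le> M"
  shows "real (card S) \<le> real (card H) * M"
proof -
  have "card S \<le> card (\<Union>h\<in>H. D h)" using assms by (intro card_mono) auto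
  also have "\<dots> \<le> (\<Sum>h\<in>H. card (D h))" by (rule card_UN_le) (rule assms)
  finally have "real (card S) \<le> (\<Sum>h\<in>H. real (card (D h)))" by (simp only: of_nat_sum[symmetric] of_nat_le_iff)
  also have "\<dots> \<le> real (card H) * M" using assms(4) by (rule sum_bounded_above)
  finally show ?thesis .
qed

text \<open>Hua's lemma at the exponent \<open>m (m + 1)\<close>: fix the values of the lower power sums in the Vinogradov system.\<close>
lemma mean_value_power:
  assumes m: "m \<ge> 1" and eps: "\<epsilon> > 0"
  obtains C where "C > 0" "\<And>U Q c. U \<ge> 1 \<Longrightarrow> c \<noteq> 0 \<Longrightarrow> \<bar>c\<bar> * (int (crit m) * int U ^ m) < Q \<Longrightarrow>
    avg {0..<Q} (\<lambda>r. norm (\<Sum>x\<in>{1..int U}. em Q (r * (c * x ^ m))) ^ (2 * crit m)) \<le> C * real U powr (real (m * m) + \<epsilon>)"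
proof -
  define s where "s = crit m"
  have s: "s \<ge> 1" using crit_pos[OF m] by (simp add: s_def)
  obtain C where C: "C > 0" and V: "\<And>U h. U \<ge> 1 \<Longrightarrow>
    real (card {(x, y). x \<in> PiE {..<s} (\<lambda>_. {1..int U}) \<and> y \<in> PiE {..<s} (\<lambda>_. {1..int U}) \<and>
      (\<forall>j\<in>{1..m}. (\<Sum>i<s. x i ^ j) - (\<Sum>i<s. y i ^ j) = h j)}) \<le> C * real U powr (real s + \<epsilon>)"
    using Vinogradov_mean_value[OF m eps] unfolding s_def by blast
  \<comment> \<open>The lower power sums take about \<open>U^(s - m)\<close> values; together with
    Vinogradov's \<open>U^s\<close> for each value this gives
    \<open>2 s - m = m * m\<close>.\<close>
  have tri: "real (\<Sum>j\<in>{1..<m}. j) = real s - real m"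
  proof -
    have "{1..m} = insert m {1..<m}" using m by auto
    then have "(\<Sum>j\<in>{1..m}. j) = m + (\<Sum>j\<in>{1..<m}. j)" by simp
    moreover have "2 * (\<Sum>j\<in>{1..m}. j) = m * (m + 1)" by (induction m) auto
    then have "2 * (\<Sum>j\<in>{1..m}. j) = 2 * s" by (simp only: s_def two_crit)
    ultimately show ?thesis by linarith
  qed
  define C' where "C' = real (3 * s) ^ (m - 1) * C"
  show ?thesis
  proof (rule that)
    show "C' > 0" using C s by (simp add: C'_def)
    fix U :: nat and Q c :: int
    assume U: "U \<ge> 1" and c: "c \<noteq> 0" and Q: "\<bar>c\<bar> * (int (crit m) * int U ^ m) < Q"
    have "0 \<le> \<bar>c\<bar> * (int (crit m) * int U ^ m)" by simp
    then have Q0: "Q > 0" using Q by linarith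
    define X where "X = {1..int U}"
    define T where "T = PiE {..<s} (\<lambda>_. X)"
    have T: "finite T" unfolding T_def X_def by (intro finite_PiE) auto
    define dl where "dl x y j = (\<Sum>i<s. x i ^ j) - (\<Sum>i<s. y i ^ j)" for x y :: "nat \<Rightarrow> int" and j :: nat
    have bd: "\<bar>dl x y j\<bar> \<le> int s * int U ^ j" if "x \<in> T" "y \<in> T" for x y j
    proof -
      have "0 \<le> (\<Sum>i<s. z i ^ j)" "(\<Sum>i<s. z i ^ j) \<le> int s * int U ^ j" if "z \<in> T" for z
      proof -
        have z: "1 \<le> z i" "z i \<le> int U" if "i < s" for i using \<open>z \<in> T\<close> that by (auto simp: T_def X_def PiE_iff)
        show "0 \<le> (\<Sum>i<s. z i ^ j)" using z by (intro sum_nonneg zero_le_power) force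
        have "(\<Sum>i<s. z i ^ j) \<le> (\<Sum>i<s. int U ^ j)" using z by (intro sum_mono power_mono) force+
        then show "(\<Sum>i<s. z i ^ j) \<le> int s * int U ^ j" by simp
      qed
      from this[OF that(1)] this[OF that(2)] show ?thesis unfolding dl_def by linarith
    qed
    define S where "S = {(x, y). x \<in> T \<and> y \<in> T \<and> Q dvd (\<Sum>i<s. c * x i ^ m) - (\<Sum>i<s. c * y i ^ m)}"
    define H where "H = PiE {1..<m} (\<lambda>j. {- (int s * int U ^ j)..int s * int U ^ j})"
    have H: "finite H" unfolding H_def by (intro finite_PiE) auto
    \<comment> \<open>The top difference is forced to be 0: it is divisible by \<open>Q\<close>
      after multiplication by \<open>c\<close>, and \<open>Q\<close> exceeds its size. Only the
      differences of degree below \<open>m\<close> are free.\<close>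
    define D where "D h = {(x, y). x \<in> T \<and> y \<in> T \<and> (\<forall>j\<in>{1..m}. dl x y j = (h(m := 0)) j)}" for h
    have "S \<subseteq> (\<Union>h\<in>H. D h)"
    proof (clarsimp simp: S_def)
      fix x y assume xy: "x \<in> T" "y \<in> T" and "Q dvd (\<Sum>i<s. c * x i ^ m) - (\<Sum>i<s. c * y i ^ m)"
      then have dv: "Q dvd c * dl x y m" by (simp add: dl_def sum_distrib_left right_diff_distrib)
      have "\<bar>c * dl x y m\<bar> \<le> \<bar>c\<bar> * (int s * int U ^ m)"
        unfolding abs_mult using bd[OF xy] by (intro mult_left_mono) auto
      then have "\<bar>c * dl x y m\<bar> < Q" using Q by (simp add: s_def)
      then have "c * dl x y m = 0" using dv by (metis abs_of_pos Q0 dvd_imp_le_int leD abs_ge_self order.trans)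
      then have z: "dl x y m = 0" using c by simp
      define h where "h = restrict (dl x y) {1..<m}"
      have "h \<in> H" using bd[OF xy] by (auto simp: h_def H_def abs_le_iff) (smt (verit))+
      moreover have "(x, y) \<in> D h" using xy z by (auto simp: D_def h_def)
      ultimately show "\<exists>h\<in>H. (x, y) \<in> D h" by blast
    qed
    then have "real (card S) \<le> real (card H) * (C * real U powr (real s + \<epsilon>))"
    proof (rule card_fiber_union_le[OF H, rotated])
      show "finite (D h)" for h using T by (intro finite_subset[of "D h" "T \<times> T"]) (auto simp: D_def)
      show "real (card (D h)) \<le> C * real U powr (real s + \<epsilon>)" for h
        using V[OF U, of "h(m := 0)"] by (simp add: D_def T_def X_def dl_def)
    qed
    also have "real (card H) \<le> real (3 * s) ^ (m - 1) * real U powr (real s - real m)"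
    proof -
      have "real (card H) = (\<Prod>j\<in>{1..<m}. real (2 * (s * U ^ j) + 1))"
        unfolding H_def by (subst card_PiE) (auto simp: nat_add_distrib nat_mult_distrib nat_power_eq intro!: prod.cong)
      also have "\<dots> \<le> (\<Prod>j\<in>{1..<m}. real (3 * s) * real U ^ j)"
      proof (intro prod_mono conjI)
        fix j
        have "1 * 1 \<le> s * U ^ j" using s U by (intro mult_le_mono) auto
        then have "2 * (s * U ^ j) + 1 \<le> 3 * s * U ^ j" by linarith
        then show "real (2 * (s * U ^ j) + 1) \<le> real (3 * s) * real U ^ j"
          by (metis of_nat_le_iff of_nat_mult of_nat_power)
      qed simp
      also have "\<dots> = real (3 * s) ^ (m - 1) * real U ^ (\<Sum>j\<in>{1..<m}. j)"
        by (simp add: prod.distrib power_sum)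
      also have "real U ^ (\<Sum>j\<in>{1..<m}. j) = real U powr (real s - real m)"
        using U unfolding tri[symmetric] by (subst powr_realpow) auto
      finally show ?thesis .
    qed
    finally have "real (card S) \<le> real (3 * s) ^ (m - 1) * real U powr (real s - real m) * (C * real U powr (real s + \<epsilon>))"
      using C by (simp add: mult_right_mono)
    also have "\<dots> = C' * real U powr (real (2 * s) - real m + \<epsilon>)"
      by (simp add: C'_def powr_add[symmetric] algebra_simps)
    also have "real (2 * s) - real m = real (m * m)" unfolding s_def two_crit by (simp add: algebra_simps)
    finally have "real (card S) \<le> C' * real U powr (real (m * m) + \<epsilon>)" .
    then show "avg {0..<Q} (\<lambda>r. norm (\<Sum>x\<in>{1..int U}. em Q (r * (c * x ^ m))) ^ (2 * crit m)) \<le> C' * real U powr (real (m * m) + \<epsilon>)"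
      using avg_exponential_sum_power[of X Q "\<lambda>x. c * x ^ m" s] Q0 by (simp add: S_def T_def X_def s_def)
  qed
qed

section \<open>Weyl's inequality\<close>

lemma concave_on_sin: "concave_on {0..pi} sin"
  by (rule f''_le0_imp_concave[where f' = cos and f'' = "\<lambda>x. - sin x"])
     (auto intro!: derivative_eq_intros sin_ge_zero)

lemma sin_ge_two_div_pi:
  assumes "0 \<le> x" "x \<le> pi / 2"
  shows "2 / pi * x \<le> sin x"
proof -
  define s where "s = 2 * x / pi"
  have s: "0 \<le> s" "s \<le> 1" using assms by (auto simp: s_def field_simps)
  have "(1 - s) * sin 0 + s * sin (pi / 2) \<le> sin ((1 - s) *\<^sub>R 0 + s *\<^sub>R (pi / 2))"
    using concave_onD[OF concave_on_sin s, of 0 "pi / 2"] by (auto simp: field_simps)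
  then show ?thesis by (simp add: s_def)
qed

lemma norm_ee_diff_1: "norm (ee x - 1) = 2 * \<bar>sin (pi * x)\<bar>"
proof -
  have "(norm (ee x - 1))\<^sup>2 = (cos (2 * pi * x) - 1)\<^sup>2 + (sin (2 * pi * x))\<^sup>2"
    by (simp add: ee_def cmod_power2)
  also have "\<dots> = 2 - 2 * cos (2 * (pi * x))"
    using sin_cos_squared_add[of "2 * (pi * x)"] by (simp add: power2_eq_square algebra_simps)
  also have "\<dots> = (2 * \<bar>sin (pi * x)\<bar>)\<^sup>2" unfolding cos_double_sin by (simp add: power_mult_distrib)
  finally show ?thesis by (rule power2_eq_imp_eq) auto
qed

lemma norm_ee_diff_1_le: "norm (ee x - 1) \<le> 2 * pi * \<bar>x\<bar>"
  using abs_sin_x_le_abs_x[of "pi * x"] by (simp add: norm_ee_diff_1 abs_mult)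

lemma norm_ee_diff_1_ge:
  "4 * \<bar>x - of_int (round x)\<bar> \<le> norm (ee x - 1)"
proof -
  define y where "y = x - of_int (round x)"
  have y: "\<bar>y\<bar> \<le> 1 / 2" using of_int_round_abs_le[of x] by (simp add: y_def abs_minus_commute)
  have "ee x = ee y * ee (of_int (round x))" unfolding ee_add[symmetric] by (simp add: y_def)
  then have "norm (ee x - 1) = 2 * \<bar>sin (pi * y)\<bar>" by (simp add: norm_ee_diff_1)
  also have "\<bar>sin (pi * y)\<bar> = \<bar>sin (pi * \<bar>y\<bar>)\<bar>" by (cases "y \<ge> 0") auto
  also have "2 / pi * (pi * \<bar>y\<bar>) \<le> sin (pi * \<bar>y\<bar>)" using y by (intro sin_ge_two_div_pi) auto
  then have "4 * \<bar>y\<bar> \<le> 2 * \<bar>sin (pi * \<bar>y\<bar>)\<bar>" by simp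
  finally show ?thesis by (simp add: y_def)
qed

text \<open>An \<open>h\<close> is determined by its block of length \<open>q\<close> together with
  the small remainder \<open>a * h - b * q\<close>, because \<open>a\<close> is invertible modulo
  \<open>q\<close>.\<close>

lemma card_small_multiples_le:
  fixes a q :: int and U :: nat and t :: nat
  assumes "coprime a q" "q > 0"
  shows "card {h \<in> {1..U}. \<exists>b::int. \<bar>a * int h - b * q\<bar> \<le> int t} \<le> (U div nat q + 1) * (2 * t + 1)"
proof -
  define S where "S = {h \<in> {1..U}. \<exists>b::int. \<bar>a * int h - b * q\<bar> \<le> int t}"
  define b where "b h = (SOME b::int. \<bar>a * int h - b * q\<bar> \<le> int t)" for h
  have b: "\<bar>a * int h - b h * q\<bar> \<le> int t" if "h \<in> S" for h
  proof -
    have "\<exists>b::int. \<bar>a * int h - b * q\<bar> \<le> int t" using that by (simp add: S_def)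
    then show ?thesis unfolding b_def by (rule someI_ex)
  qed
  define f where "f h = (h div nat q, a * int h - b h * q)" for h
  have "inj_on f S"
  proof (rule inj_onI)
    fix h h' assume h: "h \<in> S" "h' \<in> S" and eq: "f h = f h'"
    then have "a * (int h - int h') = (b h - b h') * q" by (simp add: f_def algebra_simps)
    then have "q dvd a * (int h - int h')" by simp
    then have "q dvd int h - int h'" using assms(1) by (metis coprime_commute coprime_dvd_mult_right_iff)
    then have "int h mod q = int h' mod q" by (simp add: mod_eq_dvd_iff)
    moreover have "int h div q = int h' div q"
      using eq assms(2) by (simp add: f_def) (metis int_nat_eq less_imp_le zdiv_int)
    ultimately have "int h = int h'" by (metis mult_div_mod_eq)
    then show "h = h'" by simp
  qed
  then have "card S = card (f ` S)" by (simp add: card_image)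
  also have "\<dots> \<le> card ({0..U div nat q} \<times> {- int t..int t})"
    using b by (intro card_mono) (auto simp: f_def S_def abs_le_iff intro!: div_le_mono, (smt (verit))+)
  also have "\<dots> = (U div nat q + 1) * (2 * t + 1)" 
  proof -
    have "card {- int t..int t} = 2 * t + 1" by (simp add: nat_eq_iff)
    then show ?thesis by (simp add: card_cartesian_product)
  qed
  finally show ?thesis by (simp add: S_def)
qed

text \<open>A linear phase that is small on a dense set of integers is close to a rational with small denominator.\<close>
lemma linear_phase_rational:
  fixes \<beta> \<eta> t :: real and U :: nat
  assumes U: "U \<ge> 1" and H: "H \<subseteq> {1..U}" "real U \<le> t * real (card H)"
    and small: "\<And>h. h \<in> H \<Longrightarrow> \<exists>b::int. \<bar>\<beta> * real h - of_int b\<bar> \<le> \<eta>"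
    and eta: "\<eta> \<ge> 0" "48 * \<eta> * t \<le> 1" and t: "t > 0"
  shows "\<exists>q a::int. 1 \<le> q \<and> real_of_int q \<le> 24 * t \<and> \<bar>of_int q * \<beta> - of_int a\<bar> \<le> \<eta> * t / real U"
proof -
  have "4 * U > 0" using U by simp
  \<comment> \<open>At height \<open>4 * U\<close> the drift \<open>h (q \<beta> - a)\<close> is at
    most 1/4 for all \<open>h \<le> U\<close>, so \<open>a * h - b * q\<close> has size at most
    \<open>\<eta> q + 1 / 4\<close>.\<close>
  then obtain a q where cop: "coprime a q" and q: "0 < q" "q \<le> int (4 * U)" "\<bar>of_int q * \<beta> - of_int a\<bar> < 1 / real (4 * U)"
    using Dirichlet_approx_coprime[of "4 * U" \<beta>] by blast
  have finH: "finite H" using H(1) finite_subset by blast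
  have near: "\<bar>of_int (a * int h - b * q)\<bar> \<le> \<eta> * of_int q + 1 / 4"
    if "h \<in> H" "\<bar>\<beta> * real h - of_int b\<bar> \<le> \<eta>" for h b
  proof -
    have "real h \<le> real U" using that H by auto
    have "of_int (a * int h - b * q) = of_int q * (\<beta> * real h - of_int b) - real h * (of_int q * \<beta> - of_int a)"
      by (simp add: algebra_simps)
    also have "\<bar>\<dots>\<bar> \<le> \<bar>of_int q * (\<beta> * real h - of_int b)\<bar> + \<bar>real h * (of_int q * \<beta> - of_int a)\<bar>" by (rule abs_triangle_ineq4)
    also have "\<bar>of_int q * (\<beta> * real h - of_int b)\<bar> \<le> of_int q * \<eta>"
      unfolding abs_mult using that q by (intro mult_mono) auto
    also have "\<bar>real h * (of_int q * \<beta> - of_int a)\<bar> \<le> real U * (1 / real (4 * U))"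
      unfolding abs_mult using \<open>real h \<le> real U\<close> q by (intro mult_mono) auto
    also have "\<dots> = 1 / 4" using U by simp
    finally show ?thesis by (simp add: mult.commute)
  qed
  \<comment> \<open>For larger \<open>q\<close>, \<open>card_small_multiples_le\<close> would leave
    fewer than \<open>U / t\<close> elements for \<open>H\<close>.\<close>
  have q_le: "real_of_int q \<le> 24 * t"
  proof -
    define s where "s = nat \<lfloor>\<eta> * of_int q + 1 / 4\<rfloor>"
    have s0: "0 \<le> \<eta> * of_int q + 1 / 4" using eta q by simp
    have s: "real s \<le> \<eta> * of_int q + 1 / 4" using s0 by (simp add: s_def)
    have "H \<subseteq> {h \<in> {1..U}. \<exists>b::int. \<bar>a * int h - b * q\<bar> \<le> int s}"
    proof
      fix h assume h: "h \<in> H"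
      then obtain b where "\<bar>\<beta> * real h - of_int b\<bar> \<le> \<eta>" using small by blast
      from near[OF h this] have "\<bar>a * int h - b * q\<bar> \<le> \<lfloor>\<eta> * of_int q + 1 / 4\<rfloor>" by (simp add: le_floor_iff)
      then show "h \<in> {h \<in> {1..U}. \<exists>b::int. \<bar>a * int h - b * q\<bar> \<le> int s}"
        using h H s0 by (auto simp: s_def intro!: exI[of _ b])
    qed
    then have "card H \<le> card {h \<in> {1..U}. \<exists>b::int. \<bar>a * int h - b * q\<bar> \<le> int s}"
      by (intro card_mono) auto
    also have "\<dots> \<le> (U div nat q + 1) * (2 * s + 1)" by (rule card_small_multiples_le[OF cop q(1)])
    finally have "real (card H) \<le> real ((U div nat q + 1) * (2 * s + 1))" by (rule of_nat_mono)
    also have "\<dots> = (real (U div nat q) + 1) * (2 * real s + 1)" by (simp add: algebra_simps)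
    also have "\<dots> \<le> (real U / of_int q + 1) * (2 * (\<eta> * of_int q + 1 / 4) + 1)"
    proof (intro mult_mono add_mono)
      show "real (U div nat q) \<le> real U / of_int q" 
    proof -
      have "real (U div nat q * nat q) \<le> real U" by (simp only: of_nat_le_iff div_times_less_eq_dividend)
      then show ?thesis using q by (simp add: field_simps)
    qed
    qed (use s q in auto)
    finally have cH: "real (card H) \<le> (real U / of_int q + 1) * (2 * \<eta> * of_int q + 3 / 2)" by (simp add: algebra_simps)
    then have "real U \<le> t * ((real U / of_int q + 1) * (2 * \<eta> * of_int q + 3 / 2))"
      using H(2) t by (meson mult_left_mono less_imp_le order_trans)
    also have "\<dots> = 2 * (\<eta> * t) * real U + 3 / 2 * t * (real U / of_int q) + 2 * (\<eta> * t) * of_int q + 3 / 2 * t"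
      using q by (simp add: field_simps)
    finally have main: "real U \<le> 2 * (\<eta> * t) * real U + 3 / 2 * t * (real U / of_int q) + 2 * (\<eta> * t) * of_int q + 3 / 2 * t" .
    have et: "\<eta> * t \<le> 1 / 48" using eta by simp
    have "2 * (\<eta> * t) * real U \<le> 2 * (1 / 48) * real U" using et by (intro mult_right_mono mult_left_mono) auto
    moreover have "2 * (\<eta> * t) * of_int q \<le> 2 * (1 / 48) * (4 * real U)"
    proof -
      have "real_of_int q \<le> real_of_int (int (4 * U))" using q(2) by (simp only: of_int_le_iff)
      then have "real_of_int q \<le> 4 * real U" by simp
      moreover have "2 * (\<eta> * t) * of_int q \<le> 2 * (1 / 48) * of_int q" using et q by (intro mult_right_mono mult_left_mono) auto
      ultimately show ?thesis by linarith
    qed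
    ultimately have "real U / 2 \<le> 3 / 2 * t * (real U / of_int q) + 3 / 2 * t" using main by simp
    then have 1: "real U * of_int q \<le> 3 * t * real U + 3 * t * of_int q" using q by (simp add: field_simps)
    have "real_of_int q \<le> real_of_int (int (4 * U))" using q(2) by (simp only: of_int_le_iff)
    then have "3 * t * of_int q \<le> 3 * t * (4 * real U)" using t by (intro mult_left_mono) auto
    then have "real U * of_int q \<le> real U * (15 * t)" using 1 by (simp add: algebra_simps)
    then have "real_of_int q \<le> 15 * t" using U by simp
    then show ?thesis using t by simp
  qed
  \<comment> \<open>Now \<open>\<eta> q + 1 / 4 < 1\<close>, so the integer
    \<open>a * h - b * q\<close> is 0 and every \<open>h\<close> in \<open>H\<close> is a multiple
    of \<open>q\<close>.\<close>
  have mult: "int h = q * (int h div q) \<and> \<bar>\<beta> * real h - of_int (a * (int h div q))\<bar> \<le> \<eta>" if h: "h \<in> H" for h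
  proof -
    obtain b where b: "\<bar>\<beta> * real h - of_int b\<bar> \<le> \<eta>" using small h by blast
    have "\<eta> * of_int q \<le> \<eta> * (24 * t)" using q_le eta by (intro mult_left_mono) auto
    then have "\<bar>real_of_int (a * int h - b * q)\<bar> < 1" using near[OF h b] eta by simp
    then have "\<bar>a * int h - b * q\<bar> < 1" by linarith
    then have e: "a * int h = b * q" by simp
    then have "q dvd int h" using cop by (metis coprime_commute coprime_dvd_mult_right_iff dvd_triv_right)
    then have h': "int h = q * (int h div q)" by simp
    then have "(a * (int h div q)) * q = b * q" using e by (metis mult.assoc mult.commute)
    then have "b = a * (int h div q)" using q by simp
    then show ?thesis using h' b by simp
  qed
  have ne: "H \<noteq> {}"
  proof
    assume "H = {}"
    then show False using H(2) U by simp
  qed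
  \<comment> \<open>\<open>H\<close> lies among the multiples of \<open>q\<close> up to
    \<open>h0\<close>, hence \<open>h0 / q \<ge> U / t\<close>. The error at \<open>h0\<close> is
    \<open>h0 / q\<close> times the error at \<open>q\<close>, which sharpens the Dirichlet bound to
    \<open>\<eta> t / U\<close>.\<close>
  define h0 where "h0 = Max H"
  have h0: "h0 \<in> H" unfolding h0_def using finH ne by (rule Max_in)
  have "H \<subseteq> (\<lambda>j. j * nat q) ` {1..h0 div nat q}"
  proof
    fix h assume h: "h \<in> H"
    have "int h = int ((h div nat q) * nat q)" using mult[OF h] q by (simp add: zdiv_int mult.commute)
    then have "h = (h div nat q) * nat q" by (simp only: of_nat_eq_iff)
    moreover have "h \<le> h0" using h finH by (simp add: h0_def)
    moreover have "h \<noteq> 0" using h H by auto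
    ultimately show "h \<in> (\<lambda>j. j * nat q) ` {1..h0 div nat q}"
      by (intro image_eqI[of _ _ "h div nat q"]) (auto intro: div_le_mono simp: Suc_le_eq, metis mult_0 not_gr_zero)
  qed
  then have "card H \<le> card ((\<lambda>j. j * nat q) ` {1..h0 div nat q})" by (intro card_mono) auto
  also have "\<dots> \<le> h0 div nat q" using card_image_le[of "{1..h0 div nat q}" "\<lambda>j. j * nat q"] by simp
  finally have "real (card H) \<le> real (h0 div nat q)" by simp
  then have "t * real (card H) \<le> t * real (h0 div nat q)" using t by (intro mult_left_mono) auto
  then have Uh: "real U \<le> t * real (h0 div nat q)" using H(2) by linarith
  define j where "j = real (h0 div nat q)"
  have j0: "j > 0" using Uh U t unfolding j_def by (metis gr0I mult_zero_right not_one_le_zero of_nat_0 of_nat_le_0_iff of_nat_0_less_iff)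
  have hj: "real h0 = of_int q * j" "real_of_int (int h0 div q) = j"
  proof -
    show 1: "real_of_int (int h0 div q) = j" using q by (simp add: j_def) (metis int_nat_eq less_imp_le of_int_of_nat_eq zdiv_int)
    have "real_of_int (int h0) = of_int q * of_int (int h0 div q)" using mult[OF h0] by (metis of_int_mult)
    then show "real h0 = of_int q * j" using 1 by simp
  qed
  have "j * \<bar>of_int q * \<beta> - of_int a\<bar> = \<bar>\<beta> * real h0 - of_int (a * (int h0 div q))\<bar>"
  proof -
    have "\<beta> * real h0 - of_int (a * (int h0 div q)) = j * (of_int q * \<beta> - of_int a)"
      unfolding hj of_int_mult by (simp add: algebra_simps)
    then show ?thesis using j0 by (simp only: abs_mult abs_of_pos)
  qed
  then have jb: "j * \<bar>of_int q * \<beta> - of_int a\<bar> \<le> \<eta>" using mult[OF h0] by simp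
  have "real U * \<bar>of_int q * \<beta> - of_int a\<bar> \<le> t * j * \<bar>of_int q * \<beta> - of_int a\<bar>"
    using Uh by (intro mult_right_mono) (auto simp: j_def)
  also have "\<dots> \<le> t * \<eta>" using jb t by (simp add: mult.assoc)
  finally have "\<bar>of_int q * \<beta> - of_int a\<bar> \<le> \<eta> * t / real U" using U by (simp add: field_simps)
  then show ?thesis using q(1) q_le by (intro exI[of _ q] exI[of _ a]) auto
qed

section \<open>Weyl differencing\<close>

lemma van_der_Corput:
  fixes f :: "nat \<Rightarrow> complex"
  assumes "\<And>u. norm (f u) \<le> 1"
  shows "(norm (\<Sum>u=1..n. f u))\<^sup>2 \<le> real n + 2 * (\<Sum>h=1..<n. norm (\<Sum>v=1..n-h. f (v + h) * cnj (f v)))"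
proof -
  define D where "D h = (\<Sum>v=1..n-h. f (v + h) * cnj (f v))" for h
  have tri: "(\<Sum>u=1..n. \<Sum>v\<in>{1..<u}. f u * cnj (f v)) = (\<Sum>h=1..<n. D h)"
    unfolding D_def sum.Sigma[OF finite_atLeastAtMost ballI[OF finite_atLeastLessThan]] sum.Sigma[OF finite_atLeastLessThan ballI[OF finite_atLeastAtMost]]
    by (rule sum.reindex_bij_witness[of _ "\<lambda>(h, v). (v + h, v)" "\<lambda>(u, v). (u - v, v)"]) auto
  have split: "(\<Sum>v=1..n. f u * cnj (f v)) = (\<Sum>v\<in>{1..<u}. f u * cnj (f v)) + f u * cnj (f u) + (\<Sum>v\<in>{u<..n}. f u * cnj (f v))"
    if "u \<in> {1..n}" for u
  proof -
    have "{1..n} = insert u ({1..<u} \<union> {u<..n})" using that by auto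
    then show ?thesis by simp (subst sum.union_disjoint, auto)
  qed
  have swap: "(\<Sum>u=1..n. \<Sum>v\<in>{u<..n}. f u * cnj (f v)) = cnj (\<Sum>u=1..n. \<Sum>v\<in>{1..<u}. f u * cnj (f v))"
    unfolding cnj_sum complex_cnj_mult complex_cnj_cnj
    unfolding sum.Sigma[OF finite_atLeastAtMost ballI[OF finite_greaterThanAtMost]] sum.Sigma[OF finite_atLeastAtMost ballI[OF finite_atLeastLessThan]]
    by (rule sum.reindex_bij_witness[of _ "\<lambda>(u, v). (v, u)" "\<lambda>(u, v). (v, u)"]) auto
  have "complex_of_real ((norm (\<Sum>u=1..n. f u))\<^sup>2) = (\<Sum>u=1..n. \<Sum>v=1..n. f u * cnj (f v))"
    unfolding complex_norm_square cnj_sum sum_product ..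
  also have "\<dots> = (\<Sum>h=1..<n. D h) + (\<Sum>u=1..n. f u * cnj (f u)) + cnj (\<Sum>h=1..<n. D h)"
  proof -
    have "(\<Sum>u=1..n. \<Sum>v=1..n. f u * cnj (f v)) = (\<Sum>u=1..n. (\<Sum>v\<in>{1..<u}. f u * cnj (f v)) + f u * cnj (f u) + (\<Sum>v\<in>{u<..n}. f u * cnj (f v)))"
      by (rule sum.cong[OF refl split])
    then show ?thesis by (simp only: sum.distrib tri swap)
  qed
  finally have "(norm (\<Sum>u=1..n. f u))\<^sup>2 = norm ((\<Sum>h=1..<n. D h) + (\<Sum>u=1..n. f u * cnj (f u)) + cnj (\<Sum>h=1..<n. D h))"
    by (metis norm_of_real abs_of_nonneg zero_le_power2)
  also have "\<dots> \<le> norm (\<Sum>h=1..<n. D h) + norm (\<Sum>u=1..n. f u * cnj (f u)) + norm (cnj (\<Sum>h=1..<n. D h))"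
    by (meson add_mono norm_triangle_ineq order_refl order_trans)
  also have "norm (\<Sum>u=1..n. f u * cnj (f u)) \<le> (\<Sum>u=1..n. 1)"
    using assms by (intro sum_norm_le) (auto simp: norm_mult intro: mult_le_one)
  also have "norm (cnj (\<Sum>h=1..<n. D h)) = norm (\<Sum>h=1..<n. D h)" by (rule complex_mod_cnj)
  finally have "(norm (\<Sum>u=1..n. f u))\<^sup>2 \<le> real n + 2 * norm (\<Sum>h=1..<n. D h)" by simp
  also have "\<dots> \<le> real n + 2 * (\<Sum>h=1..<n. norm (D h))" by (intro add_left_mono mult_left_mono norm_sum) auto
  finally show ?thesis by (simp add: D_def)
qed

lemma poly_shift_diff:
  fixes P :: "real poly"
  assumes "degree P \<le> Suc m"
  shows "degree (pcompose P [:h, 1:] - P) \<le> m"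
    and "coeff (pcompose P [:h, 1:] - P) m = real (Suc m) * h * coeff P (Suc m)"
proof -
  have c: "coeff (pcompose P [:h, 1:]) k = (\<Sum>i\<le>Suc m. coeff P i * (real (i choose k) * h ^ (i - k)))" for k
  proof -
    have "P = (\<Sum>i\<le>Suc m. monom (coeff P i) i)"
      using assms by (metis poly_as_sum_of_monoms')
    then have "pcompose P [:h, 1:] = (\<Sum>i\<le>Suc m. pcompose (monom (coeff P i) i) [:h, 1:])"
      by (metis (no_types, lifting) pcompose_sum sum.cong)
    moreover have "pcompose (monom c i) [:h, 1:] = smult c ([:h, 1:] ^ i)" for c i
      by (induction i) (simp_all add: monom_Suc monom_0 pcompose_pCons mult.commute)
    moreover have "coeff ([:h, 1:] ^ i) k = real (i choose k) * h ^ (i - k)" for i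
    proof (cases "k \<le> i")
      case True
      then show ?thesis using coeff_linear_poly_power[of k i h 1] by simp
    next
      case False
      then show ?thesis by (simp add: coeff_eq_0 degree_linear_power binomial_eq_0)
    qed
    ultimately show ?thesis by (simp only: coeff_sum coeff_smult)
  qed
  have z: "(\<Sum>i\<le>Suc m. coeff P i * (real (i choose k) * h ^ (i - k))) = (\<Sum>i\<in>{k..Suc m}. coeff P i * (real (i choose k) * h ^ (i - k)))" for k
    by (intro sum.mono_neutral_right) (auto simp: binomial_eq_0)
  show "degree (pcompose P [:h, 1:] - P) \<le> m"
  proof (rule degree_le, intro allI impI)
    fix k assume k: "m < k"
    then consider "k = Suc m" | "k > Suc m" by linarith
    then show "coeff (pcompose P [:h, 1:] - P) k = 0"
    proof cases
      case 1
      have "coeff (pcompose P [:h, 1:]) k = coeff P k" unfolding c z 1 by simp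
      then show ?thesis by simp
    next
      case 2
      then have e: "{k..Suc m} = {}" by simp
      have "coeff (pcompose P [:h, 1:]) k = 0" unfolding c z e by simp
      then show ?thesis using 2 assms by (simp add: coeff_eq_0)
    qed
  qed
  have e: "{m..Suc m} = {m, Suc m}" by auto
  have "coeff (pcompose P [:h, 1:]) m = coeff P m + coeff P (Suc m) * (real (Suc m) * h)"
    unfolding c z e by simp
  then show "coeff (pcompose P [:h, 1:] - P) m = real (Suc m) * h * coeff P (Suc m)"
    by (simp add: mult_ac)
qed

text \<open>Inverse form: a sum of size \<open>U / t\<close> forces a rational approximation to the
  leading coefficient with losses polynomial in \<open>t\<close>, and the power \<open>K\<close> is
  left unspecified because any power saving suffices. The range may be shorter than
  \<open>U\<close>, since differencing shortens it while \<open>U\<close> has to stay fixed. In the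
  induction many differenced sums are large, each approximates \<open>M h\<close> times the leading
  coefficient, a common denominator is found by the pigeonhole principle, and
  \<open>linear_phase_rational\<close> removes \<open>h\<close>.\<close>

theorem Weyl_inequality:
  "\<exists>K C. C \<ge> 1 \<and> (\<forall>(P :: real poly) n U t. degree P \<le> Suc m \<longrightarrow> n \<le> U \<longrightarrow> 1 \<le> U \<longrightarrow> 1 \<le> t \<longrightarrow>
     real U \<le> t * norm (\<Sum>u=1..n. ee (poly P (real u))) \<longrightarrow>
     (\<exists>q a::int. 1 \<le> q \<and> real_of_int q \<le> C * t ^ K \<and> \<bar>of_int q * coeff P (Suc m) - of_int a\<bar> \<le> C * t ^ K / real U ^ Suc m))"
proof (induction m)
  case 0
  have "\<exists>q a::int. 1 \<le> q \<and> real_of_int q \<le> 1 * t ^ 1 \<and> \<bar>of_int q * coeff P (Suc 0) - of_int a\<bar> \<le> 1 * t ^ 1 / real U ^ Suc 0"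
    if P: "degree P \<le> Suc 0" and U: "1 \<le> U" and t: "1 \<le> t" and le: "real U \<le> t * norm (\<Sum>u=1..n. ee (poly P (real u)))"
    for P :: "real poly" and n U t
  proof -
    define \<alpha> where "\<alpha> = coeff P 1"
    define z where "z = ee \<alpha>"
    have "poly P x = coeff P 0 + \<alpha> * x" for x
    proof -
      have "poly P x = (\<Sum>i\<le>Suc 0. coeff P i * x ^ i)"
        unfolding poly_altdef using P by (intro sum.mono_neutral_left) (auto simp: coeff_eq_0)
      then show ?thesis by (simp add: \<alpha>_def)
    qed
    moreover have "ee (\<alpha> * real u) = z ^ u" for u
      by (induction u) (simp_all add: z_def distrib_left ee_add)
    ultimately have eq: "(\<Sum>u=1..n. ee (poly P (real u))) = ee (coeff P 0) * (\<Sum>u=1..n. z ^ u)"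
      by (simp add: ee_add sum_distrib_left)
    have "(z - 1) * (\<Sum>u=1..n. z ^ u) = z ^ Suc n - z"
      by (induction n) (simp_all add: algebra_simps)
    then have "norm (z - 1) * norm (\<Sum>u=1..n. z ^ u) = norm (z ^ Suc n - z)" by (metis norm_mult)
    also have "\<dots> \<le> norm (z ^ Suc n) + norm z" by (rule norm_triangle_ineq4)
    also have "\<dots> = 2" by (simp add: z_def norm_power norm_mult)
    finally have "norm (z - 1) * norm (\<Sum>u=1..n. z ^ u) \<le> 2" .
    then have "norm (z - 1) * (t * norm (\<Sum>u=1..n. z ^ u)) \<le> t * 2"
      using t by (metis (no_types, opaque_lifting) mult.left_commute mult_left_mono order_trans zero_le_one)
    moreover have "norm (z - 1) * real U \<le> norm (z - 1) * (t * norm (\<Sum>u=1..n. z ^ u))"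
    proof (rule mult_left_mono)
      have "norm (\<Sum>u=1..n. ee (poly P (real u))) = norm (\<Sum>u=1..n. z ^ u)" unfolding eq norm_mult by simp
      then show "real U \<le> t * norm (\<Sum>u=1..n. z ^ u)" using le by simp
    qed simp
    moreover have "4 * \<bar>\<alpha> - of_int (round \<alpha>)\<bar> * real U \<le> norm (z - 1) * real U"
      using norm_ee_diff_1_ge[of \<alpha>] by (intro mult_right_mono) (auto simp: z_def)
    ultimately have "\<bar>\<alpha> - of_int (round \<alpha>)\<bar> * real U \<le> t" using t by linarith
    then have "\<bar>\<alpha> - of_int (round \<alpha>)\<bar> \<le> t / real U" using U by (simp add: field_simps)
    then show ?thesis using t by (intro exI[of _ 1] exI[of _ "round \<alpha>"]) (auto simp: \<alpha>_def)
  qed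
  then show ?case by (intro exI[of _ 1] exI[of _ "1 :: real"]) auto
next
  case (Suc m)
  then obtain K C where C: "C \<ge> 1" and IH: "\<And>(P :: real poly) n U t. degree P \<le> Suc m \<Longrightarrow> n \<le> U \<Longrightarrow> 1 \<le> U \<Longrightarrow> 1 \<le> t \<Longrightarrow>
     real U \<le> t * norm (\<Sum>u=1..n. ee (poly P (real u))) \<Longrightarrow>
     (\<exists>q a::int. 1 \<le> q \<and> real_of_int q \<le> C * t ^ K \<and> \<bar>of_int q * coeff P (Suc m) - of_int a\<bar> \<le> C * t ^ K / real U ^ Suc m)"
    by blast
  define M where "M = Suc (Suc m)"
  \<comment> \<open>With this choice and the next one, \<open>C' * t ^ K'\<close> is
    \<open>Z ^ M\<close> for the threshold \<open>Z\<close> below.\<close>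
  define K' where "K' = (4 * K + 2) * M"
  define C' where "C' = (192 * real M * C\<^sup>2 * 64 ^ K) ^ M"
  have C'1: "C' \<ge> 1"
  proof -
    have "1 * 1 * 1 * 1 \<le> 192 * real M * C\<^sup>2 * 64 ^ K"
      using C by (intro mult_mono) (auto simp: M_def one_le_power)
    then show ?thesis unfolding C'_def by (intro one_le_power) simp
  qed
  have "\<exists>q a::int. 1 \<le> q \<and> real_of_int q \<le> C' * t ^ K' \<and> \<bar>of_int q * coeff P M - of_int a\<bar> \<le> C' * t ^ K' / real U ^ M"
    if P: "degree P \<le> M" and n: "n \<le> U" and U: "1 \<le> U" and t: "1 \<le> t" and le: "real U \<le> t * norm (\<Sum>u=1..n. ee (poly P (real u)))"
    for P :: "real poly" and n U t
  proof -
    define \<alpha> where "\<alpha> = coeff P M"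
    \<comment> \<open>The induction hypothesis is applied with \<open>8 * t\<^sup>2\<close> in place
      of \<open>t\<close>; \<open>Y\<close> bounds the denominators that it returns.\<close>
    define Y where "Y = C * (8 * t\<^sup>2) ^ K"
    define Z where "Z = 192 * real M * Y\<^sup>2 * t\<^sup>2"
    have t2: "t\<^sup>2 \<ge> 1" using t by (simp add: one_le_power)
    have Y: "Y \<ge> 1"
    proof -
      have "1 * 1 \<le> C * (8 * t\<^sup>2) ^ K" using C t2 by (intro mult_mono one_le_power) auto
      then show ?thesis by (simp add: Y_def)
    qed
    have Y2: "Y\<^sup>2 \<ge> Y" "Y\<^sup>2 \<ge> 1" using Y by (simp_all add: power2_eq_square mult_le_cancel_left1 one_le_power) (use Y in \<open>metis mult_mono' mult_1 zero_le_one\<close>)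
    have Z1: "Z \<ge> 192 * (Y\<^sup>2 * t\<^sup>2)" 
    proof -
      have "192 * 1 * (Y\<^sup>2 * t\<^sup>2) \<le> 192 * real M * (Y\<^sup>2 * t\<^sup>2)" by (intro mult_right_mono) (auto simp: M_def)
      then show ?thesis by (simp add: Z_def mult.assoc)
    qed
    have yt: "Y\<^sup>2 * t\<^sup>2 \<ge> t\<^sup>2" "Y\<^sup>2 * t\<^sup>2 \<ge> 1" using Y2(2) t2 by (simp_all add: mult_le_cancel_right1) (use Y2(2) t2 in \<open>metis mult_mono' mult_1 zero_le_one\<close>)
    have Z1': "Z \<ge> 1" using Z1 yt by linarith
    have "Y\<^sup>2 = C\<^sup>2 * 64 ^ K * t ^ (4 * K)"
    proof -
      have "((8 * t\<^sup>2) ^ K)\<^sup>2 = ((8 * t\<^sup>2)\<^sup>2) ^ K" by (simp only: power_mult[symmetric] mult.commute)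
      also have "(8 * t\<^sup>2)\<^sup>2 = 64 * t ^ 4" by (simp add: power_mult_distrib power_mult[symmetric])
      finally show ?thesis unfolding Y_def by (simp add: power_mult_distrib power_mult mult.assoc)
    qed
    then have "Z = (192 * real M * C\<^sup>2 * 64 ^ K) * t ^ (4 * K + 2)" by (simp only: Z_def power_add mult_ac)
    then have ZM: "Z ^ M = C' * t ^ K'" by (simp only: C'_def K'_def power_mult_distrib power_mult)
    have ZZ: "Z \<le> Z ^ M" using Z1' by (intro self_le_power) (auto simp: M_def)
    show ?thesis
    proof (cases "real U \<le> Z")
      case True
      \<comment> \<open>For short ranges the nearest integer will do: its error is at most 1, which
        is at most \<open>(Z / U) ^ M\<close>.\<close>
      have "\<bar>\<alpha> - of_int (round \<alpha>)\<bar> \<le> 1" using of_int_round_abs_le[of \<alpha>] by (simp add: abs_minus_commute)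
      also have "1 \<le> (Z / real U) ^ M" using True U by (intro one_le_power) simp
      also have "\<dots> = C' * t ^ K' / real U ^ M" by (simp only: power_divide ZM)
      finally show ?thesis using ZM ZZ Z1' by (intro exI[of _ 1] exI[of _ "round \<alpha>"]) (auto simp: \<alpha>_def)
    next
      case False
      define f where "f u = ee (poly P (real u))" for u
      define Q where "Q h = pcompose P [:real h, 1:] - P" for h
      define T where "T h = (\<Sum>v=1..n-h. ee (poly (Q h) (real v)))" for h
      have T: "(\<Sum>v=1..n-h. f (v + h) * cnj (f v)) = T h" for h
        unfolding T_def f_def Q_def ee_minus[symmetric] ee_add[symmetric] by (simp add: poly_pcompose add.commute)
      have Tle: "norm (T h) \<le> real U" for h
      proof -
        have "norm (T h) \<le> (\<Sum>v=1..n-h. 1)" unfolding T_def by (intro sum_norm_le) simp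
        then show ?thesis using n by simp
      qed
      \<comment> \<open>The remaining shifts contribute at most a quarter of the square of
        \<open>U\<close>, so \<open>H\<close> has at least \<open>U / (4 t^2)\<close>
        elements.\<close>
      define H where "H = {h\<in>{1..<n}. real U \<le> (8 * t\<^sup>2) * norm (T h)}"
      have finH: "finite H" by (simp add: H_def)
      have "(real U)\<^sup>2 \<le> (t * norm (\<Sum>u=1..n. f u))\<^sup>2" using le by (intro power_mono) (auto simp: f_def)
      also have "\<dots> = t\<^sup>2 * (norm (\<Sum>u=1..n. f u))\<^sup>2" by (simp add: power_mult_distrib)
      also have "\<dots> \<le> t\<^sup>2 * (real n + 2 * (\<Sum>h=1..<n. norm (T h)))"
      proof (rule mult_left_mono)
        have "norm (f u) \<le> 1" for u by (simp add: f_def)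
        then show "(norm (\<Sum>u=1..n. f u))\<^sup>2 \<le> real n + 2 * (\<Sum>h=1..<n. norm (T h))"
          using van_der_Corput[of f n] unfolding T by blast
      qed simp
      also have "(\<Sum>h=1..<n. norm (T h)) \<le> (\<Sum>h=1..<n. (if h \<in> H then real U else 0) + real U / (8 * t\<^sup>2))"
      proof (rule sum_mono)
        fix h assume h: "h \<in> {1..<n}"
        show "norm (T h) \<le> (if h \<in> H then real U else 0) + real U / (8 * t\<^sup>2)"
        proof (cases "h \<in> H")
          case True
          then show ?thesis using Tle[of h] t2 by (simp add: add_increasing2)
        next
          case False
          then have "(8 * t\<^sup>2) * norm (T h) < real U" using h by (auto simp: H_def)
          moreover have "8 * t\<^sup>2 > 0" using t2 by linarith
          ultimately have "norm (T h) \<le> real U / (8 * t\<^sup>2)" by (simp only: pos_le_divide_eq mult.commute less_imp_le)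
          then show ?thesis using False by simp
        qed
      qed
      also have "(\<Sum>h=1..<n. (if h \<in> H then real U else 0) + real U / (8 * t\<^sup>2)) = real (card H) * real U + real (card {1..<n}) * (real U / (8 * t\<^sup>2))"
      proof -
        have "H \<subseteq> {1..<n}" by (auto simp: H_def)
        then have "{1..<n} \<inter> H = H" by blast
        then show ?thesis by (simp add: sum.distrib sum.If_cases)
      qed
      also have "\<dots> \<le> real (card H) * real U + real U * (real U / (8 * t\<^sup>2))"
        using n by (intro add_left_mono mult_right_mono) auto
      finally have "(real U)\<^sup>2 \<le> t\<^sup>2 * (real n + 2 * (real (card H) * real U + real U * (real U / (8 * t\<^sup>2))))"
        using t2 by (simp add: mult_left_mono)
      also have "\<dots> \<le> t\<^sup>2 * (real U + 2 * (real (card H) * real U + real U * (real U / (8 * t\<^sup>2))))"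
        using n by (intro mult_left_mono add_right_mono) auto
      also have "\<dots> = t\<^sup>2 * real U + 2 * t\<^sup>2 * real (card H) * real U + real U * real U / 4"
        using t by (simp add: field_simps)
      finally have "real U * real U \<le> (t\<^sup>2 + 2 * t\<^sup>2 * real (card H) + real U / 4) * real U"
        by (simp add: power2_eq_square algebra_simps)
      then have "real U \<le> t\<^sup>2 + 2 * t\<^sup>2 * real (card H) + real U / 4" using U by simp
      moreover have "4 * t\<^sup>2 \<le> real U" using False Z1 yt by linarith
      ultimately have cardH: "real U \<le> 4 * t\<^sup>2 * real (card H)" by linarith
      have ex: "\<exists>q a::int. 1 \<le> q \<and> real_of_int q \<le> Y \<and> \<bar>of_int q * (real M * real h * \<alpha>) - of_int a\<bar> \<le> Y / real U ^ Suc m" if "h \<in> H" for h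
      proof -
        have "\<exists>q a::int. 1 \<le> q \<and> real_of_int q \<le> C * (8 * t\<^sup>2) ^ K \<and> \<bar>of_int q * coeff (Q h) (Suc m) - of_int a\<bar> \<le> C * (8 * t\<^sup>2) ^ K / real U ^ Suc m"
        proof (rule IH[of "Q h" "n - h"])
          show "degree (Q h) \<le> Suc m" unfolding Q_def using P by (intro poly_shift_diff) (simp add: M_def)
          show "real U \<le> (8 * t\<^sup>2) * norm (\<Sum>v=1..n-h. ee (poly (Q h) (real v)))" using that by (simp add: H_def T_def)
        qed (use n U t2 in auto)
        moreover have "coeff (Q h) (Suc m) = real M * real h * \<alpha>"
          unfolding Q_def M_def \<alpha>_def using P by (intro poly_shift_diff) (simp add: M_def)
        ultimately show ?thesis by (simp add: Y_def)
      qed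
      then obtain qf where qf: "\<And>h. h \<in> H \<Longrightarrow> 1 \<le> qf h" "\<And>h. h \<in> H \<Longrightarrow> real_of_int (qf h) \<le> Y"
        "\<And>h. h \<in> H \<Longrightarrow> \<exists>a::int. \<bar>of_int (qf h) * (real M * real h * \<alpha>) - of_int a\<bar> \<le> Y / real U ^ Suc m"
        by metis
      \<comment> \<open>Pigeonhole over the at most \<open>Y\<close> possible denominators; a
        proportion \<open>1 / Y\<close> of \<open>H\<close> shares one of them.\<close>
      define B where "B = {1..\<lfloor>Y\<rfloor>}"
      have B: "finite B" "B \<noteq> {}" "real (card B) \<le> Y" using Y by (auto simp: B_def le_floor_iff)
      have "qf \<in> H \<rightarrow> B" using qf by (auto simp: B_def le_floor_iff)
      then obtain q where q: "q \<in> B" "card H \<le> card (qf -` {q} \<inter> H) * card B"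
        using pigeonhole_card[OF _ finH B(1,2), of qf] by blast
      define Hq where "Hq = qf -` {q} \<inter> H"
      have "real (card H) \<le> real (card Hq * card B)" using q(2) unfolding Hq_def by (rule of_nat_mono)
      also have "\<dots> \<le> real (card Hq) * Y" using B(3) by (simp add: mult_left_mono)
      finally have "4 * t\<^sup>2 * real (card H) \<le> 4 * t\<^sup>2 * (real (card Hq) * Y)" using t2 by (intro mult_left_mono) auto
      then have cHq: "real U \<le> 4 * t\<^sup>2 * Y * real (card Hq)" using cardH by (simp add: mult_ac)
      define \<eta> where "\<eta> = Y / real U ^ Suc m"
      have eta0: "\<eta> \<ge> 0" using Y by (simp add: \<eta>_def)
      have "192 * (Y\<^sup>2 * t\<^sup>2) \<le> real U ^ Suc m"
      proof -
        have "real U \<le> real U ^ Suc m" using U by (intro self_le_power) auto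
        then show ?thesis using False Z1 by linarith
      qed
      then have le1: "48 * \<eta> * (4 * t\<^sup>2 * Y) \<le> 1"
        unfolding \<eta>_def using U by (simp add: power2_eq_square mult_ac divide_le_eq)
      have sm: "\<exists>b::int. \<bar>(of_int q * real M * \<alpha>) * real h - of_int b\<bar> \<le> \<eta>" if "h \<in> Hq" for h
        using qf(3)[of h] that by (auto simp: Hq_def \<eta>_def mult_ac)
      have sub: "Hq \<subseteq> {1..U}" using n by (auto simp: Hq_def H_def)
      have pos: "4 * t\<^sup>2 * Y > 0" using t Y by (simp add: zero_less_mult_iff)
      obtain q2 a where q2: "1 \<le> q2" "real_of_int q2 \<le> 24 * (4 * t\<^sup>2 * Y)"
        "\<bar>of_int q2 * (of_int q * real M * \<alpha>) - of_int a\<bar> \<le> \<eta> * (4 * t\<^sup>2 * Y) / real U"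
        using linear_phase_rational[OF U sub cHq sm eta0 le1 pos] by blast
      define q' where "q' = q2 * q * int M"
      have qB: "1 \<le> q" "real_of_int q \<le> Y" using q(1) by (auto simp: B_def le_floor_iff)
      have "1 * 1 * 1 \<le> q2 * q * int M" using q2(1) qB(1) by (intro mult_mono) (auto simp: M_def)
      then have 1: "1 \<le> q'" by (simp add: q'_def)
      have "real_of_int q' \<le> (24 * (4 * t\<^sup>2 * Y)) * Y * real M"
        unfolding q'_def of_int_mult using q2(1,2) qB Y t2 by (intro mult_mono) auto
      also have "\<dots> = 96 * real M * Y\<^sup>2 * t\<^sup>2" by (simp add: power2_eq_square)
      also have "\<dots> \<le> Z" by (simp add: Z_def)
      finally have 2: "real_of_int q' \<le> C' * t ^ K'" using ZZ ZM by linarith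
      have "\<bar>of_int q' * \<alpha> - of_int a\<bar> \<le> \<eta> * (4 * t\<^sup>2 * Y) / real U" using q2(3) by (simp add: q'_def mult_ac)
      also have "\<dots> = 4 * Y\<^sup>2 * t\<^sup>2 / real U ^ M" by (simp add: \<eta>_def M_def power2_eq_square mult_ac)
      also have "\<dots> \<le> Z / real U ^ M" using Z1 yt by (intro divide_right_mono) auto
      also have "\<dots> \<le> C' * t ^ K' / real U ^ M" using ZZ ZM by (intro divide_right_mono) auto
      finally show ?thesis using 1 2 unfolding \<alpha>_def by blast
    qed
  qed
  then show ?case unfolding M_def using C'1 by (intro exI[of _ K'] exI[of _ C']) blast
qed

section \<open>Full numbers\<close>

text \<open>The kernels \<open>w\<close> in \<open>x = u^m w\<close> are the case
  \<open>L = m + 1\<close>. The lower bound \<open>L\<close> is a parameter because sums over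
  kernels are estimated by descending induction on it, starting from \<open>L = 2 * m\<close>, where
  only 1 is left.\<close>

definition kernel_set :: "nat \<Rightarrow> nat \<Rightarrow> nat set" where
  "kernel_set L m = {w. w > 0 \<and> (\<forall>p. prime p \<longrightarrow> p dvd w \<longrightarrow> L \<le> multiplicity p w \<and> multiplicity p w < 2 * m)}"

lemma kernel_set_pos: "w \<in> kernel_set L m \<Longrightarrow> w > 0"
  by (simp add: kernel_set_def)

lemma multiplicity_kernel:
  "w \<in> kernel_set L m \<Longrightarrow> prime p \<Longrightarrow> multiplicity p w = 0 \<or> (L \<le> multiplicity p w \<and> multiplicity p w < 2 * m)"
  by (cases "p dvd w") (auto simp: kernel_set_def not_dvd_imp_multiplicity_0)

lemma multiplicity_prod_over_primes:
  fixes x :: nat and f :: "nat \<Rightarrow> nat"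
  assumes "prime p"
  shows "multiplicity p (\<Prod>q\<in>prime_factors x. q ^ f q) = (if p \<in> prime_factors x then f p else 0)"
  using assms by (subst multiplicity_prod_prime_powers) auto

lemma prime_power_dvd_iff_multiplicity:
  fixes x :: nat
  assumes "prime p" "x > 0"
  shows "p ^ n dvd x \<longleftrightarrow> n \<le> multiplicity p x"
  using assms by (intro power_dvd_iff_le_multiplicity) auto

text \<open>The exponent of each prime splits as \<open>e = m a + e'\<close> with \<open>e' = 0\<close> or \<open>m < e' < 2m\<close>.\<close>
lemma bij_betw_full_decomposition:
  assumes m: "m \<ge> 1"
  shows "bij_betw (\<lambda>(u, w). u ^ m * w) ({0<..} \<times> kernel_set (m + 1) m)
    {x::nat. x > 0 \<and> (\<forall>p. prime p \<longrightarrow> p dvd x \<longrightarrow> p ^ m dvd x)}"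
proof (rule bij_betw_imageI)
  show "inj_on (\<lambda>(u, w). u ^ m * w) ({0<..} \<times> kernel_set (m + 1) m)"
  proof (rule inj_onI, clarsimp)
    fix u w u' w' :: nat
    assume u: "0 < u" "0 < u'" and w: "w \<in> kernel_set (Suc m) m" "w' \<in> kernel_set (Suc m) m" and eq: "u ^ m * w = u' ^ m * w'"
    have "multiplicity p w = multiplicity p w'" if p: "prime p" for p
    proof -
      have "m * multiplicity p u + multiplicity p w = m * multiplicity p u' + multiplicity p w'"
        using arg_cong[OF eq, of "multiplicity p"] p u w
        by (simp add: prime_elem_multiplicity_mult_distrib prime_elem_multiplicity_power_distrib kernel_set_pos)
      then have mods: "multiplicity p w mod m = multiplicity p w' mod m"
        by (metis mod_mult_self4)
      \<comment> \<open>An exponent that is 0 or lies strictly between \<open>m\<close> and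
        \<open>2 m\<close> is determined by its residue modulo \<open>m\<close>; hence
        \<open>w\<close> is determined by the product.\<close>
      have "x mod m = (if x = 0 then 0 else x - m)" "x \<noteq> 0 \<Longrightarrow> x - m > 0" if "x = 0 \<or> (Suc m \<le> x \<and> x < 2 * m)" for x
        using that by (auto simp: le_mod_geq)
      from this[of "multiplicity p w"] this[of "multiplicity p w'"] mods
        multiplicity_kernel[OF w(1) p] multiplicity_kernel[OF w(2) p]
      show ?thesis by (auto split: if_splits)
    qed
    then have ww: "w = w'" by (rule multiplicity_eq_nat[OF kernel_set_pos[OF w(1)] kernel_set_pos[OF w(2)]])
    then have "u ^ m = u' ^ m" using eq kernel_set_pos[OF w(1)] by simp
    then have "u = u'" using m u by (simp add: power_eq_iff_eq_base)
    then show "u = u' \<and> w = w'" using ww by simp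
  qed
  show "(\<lambda>(u, w). u ^ m * w) ` ({0<..} \<times> kernel_set (m + 1) m) = {x::nat. x > 0 \<and> (\<forall>p. prime p \<longrightarrow> p dvd x \<longrightarrow> p ^ m dvd x)}"
  proof (intro equalityI subsetI)
    fix x assume "x \<in> (\<lambda>(u, w). u ^ m * w) ` ({0<..} \<times> kernel_set (m + 1) m)"
    then obtain u w where x: "x = u ^ m * w" "u > 0" "w \<in> kernel_set (m + 1) m" by auto
    have "p ^ m dvd x" if p: "prime p" "p dvd x" for p
    proof (cases "p dvd u")
      case True
      then show ?thesis by (simp add: x(1) dvd_power_same)
    next
      case False
      then have "p dvd w" using p x(1) by (metis prime_dvd_mult_iff prime_dvd_power)
      then have "m \<le> multiplicity p w" using x(3) p by (auto simp: kernel_set_def)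
      then have "p ^ m dvd w" using p x(3) by (subst prime_power_dvd_iff_multiplicity) (auto simp: kernel_set_pos)
      then show ?thesis by (simp add: x(1))
    qed
    then show "x \<in> {x. x > 0 \<and> (\<forall>p. prime p \<longrightarrow> p dvd x \<longrightarrow> p ^ m dvd x)}"
      using x by (auto simp: kernel_set_pos)
  next
    fix x :: nat assume "x \<in> {x. x > 0 \<and> (\<forall>p. prime p \<longrightarrow> p dvd x \<longrightarrow> p ^ m dvd x)}"
    then have x: "x > 0" "\<And>p. prime p \<Longrightarrow> p dvd x \<Longrightarrow> p ^ m dvd x" by auto
    define e where "e p = multiplicity p x" for p
    \<comment> \<open>The exponent left to \<open>w\<close>: 0 if \<open>m\<close> divides
      \<open>n\<close>, otherwise the residue raised by \<open>m\<close>, so that it exceeds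
      \<open>m\<close>. The rest of \<open>n\<close> is a multiple of \<open>m\<close> and goes to
      \<open>u\<close>.\<close>
    define e' where "e' n = (if m dvd n then 0 else m + n mod m)" for n
    define w where "w = (\<Prod>p\<in>prime_factors x. p ^ e' (e p))"
    define u where "u = (\<Prod>p\<in>prime_factors x. p ^ ((e p - e' (e p)) div m))"
    have em: "m \<le> e p" if "p \<in> prime_factors x" for p
      using x that unfolding e_def by (subst prime_power_dvd_iff_multiplicity[symmetric]) (auto simp: prime_factors_dvd)
    have split: "m * ((n - e' n) div m) + e' n = n" if "m \<le> n" for n
    proof (cases "m dvd n")
      case False
      define r where "r = n mod m"
      have "n div m > 0" using that m by (simp add: div_greater_zero_iff)
      then obtain b where b: "n div m = Suc b" by (metis gr0_implies_Suc)
      have "n = m * (n div m) + r" by (simp add: r_def)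
      then have n: "n = m * b + m + r" by (simp add: b)
      have "n - (m + n mod m) = m * b" and "m + n mod m \<le> n" unfolding r_def[symmetric] using n by linarith+
      then show ?thesis using False m by (simp add: e'_def)
    qed (use m in \<open>simp add: e'_def\<close>)
    have pos: "u > 0" "w > 0" unfolding u_def w_def by (auto intro!: prod_pos dest!: in_prime_factors_imp_prime prime_gt_0_nat)
    have "u ^ m * w = x"
    proof -
      have "u ^ m * w = (\<Prod>p\<in>prime_factors x. p ^ (m * ((e p - e' (e p)) div m) + e' (e p)))"
        unfolding u_def w_def prod_power_distrib prod.distrib[symmetric]
        by (intro prod.cong refl) (simp add: power_add power_mult[symmetric] mult.commute)
      also have "\<dots> = (\<Prod>p\<in>prime_factors x. p ^ e p)" by (intro prod.cong refl) (simp add: split em)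
      also have "\<dots> = x" using x(1) unfolding e_def by (simp add: prime_factorization_nat[symmetric])
      finally show ?thesis .
    qed
    moreover have "w \<in> kernel_set (m + 1) m"
    proof -
      have "m + 1 \<le> multiplicity p w \<and> multiplicity p w < 2 * m" if p: "prime p" "p dvd w" for p
      proof -
        have mw: "multiplicity p w = (if p \<in> prime_factors x then e' (e p) else 0)"
          unfolding w_def using p by (intro multiplicity_prod_over_primes)
        have "multiplicity p w > 0" using p pos by (simp add: prime_multiplicity_gt_zero_iff)
        then show ?thesis using m by (auto simp: mw e'_def mod_greater_zero_iff_not_dvd Suc_le_eq split: if_splits)
      qed
      then show ?thesis using pos by (auto simp: kernel_set_def)
    qed
    ultimately show "x \<in> (\<lambda>(u, w). u ^ m * w) ` ({0<..} \<times> kernel_set (m + 1) m)"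
      using pos by (intro image_eqI[of _ _ "(u, w)"]) auto
  qed
qed

lemma squarefree_multiplicity_le_1:
  fixes d :: nat
  assumes "squarefree d" "prime p"
  shows "multiplicity p d \<le> 1"
proof -
  have "d \<noteq> 0" using assms(1) by (metis not_squarefree_0)
  then show ?thesis using assms squarefree_factorial_semiring''[of d] by blast
qed

lemma squarefree_dvdI:
  fixes g y :: nat
  assumes g: "squarefree g" and pr: "\<And>p. prime p \<Longrightarrow> p dvd g \<Longrightarrow> p dvd y"
  shows "g dvd y"
proof (cases "y = 0")
  case False
  have g0: "g \<noteq> 0" using g by (metis not_squarefree_0)
  show ?thesis
  proof (rule multiplicity_le_imp_dvd[OF g0])
    fix p :: nat assume p: "prime p"
    show "multiplicity p g \<le> multiplicity p y"
    proof (cases "p dvd g")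
      case True
      then have "multiplicity p y > 0" using pr[OF p] p False by (subst prime_multiplicity_gt_zero_iff) auto
      then show ?thesis using squarefree_multiplicity_le_1[OF g p] by linarith
    qed (simp add: not_dvd_imp_multiplicity_0)
  qed
qed simp

text \<open>For square-free \<open>d\<close> the quotient by \<open>gcd d w\<close> is coprime to
  \<open>w\<close>, and a square-free number dividing \<open>u ^ m\<close> divides \<open>u\<close>.
  Thus divisibility by \<open>d\<close> becomes a linear condition on \<open>u\<close>.\<close>

lemma squarefree_dvd_mult_iff:
  fixes d u w :: nat
  assumes d: "squarefree d" and m: "m \<ge> 1"
  shows "d dvd u ^ m * w \<longleftrightarrow> d div gcd d w dvd u"
proof -
  have d0: "d > 0" using d by (metis not_squarefree_0 gr0I)
  define g where "g = gcd d w"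
  define d' where "d' = d div g"
  have g0: "g > 0" using d0 by (simp add: g_def)
  have dd: "d = d' * g" by (simp add: d'_def g_def)
  have sq: "squarefree d'" using d dd by (metis dvd_triv_left squarefree_mono)
  show ?thesis unfolding g_def[symmetric] d'_def[symmetric]
  proof
    assume "d dvd u ^ m * w"
    have "coprime d' w"
    proof (rule ccontr)
      assume "\<not> coprime d' w"
      then obtain p where p: "prime p" "p dvd d'" "p dvd w" using prime_factor_nat[of "gcd d' w"] by (auto simp: coprime_iff_gcd_eq_1)
      have "p dvd d" using p(2) dd by (metis dvd_mult2)
      then have "p dvd g" unfolding g_def using p(3) by (rule gcd_greatest)
      then have "p * p dvd d' * g" using p(2) by (intro mult_dvd_mono)
      then have "p ^ 2 dvd d" by (simp only: dd[symmetric] power2_eq_square)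
      then show False using d p(1) by (auto simp: squarefree_def)
    qed
    moreover have "d' dvd u ^ m * w" using \<open>d dvd u ^ m * w\<close> dd by (metis dvd_mult_left)
    ultimately have "d' dvd u ^ m" by (simp add: coprime_dvd_mult_left_iff)
    then have "p dvd u" if "prime p" "p dvd d'" for p using that by (meson dvd_trans prime_dvd_power)
    then show "d' dvd u" by (rule squarefree_dvdI[OF sq])
  next
    assume "d' dvd u"
    moreover have "u dvd u ^ m" using m by (simp add: dvd_power)
    ultimately have "d' dvd u ^ m" by (rule dvd_trans)
    moreover have "g dvd w" by (simp add: g_def)
    ultimately show "d dvd u ^ m * w" unfolding dd by (rule mult_dvd_mono)
  qed
qed

section \<open>Divisor bounds and sums over kernels\<close>

definition tau :: "nat \<Rightarrow> nat" where
  "tau d = card {g. g dvd d}"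

text \<open>Elements above \<open>A powr (1 / \<epsilon>)\<close> pay for their factor
  \<open>A\<close> by themselves; the others are at most \<open>N + 1\<close> in number and give the
  constant.\<close>

lemma power_card_le_prod_primes:
  fixes A \<epsilon> :: real
  assumes A: "A \<ge> 1" and eps: "\<epsilon> > 0"
  obtains C where "C \<ge> 1" "\<And>S. finite S \<Longrightarrow> (\<And>p. p \<in> S \<Longrightarrow> p \<ge> 2) \<Longrightarrow> A ^ card S \<le> C * real (\<Prod>S) powr \<epsilon>"
proof
  define N where "N = nat \<lceil>A powr (1 / \<epsilon>)\<rceil>"
  show "A ^ Suc N \<ge> 1" by (rule one_le_power[OF A])
  fix S :: "nat set"
  assume S: "finite S" "\<And>p. p \<in> S \<Longrightarrow> p \<ge> 2"
  define S1 where "S1 = {p\<in>S. p \<le> N}"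
  define S2 where "S2 = {p\<in>S. p > N}"
  have un: "S = S1 \<union> S2" "S1 \<inter> S2 = {}" "finite S1" "finite S2" using S by (auto simp: S1_def S2_def)
  have "card S1 \<le> card {..N}" by (intro card_mono) (auto simp: S1_def)
  then have 1: "A ^ card S1 \<le> A ^ Suc N" using A by (intro power_increasing) auto
  have "A ^ card S2 = (\<Prod>p\<in>S2. A)" by simp
  also have "\<dots> \<le> (\<Prod>p\<in>S2. real p powr \<epsilon>)"
  proof (intro prod_mono conjI)
    fix p assume "p \<in> S2"
    then have "A powr (1 / \<epsilon>) \<le> real p" unfolding S2_def N_def by (simp add: zless_nat_eq_int_zless ceiling_less_iff nat_less_iff) linarith
    then have "(A powr (1 / \<epsilon>)) powr \<epsilon> \<le> real p powr \<epsilon>" using eps A by (intro powr_mono2) auto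
    then show "A \<le> real p powr \<epsilon>" using A eps by (simp add: powr_powr)
  qed (use A in auto)
  also have "\<dots> \<le> (\<Prod>p\<in>S1. real p powr \<epsilon>) * (\<Prod>p\<in>S2. real p powr \<epsilon>)"
  proof -
    have "1 \<le> (\<Prod>p\<in>S1. real p powr \<epsilon>)"
    proof (rule prod_ge_1)
      fix p assume "p \<in> S1"
      then have "p \<ge> 2" using S(2) by (simp add: S1_def)
      then show "1 \<le> real p powr \<epsilon>" using eps by (intro ge_one_powr_ge_zero) auto
    qed
    from mult_right_mono[OF this, of "\<Prod>p\<in>S2. real p powr \<epsilon>"] show ?thesis by (simp add: prod_nonneg)
  qed
  also have "\<dots> = (\<Prod>p\<in>S. real p powr \<epsilon>)" using un by (simp add: prod.union_disjoint)
  also have "\<dots> = real (\<Prod>S) powr \<epsilon>"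
    using S(1) by (induction S rule: finite_induct) (simp_all add: powr_mult)
  finally have 2: "A ^ card S2 \<le> real (\<Prod>S) powr \<epsilon>" .
  have "A ^ card S = A ^ card S1 * A ^ card S2" using un by (simp add: card_Un_disjoint power_add)
  also have "\<dots> \<le> A ^ Suc N * real (\<Prod>S) powr \<epsilon>" using 1 2 A by (intro mult_mono) auto
  finally show "A ^ card S \<le> A ^ Suc N * real (\<Prod>S) powr \<epsilon>" .
qed

lemma squarefree_prod_prime_factors:
  fixes d :: nat
  assumes "squarefree d"
  shows "\<Prod>(prime_factors d) = d"
proof -
  have d0: "d > 0" using assms by (metis not_squarefree_0 gr0I)
  have "d = (\<Prod>p\<in>prime_factors d. p ^ multiplicity p d)" using d0 by (simp add: prime_factorization_nat)
  also have "\<dots> = (\<Prod>p\<in>prime_factors d. p)"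
  proof (rule prod.cong[OF refl])
    fix p assume p: "p \<in> prime_factors d"
    then have p': "prime p" "p dvd d" by auto
    then have "multiplicity p d > 0" using d0 by (subst prime_multiplicity_gt_zero_iff) auto
    then have "multiplicity p d = 1" using squarefree_multiplicity_le_1[OF assms p'(1)] by linarith
    then show "p ^ multiplicity p d = p" by simp
  qed
  finally show ?thesis by simp
qed

lemma tau_le_squarefree:
  assumes "squarefree d"
  shows "tau d \<le> 2 ^ card (prime_factors d)"
proof -
  have d0: "d > 0" using assms by (metis not_squarefree_0 gr0I)
  have "inj_on prime_factors {g. g dvd d}"
  proof (rule inj_onI, clarsimp)
    fix g h assume gh: "g dvd d" "h dvd d" "prime_factors g = prime_factors h"
    have "squarefree g" "squarefree h" using gh assms squarefree_mono by blast+
    then show "g = h" using gh(3) squarefree_prod_prime_factors by metis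
  qed
  then have "tau d = card (prime_factors ` {g. g dvd d})" unfolding tau_def by (simp add: card_image)
  also have "\<dots> \<le> card (Pow (prime_factors d))"
  proof (rule card_mono)
    have "prime_factors g \<subseteq> prime_factors d" if "g dvd d" for g using that d0 by (intro dvd_prime_factors) auto
    then show "prime_factors ` {g. g dvd d} \<subseteq> Pow (prime_factors d)" by blast
  qed simp
  finally show ?thesis by (simp add: card_Pow)
qed

lemma tau_power_le:
  assumes eps: "\<epsilon> > 0"
  obtains C where "C \<ge> 1" "\<And>d. squarefree d \<Longrightarrow> real (tau d) ^ K \<le> C * real d powr \<epsilon>"
proof -
  obtain C where C: "C \<ge> 1" "\<And>S. finite S \<Longrightarrow> (\<And>p. p \<in> S \<Longrightarrow> p \<ge> 2) \<Longrightarrow> (2 ^ K) ^ card S \<le> C * real (\<Prod>S) powr \<epsilon>"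
    using power_card_le_prod_primes[of "2 ^ K" \<epsilon>] eps by (metis one_le_numeral one_le_power)
  show ?thesis
  proof (rule that[OF C(1)])
    fix d :: nat assume d: "squarefree d"
    have "real (tau d) ^ K \<le> (2 ^ card (prime_factors d)) ^ K"
      using tau_le_squarefree[OF d] by (intro power_mono) (metis of_nat_le_iff of_nat_numeral of_nat_power, simp)
    also have "\<dots> = (2 ^ K) ^ card (prime_factors d)" by (simp add: power_mult[symmetric] mult.commute)
    also have "\<dots> \<le> C * real (\<Prod>(prime_factors d)) powr \<epsilon>"
      by (intro C(2)) (auto dest!: in_prime_factors_imp_prime prime_ge_2_nat)
    finally show "real (tau d) ^ K \<le> C * real d powr \<epsilon>" using squarefree_prod_prime_factors[OF d] by simp
  qed
qed

text \<open>The term with \<open>g = gcd a d\<close> is dominated by the sum over all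
  \<open>g\<close> dividing both \<open>d\<close> and \<open>a\<close>. For each \<open>g\<close>
  the substitution \<open>a = g b\<close> leaves the factor
  \<open>g powr (\<kappa> - \<tau>) \<le> 1\<close> and a convergent sum.\<close>

lemma sum_powr_gcd_le:
  fixes \<tau> \<kappa> :: real
  assumes tau: "\<tau> > 1" and kap: "0 \<le> \<kappa>" "\<kappa> \<le> 1"
  obtains C where "C \<ge> 1" "\<And>F d. finite F \<Longrightarrow> 0 \<notin> F \<Longrightarrow> d > 0 \<Longrightarrow>
     (\<Sum>a\<in>F. real a powr (- \<tau>) * real (gcd a d) powr \<kappa>) \<le> C * real (tau d)"
proof -
  have sm: "summable (\<lambda>n. real n powr (- \<tau>))" using tau by (simp add: summable_real_powr_iff)
  define Z where "Z = (\<Sum>n. real n powr (- \<tau>))"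
  have Zb: "(\<Sum>a\<in>F. real a powr (- \<tau>)) \<le> Z" if "finite F" for F
    unfolding Z_def by (rule sum_le_suminf[OF sm that]) auto
  show ?thesis
  proof (rule that[of "max Z 1"])
    fix F :: "nat set" and d :: nat
    assume F: "finite F" "0 \<notin> F" and d: "d > 0"
    have "(\<Sum>a\<in>F. real a powr (- \<tau>) * real (gcd a d) powr \<kappa>) \<le> (\<Sum>a\<in>F. \<Sum>g\<in>{g. g dvd d}. if g dvd a then real a powr (- \<tau>) * real g powr \<kappa> else 0)"
    proof (rule sum_mono)
      fix a assume "a \<in> F"
      have "(if gcd a d dvd a then real a powr (- \<tau>) * real (gcd a d) powr \<kappa> else 0) \<le> (\<Sum>g\<in>{g. g dvd d}. if g dvd a then real a powr (- \<tau>) * real g powr \<kappa> else 0)"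
        using d by (intro member_le_sum) auto
      then show "real a powr (- \<tau>) * real (gcd a d) powr \<kappa> \<le> (\<Sum>g\<in>{g. g dvd d}. if g dvd a then real a powr (- \<tau>) * real g powr \<kappa> else 0)" by simp
    qed
    also have "\<dots> = (\<Sum>g\<in>{g. g dvd d}. \<Sum>a\<in>F. if g dvd a then real a powr (- \<tau>) * real g powr \<kappa> else 0)"
      by (rule sum.swap)
    also have "\<dots> \<le> (\<Sum>g\<in>{g. g dvd d}. max Z 1)"
    proof (rule sum_mono)
      fix g assume "g \<in> {g. g dvd d}"
      then have g: "g > 0" using d by (auto intro: Nat.gr0I)
      have "(\<Sum>a\<in>F. if g dvd a then real a powr (- \<tau>) * real g powr \<kappa> else 0) = (\<Sum>a\<in>{a\<in>F. g dvd a}. real a powr (- \<tau>) * real g powr \<kappa>)"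
        using F by (simp add: sum.inter_filter)
      also have "\<dots> = (\<Sum>a\<in>{a\<in>F. g dvd a}. real g powr (\<kappa> - \<tau>) * real (a div g) powr (- \<tau>))"
      proof (intro sum.cong refl)
        fix a assume "a \<in> {a\<in>F. g dvd a}"
        then have "real a = real g * real (a div g)" by (metis dvd_mult_div_cancel mem_Collect_eq of_nat_mult)
        then have "real a powr (- \<tau>) = real g powr (- \<tau>) * real (a div g) powr (- \<tau>)" by (simp add: powr_mult)
        then show "real a powr (- \<tau>) * real g powr \<kappa> = real g powr (\<kappa> - \<tau>) * real (a div g) powr (- \<tau>)"
          by (simp add: powr_diff powr_minus field_simps)
      qed
      also have "\<dots> = real g powr (\<kappa> - \<tau>) * (\<Sum>b\<in>(\<lambda>a. a div g) ` {a\<in>F. g dvd a}. real b powr (- \<tau>))"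
      proof -
        have "inj_on (\<lambda>a. a div g) {a\<in>F. g dvd a}" by (rule inj_onI) (metis (no_types, lifting) dvd_mult_div_cancel mem_Collect_eq)
        then show ?thesis by (simp add: sum.reindex sum_distrib_left)
      qed
      also have "\<dots> \<le> 1 * max Z 1"
      proof (intro mult_mono)
        have "real g powr (\<kappa> - \<tau>) \<le> real g powr 0" using g tau kap by (intro powr_mono) auto
        then show "real g powr (\<kappa> - \<tau>) \<le> 1" using g by simp
        show "(\<Sum>b\<in>(\<lambda>a. a div g) ` {a\<in>F. g dvd a}. real b powr (- \<tau>)) \<le> max Z 1"
          using Zb[of "(\<lambda>a. a div g) ` {a\<in>F. g dvd a}"] F by simp
      qed (auto intro!: sum_nonneg)
      finally show "(\<Sum>a\<in>F. if g dvd a then real a powr (- \<tau>) * real g powr \<kappa> else 0) \<le> max Z 1" by simp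
    qed
    also have "\<dots> = max Z 1 * real (tau d)" by (simp add: tau_def)
    finally show "(\<Sum>a\<in>F. real a powr (- \<tau>) * real (gcd a d) powr \<kappa>) \<le> max Z 1 * real (tau d)" .
  qed simp
qed

lemma gcd_power_mult_squarefree_le:
  fixes a b d :: nat
  assumes "squarefree d" "L \<ge> 1"
  shows "gcd (a ^ L * b) d \<le> gcd a d * gcd b d"
proof -
  have d0: "d > 0" using assms by (metis not_squarefree_0 gr0I)
  define g where "g = gcd (a ^ L * b) d"
  have g: "g dvd d" "squarefree g" using assms by (auto simp: g_def intro: squarefree_mono)
  have "p dvd gcd a d * gcd b d" if "prime p" "p dvd g" for p
  proof -
    have p: "p dvd a ^ L * b" "p dvd d" using that by (auto simp: g_def)
    then have "p dvd a \<or> p dvd b" using that(1) by (metis prime_dvd_mult_iff prime_dvd_power)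
    then show ?thesis using p(2) by auto
  qed
  then have "g dvd gcd a d * gcd b d" by (rule squarefree_dvdI[OF g(2)])
  then show ?thesis unfolding g_def[symmetric] using d0 by (intro dvd_imp_le) auto
qed

text \<open>The primes of exponent exactly \<open>L\<close> are collected into \<open>a\<close>, so
  that \<open>w = a^L w'\<close> with all exponents of \<open>w'\<close> above \<open>L\<close>. The
  sum over \<open>a\<close> converges since \<open>\<sigma> L > 1\<close>, and each value of
  \<open>L\<close> costs one factor \<open>tau d\<close>.\<close>

lemma sum_kernel_powr_gcd_le:
  fixes \<sigma> \<kappa> :: real
  assumes sig: "\<sigma> * real L0 > 1" "\<sigma> > 0" and kap: "0 \<le> \<kappa>" "\<kappa> \<le> 1" and L: "L0 \<le> L" "L \<le> 2 * m"
  shows "\<exists>C\<ge>1. \<forall>F d. finite F \<longrightarrow> F \<subseteq> kernel_set L m \<longrightarrow> squarefree d \<longrightarrow>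
     (\<Sum>w\<in>F. real w powr (- \<sigma>) * real (gcd w d) powr \<kappa>) \<le> C * real (tau d) ^ (2 * m - L)"
  using L(2,1)
proof (induction L rule: inc_induct)
  case base
  have "kernel_set (2 * m) m \<subseteq> {1}"
  proof
    fix w assume w: "w \<in> kernel_set (2 * m) m"
    show "w \<in> {1}"
    proof (rule ccontr)
      assume "w \<notin> {1}"
      then obtain p where "prime p" "p dvd w" using prime_factor_nat by auto
      then show False using w by (auto simp: kernel_set_def)
    qed
  qed
  then have "(\<Sum>w\<in>F. real w powr (- \<sigma>) * real (gcd w d) powr \<kappa>) \<le> 1" if "F \<subseteq> kernel_set (2 * m) m" for F d
  proof -
    have "F = {} \<or> F = {1}" using that \<open>kernel_set (2 * m) m \<subseteq> {1}\<close> by blast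
    then show ?thesis by auto
  qed
  then show ?case by (intro exI[of _ 1]) auto
next
  case (step L)
  then obtain C where C: "C \<ge> 1" and IH: "\<And>F d. finite F \<Longrightarrow> F \<subseteq> kernel_set (Suc L) m \<Longrightarrow> squarefree d \<Longrightarrow>
     (\<Sum>w\<in>F. real w powr (- \<sigma>) * real (gcd w d) powr \<kappa>) \<le> C * real (tau d) ^ (2 * m - Suc L)" by auto
  have L1: "L \<ge> 1"
  proof (rule ccontr)
    assume "\<not> L \<ge> 1"
    then have "L0 = 0" using step.prems by simp
    then show False using sig by simp
  qed
  have "\<sigma> * real L \<ge> \<sigma> * real L0" using step.prems sig by (intro mult_left_mono) auto
  then have sL: "\<sigma> * real L > 1" using sig(1) by linarith
  obtain C1 where C1: "C1 \<ge> 1" "\<And>F d. finite F \<Longrightarrow> 0 \<notin> F \<Longrightarrow> d > 0 \<Longrightarrow>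
     (\<Sum>a\<in>F. real a powr (- (\<sigma> * real L)) * real (gcd a d) powr \<kappa>) \<le> C1 * real (tau d)"
    by (rule sum_powr_gcd_le[OF sL kap]) blast
  \<comment> \<open>The pair \<open>(af w, wf w)\<close> determines \<open>w\<close>, so the sum
    over \<open>F\<close> is at most a product of two sums; \<open>gcd w d\<close> is
    submultiplicative along it because \<open>d\<close> is square-free.\<close>
  define af where "af w = (\<Prod>p\<in>{p\<in>prime_factors w. multiplicity p w = L}. p)" for w :: nat
  define wf where "wf w = (\<Prod>p\<in>{p\<in>prime_factors w. multiplicity p w \<noteq> L}. p ^ multiplicity p w)" for w :: nat
  have dec: "w = af w ^ L * wf w" if "w > 0" for w
  proof -
    have "w = (\<Prod>p\<in>prime_factors w. p ^ multiplicity p w)" using that by (simp add: prime_factorization_nat)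
    also have "prime_factors w = {p\<in>prime_factors w. multiplicity p w = L} \<union> {p\<in>prime_factors w. multiplicity p w \<noteq> L}" by auto
    also have "(\<Prod>p\<in>\<dots>. p ^ multiplicity p w) = (\<Prod>p\<in>{p\<in>prime_factors w. multiplicity p w = L}. p ^ multiplicity p w) * wf w"
      unfolding wf_def by (intro prod.union_disjoint) auto
    also have "(\<Prod>p\<in>{p\<in>prime_factors w. multiplicity p w = L}. p ^ multiplicity p w) = af w ^ L"
      unfolding af_def prod_power_distrib by (intro prod.cong) auto
    finally show ?thesis .
  qed
  have wf0: "wf w > 0" for w unfolding wf_def by (intro prod_pos) (auto dest!: in_prime_factors_imp_prime prime_gt_0_nat)
  have af0: "af w > 0" for w unfolding af_def by (intro prod_pos) (auto dest!: in_prime_factors_imp_prime prime_gt_0_nat)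
  have wfT: "wf w \<in> kernel_set (Suc L) m" if w: "w \<in> kernel_set L m" for w
  proof -
    have "Suc L \<le> multiplicity p (wf w) \<and> multiplicity p (wf w) < 2 * m" if p: "prime p" "p dvd wf w" for p
    proof -
      have "multiplicity p (wf w) = (if p \<in> {p\<in>prime_factors w. multiplicity p w \<noteq> L} then multiplicity p w else 0)"
        unfolding wf_def using p by (subst multiplicity_prod_prime_powers) auto
      moreover have "multiplicity p (wf w) > 0" using p wf0 by (simp add: prime_multiplicity_gt_zero_iff)
      ultimately show ?thesis using w p by (auto simp: kernel_set_def prime_factors_dvd split: if_splits)
    qed
    then show ?thesis using wf0 by (auto simp: kernel_set_def)
  qed
  have "(\<Sum>w\<in>F. real w powr (- \<sigma>) * real (gcd w d) powr \<kappa>) \<le> (C1 * C) * real (tau d) ^ (2 * m - L)"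
    if F: "finite F" "F \<subseteq> kernel_set L m" and d: "squarefree d" for F d
  proof -
    have d0: "d > 0" using d by (metis not_squarefree_0 gr0I)
    define g where "g a = real a powr (- (\<sigma> * real L)) * real (gcd a d) powr \<kappa>" for a :: nat
    define h where "h w = real w powr (- \<sigma>) * real (gcd w d) powr \<kappa>" for w :: nat
    have gh0: "g a \<ge> 0" "h a \<ge> 0" for a by (simp_all add: g_def h_def)
    have "(\<Sum>w\<in>F. h w) \<le> (\<Sum>w\<in>F. g (af w) * h (wf w))"
    proof (rule sum_mono)
      fix w assume "w \<in> F"
      then have w: "w = af w ^ L * wf w" using dec F by (auto simp: kernel_set_def)
      have "real w powr (- \<sigma>) = real (af w ^ L * wf w) powr (- \<sigma>)" using w by simp
      also have "\<dots> = real (af w) powr (- (\<sigma> * real L)) * real (wf w) powr (- \<sigma>)"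
        using af0[of w] by (simp add: powr_mult powr_powr mult.commute flip: powr_realpow)
      finally have 1: "real w powr (- \<sigma>) = real (af w) powr (- (\<sigma> * real L)) * real (wf w) powr (- \<sigma>)" .
      have "real (gcd w d) \<le> real (gcd (af w) d * gcd (wf w) d)"
        using gcd_power_mult_squarefree_le[OF d L1, of "af w" "wf w"] w by (metis of_nat_le_iff)
      then have "real (gcd w d) powr \<kappa> \<le> real (gcd (af w) d * gcd (wf w) d) powr \<kappa>" using kap by (intro powr_mono2) auto
      then have 2: "real (gcd w d) powr \<kappa> \<le> real (gcd (af w) d) powr \<kappa> * real (gcd (wf w) d) powr \<kappa>" by (simp add: powr_mult)
      have "h w \<le> (real (af w) powr (- (\<sigma> * real L)) * real (wf w) powr (- \<sigma>)) * (real (gcd (af w) d) powr \<kappa> * real (gcd (wf w) d) powr \<kappa>)"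
        unfolding h_def 1 using 2 by (intro mult_left_mono) auto
      then show "h w \<le> g (af w) * h (wf w)" by (simp add: g_def h_def mult_ac)
    qed
    also have "\<dots> = (\<Sum>(a, b)\<in>(\<lambda>w. (af w, wf w)) ` F. g a * h b)"
    proof -
      have "inj_on (\<lambda>w. (af w, wf w)) F"
      proof (rule inj_onI)
        fix w w' assume ww: "w \<in> F" "w' \<in> F" "(af w, wf w) = (af w', wf w')"
        have "w > 0" "w' > 0" using ww F kernel_set_pos by blast+
        then show "w = w'" using dec[of w] dec[of w'] ww(3) by simp
      qed
      then show ?thesis by (simp add: sum.reindex)
    qed
    also have "\<dots> \<le> (\<Sum>(a, b)\<in>af ` F \<times> wf ` F. g a * h b)"
      using F gh0 by (intro sum_mono2) (auto intro!: mult_nonneg_nonneg)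
    also have "\<dots> = (\<Sum>a\<in>af ` F. g a) * (\<Sum>b\<in>wf ` F. h b)" by (simp add: sum_product sum.cartesian_product)
    also have "\<dots> \<le> (C1 * real (tau d)) * (C * real (tau d) ^ (2 * m - Suc L))"
    proof (intro mult_mono)
      show "(\<Sum>a\<in>af ` F. g a) \<le> C1 * real (tau d)"
        unfolding g_def
      proof (rule C1(2))
        show "0 \<notin> af ` F" using af0 by (metis imageE less_irrefl)
      qed (use F d0 in auto)
      show "(\<Sum>b\<in>wf ` F. h b) \<le> C * real (tau d) ^ (2 * m - Suc L)"
        unfolding h_def using F wfT d by (intro IH) auto
    qed (use C1 gh0 in \<open>auto intro!: sum_nonneg\<close>)
    also have "\<dots> = (C1 * C) * (real (tau d) * real (tau d) ^ (2 * m - Suc L))" by simp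
    also have "real (tau d) * real (tau d) ^ (2 * m - Suc L) = real (tau d) ^ (2 * m - L)"
      using step.hyps by (simp flip: power_Suc add: Suc_diff_Suc)
    finally show ?thesis by (simp add: h_def)
  qed
  moreover have "C1 * C \<ge> 1" using C C1(1) by (metis mult_mono' mult_1 zero_le_one)
  ultimately show ?case by blast
qed

section \<open>Exponential sums over full numbers\<close>

definition full_upto :: "nat \<Rightarrow> nat \<Rightarrow> nat \<Rightarrow> nat set" where
  "full_upto m d B = {x. 0 < x \<and> x \<le> B \<and> (\<forall>p. prime p \<longrightarrow> p dvd x \<longrightarrow> p ^ m dvd x) \<and> d dvd x}"

lemma finite_full_upto [simp]: "finite (full_upto m d B)"
  by (rule finite_subset[of _ "{..B}"]) (auto simp: full_upto_def)

definition kernels :: "nat \<Rightarrow> nat \<Rightarrow> nat set" where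
  "kernels m B = {w \<in> kernel_set (m + 1) m. w \<le> B}"

lemma finite_kernels [simp]: "finite (kernels m B)"
  by (rule finite_subset[of _ "{..B}"]) (auto simp: kernels_def)

lemma kernels_pos: "w \<in> kernels m B \<Longrightarrow> w > 0"
  by (auto simp: kernels_def kernel_set_pos)

text \<open>For square-free \<open>d\<close> this is the number that \<open>u\<close> must be
  divisible by in order that \<open>d\<close> divides \<open>u ^ m * w\<close>.\<close>

definition cofactor :: "nat \<Rightarrow> nat \<Rightarrow> nat" where
  "cofactor d w = d div gcd d w"

lemma cofactor_real: "d > 0 \<Longrightarrow> real (cofactor d w) = real d / real (gcd w d)"
  by (simp add: cofactor_def real_of_nat_div gcd.commute)

lemma cofactor_pos: "d > 0 \<Longrightarrow> cofactor d w > 0"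
  by (metis cofactor_def div_greater_zero_iff gcd_le1_nat gcd_pos_nat less_not_refl2)

text \<open>The number of \<open>u \<ge> 1\<close> with
  \<open>(cofactor d w * u) ^ m * w \<le> B\<close>, written as the integer part of a real root so
  that its size can be read off.\<close>

definition ucut :: "nat \<Rightarrow> nat \<Rightarrow> nat \<Rightarrow> nat \<Rightarrow> nat" where
  "ucut m d B w = nat \<lfloor>(real B / real w) powr (1 / real m) / real (cofactor d w)\<rfloor>"

lemma le_powr_inverse_iff:
  fixes x y :: real
  assumes "x \<ge> 0" "y \<ge> 0" "m \<ge> 1"
  shows "x \<le> y powr (1 / real m) \<longleftrightarrow> x ^ m \<le> y"
proof (cases "y = 0")
  case True
  then show ?thesis using assms by (cases "x = 0") (auto simp: power_0_left not_le)
next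
  case False
  have "(y powr (1 / real m)) ^ m = y" using assms False by (simp add: powr_powr flip: powr_realpow)
  then show ?thesis using assms power_mono_iff[of x "y powr (1 / real m)" m] by auto
qed

lemma le_ucut_iff:
  assumes "d > 0" "w > 0" "m \<ge> 1"
  shows "u \<le> ucut m d B w \<longleftrightarrow> (cofactor d w * u) ^ m * w \<le> B"
proof -
  have e: "real (cofactor d w) > 0" using cofactor_pos[OF assms(1)] by simp
  have "u \<le> ucut m d B w \<longleftrightarrow> real u \<le> (real B / real w) powr (1 / real m) / real (cofactor d w)"
    unfolding ucut_def using e by (subst le_nat_iff) (auto simp: le_floor_iff)
  also have "\<dots> \<longleftrightarrow> real (cofactor d w * u) \<le> (real B / real w) powr (1 / real m)"
    using e by (simp add: pos_le_divide_eq mult.commute)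
  also have "\<dots> \<longleftrightarrow> real (cofactor d w * u) ^ m \<le> real B / real w"
    using assms by (intro le_powr_inverse_iff) auto
  also have "\<dots> \<longleftrightarrow> real ((cofactor d w * u) ^ m * w) \<le> real B"
    using assms by (simp add: pos_le_divide_eq)
  finally show ?thesis by (simp only: of_nat_le_iff)
qed

lemma ucut_le: "real (ucut m d B w) \<le> (real B / real w) powr (1 / real m) / real (cofactor d w)"
  unfolding ucut_def by (intro of_nat_floor) simp

lemma ucut_ge: "(real B / real w) powr (1 / real m) / real (cofactor d w) - 1 \<le> real (ucut m d B w)"
proof -
  have "0 \<le> (real B / real w) powr (1 / real m) / real (cofactor d w)" by simp
  then show ?thesis unfolding ucut_def by linarith
qed

lemma sum_full_upto:
  fixes f :: "nat \<Rightarrow> 'a :: comm_monoid_add"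
  assumes m: "m \<ge> 1" and d: "squarefree d"
  shows "(\<Sum>x\<in>full_upto m d B. f x) = (\<Sum>w\<in>kernels m B. \<Sum>u\<in>{1..ucut m d B w}. f ((cofactor d w * u) ^ m * w))"
proof -
  have d0: "d > 0" using d by (metis not_squarefree_0 gr0I)
  define S where "S = Sigma (kernels m B) (\<lambda>w. {1..ucut m d B w})"
  define g where "g = (\<lambda>(w, u). (cofactor d w * u) ^ m * w)"
  note bij = bij_betw_full_decomposition[OF m]
  have inj: "inj_on g S"
  proof (rule inj_onI, clarsimp simp: S_def g_def)
    fix w u w' u'
    assume w: "w \<in> kernels m B" "w' \<in> kernels m B" and u: "Suc 0 \<le> u" "Suc 0 \<le> u'"
      and eq: "(cofactor d w * u) ^ m * w = (cofactor d w' * u') ^ m * w'"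
    have "(cofactor d w * u, w) = (cofactor d w' * u', w')"
      using bij_betw_imp_inj_on[OF bij] by (rule inj_onD) (use w u eq cofactor_pos[OF d0] in \<open>auto simp: kernels_def\<close>)
    then show "w = w' \<and> u = u'" using cofactor_pos[OF d0, of w'] by auto
  qed
  have "g ` S = full_upto m d B"
  proof (intro equalityI subsetI)
    fix x assume "x \<in> g ` S"
    then obtain w u where x: "w \<in> kernels m B" "1 \<le> u" "u \<le> ucut m d B w" "x = (cofactor d w * u) ^ m * w"
      by (auto simp: S_def g_def)
    have "(\<lambda>(u, w). u ^ m * w) (cofactor d w * u, w) \<in> {x. x > 0 \<and> (\<forall>p. prime p \<longrightarrow> p dvd x \<longrightarrow> p ^ m dvd x)}"
      using bij_betw_apply[OF bij, of "(cofactor d w * u, w)"] x cofactor_pos[OF d0] by (auto simp: kernels_def)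
    moreover have "d dvd x" unfolding x(4) squarefree_dvd_mult_iff[OF d m] by (simp add: cofactor_def)
    moreover have "x \<le> B" using x le_ucut_iff[OF d0 kernels_pos[OF x(1)] m] by simp
    ultimately show "x \<in> full_upto m d B" using x(4) by (simp add: full_upto_def)
  next
    fix x assume x: "x \<in> full_upto m d B"
    then have "x \<in> (\<lambda>(u, w). u ^ m * w) ` ({0<..} \<times> kernel_set (m + 1) m)"
      using bij_betw_imp_surj_on[OF bij] by (simp add: full_upto_def)
    then obtain u' w where w: "u' > 0" "w \<in> kernel_set (m + 1) m" "x = u' ^ m * w" by auto
    have "cofactor d w dvd u'" using x squarefree_dvd_mult_iff[OF d m, of u' w] w(3) by (simp add: full_upto_def cofactor_def)
    then obtain u where u: "u' = cofactor d w * u" by blast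
    have "w \<le> x" using w by simp
    moreover have "x \<le> B" using x by (simp add: full_upto_def)
    ultimately have "w \<le> B" by (rule order.trans)
    then have wk: "w \<in> kernels m B" using w(2) by (simp add: kernels_def)
    moreover have "u \<le> ucut m d B w" using le_ucut_iff[OF d0 kernels_pos[OF wk] m] x w(3) u by (simp add: full_upto_def)
    moreover have "1 \<le> u" using u w(1) by (cases u) auto
    ultimately show "x \<in> g ` S" using w(3) u by (intro image_eqI[of _ _ "(w, u)"]) (auto simp: S_def g_def)
  qed
  then have "(\<Sum>x\<in>full_upto m d B. f x) = (\<Sum>z\<in>S. f (g z))" using sum.reindex[OF inj, of f] by simp
  also have "\<dots> = (\<Sum>w\<in>kernels m B. \<Sum>u\<in>{1..ucut m d B w}. f ((cofactor d w * u) ^ m * w))"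
    unfolding S_def g_def by (subst sum.Sigma) (auto simp: case_prod_unfold)
  finally show ?thesis .
qed

lemma sum_kernels_powr_gcd:
  assumes m: "m \<ge> 1" and sig: "\<sigma> > 1 / real (m + 1)" and kap: "0 \<le> \<kappa>" "\<kappa> \<le> 1"
  obtains C where "C \<ge> 1" "\<And>B d. squarefree d \<Longrightarrow>
    (\<Sum>w\<in>kernels m B. real w powr (- \<sigma>) * real (gcd w d) powr \<kappa>) \<le> C * real (tau d) ^ (m - 1)"
proof -
  have sig0: "\<sigma> > 0" using sig by (rule less_trans[rotated]) simp
  have "\<sigma> * real (m + 1) > 1" using sig by (simp add: field_simps)
  from sum_kernel_powr_gcd_le[OF this sig0 kap order_refl, of m] m obtain C where "C \<ge> 1"
    "\<And>F d. finite F \<Longrightarrow> F \<subseteq> kernel_set (m + 1) m \<Longrightarrow> squarefree d \<Longrightarrow>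
     (\<Sum>w\<in>F. real w powr (- \<sigma>) * real (gcd w d) powr \<kappa>) \<le> C * real (tau d) ^ (2 * m - (m + 1))" by auto
  moreover have "2 * m - (m + 1) = m - 1" by simp
  moreover have "kernels m B \<subseteq> kernel_set (m + 1) m" for B by (auto simp: kernels_def)
  ultimately show ?thesis by (intro that[of C]) auto
qed

lemma card_full_upto_le:
  assumes m: "m \<ge> 1"
  obtains C where "C \<ge> 1" "\<And>B d. squarefree d \<Longrightarrow>
    real (card (full_upto m d B)) \<le> C * real B powr (1 / real m) * real (tau d) ^ (m - 1) / real d"
proof -
  have s: "1 / real m > 1 / real (m + 1)" using m by (simp add: frac_less2)
  obtain C where C: "C \<ge> 1" "\<And>B d. squarefree d \<Longrightarrow>
    (\<Sum>w\<in>kernels m B. real w powr (- (1 / real m)) * real (gcd w d) powr 1) \<le> C * real (tau d) ^ (m - 1)"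
    by (rule sum_kernels_powr_gcd[OF m s, of 1]) auto
  show ?thesis
  proof (rule that[OF C(1)])
    fix B d :: nat assume d: "squarefree d"
    have d0: "d > 0" using d by (metis not_squarefree_0 gr0I)
    have "real (card (full_upto m d B)) = (\<Sum>x\<in>full_upto m d B. 1)" by simp
    also have "\<dots> = (\<Sum>w\<in>kernels m B. real (ucut m d B w))" by (subst sum_full_upto[OF m d]) simp
    also have "\<dots> \<le> (\<Sum>w\<in>kernels m B. real B powr (1 / real m) / real d * (real w powr (- (1 / real m)) * real (gcd w d) powr 1))"
    proof (rule sum_mono)
      fix w assume "w \<in> kernels m B"
      then have w: "w > 0" by (rule kernels_pos)
      have "real (ucut m d B w) \<le> (real B / real w) powr (1 / real m) / real (cofactor d w)" by (rule ucut_le)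
      also have "\<dots> = real B powr (1 / real m) / real d * (real w powr (- (1 / real m)) * real (gcd w d) powr 1)"
        using w d0 by (simp add: cofactor_real powr_divide powr_minus field_simps)
      finally show "real (ucut m d B w) \<le> real B powr (1 / real m) / real d * (real w powr (- (1 / real m)) * real (gcd w d) powr 1)" .
    qed
    also have "\<dots> = real B powr (1 / real m) / real d * (\<Sum>w\<in>kernels m B. real w powr (- (1 / real m)) * real (gcd w d) powr 1)"
      by (simp only: sum_distrib_left)
    also have "\<dots> \<le> real B powr (1 / real m) / real d * (C * real (tau d) ^ (m - 1))"
      using C(2)[OF d] by (intro mult_left_mono) auto
    finally show "real (card (full_upto m d B)) \<le> C * real B powr (1 / real m) * real (tau d) ^ (m - 1) / real d"
      by (simp add: mult_ac)
  qed
qed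

text \<open>For each kernel \<open>w\<close> the variable \<open>u\<close> runs through an interval
  and \<open>mean_value_power\<close> applies; Minkowski's inequality then adds the
  \<open>p\<close>-th roots over \<open>w\<close>. That sum converges because
  \<open>p = m (m + 1)\<close> turns the bound into a power of \<open>w\<close> just below
  \<open>- 1 / (m + 1)\<close>.\<close>

lemma mean_value_full:
  assumes m: "m \<ge> 1" and eps: "\<epsilon> > 0"
  obtains C where "C \<ge> 1" "\<And>B d Q c. squarefree d \<Longrightarrow> B \<ge> 1 \<Longrightarrow> c \<noteq> 0 \<Longrightarrow> \<bar>c\<bar> * (int (crit m) * int B) < Q \<Longrightarrow>
    avg {0..<Q} (\<lambda>r. norm (\<Sum>x\<in>full_upto m d B. em Q (r * (c * int x))) ^ (2 * crit m))
      \<le> C * real B powr (real m + \<epsilon>) * real (tau d) ^ ((m - 1) * (2 * crit m)) / real d"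
proof -
  define p where "p = 2 * crit m"
  have p2: "real p = real m * real (m + 1)" unfolding p_def two_crit by (rule of_nat_mult)
  have p1: "p \<ge> 1" using crit_pos[OF m] by (simp add: p_def)
  have me: "real m * \<epsilon> > 0" using m eps by simp
  obtain C1 where C1: "C1 > 0" and MV: "\<And>U Q c. U \<ge> 1 \<Longrightarrow> c \<noteq> 0 \<Longrightarrow> \<bar>c\<bar> * (int (crit m) * int U ^ m) < Q \<Longrightarrow>
    avg {0..<Q} (\<lambda>r. norm (\<Sum>x\<in>{1..int U}. em Q (r * (c * x ^ m))) ^ p) \<le> C1 * real U powr (real (m * m) + real m * \<epsilon>)"
    using mean_value_power[OF m me] unfolding p_def by blast
  \<comment> \<open>Here \<epsilon> puts \<sigma> strictly above \<open>1 / (m + 1)\<close>, where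
    the sum over kernels converges.\<close>
  define \<sigma> where "\<sigma> = (real m + \<epsilon>) / real p"
  have sp: "\<sigma> * real p = real m + \<epsilon>" using p1 by (simp add: \<sigma>_def)
  have "\<sigma> > 1 / real (m + 1)"
  proof -
    have "1 / real (m + 1) = real m / real p" using m by (simp add: p2)
    also have "\<dots> < \<sigma>" unfolding \<sigma>_def using eps p1 by (intro divide_strict_right_mono) auto
    finally show ?thesis .
  qed
  then obtain C2 where C2: "C2 \<ge> 1" "\<And>B d. squarefree d \<Longrightarrow>
    (\<Sum>w\<in>kernels m B. real w powr (- \<sigma>) * real (gcd w d) powr (1 / real p)) \<le> C2 * real (tau d) ^ (m - 1)"
    by (rule sum_kernels_powr_gcd[OF m, of \<sigma> "1 / real p"]) (use p1 in auto)
  define C3 where "C3 = max C1 1"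
  have C3: "C3 \<ge> 1" "C1 \<le> C3 ^ p"
  proof -
    show "C3 \<ge> 1" by (simp add: C3_def)
    then have "C3 \<le> C3 ^ p" using p1 by (intro self_le_power) auto
    then show "C1 \<le> C3 ^ p" by (simp add: C3_def)
  qed
  show ?thesis
  proof (rule that)
    have "1 * 1 \<le> C3 * C2" using C3(1) C2(1) by (intro mult_mono) auto
    then show "(C3 * C2) ^ p \<ge> 1" by (intro one_le_power) simp
    fix B d :: nat and Q c :: int
    assume d: "squarefree d" and B: "B \<ge> 1" and c: "c \<noteq> 0" and Q: "\<bar>c\<bar> * (int (crit m) * int B) < Q"
    have d0: "d > 0" using d by (metis not_squarefree_0 gr0I)
    define g where "g w r = (\<Sum>u\<in>{1..ucut m d B w}. em Q (r * (c * int ((cofactor d w * u) ^ m * w))))" for w r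
    \<comment> \<open>The \<open>p\<close>-th root of the bound for the kernel \<open>w\<close>. Of
      the saving from the divisibility of \<open>u\<close> only \<open>1 / e\<close> is kept, with
      \<open>e\<close> the cofactor \<open>d / gcd w d\<close>; it gives
      \<open>d powr (- 1 / p)\<close> and the power of the gcd.\<close>
    define N where "N w = C3 * (real B powr \<sigma> * real d powr (- (1 / real p)) * (real w powr (- \<sigma>) * real (gcd w d) powr (1 / real p)))" for w
    have N0: "N w \<ge> 0" for w using C3 by (simp add: N_def)
    have gN: "avg {0..<Q} (\<lambda>r. 1 * norm (g w r) ^ p) \<le> N w ^ p" if wk: "w \<in> kernels m B" for w
    proof (cases "ucut m d B w = 0")
      case True
      then show ?thesis using p1 N0 by (simp add: g_def avg_def power_0_left)
    next
      case False
      define U where "U = ucut m d B w"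
      define e where "e = cofactor d w"
      have w0: "w > 0" using wk by (rule kernels_pos)
      have e0: "e > 0" using cofactor_pos[OF d0] by (simp add: e_def)
      define c' where "c' = c * int (w * e ^ m)"
      have c': "c' \<noteq> 0" using c w0 e0 by (simp add: c'_def)
      have "(e * U) ^ m * w \<le> B" using le_ucut_iff[OF d0 w0 m, of U B] by (simp add: U_def e_def)
      then have "int (w * e ^ m) * int U ^ m \<le> int B" by (simp add: power_mult_distrib mult_ac flip: of_nat_power of_nat_mult)
      then have "\<bar>c\<bar> * int (crit m) * (int (w * e ^ m) * int U ^ m) \<le> \<bar>c\<bar> * int (crit m) * int B" by (intro mult_left_mono) auto
      then have "\<bar>c'\<bar> * (int (crit m) * int U ^ m) < Q" using Q by (simp add: c'_def abs_mult mult_ac)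
      from MV[OF _ c' this] False have "avg {0..<Q} (\<lambda>r. norm (\<Sum>x\<in>{1..int U}. em Q (r * (c' * x ^ m))) ^ p) \<le> C1 * real U powr (real (m * m) + real m * \<epsilon>)"
        by (simp add: U_def)
      moreover have "(\<Sum>x\<in>{1..int U}. em Q (r * (c' * x ^ m))) = g w r" for r
      proof -
        have "{1..int U} = int ` {1..U}" using image_int_atLeastAtMost[of 1 U] by simp
        then have "(\<Sum>x\<in>{1..int U}. em Q (r * (c' * x ^ m))) = (\<Sum>u\<in>{1..U}. em Q (r * (c' * int u ^ m)))"
          by (simp add: sum.reindex)
        then show ?thesis unfolding g_def c'_def U_def e_def by (simp add: power_mult_distrib mult_ac)
      qed
      ultimately have "avg {0..<Q} (\<lambda>r. norm (g w r) ^ p) \<le> C1 * real U powr (real (m * m) + real m * \<epsilon>)" by simp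
      also have "\<dots> \<le> C3 ^ p * ((real B / real w) powr (real m + \<epsilon>) * (1 / real e))"
      proof (intro mult_mono)
        have "real U powr (real (m * m) + real m * \<epsilon>) \<le> ((real B / real w) powr (1 / real m) / real e) powr (real m * (real m + \<epsilon>))"
          using ucut_le[of m d B w] eps by (simp add: U_def e_def distrib_left powr_mono2)
        also have "\<dots> = (real B / real w) powr (real m + \<epsilon>) * (1 / real e powr (real m * (real m + \<epsilon>)))"
          using m by (simp add: powr_divide powr_mult powr_powr)
        also have "\<dots> \<le> (real B / real w) powr (real m + \<epsilon>) * (1 / real e)"
        proof -
          have "1 * 1 \<le> real m * (real m + \<epsilon>)" using m eps by (intro mult_mono) auto
          then have "real e powr 1 \<le> real e powr (real m * (real m + \<epsilon>))" using e0 by (intro powr_mono) auto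
          then show ?thesis using e0 by (intro mult_left_mono divide_left_mono) auto
        qed
        finally show "real U powr (real (m * m) + real m * \<epsilon>) \<le> (real B / real w) powr (real m + \<epsilon>) * (1 / real e)" .
      qed (use C3 in auto)
      also have "\<dots> = N w ^ p"
      proof -
        have pw: "(x powr y) ^ p = x powr (y * real p)" if "x > 0" for x y :: real using that by (simp add: powr_powr flip: powr_realpow)
        have g0: "real (gcd w d) > 0" using d0 by simp
        have "N w ^ p = C3 ^ p * ((real B powr (\<sigma> * real p)) * real d powr (- 1) * (real w powr (- (\<sigma> * real p)) * real (gcd w d) powr 1))"
          unfolding N_def power_mult_distrib using B d0 w0 g0 p1 by (simp add: pw)
        also have "\<dots> = C3 ^ p * ((real B / real w) powr (real m + \<epsilon>) * (1 / real e))"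
        proof -
          have "real w powr (- (real m + \<epsilon>)) = 1 / real w powr (real m + \<epsilon>)" by (rule powr_minus_divide)
          moreover have "real d powr (- 1) = 1 / real d" using d0 by (simp add: powr_minus_divide)
          ultimately show ?thesis unfolding sp e_def cofactor_real[OF d0] by (simp add: powr_divide)
        qed
        finally show ?thesis ..
      qed
      finally show ?thesis by simp
    qed
    have "avg {0..<Q} (\<lambda>r. norm (\<Sum>x\<in>full_upto m d B. em Q (r * (c * int x))) ^ p)
      \<le> avg {0..<Q} (\<lambda>r. 1 * (\<Sum>w\<in>kernels m B. norm (g w r)) ^ p)"
      unfolding sum_full_upto[OF m d] g_def by (intro avg_mono) (simp add: power_mono norm_sum)
    also have "\<dots> \<le> (\<Sum>w\<in>kernels m B. N w) ^ p"
      using p1 N0 gN by (intro avg_Minkowski) auto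
    also have "\<dots> \<le> (C3 * (real B powr \<sigma> * real d powr (- (1 / real p)) * (C2 * real (tau d) ^ (m - 1)))) ^ p"
    proof (intro power_mono sum_nonneg N0)
      have "(\<Sum>w\<in>kernels m B. N w) = C3 * (real B powr \<sigma> * real d powr (- (1 / real p)) * (\<Sum>w\<in>kernels m B. real w powr (- \<sigma>) * real (gcd w d) powr (1 / real p)))"
        unfolding N_def by (simp only: sum_distrib_left)
      also have "\<dots> \<le> C3 * (real B powr \<sigma> * real d powr (- (1 / real p)) * (C2 * real (tau d) ^ (m - 1)))"
        using C2(2)[OF d] C3 by (intro mult_left_mono) auto
      finally show "(\<Sum>w\<in>kernels m B. N w) \<le> C3 * (real B powr \<sigma> * real d powr (- (1 / real p)) * (C2 * real (tau d) ^ (m - 1)))" .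
    qed
    also have "\<dots> = (C3 * C2) ^ p * real B powr (real m + \<epsilon>) * real (tau d) ^ ((m - 1) * p) / real d"
    proof -
      have "(real B powr \<sigma>) ^ p = real B powr (real m + \<epsilon>)" using B by (simp add: powr_powr sp flip: powr_realpow)
      moreover have "(real d powr (- (1 / real p))) ^ p = 1 / real d"
      proof -
        have "(real d powr (- (1 / real p))) ^ p = real d powr (- 1)" using d0 p1 by (simp add: powr_powr flip: powr_realpow)
        then show ?thesis using d0 by (simp add: powr_minus_divide)
      qed
      ultimately show ?thesis by (simp add: power_mult_distrib power_mult[symmetric] mult_ac)
    qed
    finally show "avg {0..<Q} (\<lambda>r. norm (\<Sum>x\<in>full_upto m d B. em Q (r * (c * int x))) ^ (2 * crit m))
      \<le> (C3 * C2) ^ p * real B powr (real m + \<epsilon>) * real (tau d) ^ ((m - 1) * (2 * crit m)) / real d"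
      by (simp add: p_def)
  qed
qed

section \<open>Full numbers in progressions and on major arcs\<close>

lemma periodic_mean:
  fixes f :: "nat \<Rightarrow> complex"
  assumes q: "q \<ge> 1" and per: "\<And>u. f (u + q) = f u" and bd: "\<And>u. norm (f u) \<le> 1"
  obtains \<mu> where "norm \<mu> \<le> 1" "\<And>U. norm ((\<Sum>u\<in>{1..U}. f u) - of_nat U * \<mu>) \<le> 2 * real q"
proof -
  define \<mu> where "\<mu> = (\<Sum>u\<in>{1..q}. f u) / of_nat q"
  have bs: "norm (\<Sum>u\<in>{1..U}. f u) \<le> real U" for U
    using sum_norm_le[of "{1..U}" f "\<lambda>_. 1"] bd by simp
  have mu: "norm \<mu> \<le> 1" using bs[of q] q by (simp add: \<mu>_def norm_divide divide_le_eq)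
  show ?thesis
  proof (rule that[OF mu])
    show "norm ((\<Sum>u\<in>{1..U}. f u) - of_nat U * \<mu>) \<le> 2 * real q" for U
    proof (induction U rule: less_induct)
      case (less U)
      show ?case
      proof (cases "U < q")
        case True
        have "norm ((\<Sum>u\<in>{1..U}. f u) - of_nat U * \<mu>) \<le> norm (\<Sum>u\<in>{1..U}. f u) + norm (of_nat U * \<mu>)" by (rule norm_triangle_ineq4)
        also have "\<dots> \<le> real U + real U * 1" unfolding norm_mult norm_of_nat using bs[of U] mu by (intro add_mono mult_left_mono) auto
        finally show ?thesis using True by simp
      next
        case False
        define V where "V = U - q"
        have U: "U = V + q" using False by (simp add: V_def)
        have "(\<Sum>u\<in>{1..U}. f u) = (\<Sum>u\<in>{1..q}. f u) + (\<Sum>u\<in>{q+1..q+V}. f u)"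
          unfolding U by (subst sum.ub_add_nat[of 1 q f V, symmetric]) (auto simp: add.commute)
        also have "(\<Sum>u\<in>{q+1..q+V}. f u) = (\<Sum>u\<in>{1..V}. f (u + q))"
          by (rule sum.reindex_bij_witness[of _ "\<lambda>u. u + q" "\<lambda>u. u - q"]) auto
        also have "\<dots> = (\<Sum>u\<in>{1..V}. f u)" by (simp only: per)
        also have "(\<Sum>u\<in>{1..q}. f u) = of_nat q * \<mu>" using q by (simp add: \<mu>_def)
        finally have "(\<Sum>u\<in>{1..U}. f u) - of_nat U * \<mu> = (\<Sum>u\<in>{1..V}. f u) - of_nat V * \<mu>"
          by (simp add: U algebra_simps)
        then show ?thesis using less[of V] q U by simp
      qed
    qed
  qed
qed

lemma sum_kernels_powr:
  assumes m: "m \<ge> 1" and sig: "\<sigma> > 1 / real (m + 1)"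
  obtains C where "C \<ge> 1" "\<And>B. (\<Sum>w\<in>kernels m B. real w powr (- \<sigma>)) \<le> C"
proof -
  obtain C where C: "C \<ge> 1" "\<And>B d. squarefree d \<Longrightarrow> (\<Sum>w\<in>kernels m B. real w powr (- \<sigma>) * real (gcd w d) powr 0) \<le> C * real (tau d) ^ (m - 1)"
    by (rule sum_kernels_powr_gcd[OF m sig, of 0]) auto
  have "{g. g dvd (1::nat)} = {1}" by auto
  then have "tau 1 = 1" by (simp add: tau_def)
  then show ?thesis using C(2)[of 1] C(1) by (intro that[of C]) auto
qed

text \<open>The midpoint of \<open>1 / (m + 1)\<close> and \<open>1 / m\<close>: above the first the
  sum over kernels converges, and the distance to the second is a power saving.\<close>

definition kexp :: "nat \<Rightarrow> real" where
  "kexp m = (1 / real m + 1 / real (m + 1)) / 2"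

lemma kexp:
  assumes "m \<ge> 1"
  shows "1 / real (m + 1) < kexp m" "kexp m < 1 / real m" "0 < kexp m"
proof -
  have "1 / real (m + 1) < 1 / real m" using assms by (intro frac_less2) auto
  then show "1 / real (m + 1) < kexp m" "kexp m < 1 / real m" by (simp_all add: kexp_def)
  show "0 < kexp m" unfolding kexp_def using assms by (intro divide_pos_pos add_pos_pos) auto
qed

text \<open>For each kernel the summand is periodic in \<open>u\<close> modulo \<open>q\<close>, so
  the sum over \<open>u\<close> is its length times a mean, with an error \<open>O(q)\<close>. There
  are few kernels up to \<open>y\<close>, and completing the sum over \<open>w\<close> to a series
  makes the main term depend on \<open>y\<close> only through \<open>y powr (1 / m)\<close>.\<close>

lemma full_in_progressions:
  assumes m: "m \<ge> 1"
  obtains K where "K \<ge> 1" "\<And>d a q. squarefree d \<Longrightarrow> q \<ge> 1 \<Longrightarrow>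
    \<exists>\<kappa>. norm \<kappa> \<le> K \<and> (\<forall>y\<ge>1. norm ((\<Sum>x\<in>full_upto m d y. em q (a * int x)) - \<kappa> * of_real (real y powr (1 / real m)))
      \<le> K * real_of_int q * real y powr kexp m)"
proof -
  define \<sigma> where "\<sigma> = kexp m"
  note sig = kexp[OF m, folded \<sigma>_def]
  obtain C where C: "C \<ge> 1" "\<And>B. (\<Sum>w\<in>kernels m B. real w powr (- \<sigma>)) \<le> C"
    using sum_kernels_powr[OF m sig(1)] by blast
  define hs where "hs w = (if w \<in> kernel_set (m + 1) m then real w powr (- \<sigma>) else 0)" for w
  define h where "h w = (if w \<in> kernel_set (m + 1) m then real w powr (- (1 / real m)) else 0)" for w
  have hs0: "0 \<le> hs w" and h0: "0 \<le> h w" for w by (auto simp: hs_def h_def)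
  have hhs: "h w \<le> hs w" for w
  proof (cases "w \<in> kernel_set (m + 1) m")
    case True
    then have "real w \<ge> 1" using kernel_set_pos[of w] by (simp add: Suc_leI)
    then show ?thesis using sig by (auto simp: h_def hs_def intro!: powr_mono)
  qed (simp add: h_def hs_def)
  have partial: "(\<Sum>w<n. hs w) \<le> C" for n
  proof -
    have "(\<Sum>w<n. hs w) = (\<Sum>w\<in>{w\<in>{..<n}. w \<in> kernel_set (m + 1) m}. real w powr (- \<sigma>))"
      unfolding hs_def by (rule sum.inter_filter[symmetric]) simp
    also have "\<dots> \<le> (\<Sum>w\<in>kernels m n. real w powr (- \<sigma>))" by (intro sum_mono2) (auto simp: kernels_def)
    finally show ?thesis using C(2)[of n] by simp
  qed
  have shs: "summable hs" by (rule summableI_nonneg_bounded[OF hs0 partial])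
  have sh: "summable h" by (rule summable_comparison_test'[OF shs, of 0]) (use hhs h0 in auto)
  have hsC: "suminf hs \<le> C" using suminf_le_const[OF shs partial] .
  have cardk: "real (card (kernels m y)) \<le> C * real y powr \<sigma>" if "y \<ge> 1" for y
  proof -
    have "real (card (kernels m y)) = (\<Sum>w\<in>kernels m y. 1)" by simp
    also have "\<dots> \<le> (\<Sum>w\<in>kernels m y. real y powr \<sigma> * real w powr (- \<sigma>))"
    proof (rule sum_mono)
      fix w assume w: "w \<in> kernels m y"
      then have "1 \<le> (real y / real w) powr \<sigma>" using kernels_pos[OF w] sig by (intro ge_one_powr_ge_zero) (auto simp: kernels_def)
      then show "1 \<le> real y powr \<sigma> * real w powr (- \<sigma>)" using kernels_pos[OF w] by (simp add: powr_divide powr_minus field_simps)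
    qed
    also have "\<dots> \<le> real y powr \<sigma> * C" unfolding sum_distrib_left[symmetric] using C by (intro mult_left_mono) auto
    finally show ?thesis by (simp add: mult.commute)
  qed
  show ?thesis
  proof (rule that[of "4 * C"])
    show "4 * C \<ge> 1" using C by simp
    fix d :: nat and a q :: int
    assume d: "squarefree d" and q: "q \<ge> 1"
    have d0: "d > 0" using d by (metis not_squarefree_0 gr0I)
    define e where "e w = cofactor d w" for w
    have e0: "e w \<ge> 1" for w using cofactor_pos[OF d0, of w] by (simp add: e_def)
    have "\<exists>\<mu>. norm \<mu> \<le> 1 \<and> (\<forall>U. norm ((\<Sum>u\<in>{1..U}. em q (a * int ((e w * u) ^ m * w))) - of_nat U * \<mu>) \<le> 2 * real (nat q))" for w
    proof -
      have "em q (a * int ((e w * (u + nat q)) ^ m * w)) = em q (a * int ((e w * u) ^ m * w))" for u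
      proof (rule em_cong)
        have "[int u + q = int u] (mod q)" by (simp add: cong_def)
        then have "[a * ((int (e w) * (int u + q)) ^ m * int w) = a * ((int (e w) * int u) ^ m * int w)] (mod q)"
          by (intro cong_mult cong_pow cong_refl)
        then show "[a * int ((e w * (u + nat q)) ^ m * w) = a * int ((e w * u) ^ m * w)] (mod q)" using q by simp
      qed
      then show ?thesis using periodic_mean[of "nat q" "\<lambda>u. em q (a * int ((e w * u) ^ m * w))"] q by (metis norm_em order_refl nat_mono nat_1 One_nat_def)
    qed
    then obtain \<mu> where mu: "\<And>w. norm (\<mu> w) \<le> 1" "\<And>w U. norm ((\<Sum>u\<in>{1..U}. em q (a * int ((e w * u) ^ m * w))) - of_nat U * \<mu> w) \<le> 2 * real (nat q)"
      by metis
    \<comment> \<open>The contribution of \<open>w\<close> to \<kappa>: the mean of the phase times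
      the density of admissible \<open>u\<close>. It depends on \<open>d\<close>, \<open>a\<close>
      and \<open>q\<close>, but not on \<open>y\<close>.\<close>
    define g where "g w = (if w \<in> kernel_set (m + 1) m then \<mu> w * of_real (real w powr (- (1 / real m)) / real (e w)) else 0)" for w
    have gh: "norm (g w) \<le> h w" for w
    proof (cases "w \<in> kernel_set (m + 1) m")
      case True
      have "norm (\<mu> w) * (real w powr (- (1 / real m)) / real (e w)) \<le> 1 * (real w powr (- (1 / real m)) / 1)"
        using mu(1)[of w] e0[of w] by (intro mult_mono divide_left_mono) auto
      then show ?thesis using True by (simp add: g_def h_def norm_mult norm_divide)
    qed (simp add: g_def h_def)
    have sng: "summable (\<lambda>w. norm (g w))" by (rule summable_comparison_test'[OF sh, of 0]) (use gh in auto)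
    then have sg: "summable g" by (rule summable_norm_cancel)
    define \<kappa> where "\<kappa> = suminf g"
    have "norm \<kappa> \<le> suminf h" unfolding \<kappa>_def using summable_norm[OF sng] suminf_le[OF gh sng sh] by linarith
    also have "\<dots> \<le> suminf hs" by (rule suminf_le[OF hhs sh shs])
    finally have kC: "norm \<kappa> \<le> C" using hsC by simp
    have main: "norm ((\<Sum>x\<in>full_upto m d y. em q (a * int x)) - \<kappa> * of_real (real y powr (1 / real m))) \<le> 4 * C * real_of_int q * real y powr \<sigma>"
      if y: "y \<ge> 1" for y :: nat
    proof -
      define Y where "Y = real y powr (1 / real m)"
      define G where "G = (\<Sum>w\<in>kernels m y. g w)"
      have 1: "norm ((\<Sum>x\<in>full_upto m d y. em q (a * int x)) - of_real Y * G) \<le> 3 * real_of_int q * (C * real y powr \<sigma>)"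
      proof -
        have "(\<Sum>x\<in>full_upto m d y. em q (a * int x)) - of_real Y * G
          = (\<Sum>w\<in>kernels m y. (\<Sum>u\<in>{1..ucut m d y w}. em q (a * int ((e w * u) ^ m * w))) - of_real Y * g w)"
          unfolding G_def e_def by (subst sum_full_upto[OF m d]) (simp add: sum_subtractf sum_distrib_left)
        also have "norm \<dots> \<le> (\<Sum>w\<in>kernels m y. 3 * real_of_int q)"
        proof (rule sum_norm_le)
          fix w assume w: "w \<in> kernels m y"
          define U where "U = ucut m d y w"
          define u0 where "u0 = (real y / real w) powr (1 / real m) / real (e w)"
          have "\<bar>real U - u0\<bar> \<le> 1" using ucut_le[of m d y w] ucut_ge[of y w m d] by (simp add: U_def u0_def e_def abs_le_iff)
          have gw: "of_real Y * g w = of_real u0 * \<mu> w"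
            using w by (simp add: g_def kernels_def u0_def Y_def powr_divide powr_minus field_simps)
          have "norm ((\<Sum>u\<in>{1..U}. em q (a * int ((e w * u) ^ m * w))) - of_real u0 * \<mu> w)
            = norm (((\<Sum>u\<in>{1..U}. em q (a * int ((e w * u) ^ m * w))) - of_nat U * \<mu> w) + of_real (real U - u0) * \<mu> w)"
            by (simp add: algebra_simps)
          also have "\<dots> \<le> 2 * real (nat q) + \<bar>real U - u0\<bar> * norm (\<mu> w)"
            using mu(2)[of w U] by (intro norm_triangle_le add_mono) (auto simp: norm_mult simp del: of_real_diff)
          also have "\<bar>real U - u0\<bar> * norm (\<mu> w) \<le> 1 * 1" using mu(1)[of w] \<open>\<bar>real U - u0\<bar> \<le> 1\<close> by (intro mult_mono) auto
          finally show "norm ((\<Sum>u\<in>{1..ucut m d y w}. em q (a * int ((e w * u) ^ m * w))) - of_real Y * g w) \<le> 3 * real_of_int q"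
            using q unfolding gw U_def by simp
        qed
        also have "\<dots> = 3 * real_of_int q * real (card (kernels m y))" by simp
        also have "\<dots> \<le> 3 * real_of_int q * (C * real y powr \<sigma>)" using cardk[OF y] q by (intro mult_left_mono) auto
        finally show ?thesis .
      qed
      have 2: "norm (\<kappa> - G) \<le> real y powr (\<sigma> - 1 / real m) * C"
      proof -
        have "G = (\<Sum>w<Suc y. g w)"
        proof -
          have "(\<Sum>w<Suc y. g w) = (\<Sum>w\<in>kernels m y. g w)" by (intro sum.mono_neutral_right) (auto simp: kernels_def g_def)
          then show ?thesis by (simp add: G_def)
        qed
        then have "\<kappa> - G = (\<Sum>w. g (w + Suc y))" 
          unfolding \<kappa>_def using suminf_minus_initial_segment[OF sg, of "Suc y"] by simp
        also have "norm \<dots> \<le> (\<Sum>w. norm (g (w + Suc y)))" by (rule summable_norm) (rule summable_ignore_initial_segment[OF sng])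
        also have "\<dots> \<le> (\<Sum>w. real y powr (\<sigma> - 1 / real m) * hs (w + Suc y))"
        proof (rule suminf_le)
          fix w
          show "norm (g (w + Suc y)) \<le> real y powr (\<sigma> - 1 / real m) * hs (w + Suc y)"
          proof (cases "w + Suc y \<in> kernel_set (m + 1) m")
            case True
            define v where "v = w + Suc y"
            \<comment> \<open>Rankin's trick for the tail \<open>v > y\<close>: part of the decay is
              traded for a power of \<open>y\<close>.\<close>
            have "real v powr (- (1 / real m)) = real v powr (\<sigma> - 1 / real m) * real v powr (- \<sigma>)" by (simp add: powr_add[symmetric])
            also have "\<dots> \<le> real y powr (\<sigma> - 1 / real m) * real v powr (- \<sigma>)"
              using y sig by (intro mult_right_mono powr_mono2') (auto simp: v_def)
            finally show ?thesis using True gh[of v] by (simp add: h_def hs_def v_def)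
          next
            case False
            then show ?thesis by (simp add: g_def hs_def)
          qed
        next
          show "summable (\<lambda>w. norm (g (w + Suc y)))" by (rule summable_ignore_initial_segment[OF sng])
          show "summable (\<lambda>w. real y powr (\<sigma> - 1 / real m) * hs (w + Suc y))" by (intro summable_mult summable_ignore_initial_segment[OF shs])
        qed
        also have "\<dots> = real y powr (\<sigma> - 1 / real m) * (\<Sum>w. hs (w + Suc y))"
          by (rule suminf_mult[OF summable_ignore_initial_segment[OF shs]])
        also have "(\<Sum>w. hs (w + Suc y)) \<le> suminf hs"
          using suminf_split_initial_segment[OF shs, of "Suc y"] sum_nonneg[of "{..<Suc y}" hs] hs0 by simp
        finally show ?thesis using hsC by (meson mult_left_mono order_trans powr_ge_zero)
      qed
      have "norm (of_real Y * G - \<kappa> * of_real Y) = Y * norm (\<kappa> - G)"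
      proof -
        have "of_real Y * G - \<kappa> * of_real Y = - (of_real Y * (\<kappa> - G))" by (simp add: algebra_simps)
        then show ?thesis by (simp add: norm_mult Y_def)
      qed
      also have "\<dots> \<le> Y * (real y powr (\<sigma> - 1 / real m) * C)" using 2 by (intro mult_left_mono) (auto simp: Y_def)
      also have "\<dots> = C * real y powr \<sigma>" by (simp add: Y_def powr_add[symmetric])
      also have "\<dots> \<le> real_of_int q * (C * real y powr \<sigma>)" using q C mult_right_mono[of 1 "real_of_int q" "C * real y powr \<sigma>"] by simp
      finally have 3: "norm (of_real Y * G - \<kappa> * of_real Y) \<le> real_of_int q * (C * real y powr \<sigma>)" .
      have "norm ((\<Sum>x\<in>full_upto m d y. em q (a * int x)) - \<kappa> * of_real Y) \<le>
        norm ((\<Sum>x\<in>full_upto m d y. em q (a * int x)) - of_real Y * G) + norm (of_real Y * G - \<kappa> * of_real Y)"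
        by (rule norm_triangle_sub[of _ "of_real Y * G - \<kappa> * of_real Y", THEN order.trans]) (simp add: algebra_simps)
      moreover have "4 * C * real_of_int q * real y powr \<sigma> = 3 * real_of_int q * (C * real y powr \<sigma>) + real_of_int q * (C * real y powr \<sigma>)" by simp
      ultimately show ?thesis using 1 3 unfolding Y_def by linarith
    qed
    show "\<exists>\<kappa>. norm \<kappa> \<le> 4 * C \<and> (\<forall>y\<ge>1. norm ((\<Sum>x\<in>full_upto m d y. em q (a * int x)) - \<kappa> * of_real (real y powr (1 / real m)))
      \<le> 4 * C * real_of_int q * real y powr kexp m)"
      using main kC C unfolding \<sigma>_def by (intro exI[of _ \<kappa>]) auto
  qed
qed

lemma Abel_summation_bound:
  fixes D z :: "nat \<Rightarrow> complex"
  assumes D: "D 0 = 0" "\<And>j. j \<le> B \<Longrightarrow> norm (D j) \<le> E" and z: "\<And>j. norm (z j) \<le> 1" "\<And>j. norm (z (Suc j) - z j) \<le> \<delta>"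
  shows "norm (\<Sum>j\<in>{1..B}. (D j - D (j - 1)) * z j) \<le> E * (1 + \<delta> * real B)"
proof -
  have E: "E \<ge> 0" using D(2)[of 0] norm_ge_zero order_trans by blast
  have "(\<Sum>j\<in>{1..n}. (D j - D (j - 1)) * z j) = D n * z n - (\<Sum>j<n. D j * (z (Suc j) - z j))" for n
    by (induction n) (simp_all add: D(1) algebra_simps)
  then have "norm (\<Sum>j\<in>{1..B}. (D j - D (j - 1)) * z j) \<le> norm (D B * z B) + norm (\<Sum>j<B. D j * (z (Suc j) - z j))"
    by (simp add: norm_triangle_ineq4)
  also have "\<dots> \<le> E * 1 + (\<Sum>j<B. E * \<delta>)"
  proof (intro add_mono sum_norm_le)
    show "norm (D B * z B) \<le> E * 1" unfolding norm_mult using D(2) z(1) E by (intro mult_mono) auto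
    show "norm (D j * (z (Suc j) - z j)) \<le> E * \<delta>" if "j \<in> {..<B}" for j
      unfolding norm_mult using D(2)[of j] z(2)[of j] E that by (intro mult_mono) auto
  qed
  finally show ?thesis by (simp add: algebra_simps)
qed

text \<open>A Riemann-Stieltjes sum with mesh \<open>1 / B\<close> for the integral of
  \<open>ee (\<gamma> * t)\<close> against \<open>t powr \<theta>\<close> over the unit interval. It
  takes the place of the singular integral, which is never formed.\<close>

definition model_sum :: "real \<Rightarrow> nat \<Rightarrow> real \<Rightarrow> complex" where
  "model_sum \<theta> B \<gamma> = (\<Sum>j\<in>{1..B}. of_real ((real j / real B) powr \<theta> - (real (j - 1) / real B) powr \<theta>) * ee (\<gamma> * real j / real B))"

lemma sum_blocks:
  fixes f :: "nat \<Rightarrow> 'a :: comm_monoid_add"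
  shows "(\<Sum>i\<in>{1..B * B'}. f i) = (\<Sum>j\<in>{1..B}. \<Sum>i\<in>{1..B'}. f ((j - 1) * B' + i))"
proof (induction B)
  case (Suc B)
  have "(\<Sum>i\<in>{1..Suc B * B'}. f i) = (\<Sum>i\<in>{1..B * B'}. f i) + (\<Sum>i\<in>{B * B' + 1..B * B' + B'}. f i)"
    using sum.ub_add_nat[of 1 "B * B'" f B'] by (simp add: add.commute)
  also have "(\<Sum>i\<in>{B * B' + 1..B * B' + B'}. f i) = (\<Sum>i\<in>{1..B'}. f (B * B' + i))"
    by (rule sum.reindex_bij_witness[of _ "\<lambda>i. B * B' + i" "\<lambda>i. i - B * B'"]) auto
  finally show ?case using Suc by simp
qed simp

text \<open>Refining the mesh moves the phase by at most \<open>\<bar>\<gamma>\<bar> / B\<close>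
  within a block, and the weights add up to 1. Two meshes \<open>B\<close> and \<open>B'\<close> are
  compared through their common refinement \<open>B * B'\<close>.\<close>

lemma model_sum_refine:
  assumes "B \<ge> 1" "B' \<ge> 1" "\<theta> > 0"
  shows "norm (model_sum \<theta> B \<gamma> - model_sum \<theta> (B * B') \<gamma>) \<le> 2 * pi * \<bar>\<gamma>\<bar> / real B"
proof -
  define v where "v i = (real i / real (B * B')) powr \<theta>" for i
  define D where "D j = (real j / real B) powr \<theta> - (real (j - 1) / real B) powr \<theta>" for j :: nat
  have vD: "(\<Sum>i\<in>{1..B'}. v ((j - 1) * B' + i) - v ((j - 1) * B' + (i - 1))) = D j" if "j \<ge> 1" for j
  proof -
    have "(\<Sum>i\<in>{1..n}. v (c + i) - v (c + (i - 1))) = v (c + n) - v c" for c n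
      by (induction n) simp_all
    then have "(\<Sum>i\<in>{1..B'}. v ((j - 1) * B' + i) - v ((j - 1) * B' + (i - 1))) = v ((j - 1) * B' + B') - v ((j - 1) * B')" .
    also have "(j - 1) * B' + B' = j * B'" using that by (simp add: algebra_simps)
    also have "v (j * B') - v ((j - 1) * B') = D j" using assms by (simp add: v_def D_def)
    finally show ?thesis .
  qed
  have vm: "v i \<le> v k" if "i \<le> k" for i k
    unfolding v_def using that assms by (intro powr_mono2 divide_right_mono) auto
  have D0: "D j \<ge> 0" for j
    unfolding D_def using assms by (auto intro!: powr_mono2 divide_right_mono)
  have "model_sum \<theta> (B * B') \<gamma> = (\<Sum>j\<in>{1..B}. \<Sum>i\<in>{1..B'}. of_real (v ((j - 1) * B' + i) - v ((j - 1) * B' + i - 1)) * ee (\<gamma> * real ((j - 1) * B' + i) / real (B * B')))"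
    unfolding model_sum_def v_def by (rule sum_blocks)
  also have "\<dots> = (\<Sum>j\<in>{1..B}. \<Sum>i\<in>{1..B'}. of_real (v ((j - 1) * B' + i) - v ((j - 1) * B' + (i - 1))) * ee (\<gamma> * real ((j - 1) * B' + i) / real (B * B')))"
    by (intro sum.cong refl) (simp add: Nat.add_diff_assoc)
  finally have M: "model_sum \<theta> (B * B') \<gamma> = \<dots>" .
  have "model_sum \<theta> B \<gamma> = (\<Sum>j\<in>{1..B}. of_real (D j) * ee (\<gamma> * real j / real B))"
    by (simp add: model_sum_def D_def)
  also have "\<dots> = (\<Sum>j\<in>{1..B}. \<Sum>i\<in>{1..B'}. of_real (v ((j - 1) * B' + i) - v ((j - 1) * B' + (i - 1))) * ee (\<gamma> * real j / real B))"
    by (intro sum.cong refl) (simp only: vD[symmetric] of_real_sum sum_distrib_right atLeastAtMost_iff)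
  finally have "norm (model_sum \<theta> B \<gamma> - model_sum \<theta> (B * B') \<gamma>) =
    norm (\<Sum>j\<in>{1..B}. \<Sum>i\<in>{1..B'}. of_real (v ((j - 1) * B' + i) - v ((j - 1) * B' + (i - 1))) * (ee (\<gamma> * real j / real B) - ee (\<gamma> * real ((j - 1) * B' + i) / real (B * B'))))"
    unfolding M by (simp add: sum_subtractf[symmetric] right_diff_distrib)
  also have "\<dots> \<le> (\<Sum>j\<in>{1..B}. D j * (2 * pi * \<bar>\<gamma>\<bar> / real B))"
  proof (rule sum_norm_le)
    fix j assume j: "j \<in> {1..B}"
    have "norm (\<Sum>i\<in>{1..B'}. of_real (v ((j - 1) * B' + i) - v ((j - 1) * B' + (i - 1))) * (ee (\<gamma> * real j / real B) - ee (\<gamma> * real ((j - 1) * B' + i) / real (B * B'))))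
      \<le> (\<Sum>i\<in>{1..B'}. (v ((j - 1) * B' + i) - v ((j - 1) * B' + (i - 1))) * (2 * pi * \<bar>\<gamma>\<bar> / real B))"
    proof (rule sum_norm_le)
      fix i assume i: "i \<in> {1..B'}"
      define x where "x = \<gamma> * real j / real B"
      define y where "y = \<gamma> * real ((j - 1) * B' + i) / real (B * B')"
      have "ee x - ee y = ee y * (ee (x - y) - 1)" by (simp add: right_diff_distrib flip: ee_add)
      then have "norm (ee x - ee y) \<le> 2 * pi * \<bar>x - y\<bar>" using norm_ee_diff_1_le[of "x - y"] by (simp add: norm_mult)
      also have "\<bar>x - y\<bar> \<le> \<bar>\<gamma>\<bar> / real B"
      proof -
        obtain j' where "j = Suc j'" using j by (cases j) auto
        then have "real ((j - 1) * B' + i) = real j * real B' - (real B' - real i)" by (simp add: algebra_simps)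
        then have "x - y = \<gamma> / real B * ((real B' - real i) / real B')"
          using assms unfolding x_def y_def by (simp only: of_nat_mult) (simp add: field_simps del: of_nat_diff)
        moreover have "\<bar>(real B' - real i) / real B'\<bar> \<le> 1" using i assms by (simp add: divide_le_eq)
        then have "\<bar>\<gamma> / real B\<bar> * \<bar>(real B' - real i) / real B'\<bar> \<le> \<bar>\<gamma> / real B\<bar> * 1" by (intro mult_left_mono) auto
        ultimately have "\<bar>x - y\<bar> \<le> \<bar>\<gamma> / real B\<bar> * 1" by (simp only: abs_mult)
        then show ?thesis by simp
      qed
      then have "2 * pi * \<bar>x - y\<bar> \<le> 2 * pi * (\<bar>\<gamma>\<bar> / real B)" by (intro mult_left_mono) auto
      then have "2 * pi * \<bar>x - y\<bar> \<le> 2 * pi * \<bar>\<gamma>\<bar> / real B" by simp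
      finally have n: "norm (ee x - ee y) \<le> 2 * pi * \<bar>\<gamma>\<bar> / real B" .
      have "v ((j - 1) * B' + (i - 1)) \<le> v ((j - 1) * B' + i)" by (rule vm) simp
      then show "norm (of_real (v ((j - 1) * B' + i) - v ((j - 1) * B' + (i - 1))) * (ee (\<gamma> * real j / real B) - ee (\<gamma> * real ((j - 1) * B' + i) / real (B * B'))))
        \<le> (v ((j - 1) * B' + i) - v ((j - 1) * B' + (i - 1))) * (2 * pi * \<bar>\<gamma>\<bar> / real B)"
        unfolding norm_mult norm_of_real x_def[symmetric] y_def[symmetric] using n by (intro mult_mono) auto
    qed
    also have "\<dots> = D j * (2 * pi * \<bar>\<gamma>\<bar> / real B)"
      using j by (simp only: sum_distrib_right[symmetric] vD atLeastAtMost_iff)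
    finally show "norm (\<Sum>i\<in>{1..B'}. of_real (v ((j - 1) * B' + i) - v ((j - 1) * B' + (i - 1))) * (ee (\<gamma> * real j / real B) - ee (\<gamma> * real ((j - 1) * B' + i) / real (B * B'))))
      \<le> D j * (2 * pi * \<bar>\<gamma>\<bar> / real B)" .
  qed
  also have "\<dots> = (\<Sum>j\<in>{1..B}. D j) * (2 * pi * \<bar>\<gamma>\<bar> / real B)" by (simp only: sum_distrib_right)
  also have "(\<Sum>j\<in>{1..B}. D j) = 1"
  proof -
    have "(\<Sum>j\<in>{1..n}. D j) = (real n / real B) powr \<theta>" for n
      by (induction n) (simp_all add: D_def)
    then show ?thesis using assms by simp
  qed
  finally show ?thesis by simp
qed

text \<open>By partial summation each normalised sum is close to \<kappa> times its model sum, with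
  the same \<kappa> for \<open>B\<close> and \<open>B'\<close>; the model sums are close to each
  other. The value of \<kappa> is irrelevant.\<close>

lemma full_major_arc_compare:
  assumes m: "m \<ge> 1"
  obtains K \<delta> where "K \<ge> 1" "0 < \<delta>" "\<delta> \<le> 1" "\<And>d a q B B' \<gamma>. squarefree d \<Longrightarrow> q \<ge> 1 \<Longrightarrow> 1 \<le> B \<Longrightarrow> B \<le> B' \<Longrightarrow>
    norm (of_real (real B powr (- (1 / real m))) * (\<Sum>x\<in>full_upto m d B. em q (a * int x) * ee (\<gamma> * real x / real B))
        - of_real (real B' powr (- (1 / real m))) * (\<Sum>x\<in>full_upto m d B'. em q (a * int x) * ee (\<gamma> * real x / real B')))
      \<le> K * real_of_int q * (1 + \<bar>\<gamma>\<bar>) * real B powr (- \<delta>)"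
proof -
  define \<theta> where "\<theta> = 1 / real m"
  define \<delta> where "\<delta> = \<theta> - kexp m"
  have th: "0 < \<theta>" "\<theta> \<le> 1" using m by (auto simp: \<theta>_def)
  have del: "0 < \<delta>" "\<delta> \<le> 1" using kexp[OF m, folded \<theta>_def] th unfolding \<delta>_def by linarith+
  obtain K where K: "K \<ge> 1" and prog: "\<And>d a q. squarefree d \<Longrightarrow> q \<ge> 1 \<Longrightarrow>
    \<exists>\<kappa>. norm \<kappa> \<le> K \<and> (\<forall>y\<ge>1. norm ((\<Sum>x\<in>full_upto m d y. em q (a * int x)) - \<kappa> * of_real (real y powr (1 / real m)))
      \<le> K * real_of_int q * real y powr kexp m)"
    using full_in_progressions[OF m] by metis
  show ?thesis
  proof (rule that[of "K * (4 * pi + 2 * (1 + 2 * pi))"])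
    have "1 * 1 \<le> K * (4 * pi + 2 * (1 + 2 * pi))" using K pi_gt_zero by (intro mult_mono) auto
    then show "K * (4 * pi + 2 * (1 + 2 * pi)) \<ge> 1" by simp
    fix d B B' :: nat and a q :: int and \<gamma> :: real
    assume d: "squarefree d" and q: "q \<ge> 1" and B: "1 \<le> B" "B \<le> B'"
    obtain \<kappa> where kap: "norm \<kappa> \<le> K" and asy: "\<And>y. y \<ge> 1 \<Longrightarrow> norm ((\<Sum>x\<in>full_upto m d y. em q (a * int x)) - \<kappa> * of_real (real y powr \<theta>))
      \<le> K * real_of_int q * real y powr kexp m" using prog[OF d q] unfolding \<theta>_def by blast
    define F where "F y = (\<Sum>x\<in>full_upto m d y. em q (a * int x))" for y
    have single: "norm (of_real (real N powr (- \<theta>)) * (\<Sum>x\<in>full_upto m d N. em q (a * int x) * ee (\<gamma> * real x / real N)) - \<kappa> * model_sum \<theta> N \<gamma>)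
        \<le> K * real_of_int q * (1 + 2 * pi * \<bar>\<gamma>\<bar>) * real N powr (- \<delta>)" if N: "N \<ge> 1" for N
    proof -
      define D where "D j = F j - \<kappa> * of_real (real j powr \<theta>)" for j
      define z where "z j = ee (\<gamma> * real j / real N)" for j
      have "full_upto m d 0 = {}" by (auto simp: full_upto_def)
      then have F0: "F 0 = 0" by (simp add: F_def)
      have "(\<Sum>x\<in>full_upto m d N. em q (a * int x) * z x) = (\<Sum>j\<in>{1..N}. if j \<in> full_upto m d N then em q (a * int j) * z j else 0)"
        by (subst sum.inter_restrict[symmetric]) (auto simp: full_upto_def intro!: sum.cong)
      also have "\<dots> = (\<Sum>j\<in>{1..N}. (F j - F (j - 1)) * z j)"
      proof (intro sum.cong refl)
        fix j assume j: "j \<in> {1..N}"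
        have "full_upto m d j = (if j \<in> full_upto m d N then insert j (full_upto m d (j - 1)) else full_upto m d (j - 1))"
        proof -
          obtain j' where "j = Suc j'" using j by (cases j) auto
          then show ?thesis using j by (auto simp: full_upto_def le_Suc_eq)
        qed
        moreover have "j \<notin> full_upto m d (j - 1)" using j by (auto simp: full_upto_def)
        ultimately have "F j - F (j - 1) = (if j \<in> full_upto m d N then em q (a * int j) else 0)" by (simp add: F_def)
        then show "(if j \<in> full_upto m d N then em q (a * int j) * z j else 0) = (F j - F (j - 1)) * z j" by simp
      qed
      finally have S: "(\<Sum>x\<in>full_upto m d N. em q (a * int x) * z x) = (\<Sum>j\<in>{1..N}. (F j - F (j - 1)) * z j)" .
      have W: "of_real (real N powr \<theta>) * model_sum \<theta> N \<gamma> = (\<Sum>j\<in>{1..N}. of_real (real j powr \<theta> - real (j - 1) powr \<theta>) * z j)"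
        unfolding model_sum_def z_def sum_distrib_left using N
        by (intro sum.cong refl) (simp add: powr_divide diff_divide_distrib[symmetric])
      have "(\<Sum>x\<in>full_upto m d N. em q (a * int x) * z x) - \<kappa> * (of_real (real N powr \<theta>) * model_sum \<theta> N \<gamma>) = (\<Sum>j\<in>{1..N}. (D j - D (j - 1)) * z j)"
        unfolding S W sum_distrib_left sum_subtractf[symmetric] by (intro sum.cong refl) (simp add: D_def algebra_simps)
      also have "norm \<dots> \<le> (K * real_of_int q * real N powr kexp m) * (1 + (2 * pi * \<bar>\<gamma>\<bar> / real N) * real N)"
      proof (rule Abel_summation_bound)
        show "D 0 = 0" using th by (simp add: D_def F0)
        show "norm (D j) \<le> K * real_of_int q * real N powr kexp m" if "j \<le> N" for j
        proof (cases "j = 0")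
          case True
          then show ?thesis using K q th by (simp add: D_def F0)
        next
          case False
          then have "norm (D j) \<le> K * real_of_int q * real j powr kexp m" using asy[of j] by (simp add: D_def F_def)
          also have "\<dots> \<le> K * real_of_int q * real N powr kexp m"
            using that kexp[OF m] K q by (intro mult_left_mono powr_mono2) auto
          finally show ?thesis .
        qed
        show "norm (z j) \<le> 1" for j by (simp add: z_def)
        show "norm (z (Suc j) - z j) \<le> 2 * pi * \<bar>\<gamma>\<bar> / real N" for j
        proof -
          have "\<gamma> * real (Suc j) / real N = \<gamma> * real j / real N + \<gamma> / real N" by (simp add: add_divide_distrib algebra_simps)
          then have "z (Suc j) - z j = z j * (ee (\<gamma> / real N) - 1)" by (simp add: z_def ee_add algebra_simps)
          then show ?thesis using norm_ee_diff_1_le[of "\<gamma> / real N"] by (simp add: norm_mult z_def)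
        qed
      qed
      finally have n: "norm ((\<Sum>x\<in>full_upto m d N. em q (a * int x) * z x) - \<kappa> * (of_real (real N powr \<theta>) * model_sum \<theta> N \<gamma>))
         \<le> (K * real_of_int q * real N powr kexp m) * (1 + 2 * pi * \<bar>\<gamma>\<bar>)" using N by simp
      have one: "real N powr (- \<theta>) * real N powr \<theta> = 1" using N by (simp flip: powr_add)
      then have one': "complex_of_real (real N powr (- \<theta>)) * of_real (real N powr \<theta>) = 1" by (metis of_real_1 of_real_mult)
      have "of_real (real N powr (- \<theta>)) * (\<Sum>x\<in>full_upto m d N. em q (a * int x) * z x) - \<kappa> * model_sum \<theta> N \<gamma>
        = of_real (real N powr (- \<theta>)) * ((\<Sum>x\<in>full_upto m d N. em q (a * int x) * z x) - \<kappa> * (of_real (real N powr \<theta>) * model_sum \<theta> N \<gamma>))"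
        using one' by (simp add: right_diff_distrib mult.left_commute flip: mult.assoc)
      also have "norm \<dots> \<le> real N powr (- \<theta>) * ((K * real_of_int q * real N powr kexp m) * (1 + 2 * pi * \<bar>\<gamma>\<bar>))"
        unfolding norm_mult using n by (intro mult_mono) auto
      also have "\<dots> = K * real_of_int q * (1 + 2 * pi * \<bar>\<gamma>\<bar>) * (real N powr (- \<theta>) * real N powr kexp m)" by simp
      also have "real N powr (- \<theta>) * real N powr kexp m = real N powr (- \<delta>)" by (simp add: \<delta>_def flip: powr_add)
      finally show ?thesis by (simp add: z_def)
    qed
    have Bd: "real B' powr (- \<delta>) \<le> real B powr (- \<delta>)" using B del by (intro powr_mono2') auto
    have B1: "1 / real B \<le> real B powr (- \<delta>)"
    proof -
      have "real B powr (- 1) \<le> real B powr (- \<delta>)" using B del by (intro powr_mono) auto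
      then show ?thesis using B by (simp add: powr_minus_divide)
    qed
    have mod: "norm (model_sum \<theta> B \<gamma> - model_sum \<theta> B' \<gamma>) \<le> 4 * pi * \<bar>\<gamma>\<bar> * real B powr (- \<delta>)"
    proof -
      have "norm (model_sum \<theta> B \<gamma> - model_sum \<theta> B' \<gamma>) \<le> norm (model_sum \<theta> B \<gamma> - model_sum \<theta> (B * B') \<gamma>) + norm (model_sum \<theta> B' \<gamma> - model_sum \<theta> (B' * B) \<gamma>)"
        using norm_triangle_ineq4[of "model_sum \<theta> B \<gamma> - model_sum \<theta> (B * B') \<gamma>" "model_sum \<theta> B' \<gamma> - model_sum \<theta> (B' * B) \<gamma>"]
        by (simp add: mult.commute[of B'])
      also have "\<dots> \<le> 2 * pi * \<bar>\<gamma>\<bar> / real B + 2 * pi * \<bar>\<gamma>\<bar> / real B'"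
        using B th by (intro add_mono model_sum_refine) auto
      also have "2 * pi * \<bar>\<gamma>\<bar> / real B' \<le> 2 * pi * \<bar>\<gamma>\<bar> / real B" using B by (intro divide_left_mono) auto
      also have "2 * pi * \<bar>\<gamma>\<bar> / real B + 2 * pi * \<bar>\<gamma>\<bar> / real B = 4 * pi * \<bar>\<gamma>\<bar> * (1 / real B)" by simp
      also have "\<dots> \<le> 4 * pi * \<bar>\<gamma>\<bar> * real B powr (- \<delta>)" using B1 by (intro mult_left_mono) auto
      finally show ?thesis by simp
    qed
    define S where "S N = of_real (real N powr (- \<theta>)) * (\<Sum>x\<in>full_upto m d N. em q (a * int x) * ee (\<gamma> * real x / real N))" for N
    have "S B - S B' = (S B - \<kappa> * model_sum \<theta> B \<gamma>) - (S B' - \<kappa> * model_sum \<theta> B' \<gamma>) + \<kappa> * (model_sum \<theta> B \<gamma> - model_sum \<theta> B' \<gamma>)"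
      by (simp add: algebra_simps)
    also have "norm \<dots> \<le> norm (S B - \<kappa> * model_sum \<theta> B \<gamma>) + norm (S B' - \<kappa> * model_sum \<theta> B' \<gamma>) + norm (\<kappa> * (model_sum \<theta> B \<gamma> - model_sum \<theta> B' \<gamma>))"
      by (intro order.trans[OF norm_triangle_ineq] add_mono norm_triangle_ineq4 order_refl)
    also have "\<dots> \<le> K * real_of_int q * (1 + 2 * pi * \<bar>\<gamma>\<bar>) * real B powr (- \<delta>) + K * real_of_int q * (1 + 2 * pi * \<bar>\<gamma>\<bar>) * real B powr (- \<delta>)
       + K * (4 * pi * \<bar>\<gamma>\<bar> * real B powr (- \<delta>))"
    proof (intro add_mono)
      show "norm (S B - \<kappa> * model_sum \<theta> B \<gamma>) \<le> K * real_of_int q * (1 + 2 * pi * \<bar>\<gamma>\<bar>) * real B powr (- \<delta>)"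
        using single[of B] B by (simp add: S_def)
      have "norm (S B' - \<kappa> * model_sum \<theta> B' \<gamma>) \<le> K * real_of_int q * (1 + 2 * pi * \<bar>\<gamma>\<bar>) * real B' powr (- \<delta>)"
        using single[of B'] B by (simp add: S_def)
      also have "\<dots> \<le> K * real_of_int q * (1 + 2 * pi * \<bar>\<gamma>\<bar>) * real B powr (- \<delta>)"
        using Bd K q by (intro mult_left_mono) auto
      finally show "norm (S B' - \<kappa> * model_sum \<theta> B' \<gamma>) \<le> K * real_of_int q * (1 + 2 * pi * \<bar>\<gamma>\<bar>) * real B powr (- \<delta>)" .
      show "norm (\<kappa> * (model_sum \<theta> B \<gamma> - model_sum \<theta> B' \<gamma>)) \<le> K * (4 * pi * \<bar>\<gamma>\<bar> * real B powr (- \<delta>))"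
        unfolding norm_mult using kap mod K by (intro mult_mono) auto
    qed
    also have "\<dots> \<le> K * (4 * pi + 2 * (1 + 2 * pi)) * real_of_int q * (1 + \<bar>\<gamma>\<bar>) * real B powr (- \<delta>)"
    proof -
      have "2 * (1 + 2 * pi * \<bar>\<gamma>\<bar>) \<le> 2 * (1 + 2 * pi) * (1 + \<bar>\<gamma>\<bar>)" using pi_gt_zero by (simp add: algebra_simps)
      then have "K * real_of_int q * (2 * (1 + 2 * pi * \<bar>\<gamma>\<bar>)) \<le> K * real_of_int q * (2 * (1 + 2 * pi) * (1 + \<bar>\<gamma>\<bar>))"
        using K q by (intro mult_left_mono) auto
      moreover have "K * (4 * pi * \<bar>\<gamma>\<bar>) \<le> K * real_of_int q * (4 * pi * (1 + \<bar>\<gamma>\<bar>))"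
      proof -
        have "K * 1 * (4 * pi * \<bar>\<gamma>\<bar>) \<le> K * real_of_int q * (4 * pi * (1 + \<bar>\<gamma>\<bar>))" using K q pi_gt_zero by (intro mult_mono) auto
        then show ?thesis by simp
      qed
      ultimately have "K * real_of_int q * (2 * (1 + 2 * pi * \<bar>\<gamma>\<bar>)) + K * (4 * pi * \<bar>\<gamma>\<bar>) \<le> K * (4 * pi + 2 * (1 + 2 * pi)) * real_of_int q * (1 + \<bar>\<gamma>\<bar>)"
        by (simp add: algebra_simps)
      then have "(K * real_of_int q * (2 * (1 + 2 * pi * \<bar>\<gamma>\<bar>)) + K * (4 * pi * \<bar>\<gamma>\<bar>)) * real B powr (- \<delta>) \<le> (K * (4 * pi + 2 * (1 + 2 * pi)) * real_of_int q * (1 + \<bar>\<gamma>\<bar>)) * real B powr (- \<delta>)"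
        by (intro mult_right_mono) auto
      then show ?thesis by (simp add: algebra_simps)
    qed
    finally show "norm (of_real (real B powr (- (1 / real m))) * (\<Sum>x\<in>full_upto m d B. em q (a * int x) * ee (\<gamma> * real x / real B))
        - of_real (real B' powr (- (1 / real m))) * (\<Sum>x\<in>full_upto m d B'. em q (a * int x) * ee (\<gamma> * real x / real B')))
      \<le> K * (4 * pi + 2 * (1 + 2 * pi)) * real_of_int q * (1 + \<bar>\<gamma>\<bar>) * real B powr (- \<delta>)"
      by (simp add: S_def \<theta>_def)
  qed (use del in auto)
qed

section \<open>Full numbers on minor arcs\<close>

text \<open>A large sum has a single kernel \<open>w\<close> with a large inner sum, and then both
  \<open>w\<close> and its cofactor are smaller than a small power of \<open>B\<close>. Weyl's
  inequality for a monomial in \<open>u\<close> gives an approximation to \<alpha> whose denominator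
  grows only by that factor. The modulus \<open>d\<close> enters only through the cofactor, hence
  the uniformity in \<open>d\<close>.\<close>

lemma full_minor_arc:
  assumes m: "m \<ge> 1" and rho: "\<rho> > 0"
  obtains C \<kappa> where "C \<ge> 1" "\<kappa> > 0" "\<And>d B \<alpha>. squarefree d \<Longrightarrow> B \<ge> 1 \<Longrightarrow>
    norm (\<Sum>x\<in>full_upto m d B. ee (\<alpha> * real x)) > C * real B powr (1 / real m - \<kappa>) \<Longrightarrow>
    \<exists>q a::int. 1 \<le> q \<and> real_of_int q \<le> C * real B powr \<rho> \<and> \<bar>of_int q * \<alpha> - of_int a\<bar> \<le> C * real B powr \<rho> / real B"
proof -
  obtain m' where m': "m = Suc m'" using m by (cases m) auto
  define \<theta> where "\<theta> = 1 / real m"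
  define \<sigma> where "\<sigma> = kexp m"
  note sig = kexp[OF m, folded \<sigma>_def \<theta>_def]
  define \<delta> where "\<delta> = \<theta> - \<sigma>"
  have del: "\<delta> > 0" using sig by (simp add: \<delta>_def)
  have "\<theta> \<le> 1" using m by (simp add: \<theta>_def)
  then have sig1: "\<sigma> \<le> 1" using sig(2) by linarith
  obtain K C0 where C0: "C0 \<ge> 1" and Weyl: "\<And>(P :: real poly) n U t. degree P \<le> m \<Longrightarrow> n \<le> U \<Longrightarrow> 1 \<le> U \<Longrightarrow> 1 \<le> t \<Longrightarrow>
     real U \<le> t * norm (\<Sum>u=1..n. ee (poly P (real u))) \<Longrightarrow>
     (\<exists>q a::int. 1 \<le> q \<and> real_of_int q \<le> C0 * t ^ K \<and> \<bar>of_int q * coeff P m - of_int a\<bar> \<le> C0 * t ^ K / real U ^ m)"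
    using Weyl_inequality[of m'] unfolding m' by blast
  obtain C1 where C1: "C1 \<ge> 1" "\<And>B. (\<Sum>w\<in>kernels m B. real w powr (- \<sigma>)) \<le> C1"
    using sum_kernels_powr[OF m sig(1)] by blast
  \<comment> \<open>With this exponent \<open>t = T powr (1 / \<delta>) * T\<close> dominates both
    \<open>w\<close> and its cofactor.\<close>
  define \<omega> where "\<omega> = 1 + 1 / \<delta>"
  have om: "\<omega> > 0" using del by (simp add: \<omega>_def add_pos_pos)
  \<comment> \<open>The factors \<open>t ^ K\<close> from Weyl's inequality, \<open>t ^ m\<close>
    from the cofactor and \<open>t\<close> from \<open>w\<close> must together be
    \<open>B powr \<rho>\<close>.\<close>
  define \<kappa> where "\<kappa> = \<rho> / (\<omega> * real (K + m + 1))"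
  have kap: "\<kappa> > 0" using rho om by (simp add: \<kappa>_def)
  show ?thesis
  proof (rule that[of "max C0 C1" \<kappa>])
    show "max C0 C1 \<ge> 1" using C0 by simp
    fix d B :: nat and \<alpha> :: real
    assume d: "squarefree d" and B: "B \<ge> 1" and big: "norm (\<Sum>x\<in>full_upto m d B. ee (\<alpha> * real x)) > max C0 C1 * real B powr (1 / real m - \<kappa>)"
    have d0: "d > 0" using d by (metis not_squarefree_0 gr0I)
    define T where "T = real B powr \<kappa>"
    have T: "T \<ge> 1" using B kap by (simp add: T_def ge_one_powr_ge_zero)
    define t where "t = T powr \<omega>"
    have t: "t \<ge> 1" using T om by (simp add: t_def ge_one_powr_ge_zero)
    define e where "e w = cofactor d w" for w
    define I where "I w = (\<Sum>u\<in>{1..ucut m d B w}. ee (\<alpha> * real ((e w * u) ^ m * w)))" for w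
    \<comment> \<open>Otherwise the inner sums would add up to less than the assumed size, because
      the powers \<open>w powr (- \<sigma>)\<close> have a bounded sum.\<close>
    have "\<exists>w\<in>kernels m B. norm (I w) > real B powr \<theta> / T * real w powr (- \<sigma>)"
    proof (rule ccontr)
      assume "\<not> ?thesis"
      then have le: "norm (I w) \<le> real B powr \<theta> / T * real w powr (- \<sigma>)" if "w \<in> kernels m B" for w using that by force
      have "norm (\<Sum>x\<in>full_upto m d B. ee (\<alpha> * real x)) = norm (\<Sum>w\<in>kernels m B. I w)"
        unfolding I_def e_def by (subst sum_full_upto[OF m d]) simp
      also have "\<dots> \<le> (\<Sum>w\<in>kernels m B. real B powr \<theta> / T * real w powr (- \<sigma>))" using le by (rule sum_norm_le)
      also have "\<dots> = real B powr \<theta> / T * (\<Sum>w\<in>kernels m B. real w powr (- \<sigma>))" by (simp only: sum_distrib_left)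
      also have "\<dots> \<le> real B powr \<theta> / T * max C0 C1" using C1(2)[of B] T by (intro mult_left_mono) auto
      also have "\<dots> = max C0 C1 * real B powr (1 / real m - \<kappa>)" by (simp add: \<theta>_def T_def powr_diff)
      finally show False using big by simp
    qed
    then obtain w where wk: "w \<in> kernels m B" and Iw: "norm (I w) > real B powr \<theta> / T * real w powr (- \<sigma>)" by blast
    have w0: "w > 0" using wk by (rule kernels_pos)
    have e0: "e w > 0" using cofactor_pos[OF d0] by (simp add: e_def)
    define U where "U = ucut m d B w"
    have IU: "norm (I w) \<le> real U" unfolding I_def U_def using sum_norm_le[of "{1..ucut m d B w}" "\<lambda>u. ee (\<alpha> * real ((e w * u) ^ m * w))" "\<lambda>_. 1"] by simp
    have Ule: "real U \<le> real B powr \<theta> * real w powr (- \<theta>) / real (e w)"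
      using ucut_le[of m d B w] w0 by (simp add: U_def \<theta>_def e_def powr_divide powr_minus field_simps)
    have U1: "U \<ge> 1"
    proof (rule ccontr)
      assume "\<not> U \<ge> 1"
      then have "U = 0" by simp
      then have "norm (I w) \<le> 0" using IU by simp
      moreover have "0 \<le> real B powr \<theta> / T * real w powr (- \<sigma>)" using T by simp
      ultimately show False using Iw by linarith
    qed
    \<comment> \<open>The trivial bound for the inner sum decays like
      \<open>w powr (- \<theta>)\<close> and the assumed lower bound only like
      \<open>w powr (- \<sigma>)\<close>; comparing them bounds \<open>w\<close> and
      \<open>e w\<close>.\<close>
    have we: "real w powr \<delta> * real (e w) \<le> T"
    proof -
      have Bp: "real B powr \<theta> > 0" using B by simp
      have "real B powr \<theta> / T * real w powr (- \<sigma>) \<le> real B powr \<theta> * real w powr (- \<theta>) / real (e w)" using Iw IU Ule by linarith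
      then have "real B powr \<theta> * (real w powr (- \<sigma>) / T) \<le> real B powr \<theta> * (real w powr (- \<theta>) / real (e w))" by simp
      then have "real w powr (- \<sigma>) / T \<le> real w powr (- \<theta>) / real (e w)" using Bp by (simp only: mult_le_cancel_left_pos)
      then have "real w powr (- \<sigma>) * real (e w) \<le> real w powr (- \<theta>) * T" using T e0 by (simp add: field_simps)
      then have "real w powr \<theta> * (real w powr (- \<sigma>) * real (e w)) \<le> real w powr \<theta> * (real w powr (- \<theta>) * T)" by (intro mult_left_mono) auto
      then show ?thesis using w0 by (simp add: \<delta>_def flip: powr_add mult.assoc)
    qed
    have w1: "real w \<ge> 1" using w0 by simp
    have eT: "real (e w) \<le> T"
    proof -
      have "1 * real (e w) \<le> real w powr \<delta> * real (e w)" using w1 del by (intro mult_right_mono ge_one_powr_ge_zero) auto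
      then show ?thesis using we by simp
    qed
    have wT: "real w \<le> T powr (1 / \<delta>)"
    proof -
      have "real w powr \<delta> * 1 \<le> real w powr \<delta> * real (e w)" using e0 by (intro mult_left_mono) auto
      then have "real w powr \<delta> \<le> T" using we by simp
      then have "(real w powr \<delta>) powr (1 / \<delta>) \<le> T powr (1 / \<delta>)" using del by (intro powr_mono2) auto
      then show ?thesis using del w0 by (simp add: powr_powr)
    qed
    have Tt: "T powr (1 / \<delta>) * T = t" using T by (simp add: t_def \<omega>_def powr_add mult.commute)
    have T1: "T powr (1 / \<delta>) \<ge> 1" using T del by (intro ge_one_powr_ge_zero) auto
    have Tlt: "T \<le> t" using mult_right_mono[OF T1, of T] T Tt by simp
    have wt: "real w \<le> t" using wT mult_left_mono[OF T, of "T powr (1 / \<delta>)"] Tt T1 by simp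
    have BI: "real B powr \<theta> \<le> t * norm (I w)"
    proof -
      have "real w powr \<sigma> \<le> real w powr 1" using w1 sig1 by (intro powr_mono) auto
      then have "real w powr \<sigma> \<le> T powr (1 / \<delta>)" using wT w0 by simp
      then have "T * real w powr \<sigma> \<le> t" using T Tt by (metis mult.commute mult_right_mono zero_le_one order_trans)
      moreover have "real B powr \<theta> = (T * real w powr \<sigma>) * (real B powr \<theta> / T * real w powr (- \<sigma>))"
        using T w0 by (simp add: powr_minus field_simps)
      moreover have "real B powr \<theta> / T * real w powr (- \<sigma>) \<ge> 0" using T by simp
      ultimately have "real B powr \<theta> \<le> t * (real B powr \<theta> / T * real w powr (- \<sigma>))" using mult_right_mono by metis
      also have "\<dots> \<le> t * norm (I w)" using Iw t by (intro mult_left_mono) auto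
      finally show ?thesis .
    qed
    have UB: "real U \<le> real B powr \<theta>"
    proof -
      have "real w powr (- \<theta>) / real (e w) \<le> 1 / 1" using w1 e0 sig by (intro frac_le) (auto simp: powr_minus_divide ge_one_powr_ge_zero)
      then have "real B powr \<theta> * (real w powr (- \<theta>) / real (e w)) \<le> real B powr \<theta> * 1" by (intro mult_left_mono) auto
      then show ?thesis using Ule by simp
    qed
    define b where "b = \<alpha> * real (e w ^ m * w)"
    have "real U \<le> t * norm (\<Sum>u=1..U. ee (poly (monom b m) (real u)))"
    proof -
      have "(\<Sum>u=1..U. ee (poly (monom b m) (real u))) = I w"
        unfolding I_def U_def b_def by (intro sum.cong refl) (simp add: poly_monom power_mult_distrib mult_ac)
      then show ?thesis using BI UB by simp
    qed
    from Weyl[OF degree_monom_le order_refl U1 t this] obtain q a :: int where qa: "1 \<le> q" "real_of_int q \<le> C0 * t ^ K"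
      "\<bar>of_int q * b - of_int a\<bar> \<le> C0 * t ^ K / real U ^ m" by auto
    define q' where "q' = q * int (e w ^ m * w)"
    have "1 * 1 \<le> q * int (e w ^ m * w)" using qa(1) e0 w0 by (intro mult_mono) (auto simp: Suc_le_eq simp flip: of_nat_mult of_nat_power)
    then have q1: "1 \<le> q'" by (simp add: q'_def)
    have tK: "t ^ (K + m + 1) = real B powr \<rho>"
    proof -
      have "t ^ (K + m + 1) = t powr real (K + m + 1)" using t by (intro powr_realpow[symmetric]) auto
      also have "\<dots> = real B powr (\<kappa> * \<omega> * real (K + m + 1))" by (simp add: t_def T_def powr_powr mult_ac)
      also have "\<kappa> * \<omega> * real (K + m + 1) = \<rho>" using om by (simp add: \<kappa>_def)
      finally show ?thesis .
    qed
    have "real_of_int q' = real_of_int q * (real (e w) ^ m * real w)" by (simp add: q'_def)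
    also have "\<dots> \<le> (C0 * t ^ K) * (t ^ m * t)"
      using qa(2) eT Tlt wt C0 t by (intro mult_mono power_mono) auto
    also have "\<dots> = C0 * t ^ (K + m + 1)" by (simp add: power_add)
    also have "\<dots> \<le> max C0 C1 * real B powr \<rho>" unfolding tK by (intro mult_right_mono) auto
    finally have q2: "real_of_int q' \<le> max C0 C1 * real B powr \<rho>" .
    have Um: "real B \<le> t ^ m * real U ^ m"
    proof -
      have "real B powr \<theta> \<le> t * real U" using BI IU t by (meson mult_left_mono order_trans zero_le_one)
      then have "(real B powr \<theta>) ^ m \<le> (t * real U) ^ m" by (intro power_mono) auto
      moreover have "(real B powr \<theta>) ^ m = real B" using B m by (simp add: \<theta>_def powr_powr flip: powr_realpow)
      ultimately show ?thesis by (simp add: power_mult_distrib)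
    qed
    have "\<bar>of_int q' * \<alpha> - of_int a\<bar> = \<bar>of_int q * b - of_int a\<bar>" by (simp add: q'_def b_def mult_ac)
    also have "\<dots> \<le> C0 * t ^ K / real U ^ m" by (rule qa(3))
    also have "\<dots> \<le> C0 * t ^ K * (t ^ m / real B)"
    proof -
      have "1 / real U ^ m \<le> t ^ m / real B" using Um U1 B by (simp add: field_simps)
      then have "C0 * t ^ K * (1 / real U ^ m) \<le> C0 * t ^ K * (t ^ m / real B)" using C0 t by (intro mult_left_mono) auto
      then show ?thesis by simp
    qed
    also have "\<dots> = C0 * t ^ (K + m) / real B" by (simp add: power_add)
    also have "\<dots> \<le> C0 * t ^ (K + m + 1) / real B" using C0 t by (intro divide_right_mono mult_left_mono power_increasing) auto
    also have "\<dots> \<le> max C0 C1 * real B powr \<rho> / real B" unfolding tK by (intro divide_right_mono mult_right_mono) auto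
    finally show "\<exists>q a::int. 1 \<le> q \<and> real_of_int q \<le> max C0 C1 * real B powr \<rho> \<and> \<bar>of_int q * \<alpha> - of_int a\<bar> \<le> max C0 C1 * real B powr \<rho> / real B"
      using q1 q2 by blast
  qed (rule kap)
qed

section \<open>Diagonal equations in full numbers\<close>

lemma uniform_constant:
  fixes P :: "'a \<Rightarrow> real \<Rightarrow> bool"
  assumes "finite I" "\<And>i. i \<in> I \<Longrightarrow> \<exists>C. \<forall>C'\<ge>C. P i C'"
  shows "\<exists>C\<ge>1. \<forall>i\<in>I. P i C"
proof -
  obtain f where f: "\<And>i C'. i \<in> I \<Longrightarrow> C' \<ge> f i \<Longrightarrow> P i C'" using assms(2) by metis
  define C where "C = (\<Sum>i\<in>I. \<bar>f i\<bar>) + 1"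
  have "f i \<le> C" if "i \<in> I" for i
    using member_le_sum[of i I "\<lambda>i. \<bar>f i\<bar>"] assms(1) that by (simp add: C_def)
  then show ?thesis using f by (intro exI[of _ C]) (auto simp: C_def sum_nonneg)
qed

definition full_signed :: "nat \<Rightarrow> nat \<Rightarrow> nat \<Rightarrow> int set" where
  "full_signed m d B = int ` full_upto m d B \<union> (\<lambda>x. - int x) ` full_upto m d B"

lemma finite_full_signed [simp]: "finite (full_signed m d B)"
  by (simp add: full_signed_def)

lemma full_signed_bounds:
  assumes "x \<in> full_signed m d B"
  shows "x \<noteq> 0" "\<bar>x\<bar> \<le> int B"
  using assms by (auto simp: full_signed_def full_upto_def)

lemma sum_full_signed: "(\<Sum>x\<in>full_signed m d B. f x) = (\<Sum>x\<in>full_upto m d B. f (int x)) + (\<Sum>x\<in>full_upto m d B. f (- int x))"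
proof -
  have "int ` full_upto m d B \<inter> (\<lambda>x. - int x) ` full_upto m d B = {}" by (auto simp: full_upto_def)
  then have "(\<Sum>x\<in>full_signed m d B. f x) = sum f (int ` full_upto m d B) + sum f ((\<lambda>x. - int x) ` full_upto m d B)"
    unfolding full_signed_def by (intro sum.union_disjoint) auto
  then show ?thesis by (simp add: sum.reindex inj_on_def)
qed

text \<open>Since \<open>Q\<close> exceeds every value of the linear form, a congruence modulo
  \<open>Q\<close> is an equation; finite Fourier analysis replaces the integral over the
  circle.\<close>

lemma card_zero_sum_fourier:
  fixes X :: "nat \<Rightarrow> int set"
  assumes X: "\<And>i. i \<le> n \<Longrightarrow> finite (X i)" and Q: "Q > 0"
    and small: "\<And>x. x \<in> PiE {..n} X \<Longrightarrow> \<bar>\<Sum>i\<le>n. c i * x i\<bar> < Q"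
  shows "of_nat (card {x \<in> PiE {..n} X. (\<Sum>i\<le>n. c i * x i) = 0}) * of_int Q = (\<Sum>r\<in>{0..<Q}. \<Prod>i\<le>n. \<Sum>x\<in>X i. em Q (r * (c i * x)))"
proof -
  define T where "T = PiE {..n} X"
  have T: "finite T" unfolding T_def using X by (intro finite_PiE) auto
  have "(\<Sum>r\<in>{0..<Q}. \<Prod>i\<le>n. \<Sum>x\<in>X i. em Q (r * (c i * x))) = (\<Sum>r\<in>{0..<Q}. \<Sum>x\<in>T. em Q (r * (\<Sum>i\<le>n. c i * x i)))"
  proof (intro sum.cong refl)
    fix r
    have "(\<Prod>i\<le>n. \<Sum>x\<in>X i. em Q (r * (c i * x))) = (\<Sum>x\<in>T. \<Prod>i\<le>n. em Q (r * (c i * x i)))"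
      unfolding T_def using X by (intro prod_sum_PiE) auto
    then show "(\<Prod>i\<le>n. \<Sum>x\<in>X i. em Q (r * (c i * x))) = (\<Sum>x\<in>T. em Q (r * (\<Sum>i\<le>n. c i * x i)))"
      by (simp add: sum_distrib_left em_sum)
  qed
  also have "\<dots> = (\<Sum>x\<in>T. \<Sum>r\<in>{0..<Q}. em Q (r * (\<Sum>i\<le>n. c i * x i)))" by (rule sum.swap)
  also have "\<dots> = (\<Sum>x\<in>T. if (\<Sum>i\<le>n. c i * x i) = 0 then of_int Q else 0)"
  proof (intro sum.cong refl)
    fix x assume "x \<in> T"
    then have "\<bar>\<Sum>i\<le>n. c i * x i\<bar> < Q" using small by (simp add: T_def)
    then have "Q dvd (\<Sum>i\<le>n. c i * x i) \<longleftrightarrow> (\<Sum>i\<le>n. c i * x i) = 0"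
      using Q by (metis abs_ge_zero abs_of_pos dvd_0_right dvd_imp_le_int leD)
    then show "(\<Sum>r\<in>{0..<Q}. em Q (r * (\<Sum>i\<le>n. c i * x i))) = (if (\<Sum>i\<le>n. c i * x i) = 0 then of_int Q else 0)"
      by (simp add: sum_em[OF Q])
  qed
  also have "\<dots> = of_nat (card {x \<in> T. (\<Sum>i\<le>n. c i * x i) = 0}) * of_int Q"
    using T by (simp add: sum.inter_filter[symmetric])
  finally show ?thesis by (simp add: T_def)
qed

text \<open>The equation is put in homogeneous form, with \<open>x n\<close> on the same footing as
  the other variables; the application has \<open>c n = - 1\<close>.\<close>

locale diagonal_data =
  fixes n :: nat and c :: "nat \<Rightarrow> int" and m :: "nat \<Rightarrow> nat" and j :: nat
  assumes c: "\<And>i. i \<le> n \<Longrightarrow> c i \<noteq> 0" and m: "\<And>i. i \<le> n \<Longrightarrow> m i \<ge> 2" and j: "j \<le> n"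
    and crit: "(\<Sum>i\<in>{..n} - {j}. 1 / (real (m i) * (real (m i) + 1))) \<ge> 1"
begin

definition \<Theta> :: real where
  "\<Theta> = (\<Sum>i\<le>n. 1 / real (m i)) - 1"

definition solutions :: "nat \<Rightarrow> nat \<Rightarrow> (nat \<Rightarrow> int) set" where
  "solutions d B = {x \<in> PiE {..n} (\<lambda>i. full_signed (m i) d B). (\<Sum>i\<le>n. c i * x i) = 0}"

definition S :: "nat \<Rightarrow> nat \<Rightarrow> int \<Rightarrow> nat \<Rightarrow> int \<Rightarrow> complex" where
  "S d B Q i r = (\<Sum>x\<in>full_signed (m i) d B. em Q (r * (c i * x)))"

text \<open>Large enough for two purposes: modulo \<open>csum * B\<close> the linear equation is
  detected exactly, and so is the system behind the mean value for each single variable.\<close>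

definition csum :: int where
  "csum = (\<Sum>i\<le>n. \<bar>c i\<bar> * (int (crit (m i)) + 1)) + 1"

lemma csum: "i \<le> n \<Longrightarrow> \<bar>c i\<bar> * int (crit (m i)) < csum" "(\<Sum>i\<le>n. \<bar>c i\<bar>) < csum" "i \<le> n \<Longrightarrow> \<bar>c i\<bar> < csum" "csum > 0"
proof -
  have le: "\<bar>c i\<bar> * (int (crit (m i)) + 1) \<le> (\<Sum>i\<le>n. \<bar>c i\<bar> * (int (crit (m i)) + 1))" if "i \<le> n" for i
    using that by (intro member_le_sum) auto
  show "\<bar>c i\<bar> * int (crit (m i)) < csum" if "i \<le> n" for i
    using le[OF that] by (simp add: csum_def distrib_left)
  have "\<bar>c i\<bar> * 1 \<le> \<bar>c i\<bar> * (int (crit (m i)) + 1)" for i by (intro mult_left_mono) auto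
  then have l1: "\<bar>c i\<bar> \<le> \<bar>c i\<bar> * (int (crit (m i)) + 1)" for i by simp
  then have "(\<Sum>i\<le>n. \<bar>c i\<bar>) \<le> (\<Sum>i\<le>n. \<bar>c i\<bar> * (int (crit (m i)) + 1))" by (rule sum_mono)
  then show "(\<Sum>i\<le>n. \<bar>c i\<bar>) < csum" by (simp add: csum_def)
  show "\<bar>c i\<bar> < csum" if "i \<le> n" for i using le[OF that] l1[of i] by (simp add: csum_def)
  show "csum > 0" unfolding csum_def by (intro add_nonneg_pos sum_nonneg) auto
qed

lemma card_solutions_fourier:
  assumes B: "B \<ge> 1" and Q: "csum * int B \<le> Q"
  shows "of_nat (card (solutions d B)) * of_int Q = (\<Sum>r\<in>{0..<Q}. \<Prod>i\<le>n. S d B Q i r)"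
  unfolding solutions_def S_def
proof (rule card_zero_sum_fourier)
  have "csum * int B > 0" using csum(4) B by simp
  then show Q0: "Q > 0" using Q by linarith
  fix x assume x: "x \<in> PiE {..n} (\<lambda>i. full_signed (m i) d B)"
  have "\<bar>\<Sum>i\<le>n. c i * x i\<bar> \<le> (\<Sum>i\<le>n. \<bar>c i * x i\<bar>)" by (rule sum_abs)
  also have "\<dots> \<le> (\<Sum>i\<le>n. \<bar>c i\<bar> * int B)"
    unfolding abs_mult using x by (intro sum_mono mult_left_mono full_signed_bounds(2)) (auto simp: PiE_iff)
  also have "\<dots> = (\<Sum>i\<le>n. \<bar>c i\<bar>) * int B" by (simp add: sum_distrib_right)
  also have "\<dots> < csum * int B" using csum(2) B by (intro mult_strict_right_mono) auto
  finally show "\<bar>\<Sum>i\<le>n. c i * x i\<bar> < Q" using Q by linarith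
qed simp

text \<open>The density of multiples of \<open>d\<close> gives \<open>1 / d\<close>; the power of
  \<open>tau d\<close> costs \<open>d powr (1 / 4)\<close>. Two savings of this kind make
  \<open>d powr (- 3 / 2)\<close>, which is summable.\<close>

lemma norm_S_le:
  "\<exists>C\<ge>1. \<forall>i\<in>{..n}. \<forall>d B Q r. squarefree d \<longrightarrow> norm (S d B Q i r) \<le> C * real B powr (1 / real (m i)) * real d powr (- 3 / 4)"
proof (rule uniform_constant)
  fix i assume "i \<in> {..n}"
  then have mi: "m i \<ge> 1" using m[of i] by simp
  obtain C1 where C1: "C1 \<ge> 1" "\<And>B d. squarefree d \<Longrightarrow>
    real (card (full_upto (m i) d B)) \<le> C1 * real B powr (1 / real (m i)) * real (tau d) ^ (m i - 1) / real d"
    using card_full_upto_le[OF mi] by blast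
  obtain C2 where C2: "C2 \<ge> 1" "\<And>d. squarefree d \<Longrightarrow> real (tau d) ^ (m i - 1) \<le> C2 * real d powr (1 / 4)"
    using tau_power_le[of "1 / 4" "m i - 1"] by (metis zero_less_divide_1_iff zero_less_numeral)
  have "norm (S d B Q i r) \<le> C' * real B powr (1 / real (m i)) * real d powr (- 3 / 4)"
    if C': "C' \<ge> 2 * C1 * C2" and d: "squarefree d" for C' d B Q r
  proof -
    have d0: "d > 0" using d by (metis not_squarefree_0 gr0I)
    have "norm (S d B Q i r) \<le> (\<Sum>x\<in>full_signed (m i) d B. 1)" unfolding S_def by (intro sum_norm_le) simp
    also have "\<dots> = 2 * real (card (full_upto (m i) d B))" by (subst sum_full_signed) simp
    also have "\<dots> \<le> 2 * (C1 * real B powr (1 / real (m i)) * real (tau d) ^ (m i - 1) / real d)"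
      using C1(2)[OF d, of B] by simp
    also have "\<dots> \<le> 2 * (C1 * real B powr (1 / real (m i)) * (C2 * real d powr (1 / 4)) / real d)"
      using C2(2)[OF d] C1(1) by (intro mult_left_mono divide_right_mono) auto
    also have "\<dots> = (2 * C1 * C2) * real B powr (1 / real (m i)) * (real d powr (1 / 4) * real d powr (- 1))"
      using d0 by (simp add: powr_minus_divide)
    also have "real d powr (1 / 4) * real d powr (- 1) = real d powr (- 3 / 4)" by (simp only: powr_add[symmetric]) simp
    also have "(2 * C1 * C2) * real B powr (1 / real (m i)) * real d powr (- 3 / 4) \<le> C' * real B powr (1 / real (m i)) * real d powr (- 3 / 4)"
      using C' by (intro mult_right_mono) auto
    finally show ?thesis .
  qed
  then show "\<exists>C. \<forall>C'\<ge>C. \<forall>d B Q r. squarefree d \<longrightarrow> norm (S d B Q i r) \<le> C' * real B powr (1 / real (m i)) * real d powr (- 3 / 4)"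
    by blast
qed simp

lemma mean_S_le:
  assumes eps: "\<epsilon> > 0"
  shows "\<exists>C\<ge>1. \<forall>i\<in>{..n}. \<forall>d B Q. squarefree d \<longrightarrow> B \<ge> 1 \<longrightarrow> csum * int B \<le> Q \<longrightarrow>
    avg {0..<Q} (\<lambda>r. norm (S d B Q i r) ^ (2 * crit (m i))) \<le> C * real B powr (real (m i) + \<epsilon>) * real d powr (- 3 / 4)"
proof (rule uniform_constant)
  fix i assume "i \<in> {..n}"
  then have i: "i \<le> n" and mi: "m i \<ge> 1" using m[of i] by auto
  define p where "p = 2 * crit (m i)"
  have p: "p > 0" using crit_pos[OF mi] by (simp add: p_def)
  obtain C1 where C1: "C1 \<ge> 1" "\<And>B d Q c. squarefree d \<Longrightarrow> B \<ge> 1 \<Longrightarrow> c \<noteq> 0 \<Longrightarrow> \<bar>c\<bar> * (int (crit (m i)) * int B) < Q \<Longrightarrow>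
    avg {0..<Q} (\<lambda>r. norm (\<Sum>x\<in>full_upto (m i) d B. em Q (r * (c * int x))) ^ p)
      \<le> C1 * real B powr (real (m i) + \<epsilon>) * real (tau d) ^ ((m i - 1) * p) / real d"
    using mean_value_full[OF mi eps] unfolding p_def by blast
  obtain C2 where C2: "C2 \<ge> 1" "\<And>d. squarefree d \<Longrightarrow> real (tau d) ^ ((m i - 1) * p) \<le> C2 * real d powr (1 / 4)"
    using tau_power_le[of "1 / 4" "(m i - 1) * p"] by (metis zero_less_divide_1_iff zero_less_numeral)
  have "avg {0..<Q} (\<lambda>r. norm (S d B Q i r) ^ p) \<le> C' * real B powr (real (m i) + \<epsilon>) * real d powr (- 3 / 4)"
    if C': "C' \<ge> 2 ^ p * C1 * C2" and d: "squarefree d" and B: "B \<ge> 1" and Q: "csum * int B \<le> Q" for C' d B Q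
  proof -
    have d0: "d > 0" using d by (metis not_squarefree_0 gr0I)
    define z where "z r = (\<Sum>x\<in>full_upto (m i) d B. em Q (r * (c i * int x)))" for r
    have "norm (S d B Q i r) \<le> 2 * norm (z r)" for r
    proof -
      have "(\<Sum>x\<in>full_upto (m i) d B. em Q (r * (c i * - int x))) = cnj (z r)"
        by (simp add: z_def em_minus)
      then have "S d B Q i r = z r + cnj (z r)" unfolding S_def sum_full_signed z_def by simp
      then show ?thesis using norm_triangle_ineq[of "z r" "cnj (z r)"] by simp
    qed
    then have "avg {0..<Q} (\<lambda>r. norm (S d B Q i r) ^ p) \<le> avg {0..<Q} (\<lambda>r. 2 ^ p * norm (z r) ^ p)"
      unfolding power_mult_distrib[symmetric] by (intro avg_mono power_mono) auto
    also have "\<dots> = 2 ^ p * avg {0..<Q} (\<lambda>r. norm (z r) ^ p)" by (rule avg_cmult)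
    also have "avg {0..<Q} (\<lambda>r. norm (z r) ^ p) \<le> C1 * real B powr (real (m i) + \<epsilon>) * real (tau d) ^ ((m i - 1) * p) / real d"
      unfolding z_def
    proof (rule C1(2)[OF d B c[OF i]])
      have "(\<bar>c i\<bar> * int (crit (m i))) * int B < csum * int B" using csum(1)[OF i] B by (intro mult_strict_right_mono) auto
      then show "\<bar>c i\<bar> * (int (crit (m i)) * int B) < Q" using Q by (simp add: mult.assoc)
    qed
    also have "\<dots> \<le> C1 * real B powr (real (m i) + \<epsilon>) * (C2 * real d powr (1 / 4)) / real d"
      using C2(2)[OF d] C1(1) by (intro mult_left_mono divide_right_mono) auto
    also have "2 ^ p * \<dots> = (2 ^ p * C1 * C2) * real B powr (real (m i) + \<epsilon>) * (real d powr (1 / 4) * real d powr (- 1))"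
      using d0 by (simp add: powr_minus_divide)
    also have "real d powr (1 / 4) * real d powr (- 1) = real d powr (- 3 / 4)" by (simp only: powr_add[symmetric]) simp
    also have "(2 ^ p * C1 * C2) * real B powr (real (m i) + \<epsilon>) * real d powr (- 3 / 4) \<le> C' * real B powr (real (m i) + \<epsilon>) * real d powr (- 3 / 4)"
      using C' by (intro mult_right_mono) auto
    finally show ?thesis by simp
  qed
  then show "\<exists>C. \<forall>C'\<ge>C. \<forall>d B Q. squarefree d \<longrightarrow> B \<ge> 1 \<longrightarrow> csum * int B \<le> Q \<longrightarrow>
    avg {0..<Q} (\<lambda>r. norm (S d B Q i r) ^ (2 * crit (m i))) \<le> C' * real B powr (real (m i) + \<epsilon>) * real d powr (- 3 / 4)"
    unfolding p_def by blast
qed simp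

text \<open>Hoelder's inequality with weights proportional to \<open>1 / (m\<^sub>i (m\<^sub>i + 1))\<close>; the excess over the critical
  exponent is absorbed by the trivial bound.\<close>
lemma mean_product_S_le:
  assumes eps: "\<epsilon> > 0"
  shows "\<exists>C\<ge>1. \<forall>d B Q. squarefree d \<longrightarrow> B \<ge> 1 \<longrightarrow> csum * int B \<le> Q \<longrightarrow>
    avg {0..<Q} (\<lambda>r. \<Prod>i\<in>{..n} - {j}. norm (S d B Q i r))
      \<le> C * real B powr ((\<Sum>i\<in>{..n} - {j}. 1 / real (m i)) - 1 + \<epsilon>) * real d powr (- 3 / 4)"
proof -
  define I where "I = {..n} - {j}"
  have I: "finite I" "\<And>i. i \<in> I \<Longrightarrow> i \<le> n" by (auto simp: I_def)
  define p where "p i = 2 * crit (m i)" for i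
  have p: "p i > 0" "real (p i) = real (m i) * (real (m i) + 1)" if "i \<in> I" for i
  proof -
    show "p i > 0" using crit_pos[of "m i"] m[OF I(2)[OF that]] by (simp add: p_def)
    have "p i = m i * (m i + 1)" by (simp only: p_def two_crit)
    then show "real (p i) = real (m i) * (real (m i) + 1)" by (simp add: distrib_left)
  qed
  define W where "W = (\<Sum>i\<in>I. 1 / real (p i))"
  have W: "W \<ge> 1"
  proof -
    have "W = (\<Sum>i\<in>I. 1 / (real (m i) * (real (m i) + 1)))" unfolding W_def by (intro sum.cong refl) (simp add: p)
    then show ?thesis using crit by (simp add: I_def)
  qed
  \<comment> \<open>The weights are normalised by \<open>W \<ge> 1\<close>, so the Hoelder exponent
    \<open>1 / t i = p i * W\<close> is at least the critical one.\<close>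
  define t where "t i = 1 / (real (p i) * W)" for i
  have t: "t i > 0" "t i * real (p i) \<le> 1" if "i \<in> I" for i
    using p(1)[OF that] W by (auto simp: t_def)
  have ts: "(\<Sum>i\<in>I. t i) = 1"
  proof -
    have "(\<Sum>i\<in>I. t i) = (\<Sum>i\<in>I. 1 / real (p i)) / W" unfolding t_def sum_divide_distrib by (intro sum.cong refl) simp
    then show ?thesis using W by (simp add: W_def[symmetric])
  qed
  obtain C1 where C1: "C1 \<ge> 1" "\<And>i d B Q r. i \<le> n \<Longrightarrow> squarefree d \<Longrightarrow> norm (S d B Q i r) \<le> C1 * real B powr (1 / real (m i)) * real d powr (- 3 / 4)"
    using norm_S_le by auto
  obtain C2 where C2: "C2 \<ge> 1" "\<And>i d B Q. i \<le> n \<Longrightarrow> squarefree d \<Longrightarrow> B \<ge> 1 \<Longrightarrow> csum * int B \<le> Q \<Longrightarrow>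
    avg {0..<Q} (\<lambda>r. norm (S d B Q i r) ^ (p i)) \<le> C2 * real B powr (real (m i) + \<epsilon>) * real d powr (- 3 / 4)"
    using mean_S_le[OF eps] unfolding p_def by auto
  define C where "C = (\<Prod>i\<in>I. C1 * C2)"
  have CC: "C1 * C2 \<ge> 1" using mult_mono[of 1 C1 1 C2] C1(1) C2(1) by simp
  have Cge: "C \<ge> 1" unfolding C_def using CC by (intro prod_ge_1) auto
  have "avg {0..<Q} (\<lambda>r. \<Prod>i\<in>I. norm (S d B Q i r))
      \<le> C * real B powr ((\<Sum>i\<in>I. 1 / real (m i)) - 1 + \<epsilon>) * real d powr (- 3 / 4)"
    if d: "squarefree d" and B: "B \<ge> 1" and Q: "csum * int B \<le> Q" for d B Q
  proof -
    have d0: "d > 0" using d by (metis not_squarefree_0 gr0I)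
    have d34: "real d powr (- 3 / 4) \<le> 1" using powr_mono[of "- 3 / 4" 0 "real d"] d0 by simp
    define Y where "Y i = C1 * real B powr (1 / real (m i))" for i
    have Y1: "Y i \<ge> 1" for i
    proof -
      have "1 * 1 \<le> C1 * real B powr (1 / real (m i))" using C1(1) B by (intro mult_mono ge_one_powr_ge_zero) auto
      then show ?thesis by (simp add: Y_def)
    qed
    have SY: "norm (S d B Q i r) \<le> Y i" if "i \<in> I" for i r
    proof -
      have "norm (S d B Q i r) \<le> Y i * real d powr (- 3 / 4)" using C1(2)[OF I(2)[OF that] d] by (simp add: Y_def)
      also have "\<dots> \<le> Y i * 1" using d34 Y1[of i] by (intro mult_left_mono) auto
      finally show ?thesis by simp
    qed
    define u where "u i r = norm (S d B Q i r) powr (1 / t i)" for i r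
    have "avg {0..<Q} (\<lambda>r. \<Prod>i\<in>I. norm (S d B Q i r)) = avg {0..<Q} (\<lambda>r. \<Prod>i\<in>I. u i r powr t i)"
    proof (intro avg_cong refl prod.cong)
      fix i r assume "i \<in> I"
      then show "norm (S d B Q i r) = u i r powr t i" using t(1) by (simp add: u_def powr_powr less_imp_neq[symmetric])
    qed
    also have "\<dots> \<le> (\<Prod>i\<in>I. avg {0..<Q} (u i) powr t i)"
      using I t ts by (intro avg_Holder) (auto simp: u_def)
    also have "\<dots> \<le> (\<Prod>i\<in>I. (C1 * C2) * (real B powr (1 / real (m i) - t i + \<epsilon> * t i) * real d powr (- 3 / 4 * t i)))"
    proof (intro prod_mono conjI)
      fix i assume i: "i \<in> I"
      have pt: "real (p i) \<le> 1 / t i" using t[OF i] by (simp add: field_simps)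
      \<comment> \<open>The surplus \<open>1 / t i - p i\<close> of factors is estimated by the
        trivial bound \<open>Y i\<close>.\<close>
      have u_le: "u i r \<le> Y i powr (1 / t i - real (p i)) * norm (S d B Q i r) ^ p i" for r
      proof (cases "S d B Q i r = 0")
        case False
        then have "u i r = norm (S d B Q i r) powr (1 / t i - real (p i)) * norm (S d B Q i r) powr real (p i)"
          by (simp add: u_def flip: powr_add)
        also have "\<dots> \<le> Y i powr (1 / t i - real (p i)) * norm (S d B Q i r) powr real (p i)"
          using pt SY[OF i] by (intro mult_right_mono powr_mono2) auto
        also have "norm (S d B Q i r) powr real (p i) = norm (S d B Q i r) ^ p i" using False by (intro powr_realpow) auto
        finally show ?thesis .
      qed (simp add: u_def)
      have "avg {0..<Q} (u i) \<le> avg {0..<Q} (\<lambda>r. Y i powr (1 / t i - real (p i)) * norm (S d B Q i r) ^ p i)"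
        by (intro avg_mono u_le)
      also have "\<dots> = Y i powr (1 / t i - real (p i)) * avg {0..<Q} (\<lambda>r. norm (S d B Q i r) ^ p i)" by (rule avg_cmult)
      also have "\<dots> \<le> Y i powr (1 / t i - real (p i)) * (C2 * real B powr (real (m i) + \<epsilon>) * real d powr (- 3 / 4))"
        using C2(2)[OF I(2)[OF i] d B Q] by (intro mult_left_mono) auto
      finally have "avg {0..<Q} (u i) powr t i \<le> (Y i powr (1 / t i - real (p i)) * (C2 * real B powr (real (m i) + \<epsilon>) * real d powr (- 3 / 4))) powr t i"
        using t(1)[OF i] by (intro powr_mono2 avg_nonneg) (auto simp: u_def)
      also have "\<dots> = Y i powr ((1 / t i - real (p i)) * t i) * C2 powr t i * (real B powr ((real (m i) + \<epsilon>) * t i) * real d powr (- 3 / 4 * t i))"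
        using C2(1) Y1[of i] by (simp add: powr_mult powr_powr)
      also have "(1 / t i - real (p i)) * t i = 1 - real (p i) * t i" using t(1)[OF i] by (simp add: left_diff_distrib)
      also have "Y i powr (1 - real (p i) * t i) = C1 powr (1 - real (p i) * t i) * real B powr (1 / real (m i) * (1 - real (p i) * t i))"
        using C1(1) by (simp add: Y_def powr_mult powr_powr)
      also have "C1 powr (1 - real (p i) * t i) * real B powr (1 / real (m i) * (1 - real (p i) * t i)) * C2 powr t i * (real B powr ((real (m i) + \<epsilon>) * t i) * real d powr (- 3 / 4 * t i))
         = (C1 powr (1 - real (p i) * t i) * C2 powr t i) * (real B powr (1 / real (m i) * (1 - real (p i) * t i) + (real (m i) + \<epsilon>) * t i) * real d powr (- 3 / 4 * t i))"
        by (simp add: powr_add)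
      \<comment> \<open>Here \<open>p i = m i * (m i + 1)\<close> enters: \<open>p i / m i\<close>
        exceeds \<open>m i\<close> by exactly 1, so each variable loses exactly \<open>t i\<close>,
        and the weights sum to the total loss 1 in the exponent of \<open>B\<close>.\<close>
      also have "1 / real (m i) * (1 - real (p i) * t i) + (real (m i) + \<epsilon>) * t i = 1 / real (m i) - t i + \<epsilon> * t i"
      proof -
        have "real (m i) > 0" using m[OF I(2)[OF i]] by simp
        then show ?thesis unfolding p(2)[OF i] by (simp add: field_simps)
      qed
      also have "(C1 powr (1 - real (p i) * t i) * C2 powr t i) * (real B powr (1 / real (m i) - t i + \<epsilon> * t i) * real d powr (- 3 / 4 * t i))
         \<le> (C1 * C2) * (real B powr (1 / real (m i) - t i + \<epsilon> * t i) * real d powr (- 3 / 4 * t i))"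
      proof (intro mult_right_mono mult_mono)
        have pt0: "real (p i) * t i \<ge> 0" using t(1)[OF i] by simp
        have "C1 powr (1 - real (p i) * t i) \<le> C1 powr 1" using C1(1) pt0 by (intro powr_mono) auto
        then show "C1 powr (1 - real (p i) * t i) \<le> C1" using C1(1) by simp
        have "t i \<le> 1"
        proof -
          have "t i * 1 \<le> t i * real (p i)" using t(1)[OF i] p(1)[OF i] by (intro mult_left_mono) auto
          then show ?thesis using t(2)[OF i] by simp
        qed
        then have "C2 powr t i \<le> C2 powr 1" using C2(1) by (intro powr_mono) auto
        then show "C2 powr t i \<le> C2" using C2(1) by simp
      qed (use C1(1) in auto)
      finally show "avg {0..<Q} (u i) powr t i \<le> (C1 * C2) * (real B powr (1 / real (m i) - t i + \<epsilon> * t i) * real d powr (- 3 / 4 * t i))" .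
    qed simp
    also have "\<dots> = C * (real B powr (\<Sum>i\<in>I. 1 / real (m i) - t i + \<epsilon> * t i) * real d powr (\<Sum>i\<in>I. - 3 / 4 * t i))"
      using B d0 I(1) by (simp add: C_def prod.distrib powr_sum)
    also have "(\<Sum>i\<in>I. 1 / real (m i) - t i + \<epsilon> * t i) = (\<Sum>i\<in>I. 1 / real (m i)) - 1 + \<epsilon>"
      by (simp add: sum.distrib sum_subtractf ts sum_distrib_left[symmetric])
    also have "(\<Sum>i\<in>I. - 3 / 4 * t i) = - 3 / 4" by (simp only: sum_distrib_left[symmetric] ts mult_1_right)
    finally show ?thesis by (simp only: mult.assoc)
  qed
  then show ?thesis unfolding I_def using Cge by blast
qed

text \<open>The sum with index \<open>j\<close> is bounded trivially and the product of the others
  in mean. Each of the two estimates saves \<open>d powr (- 3 / 4)\<close>.\<close>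

lemma card_solutions_tail:
  assumes eps: "\<epsilon> > 0"
  shows "\<exists>C\<ge>1. \<forall>d B. squarefree d \<longrightarrow> B \<ge> 1 \<longrightarrow> real (card (solutions d B)) \<le> C * real B powr (\<Theta> + \<epsilon>) * real d powr (- 3 / 2)"
proof -
  obtain C1 where C1: "C1 \<ge> 1" "\<And>i d B Q r. i \<le> n \<Longrightarrow> squarefree d \<Longrightarrow> norm (S d B Q i r) \<le> C1 * real B powr (1 / real (m i)) * real d powr (- 3 / 4)"
    using norm_S_le by auto
  obtain C2 where C2: "C2 \<ge> 1" "\<And>d B Q. squarefree d \<Longrightarrow> B \<ge> 1 \<Longrightarrow> csum * int B \<le> Q \<Longrightarrow>
    avg {0..<Q} (\<lambda>r. \<Prod>i\<in>{..n} - {j}. norm (S d B Q i r))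
      \<le> C2 * real B powr ((\<Sum>i\<in>{..n} - {j}. 1 / real (m i)) - 1 + \<epsilon>) * real d powr (- 3 / 4)"
    using mean_product_S_le[OF eps] by blast
  have "real (card (solutions d B)) \<le> (C1 * C2) * real B powr (\<Theta> + \<epsilon>) * real d powr (- 3 / 2)"
    if d: "squarefree d" and B: "B \<ge> 1" for d B
  proof -
    define Q where "Q = csum * int B"
    have Q: "Q > 0" using csum(4) B by (simp add: Q_def)
    have "real (card (solutions d B)) * real_of_int Q = norm (of_nat (card (solutions d B)) * of_int Q :: complex)"
      using Q by (simp add: norm_mult)
    also have "\<dots> \<le> (\<Sum>r\<in>{0..<Q}. norm (\<Prod>i\<le>n. S d B Q i r))"
      by (subst card_solutions_fourier[OF B]) (auto simp: Q_def norm_sum)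
    finally have "real (card (solutions d B)) \<le> avg {0..<Q} (\<lambda>r. norm (\<Prod>i\<le>n. S d B Q i r))"
      using Q by (simp add: avg_def pos_le_divide_eq)
    also have "\<dots> \<le> avg {0..<Q} (\<lambda>r. (C1 * real B powr (1 / real (m j)) * real d powr (- 3 / 4)) * (\<Prod>i\<in>{..n} - {j}. norm (S d B Q i r)))"
    proof (intro avg_mono)
      fix r
      have "norm (\<Prod>i\<le>n. S d B Q i r) = norm (S d B Q j r) * (\<Prod>i\<in>{..n} - {j}. norm (S d B Q i r))"
        using j by (simp add: prod_norm prod.remove[of "{..n}" j] norm_mult)
      then show "norm (\<Prod>i\<le>n. S d B Q i r) \<le> (C1 * real B powr (1 / real (m j)) * real d powr (- 3 / 4)) * (\<Prod>i\<in>{..n} - {j}. norm (S d B Q i r))"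
        using C1(2)[OF j d, of B Q r] by (simp add: mult_right_mono prod_nonneg)
    qed
    also have "\<dots> = (C1 * real B powr (1 / real (m j)) * real d powr (- 3 / 4)) * avg {0..<Q} (\<lambda>r. \<Prod>i\<in>{..n} - {j}. norm (S d B Q i r))"
      by (rule avg_cmult)
    also have "\<dots> \<le> (C1 * real B powr (1 / real (m j)) * real d powr (- 3 / 4)) * (C2 * real B powr ((\<Sum>i\<in>{..n} - {j}. 1 / real (m i)) - 1 + \<epsilon>) * real d powr (- 3 / 4))"
      using C2(2)[OF d B, of Q] C1(1) by (intro mult_left_mono) (auto simp: Q_def)
    also have "\<dots> = (C1 * C2) * (real B powr (1 / real (m j)) * real B powr ((\<Sum>i\<in>{..n} - {j}. 1 / real (m i)) - 1 + \<epsilon>)) * (real d powr (- 3 / 4) * real d powr (- 3 / 4))"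
      by simp
    also have "real B powr (1 / real (m j)) * real B powr ((\<Sum>i\<in>{..n} - {j}. 1 / real (m i)) - 1 + \<epsilon>) = real B powr (\<Theta> + \<epsilon>)"
      using j by (simp add: \<Theta>_def sum.remove[of "{..n}" j] algebra_simps flip: powr_add)
    also have "real d powr (- 3 / 4) * real d powr (- 3 / 4) = real d powr (- 3 / 2)" by (simp flip: powr_add)
    finally show ?thesis .
  qed
  moreover have "C1 * C2 \<ge> 1" using mult_mono[of 1 C1 1 C2] C1(1) C2(1) by simp
  ultimately show ?thesis by blast
qed

end

section \<open>Major and minor arcs\<close>

text \<open>The fractions \<open>a / q\<close> with \<open>q \<le> p\<close>, written as numerators
  over the common denominator \<open>R\<close>; each centre occurs once although a fraction has
  several representations.\<close>

definition arc_centres :: "int \<Rightarrow> int \<Rightarrow> int set" where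
  "arc_centres p R = (\<lambda>(q, a). a * (R div q)) ` (SIGMA q:{1..p}. {0..<q})"

text \<open>As a frequency over \<open>R * w\<close>, the pair \<open>(b, s)\<close> is
  \<open>b / R + s / (R * w)\<close>: a centre and an offset. The same pair makes sense for every
  \<open>w\<close>.\<close>

definition arc_point :: "int \<Rightarrow> int \<Rightarrow> int \<times> int \<Rightarrow> int" where
  "arc_point R w x = (fst x * w + snd x) mod (R * w)"

lemma finite_arc_centres [simp]: "finite (arc_centres p R)"
  by (simp add: arc_centres_def)

lemma card_arc_centres_le:
  assumes "p \<ge> 0"
  shows "real (card (arc_centres p R)) \<le> real_of_int p ^ 2"
proof -
  have "card (arc_centres p R) \<le> card (SIGMA q:{1..p}. {0..<q})"
    unfolding arc_centres_def by (rule card_image_le) simp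
  also have "\<dots> = (\<Sum>q\<in>{1..p}. nat q)" by (simp add: card_SigmaI)
  also have "\<dots> \<le> (\<Sum>q\<in>{1..p}. nat p)" by (intro sum_mono) auto
  finally have "card (arc_centres p R) \<le> nat p * nat p" by simp
  then have "real (card (arc_centres p R)) \<le> real (nat p * nat p)" by (rule of_nat_mono)
  then show ?thesis using assms by (simp add: power2_eq_square)
qed

text \<open>Distinct fractions with denominators at most \<open>p\<close> are at least \<open>1 / p\<^sup>2\<close> apart.\<close>
lemma inj_on_arc_point:
  assumes R: "R > 0" and dvd: "\<And>q. q \<in> {1..p} \<Longrightarrow> q dvd R" and w: "w > 0" and U: "2 * U * p ^ 2 < R * w"
  shows "inj_on (arc_point R w) (arc_centres p R \<times> {- U..U})"
proof (rule inj_onI)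
  fix x y assume x: "x \<in> arc_centres p R \<times> {- U..U}" and y: "y \<in> arc_centres p R \<times> {- U..U}"
    and eq: "arc_point R w x = arc_point R w y"
  obtain q a s where x': "x = (a * (R div q), s)" "q \<in> {1..p}" "a \<in> {0..<q}" "s \<in> {- U..U}"
    using x by (auto simp: arc_centres_def)
  obtain q' a' s' where y': "y = (a' * (R div q'), s')" "q' \<in> {1..p}" "a' \<in> {0..<q'}" "s' \<in> {- U..U}"
    using y by (auto simp: arc_centres_def)
  define b where "b = a * (R div q)"
  define b' where "b' = a' * (R div q')"
  have qb: "q * b = a * R" "q' * b' = a' * R" using dvd[OF x'(2)] dvd[OF y'(2)] by (simp_all add: b_def b'_def)
  have "R div q > 0" "R div q' > 0" using dvd[OF x'(2)] dvd[OF y'(2)] R x'(2) y'(2) by (auto simp: pos_imp_zdiv_pos_iff zdvd_imp_le)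
  then have "b < q * (R div q)" "b' < q' * (R div q')" "b \<ge> 0" "b' \<ge> 0" using x'(3) y'(3) by (auto simp: b_def b'_def)
  then have bR: "0 \<le> b" "b < R" "0 \<le> b'" "b' < R" using dvd[OF x'(2)] dvd[OF y'(2)] by simp_all
  have "(b * w + s) mod (R * w) = (b' * w + s') mod (R * w)" using eq by (simp add: arc_point_def x' y' b_def b'_def)
  then have "R * w dvd (b * w + s) - (b' * w + s')" by (simp add: mod_eq_dvd_iff)
  then obtain k where k: "(b * w + s) - (b' * w + s') = R * w * k" by (auto simp: dvd_def)
  define e where "e = R * k - (b - b')"
  have se: "s - s' = w * e" using k by (simp add: e_def algebra_simps)
  have "e = 0"
  proof (rule ccontr)
    assume e: "e \<noteq> 0"
    have "q * q' * e = R * (k * q * q' - a * q' + a' * q)"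
    proof -
      have "q * q' * e = R * k * (q * q') - q' * (q * b) + q * (q' * b')" by (simp add: e_def algebra_simps)
      then show ?thesis unfolding qb by (simp add: algebra_simps)
    qed
    then have "R dvd q * q' * e" by simp
    moreover have "q * q' * e \<noteq> 0" using e x'(2) y'(2) by auto
    ultimately have "R \<le> \<bar>q * q' * e\<bar>" using dvd_imp_le_int[of "q * q' * e" R] R by simp
    also have "\<dots> = q * q' * \<bar>e\<bar>" using x'(2) y'(2) by (simp add: abs_mult)
    also have "\<dots> \<le> p * p * \<bar>e\<bar>" using x'(2) y'(2) by (intro mult_right_mono mult_mono) auto
    finally have "R * w \<le> p * p * \<bar>e\<bar> * w" using w by (intro mult_right_mono) auto
    also have "\<dots> = p * p * \<bar>s - s'\<bar>" using w by (simp add: se abs_mult)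
    also have "\<dots> \<le> p * p * (2 * U)" using x'(4) y'(4) x'(2) by (intro mult_left_mono) auto
    finally show False using U by (simp add: power2_eq_square mult_ac)
  qed
  then have s: "s = s'" and "R * k = b - b'" using se by (simp_all add: e_def)
  then have "R dvd b - b'" by (metis dvd_triv_left)
  moreover have "\<bar>b - b'\<bar> < R" using bR by auto
  ultimately have "b = b'" using dvd_imp_le_int[of "b - b'" R] R by fastforce
  then show "x = y" using s by (simp add: x' y' b_def b'_def)
qed

text \<open>Reducing \<open>a\<close> modulo \<open>q\<close> changes \<open>r\<close> by a multiple
  of the modulus; the offset \<open>s\<close> satisfies \<open>\<bar>q * s\<bar> \<le> U\<close>,
  and \<open>q \<ge> 1\<close> gives the weaker bound that is used.\<close>

lemma arc_point_cover:
  assumes q: "1 \<le> q" "q \<le> p" "q dvd R" and R: "R > 0" and w: "w > 0" and r: "0 \<le> r" "r < R * w"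
    and close: "\<bar>q * r - a * (R * w)\<bar> \<le> U"
  shows "r \<in> arc_point R w ` (arc_centres p R \<times> {- U..U})"
proof -
  define b where "b = (a mod q) * (R div q)"
  define s where "s = r - b * w - (a div q) * (R * w)"
  have b: "b \<in> arc_centres p R" unfolding arc_centres_def b_def using q by (force intro!: image_eqI[where x = "(q, a mod q)"])
  have qb: "q * b = (a mod q) * R" using q(3) by (simp add: b_def)
  have "q * s = q * r - q * b * w - (q * (a div q)) * (R * w)" by (simp add: s_def algebra_simps)
  also have "\<dots> = q * r - (a mod q + q * (a div q)) * (R * w)" 
  proof -
    have "x - A * R * w - B * (R * w) = x - (A + B) * (R * w)" for x A B by (simp add: algebra_simps)
    then show ?thesis unfolding qb .
  qed
  also have "a mod q + q * (a div q) = a" by simp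
  finally have "\<bar>q * s\<bar> \<le> U" using close by simp
  moreover have "1 * \<bar>s\<bar> \<le> q * \<bar>s\<bar>" using q(1) by (intro mult_right_mono) auto
  ultimately have "\<bar>s\<bar> \<le> U" using q(1) by (simp add: abs_mult)
  moreover have "arc_point R w (b, s) = r"
  proof -
    have "b * w + s = r - (a div q) * (R * w)" by (simp add: s_def)
    then have "arc_point R w (b, s) = (r - (a div q) * (R * w)) mod (R * w)" by (simp add: arc_point_def)
    also have "\<dots> = r mod (R * w)" 
      using mod_mult_self1[of "r - (a div q) * (R * w)" "a div q" "R * w"] by (simp only: diff_add_cancel)
    finally show ?thesis using r by simp
  qed
  ultimately show ?thesis using b by (intro image_eqI[where x = "(b, s)"]) auto
qed

lemma em_arc_point:
  assumes "q \<ge> 1" "q dvd R" "R \<ge> 1" "w \<ge> 1"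
  shows "em (R * w) (arc_point R w (a * (R div q), s) * y) = em q (a * y) * ee (of_int (s * y) / of_int (R * w))"
proof -
  obtain k where k: "R = q * k" using assms(2) by (auto simp: dvd_def)
  have k0: "k \<noteq> 0" using k assms(3) by auto
  have "em (R * w) (arc_point R w (a * (R div q), s) * y) = em (R * w) ((a * k * w + s) * y)"
  proof (rule em_cong)
    have "R div q = k" using k assms(1) by simp
    then show "[arc_point R w (a * (R div q), s) * y = (a * k * w + s) * y] (mod (R * w))"
      by (simp add: arc_point_def cong_def mod_mult_left_eq)
  qed
  also have "of_int ((a * k * w + s) * y) / of_int (R * w) = (of_int (a * y) / of_int q + of_int (s * y) / of_int (R * w) :: real)"
    using k0 assms(1,4) by (simp add: k add_divide_distrib distrib_right)
  then have "em (R * w) ((a * k * w + s) * y) = em q (a * y) * ee (of_int (s * y) / of_int (R * w))"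
    by (simp only: em_def ee_add)
  finally show ?thesis .
qed

section \<open>Comparison of the counting functions for N and 2N\<close>

context diagonal_data
begin

text \<open>The factor \<open>R\<close>, divisible by all denominators in use, makes every
  \<open>a / q\<close> an exact frequency; the rest is proportional to \<open>N\<close>.\<close>

abbreviation modulus :: "int \<Rightarrow> nat \<Rightarrow> int" where
  "modulus R N \<equiv> R * (int N * csum)"

text \<open>No \<open>N\<close> occurs here. The offsets are measured in units of
  \<open>1 / modulus R N\<close>, so the arcs shrink with \<open>N\<close> while their index set
  stays the same; this is the correspondence between the arcs for \<open>B\<close> and
  \<open>B'\<close>.\<close>

abbreviation arcs :: "int \<Rightarrow> int \<Rightarrow> (int \<times> int) set" where
  "arcs p R \<equiv> arc_centres p R \<times> {- (p * R * csum)..p * R * csum}"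

definition T :: "nat \<Rightarrow> nat \<Rightarrow> int \<Rightarrow> nat \<Rightarrow> int \<Rightarrow> complex" where
  "T d N R i r = of_real (real N powr (- (1 / real (m i)))) * S d N (modulus R N) i r"

lemma minor_arc_S_le:
  assumes rho: "\<rho> > 0"
  shows "\<exists>C \<kappa>. C \<ge> 1 \<and> \<kappa> > 0 \<and> (\<forall>d N R p r. squarefree d \<longrightarrow> N \<ge> 1 \<longrightarrow> R \<ge> 1 \<longrightarrow> (\<forall>q\<in>{1..p}. q dvd R) \<longrightarrow>
    C * real N powr \<rho> \<le> real_of_int p \<longrightarrow> 0 \<le> r \<longrightarrow> r < modulus R N \<longrightarrow> r \<notin> arc_point R (int N * csum) ` arcs p R \<longrightarrow>
    norm (S d N (modulus R N) j r) \<le> C * real N powr (1 / real (m j) - \<kappa>))"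
proof -
  have mj: "m j \<ge> 1" using m[OF j] by simp
  obtain C \<kappa> where C: "C \<ge> 1" and kap: "\<kappa> > 0" and F: "\<And>d B \<alpha>. squarefree d \<Longrightarrow> B \<ge> 1 \<Longrightarrow>
    norm (\<Sum>x\<in>full_upto (m j) d B. ee (\<alpha> * real x)) > C * real B powr (1 / real (m j) - \<kappa>) \<Longrightarrow>
    \<exists>q a :: int. 1 \<le> q \<and> real_of_int q \<le> C * real B powr \<rho> \<and> \<bar>of_int q * \<alpha> - of_int a\<bar> \<le> C * real B powr \<rho> / real B"
    using full_minor_arc[OF mj rho] by metis
  have cj: "\<bar>c j\<bar> \<ge> 1" using c[OF j] by simp
  \<comment> \<open>The factor 2 accounts for the two signs of \<open>x\<close>. Approximating
    \<open>c j * r\<close> by \<open>a / q\<close> approximates \<open>r\<close> with denominator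
    \<open>q * \<bar>c j\<bar>\<close>, hence the other factor.\<close>
  define C' where "C' = 2 * C * real_of_int \<bar>c j\<bar>"
  have C'2: "C' \<ge> 2 * C" using C cj mult_left_mono[of 1 "real_of_int \<bar>c j\<bar>" "2 * C"] by (simp add: C'_def)
  have "norm (S d N (modulus R N) j r) \<le> C' * real N powr (1 / real (m j) - \<kappa>)"
    if d: "squarefree d" and N: "N \<ge> 1" and R: "R \<ge> 1" and dvd: "\<forall>q\<in>{1..p}. q dvd R" and p: "C' * real N powr \<rho> \<le> real_of_int p"
      and r: "0 \<le> r" "r < modulus R N" and out: "r \<notin> arc_point R (int N * csum) ` arcs p R" for d N R p r
  proof -
    define w where "w = int N * csum"
    have w: "w > 0" using N csum(4) by (simp add: w_def)
    define \<alpha> where "\<alpha> = real_of_int (c j * r) / real_of_int (R * w)"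
    define z where "z = (\<Sum>x\<in>full_upto (m j) d N. ee (\<alpha> * real x))"
    have z1: "em (R * w) (r * (c j * int x)) = ee (\<alpha> * real x)" for x
      by (simp add: em_def \<alpha>_def mult_ac)
    have z2: "em (R * w) (r * (c j * - int x)) = cnj (ee (\<alpha> * real x))" for x
      using z1[of x] by (simp add: em_minus)
    have S: "S d N (R * w) j r = z + cnj z"
      unfolding S_def sum_full_signed z1 z2 by (simp add: z_def)
    have "norm z \<le> C * real N powr (1 / real (m j) - \<kappa>)"
    proof (rule ccontr)
      assume "\<not> norm z \<le> C * real N powr (1 / real (m j) - \<kappa>)"
      then obtain q a :: int where qa: "1 \<le> q" "real_of_int q \<le> C * real N powr \<rho>" "\<bar>of_int q * \<alpha> - of_int a\<bar> \<le> C * real N powr \<rho> / real N"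
        using F[OF d N, of \<alpha>] by (auto simp: z_def not_le)
      have CN: "C * real N powr \<rho> \<le> real_of_int p"
      proof -
        have "C * real N powr \<rho> \<le> C' * real N powr \<rho>" using C'2 C by (intro mult_right_mono) auto
        then show ?thesis using p by simp
      qed
      have "r \<in> arc_point R w ` (arc_centres p R \<times> {- (p * R * csum)..p * R * csum})"
      proof (rule arc_point_cover[of "q * \<bar>c j\<bar>" _ _ _ _ "sgn (c j) * a"])
        have "1 * 1 \<le> q * \<bar>c j\<bar>" using qa(1) cj by (intro mult_mono) auto
        then show q1: "1 \<le> q * \<bar>c j\<bar>" by simp
        have "real_of_int (q * \<bar>c j\<bar>) \<le> C * real N powr \<rho> * real_of_int \<bar>c j\<bar>"
          using qa(2) by (simp add: mult_right_mono)
        also have "\<dots> \<le> C' * real N powr \<rho>" using C by (simp add: C'_def)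
        finally have "real_of_int (q * \<bar>c j\<bar>) \<le> real_of_int p" using p by linarith
        then show qp: "q * \<bar>c j\<bar> \<le> p" by linarith
        show "q * \<bar>c j\<bar> dvd R" using dvd q1 qp by auto
        have sg: "\<bar>sgn (c j)\<bar> = 1" using cj by (auto simp: abs_sgn_eq)
        have "q * \<bar>c j\<bar> * r - sgn (c j) * a * (R * w) = sgn (c j) * (q * (c j * r) - a * (R * w))"
          by (simp add: right_diff_distrib abs_sgn mult_ac)
        then have "\<bar>q * \<bar>c j\<bar> * r - sgn (c j) * a * (R * w)\<bar> = \<bar>sgn (c j)\<bar> * \<bar>q * (c j * r) - a * (R * w)\<bar>"
          by (simp only: abs_mult)
        then have "\<bar>q * \<bar>c j\<bar> * r - sgn (c j) * a * (R * w)\<bar> = \<bar>q * (c j * r) - a * (R * w)\<bar>"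
          by (simp only: sg mult_1)
        moreover have "real_of_int \<bar>q * (c j * r) - a * (R * w)\<bar> \<le> real_of_int (p * R * csum)"
        proof -
          have Rw: "real_of_int (R * w) > 0" using R w by simp
          then have "real_of_int (q * (c j * r) - a * (R * w)) = (of_int q * \<alpha> - of_int a) * real_of_int (R * w)"
          proof -
            have "\<alpha> * real_of_int (R * w) = real_of_int (c j * r)" using R w by (simp add: \<alpha>_def)
            then show ?thesis by (simp only: left_diff_distrib mult.assoc) simp
          qed
          then have "real_of_int \<bar>q * (c j * r) - a * (R * w)\<bar> = \<bar>of_int q * \<alpha> - of_int a\<bar> * real_of_int (R * w)"
            using Rw by (simp only: of_int_abs abs_mult abs_of_pos)
          also have "\<dots> \<le> (C * real N powr \<rho> / real N) * real_of_int (R * w)" using qa(3) Rw by (intro mult_right_mono) auto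
          also have "\<dots> = C * real N powr \<rho> * real_of_int (R * csum)" using N by (simp add: w_def)
          also have "\<dots> \<le> real_of_int p * real_of_int (R * csum)" using CN R csum(4) by (intro mult_right_mono) auto
          finally show ?thesis by (simp add: mult_ac)
        qed
        ultimately show "\<bar>q * \<bar>c j\<bar> * r - sgn (c j) * a * (R * w)\<bar> \<le> p * R * csum" by linarith
      qed (use R w r in \<open>auto simp: w_def\<close>)
      then show False using out by (simp add: w_def)
    qed
    then have "norm (S d N (R * w) j r) \<le> 2 * (C * real N powr (1 / real (m j) - \<kappa>))"
      unfolding S using norm_triangle_ineq[of z "cnj z"] by simp
    also have "\<dots> = 2 * C * real N powr (1 / real (m j) - \<kappa>)" by simp
    also have "\<dots> \<le> C' * real N powr (1 / real (m j) - \<kappa>)" using C'2 by (intro mult_right_mono) auto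
    finally show ?thesis by (simp add: w_def)
  qed
  moreover have "C' \<ge> 1" using C C'2 by simp
  ultimately show ?thesis using kap by blast
qed

lemma uniform_major_arc_compare:
  "\<exists>K \<delta>. K \<ge> 1 \<and> 0 < \<delta> \<and> \<delta> \<le> 1 \<and> (\<forall>i d a q B B' \<gamma>. i \<le> n \<longrightarrow> squarefree d \<longrightarrow> q \<ge> 1 \<longrightarrow> 1 \<le> B \<longrightarrow> B \<le> B' \<longrightarrow>
    norm (of_real (real B powr (- (1 / real (m i)))) * (\<Sum>x\<in>full_upto (m i) d B. em q (a * int x) * ee (\<gamma> * real x / real B))
      - of_real (real B' powr (- (1 / real (m i)))) * (\<Sum>x\<in>full_upto (m i) d B'. em q (a * int x) * ee (\<gamma> * real x / real B')))
      \<le> K * real_of_int q * (1 + \<bar>\<gamma>\<bar>) * real B powr (- \<delta>))"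
proof -
  define P where "P i K \<delta> \<longleftrightarrow> (\<forall>d a q B B' \<gamma>. squarefree d \<longrightarrow> q \<ge> 1 \<longrightarrow> 1 \<le> B \<longrightarrow> B \<le> B' \<longrightarrow>
    norm (of_real (real B powr (- (1 / real (m i)))) * (\<Sum>x\<in>full_upto (m i) d B. em q (a * int x) * ee (\<gamma> * real x / real B))
      - of_real (real B' powr (- (1 / real (m i)))) * (\<Sum>x\<in>full_upto (m i) d B'. em q (a * int x) * ee (\<gamma> * real x / real B')))
      \<le> K * real_of_int q * (1 + \<bar>\<gamma>\<bar>) * real B powr (- \<delta>))" for i K \<delta>
  have mono: "P i K' \<delta>'" if "P i K \<delta>" "K \<le> K'" "\<delta>' \<le> \<delta>" "1 \<le> K" for i K K' \<delta> \<delta>'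
    unfolding P_def
  proof (intro allI impI)
    fix d :: nat and a q :: int and B B' :: nat and \<gamma> :: real
    assume h: "squarefree d" "1 \<le> q" "1 \<le> B" "B \<le> B'"
    have "K * real_of_int q * (1 + \<bar>\<gamma>\<bar>) * real B powr (- \<delta>) \<le> K' * real_of_int q * (1 + \<bar>\<gamma>\<bar>) * real B powr (- \<delta>')"
      using that h by (intro mult_mono powr_mono) auto
    then show "norm (of_real (real B powr (- (1 / real (m i)))) * (\<Sum>x\<in>full_upto (m i) d B. em q (a * int x) * ee (\<gamma> * real x / real B))
      - of_real (real B' powr (- (1 / real (m i)))) * (\<Sum>x\<in>full_upto (m i) d B'. em q (a * int x) * ee (\<gamma> * real x / real B')))
      \<le> K' * real_of_int q * (1 + \<bar>\<gamma>\<bar>) * real B powr (- \<delta>')"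
      using that(1)[unfolded P_def] h order_trans by blast
  qed
  have "\<exists>K \<delta>. K \<ge> 1 \<and> 0 < \<delta> \<and> \<delta> \<le> 1 \<and> P i K \<delta>" if i: "i \<le> n" for i
  proof -
    have "m i \<ge> 1" using m[OF i] by simp
    then show ?thesis unfolding P_def by (rule full_major_arc_compare) blast
  qed
  then obtain K \<delta> where KD: "\<And>i. i \<le> n \<Longrightarrow> K i \<ge> 1 \<and> 0 < \<delta> i \<and> \<delta> i \<le> (1 :: real) \<and> P i (K i) (\<delta> i)" by metis
  define \<delta>' where "\<delta>' = Min (\<delta> ` {..n})"
  define K' where "K' = Max (K ` {..n})"
  have "\<delta>' \<in> \<delta> ` {..n}" unfolding \<delta>'_def by (intro Min_in) auto
  then have d: "0 < \<delta>'" "\<delta>' \<le> 1" using KD by auto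
  have "K' \<in> K ` {..n}" unfolding K'_def by (intro Max_in) auto
  then have k: "K' \<ge> 1" using KD by auto
  have "P i K' \<delta>'" if "i \<le> n" for i
    using mono[of i "K i" "\<delta> i" K' \<delta>'] KD[OF that] that by (auto simp: K'_def \<delta>'_def)
  then show ?thesis using d k unfolding P_def by blast
qed

text \<open>One factor \<open>p\<close> comes from the denominator \<open>q\<close>, the other from
  \<gamma>, which is at most \<open>p * csum\<close>.\<close>

lemma major_arc_T_compare:
  "\<exists>K \<delta>. K \<ge> 1 \<and> 0 < \<delta> \<and> \<delta> \<le> 1 \<and> (\<forall>i d N N' R p x. i \<le> n \<longrightarrow> squarefree d \<longrightarrow> 1 \<le> N \<longrightarrow> N \<le> N' \<longrightarrow> R \<ge> 1 \<longrightarrow> (\<forall>q\<in>{1..p}. q dvd R) \<longrightarrow>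
    x \<in> arcs p R \<longrightarrow>
    norm (T d N R i (arc_point R (int N * csum) x) - T d N' R i (arc_point R (int N' * csum) x)) \<le> K * real_of_int p ^ 2 * real N powr (- \<delta>))"
proof -
  obtain K \<delta> where K: "K \<ge> 1" and del: "0 < \<delta>" "\<delta> \<le> 1" and F: "\<And>i d a q B B' \<gamma>. i \<le> n \<Longrightarrow> squarefree d \<Longrightarrow> q \<ge> 1 \<Longrightarrow> 1 \<le> B \<Longrightarrow> B \<le> B' \<Longrightarrow>
    norm (of_real (real B powr (- (1 / real (m i)))) * (\<Sum>x\<in>full_upto (m i) d B. em q (a * int x) * ee (\<gamma> * real x / real B))
      - of_real (real B' powr (- (1 / real (m i)))) * (\<Sum>x\<in>full_upto (m i) d B'. em q (a * int x) * ee (\<gamma> * real x / real B')))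
      \<le> K * real_of_int q * (1 + \<bar>\<gamma>\<bar>) * real B powr (- \<delta>)"
    using uniform_major_arc_compare by blast
  define K' where "K' = 4 * K * real_of_int csum"
  have cs: "real_of_int csum \<ge> 1" using csum(4) by simp
  have "norm (T d N R i (arc_point R (int N * csum) x) - T d N' R i (arc_point R (int N' * csum) x)) \<le> K' * real_of_int p ^ 2 * real N powr (- \<delta>)"
    if i: "i \<le> n" and d: "squarefree d" and N: "1 \<le> N" "N \<le> N'" and R: "R \<ge> 1" and dvd: "\<forall>q\<in>{1..p}. q dvd R" and x: "x \<in> arcs p R" for i d N N' R p x
  proof -
    obtain q a s where x': "x = (a * (R div q), s)" "1 \<le> q" "q \<le> p" "\<bar>s\<bar> \<le> p * R * csum"
      using x by (auto simp: arc_centres_def)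
    \<comment> \<open>The offset contributes the phase \<open>\<gamma> y / N\<close> to the variable
      \<open>y\<close>, with \<gamma> independent of \<open>N\<close>; this is the form needed by
      \<open>full_major_arc_compare\<close>.\<close>
    define \<gamma> where "\<gamma> = real_of_int (s * c i) / real_of_int (R * csum)"
    define G where "G M \<sigma> = (\<Sum>y\<in>full_upto (m i) d M. em q ((\<sigma> * a * c i) * int y) * ee ((of_int \<sigma> * \<gamma>) * real y / real M))" for M \<sigma>
    have Sf: "S d M (modulus R M) i (arc_point R (int M * csum) x) = G M 1 + G M (- 1)" if M: "M \<ge> 1" for M
    proof -
      have w: "int M * csum \<ge> 1" using M csum(4) by (simp add: int_one_le_iff_zero_less)
      have e: "em (modulus R M) (arc_point R (int M * csum) x * (c i * (\<sigma> * int y))) = em q ((\<sigma> * a * c i) * int y) * ee ((of_int \<sigma> * \<gamma>) * real y / real M)" for y \<sigma>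
      proof -
        have "real_of_int (s * (c i * (\<sigma> * int y))) / real_of_int (modulus R M) = (of_int \<sigma> * \<gamma>) * real y / real M"
          by (simp add: \<gamma>_def mult_ac)
        then show ?thesis
          unfolding x'(1) using em_arc_point[of q R "int M * csum" a s "c i * (\<sigma> * int y)"] x' dvd R w by (simp add: mult_ac)
      qed
      show ?thesis unfolding S_def sum_full_signed using e[of 1] e[of "- 1"] by (simp add: G_def)
    qed
    have g: "\<bar>\<gamma>\<bar> \<le> real_of_int p * real_of_int csum"
    proof -
      have RC: "real_of_int (R * csum) > 0" using R csum(4) by simp
      have "\<bar>\<gamma>\<bar> = real_of_int \<bar>s\<bar> * real_of_int \<bar>c i\<bar> / real_of_int (R * csum)" 
        using R csum(4) by (simp add: \<gamma>_def abs_mult abs_of_pos)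
      also have "\<dots> \<le> real_of_int (p * R * csum) * real_of_int csum / real_of_int (R * csum)"
      proof -
        have s': "real_of_int \<bar>s\<bar> \<le> real_of_int (p * R * csum)" using x'(4) by (rule of_int_le_iff[THEN iffD2])
        have c': "real_of_int \<bar>c i\<bar> \<le> real_of_int csum" using csum(3)[OF i] by (intro of_int_le_iff[THEN iffD2]) simp
        have "0 \<le> real_of_int \<bar>s\<bar>" by simp
        then have "0 \<le> real_of_int (p * R * csum)" using s' by (rule order_trans)
        from mult_mono[OF s' c' this] show ?thesis using RC by (intro divide_right_mono) auto
      qed
      also have "\<dots> = real_of_int p * real_of_int csum" using R csum(4) by simp
      finally show ?thesis .
    qed
    have p1: "real_of_int p \<ge> 1" using x' by simp
    have bd: "K * real_of_int q * (1 + \<bar>of_int \<sigma> * \<gamma>\<bar>) * real N powr (- \<delta>) \<le> 2 * K * real_of_int csum * real_of_int p ^ 2 * real N powr (- \<delta>)"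
      if "\<bar>\<sigma>\<bar> = 1" for \<sigma> :: int
    proof -
      have "1 * 1 \<le> real_of_int p * real_of_int csum" using p1 cs by (intro mult_mono) auto
      moreover have "\<bar>of_int \<sigma> * \<gamma>\<bar> = \<bar>\<gamma>\<bar>" using that by (simp add: abs_mult flip: of_int_abs)
      ultimately have "1 + \<bar>of_int \<sigma> * \<gamma>\<bar> \<le> 2 * (real_of_int p * real_of_int csum)" using g by linarith
      then have "K * real_of_int q * (1 + \<bar>of_int \<sigma> * \<gamma>\<bar>) * real N powr (- \<delta>) \<le> K * real_of_int p * (2 * (real_of_int p * real_of_int csum)) * real N powr (- \<delta>)"
        using K x' by (intro mult_right_mono mult_mono) auto
      then show ?thesis by (simp add: power2_eq_square mult_ac)
    qed
    have G: "norm (of_real (real N powr (- (1 / real (m i)))) * G N \<sigma> - of_real (real N' powr (- (1 / real (m i)))) * G N' \<sigma>)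
        \<le> 2 * K * real_of_int csum * real_of_int p ^ 2 * real N powr (- \<delta>)" if "\<bar>\<sigma>\<bar> = 1" for \<sigma>
      unfolding G_def by (rule order_trans[OF F[OF i d x'(2) N] bd[OF that]])
    have N': "N' \<ge> 1" using N by simp
    have "T d N R i (arc_point R (int N * csum) x) - T d N' R i (arc_point R (int N' * csum) x) =
      (of_real (real N powr (- (1 / real (m i)))) * G N 1 - of_real (real N' powr (- (1 / real (m i)))) * G N' 1) +
      (of_real (real N powr (- (1 / real (m i)))) * G N (- 1) - of_real (real N' powr (- (1 / real (m i)))) * G N' (- 1))"
      unfolding T_def Sf[OF N(1)] Sf[OF N'] by (simp only: distrib_left add_diff_add)
    also have "norm \<dots> \<le> 2 * K * real_of_int csum * real_of_int p ^ 2 * real N powr (- \<delta>) + 2 * K * real_of_int csum * real_of_int p ^ 2 * real N powr (- \<delta>)"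
      by (intro norm_triangle_le add_mono G) auto
    finally show ?thesis by (simp add: K'_def mult_ac)
  qed
  moreover have "K' \<ge> 1"
  proof -
    have "1 * 1 \<le> (4 * K) * real_of_int csum" using K cs by (intro mult_mono) auto
    then show ?thesis by (simp add: K'_def)
  qed
  ultimately show ?thesis using del by (intro exI[of _ K'] exI[of _ \<delta>]) blast
qed

text \<open>Off the major arcs the sum with index \<open>j\<close> is small everywhere and the
  others are controlled in mean, for a total of \<open>N powr (\<epsilon> - \<kappa>)\<close>. The
  condition \<open>N > 2 * p ^ 3\<close> makes the arcs disjoint, so that summing over their indices
  counts each frequency once.\<close>

lemma solutions_major_arc_approx:
  assumes eps: "\<epsilon> > 0" and p: "p \<ge> 1" and N: "N > 2 * p ^ 3" and R: "R \<ge> 1" and dvd: "\<forall>q\<in>{1..p}. q dvd R" and d: "squarefree d"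
    and C3: "C3 \<ge> 0" and C2: "C2 \<ge> 0"
    and minor: "\<And>r. 0 \<le> r \<Longrightarrow> r < modulus R N \<Longrightarrow> r \<notin> arc_point R (int N * csum) ` arcs p R \<Longrightarrow>
      norm (S d N (modulus R N) j r) \<le> C3 * real N powr (1 / real (m j) - \<kappa>)"
    and mean: "avg {0..<modulus R N} (\<lambda>r. \<Prod>i\<in>{..n} - {j}. norm (S d N (modulus R N) i r))
      \<le> C2 * real N powr ((\<Sum>i\<in>{..n} - {j}. 1 / real (m i)) - 1 + \<epsilon>)"
  shows "norm (of_real (real (card (solutions d N)) * real N powr (- \<Theta>))
      - (\<Sum>x\<in>arcs p R. \<Prod>i\<le>n. T d N R i (arc_point R (int N * csum) x)) / of_int (R * csum)) \<le> C3 * C2 * real N powr (\<epsilon> - \<kappa>)"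
proof -
  define w where "w = int N * csum"
  define Q where "Q = R * w"
  define L where "L = R * csum"
  have "(0 :: int) < 2 * p ^ 3" using p by simp
  then have N1: "N \<ge> 1" using N by linarith
  have w: "w > 0" and Q: "Q > 0" and L: "L > 0" and QL: "Q = int N * L"
    using N1 csum(4) R by (simp_all add: w_def Q_def L_def)
  have inj: "inj_on (arc_point R w) (arcs p R)"
  proof (rule inj_on_arc_point)
    have "2 * (p * R * csum) * p ^ 2 = (2 * p ^ 3) * (R * csum)" by (simp add: power2_eq_square power3_eq_cube)
    also have "\<dots> < int N * (R * csum)" using N L by (intro mult_strict_right_mono) (auto simp: L_def)
    finally show "2 * (p * R * csum) * p ^ 2 < R * w" by (simp add: w_def mult_ac)
  qed (use R dvd w in auto)
  define M where "M = arc_point R w ` arcs p R"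
  have M: "M \<subseteq> {0..<Q}" using Q by (auto simp: M_def arc_point_def Q_def)
  have PT: "(\<Prod>i\<le>n. T d N R i r) = of_real (real N powr (- (\<Theta> + 1))) * (\<Prod>i\<le>n. S d N Q i r)" for r
  proof -
    have "(\<Prod>i\<le>n. real N powr (- (1 / real (m i)))) = real N powr (\<Sum>i\<le>n. - (1 / real (m i)))" using N1 by (simp add: powr_sum)
    also have "(\<Sum>i\<le>n. - (1 / real (m i))) = - (\<Theta> + 1)" by (simp add: \<Theta>_def sum_negf)
    finally show ?thesis by (simp add: T_def prod.distrib Q_def w_def flip: of_real_prod)
  qed
  have QN: "real_of_int Q = real N * real_of_int L" by (simp add: QL)
  have "of_real (real (card (solutions d N)) * real N powr (- \<Theta>)) * of_int L = (\<Sum>r\<in>{0..<Q}. \<Prod>i\<le>n. T d N R i r)"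
  proof -
    have "1 * w \<le> R * w" using R w by (intro mult_right_mono) auto
    then have "csum * int N \<le> Q" by (simp add: Q_def w_def mult.commute)
    then have "of_nat (card (solutions d N)) * of_int Q = (\<Sum>r\<in>{0..<Q}. \<Prod>i\<le>n. S d N Q i r)" by (rule card_solutions_fourier[OF N1])
    then have "(\<Sum>r\<in>{0..<Q}. \<Prod>i\<le>n. T d N R i r) = of_real (real N powr (- (\<Theta> + 1))) * (of_nat (card (solutions d N)) * of_int Q)"
      unfolding PT by (simp only: sum_distrib_left)
    also have "\<dots> = of_real (real N powr (- (\<Theta> + 1)) * (real (card (solutions d N)) * real_of_int Q))" by simp
    also have "real N powr (- (\<Theta> + 1)) * (real (card (solutions d N)) * real_of_int Q) =
      (real N powr (- (\<Theta> + 1)) * real N powr 1) * (real (card (solutions d N)) * real_of_int L)" unfolding QN using N1 by simp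
    also have "real N powr (- (\<Theta> + 1)) * real N powr 1 = real N powr (- \<Theta>)" by (simp only: powr_add[symmetric]) simp
    finally show ?thesis by (simp add: mult_ac)
  qed
  moreover have "(\<Sum>r\<in>{0..<Q}. \<Prod>i\<le>n. T d N R i r) = (\<Sum>r\<in>{0..<Q} - M. \<Prod>i\<le>n. T d N R i r) + (\<Sum>r\<in>M. \<Prod>i\<le>n. T d N R i r)"
    using M by (intro sum.subset_diff) auto
  moreover have "(\<Sum>r\<in>M. \<Prod>i\<le>n. T d N R i r) = (\<Sum>x\<in>arcs p R. \<Prod>i\<le>n. T d N R i (arc_point R w x))"
    unfolding M_def using inj by (simp add: sum.reindex)
  ultimately have "(of_real (real (card (solutions d N)) * real N powr (- \<Theta>)) * of_int L :: complex) - (\<Sum>x\<in>arcs p R. \<Prod>i\<le>n. T d N R i (arc_point R w x))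
      = (\<Sum>r\<in>{0..<Q} - M. \<Prod>i\<le>n. T d N R i r)" by simp
  then have "norm (of_real (real (card (solutions d N)) * real N powr (- \<Theta>))
      - (\<Sum>x\<in>arcs p R. \<Prod>i\<le>n. T d N R i (arc_point R w x)) / of_int L) = norm ((\<Sum>r\<in>{0..<Q} - M. \<Prod>i\<le>n. T d N R i r) / of_int L)"
  proof -
    assume h: "(of_real (real (card (solutions d N)) * real N powr (- \<Theta>)) * of_int L :: complex) - (\<Sum>x\<in>arcs p R. \<Prod>i\<le>n. T d N R i (arc_point R w x))
      = (\<Sum>r\<in>{0..<Q} - M. \<Prod>i\<le>n. T d N R i r)"
    have "X - A / of_int L = (X * of_int L - A) / of_int L" for X A :: complex using L by (simp add: diff_divide_distrib)
    then show ?thesis by (simp only: h)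
  qed
  also have "\<dots> = norm (\<Sum>r\<in>{0..<Q} - M. \<Prod>i\<le>n. T d N R i r) / real_of_int L" using L by (simp add: norm_divide)
  also have "\<dots> \<le> (C3 * C2 * real N powr (\<epsilon> - \<kappa>) * real_of_int L) / real_of_int L"
  proof (intro divide_right_mono)
    define H where "H r = (\<Prod>i\<in>{..n} - {j}. norm (S d N Q i r))" for r
    have H0: "H r \<ge> 0" for r unfolding H_def by (intro prod_nonneg) auto
    have "norm (\<Sum>r\<in>{0..<Q} - M. \<Prod>i\<le>n. T d N R i r) \<le> (\<Sum>r\<in>{0..<Q} - M. real N powr (- (\<Theta> + 1)) * (C3 * real N powr (1 / real (m j) - \<kappa>)) * H r)"
    proof (rule sum_norm_le)
      fix r assume r: "r \<in> {0..<Q} - M"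
      have "norm (\<Prod>i\<le>n. T d N R i r) = real N powr (- (\<Theta> + 1)) * norm (\<Prod>i\<le>n. S d N Q i r)" unfolding PT by (simp add: norm_mult)
      also have "norm (\<Prod>i\<le>n. S d N Q i r) = norm (S d N Q j r) * H r"
        using j by (simp add: H_def prod_norm prod.remove[of "{..n}" j] norm_mult)
      also have "real N powr (- (\<Theta> + 1)) * (norm (S d N Q j r) * H r) \<le> real N powr (- (\<Theta> + 1)) * ((C3 * real N powr (1 / real (m j) - \<kappa>)) * H r)"
        using minor[of r] r H0[of r] by (intro mult_left_mono mult_right_mono) (auto simp: Q_def w_def M_def)
      finally show "norm (\<Prod>i\<le>n. T d N R i r) \<le> real N powr (- (\<Theta> + 1)) * (C3 * real N powr (1 / real (m j) - \<kappa>)) * H r" by (simp only: mult.assoc)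
    qed
    also have "\<dots> \<le> (\<Sum>r\<in>{0..<Q}. real N powr (- (\<Theta> + 1)) * (C3 * real N powr (1 / real (m j) - \<kappa>)) * H r)"
      using H0 C3 by (intro sum_mono2) auto
    also have "\<dots> = real N powr (- (\<Theta> + 1)) * (C3 * real N powr (1 / real (m j) - \<kappa>)) * (avg {0..<Q} H * real_of_int Q)"
      using Q by (simp add: sum_distrib_left avg_def)
    also have "\<dots> \<le> real N powr (- (\<Theta> + 1)) * (C3 * real N powr (1 / real (m j) - \<kappa>)) *
        (C2 * real N powr ((\<Sum>i\<in>{..n} - {j}. 1 / real (m i)) - 1 + \<epsilon>) * real_of_int Q)"
    proof (intro mult_left_mono mult_right_mono)
      show "real_of_int Q \<ge> 0" using Q by simp
      show "avg {0..<Q} H \<le> C2 * real N powr ((\<Sum>i\<in>{..n} - {j}. 1 / real (m i)) - 1 + \<epsilon>)"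
        using mean by (simp add: H_def[abs_def] Q_def w_def)
    qed (use C3 in auto)
    also have "\<dots> = C3 * C2 * (real N powr (- (\<Theta> + 1)) * real N powr (1 / real (m j) - \<kappa>) *
        real N powr ((\<Sum>i\<in>{..n} - {j}. 1 / real (m i)) - 1 + \<epsilon>) * real N powr 1) * real_of_int L"
      unfolding QN using N1 by simp
    also have "real N powr (- (\<Theta> + 1)) * real N powr (1 / real (m j) - \<kappa>) *
        real N powr ((\<Sum>i\<in>{..n} - {j}. 1 / real (m i)) - 1 + \<epsilon>) * real N powr 1 = real N powr (\<epsilon> - \<kappa>)"
    proof -
      have "\<Theta> + 1 = 1 / real (m j) + (\<Sum>i\<in>{..n} - {j}. 1 / real (m i))" using j by (simp add: \<Theta>_def sum.remove[of "{..n}" j])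
      then show ?thesis by (simp only: powr_add[symmetric]) simp
    qed
    finally show "norm (\<Sum>r\<in>{0..<Q} - M. \<Prod>i\<le>n. T d N R i r) \<le> C3 * C2 * real N powr (\<epsilon> - \<kappa>) * real_of_int L" .
  qed (use L in simp)
  also have "\<dots> = C3 * C2 * real N powr (\<epsilon> - \<kappa>)" using L by simp
  finally show ?thesis by (simp only: w_def L_def)
qed

lemma solutions_compare:
  "\<exists>C \<eta>. C \<ge> 0 \<and> \<eta> > 0 \<and> (\<forall>d B B'. squarefree d \<longrightarrow> 1 \<le> B \<longrightarrow> B \<le> B' \<longrightarrow> B' \<le> 2 * B \<longrightarrow>
    \<bar>real (card (solutions d B)) * real B powr (- \<Theta>) - real (card (solutions d B')) * real B' powr (- \<Theta>)\<bar> \<le> C * real B powr (- \<eta>))"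
proof -
  obtain K \<delta> where K: "K \<ge> 1" and del: "0 < \<delta>" "\<delta> \<le> 1" and major: "\<And>i d N N' R p x. i \<le> n \<Longrightarrow> squarefree d \<Longrightarrow> 1 \<le> N \<Longrightarrow> N \<le> N' \<Longrightarrow> R \<ge> 1 \<Longrightarrow>
    (\<forall>q\<in>{1..p}. q dvd R) \<Longrightarrow> x \<in> arcs p R \<Longrightarrow>
    norm (T d N R i (arc_point R (int N * csum) x) - T d N' R i (arc_point R (int N' * csum) x)) \<le> K * real_of_int p ^ 2 * real N powr (- \<delta>)"
    using major_arc_T_compare by blast
  \<comment> \<open>The arcs number about \<open>p^3\<close> times \<open>R * csum\<close> and the
    comparison on each loses \<open>p^2\<close>. With \<open>p\<close> about
    \<open>B powr \<rho>\<close> this leaves \<open>5 \<rho> - \<delta> = - 7 \<delta> / 12\<close>,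
    and \<open>3 \<rho> \<le> 1 / 4\<close> settles the small values of \<open>B\<close>.\<close>
  define \<rho> where "\<rho> = \<delta> / 12"
  have rho: "\<rho> > 0" using del by (simp add: \<rho>_def)
  obtain C3 \<kappa> where C3: "C3 \<ge> 1" and kap: "\<kappa> > 0" and minor: "\<And>d N R p r. squarefree d \<Longrightarrow> N \<ge> 1 \<Longrightarrow> R \<ge> 1 \<Longrightarrow> (\<forall>q\<in>{1..p}. q dvd R) \<Longrightarrow>
    C3 * real N powr \<rho> \<le> real_of_int p \<Longrightarrow> 0 \<le> r \<Longrightarrow> r < modulus R N \<Longrightarrow> r \<notin> arc_point R (int N * csum) ` arcs p R \<Longrightarrow>
    norm (S d N (modulus R N) j r) \<le> C3 * real N powr (1 / real (m j) - \<kappa>)"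
    using minor_arc_S_le[OF rho] by blast
  obtain C1 where C1: "C1 \<ge> 1" "\<And>i d B Q r. i \<le> n \<Longrightarrow> squarefree d \<Longrightarrow> norm (S d B Q i r) \<le> C1 * real B powr (1 / real (m i)) * real d powr (- 3 / 4)"
    using norm_S_le by auto
  have k2: "\<kappa> / 2 > 0" using kap by simp
  obtain C2 where C2: "C2 \<ge> 1" "\<And>d B Q. squarefree d \<Longrightarrow> B \<ge> 1 \<Longrightarrow> csum * int B \<le> Q \<Longrightarrow>
    avg {0..<Q} (\<lambda>r. \<Prod>i\<in>{..n} - {j}. norm (S d B Q i r))
      \<le> C2 * real B powr ((\<Sum>i\<in>{..n} - {j}. 1 / real (m i)) - 1 + \<kappa> / 2) * real d powr (- 3 / 4)"
    using mean_product_S_le[OF k2] by blast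
  obtain C4 where C4: "C4 \<ge> 1" "\<And>d B. squarefree d \<Longrightarrow> B \<ge> 1 \<Longrightarrow> real (card (solutions d B)) \<le> C4 * real B powr (\<Theta> + 1) * real d powr (- 3 / 2)"
    using card_solutions_tail[of 1] by auto
  define \<eta> where "\<eta> = min (\<delta> / 2) (\<kappa> / 2)"
  have eta: "\<eta> > 0" "\<eta> \<le> \<delta> / 2" "\<eta> \<le> \<kappa> / 2" "\<eta> \<le> 1 / 2" using del kap by (auto simp: \<eta>_def min_def)
  define G where "G = C3 * 2 powr \<rho> + 1"
  have G1: "G \<ge> 1" using C3 by (simp add: G_def)
  define E where "E = 3 * C1 ^ n * real (n + 1) * K * G ^ 5"
  define X where "X = 2 * G ^ 3"
  define C where "C = E + 2 * (C3 * C2) + 4 * C4 * X ^ 2"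
  have E0: "E \<ge> 0" using C1(1) K G1 by (simp add: E_def)
  have "\<bar>real (card (solutions d B)) * real B powr (- \<Theta>) - real (card (solutions d B')) * real B' powr (- \<Theta>)\<bar> \<le> C * real B powr (- \<eta>)"
    if d: "squarefree d" and B: "1 \<le> B" "B \<le> B'" "B' \<le> 2 * B" for d B B'
  proof -
    have d0: "d > 0" using d by (metis not_squarefree_0 gr0I)
    have d34: "real d powr (- 3 / 4) \<le> 1" using powr_mono[of "- 3 / 4" 0 "real d"] d0 by simp
    have d32: "real d powr (- 3 / 2) \<le> 1" using powr_mono[of "- 3 / 2" 0 "real d"] d0 by simp
    \<comment> \<open>Taken at \<open>2 * B\<close>, so that the same \<open>p\<close>, and hence
      the same index set of arcs, serves every \<open>N\<close> between \<open>B\<close> and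
      \<open>2 * B\<close>.\<close>
    define p where "p = \<lceil>C3 * real (2 * B) powr \<rho>\<rceil>"
    have p_ge: "C3 * real (2 * B) powr \<rho> \<le> real_of_int p" by (simp add: p_def)
    have Br: "real B powr \<rho> \<ge> 1" using B rho by (intro ge_one_powr_ge_zero) auto
    have p_le: "real_of_int p \<le> G * real B powr \<rho>"
    proof -
      have "real_of_int p \<le> C3 * real (2 * B) powr \<rho> + 1" unfolding p_def by linarith
      also have "\<dots> \<le> C3 * 2 powr \<rho> * real B powr \<rho> + real B powr \<rho>" using Br by (simp add: powr_mult)
      finally show ?thesis by (simp add: G_def distrib_right)
    qed
    have p1: "p \<ge> 1"
    proof -
      have "1 * 1 \<le> C3 * real (2 * B) powr \<rho>" using C3 B rho by (intro mult_mono ge_one_powr_ge_zero) auto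
      then show ?thesis using p_ge by linarith
    qed
    have pk: "real_of_int p ^ k \<le> G ^ k * real B powr (real k * \<rho>)" for k
    proof -
      have "real_of_int p ^ k \<le> (G * real B powr \<rho>) ^ k" using p_le p1 by (intro power_mono) auto
      also have "\<dots> = G ^ k * real B powr (real k * \<rho>)" using B by (simp add: power_mult_distrib powr_powr mult.commute flip: powr_realpow)
      finally show ?thesis .
    qed
    have bmono: "real B powr (- x) \<le> real B powr (- \<eta>)" if "\<eta> \<le> x" for x using that B by (intro powr_mono) auto
    have C0: "0 \<le> C3 * C2" "0 \<le> 4 * C4 * X ^ 2" using C3 C2(1) C4(1) by auto
    show ?thesis
    proof (cases "int B > 2 * p ^ 3")
      case False
      \<comment> \<open>If the arcs may overlap, \<open>B\<close> is bounded by a constant: it is at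
        most a multiple of \<open>B powr (1 / 4)\<close>. The trivial bound then suffices.\<close>
      have "real B \<le> 2 * real_of_int p ^ 3"
      proof -
        have "int B \<le> 2 * p ^ 3" using False by simp
        then have "real_of_int (int B) \<le> real_of_int (2 * p ^ 3)" by (rule of_int_le_iff[THEN iffD2])
        then show ?thesis by simp
      qed
      also have "\<dots> \<le> 2 * (G ^ 3 * real B powr (real 3 * \<rho>))" using pk[of 3] by simp
      also have "real B powr (real 3 * \<rho>) \<le> real B powr (1 / 4)" using B del by (intro powr_mono) (auto simp: \<rho>_def)
      finally have "real B \<le> X * real B powr (1 / 4)" using G1 by (simp add: X_def mult_left_mono)
      then have "real B * real B powr (- 1 / 4) \<le> X * real B powr (1 / 4) * real B powr (- 1 / 4)" by (intro mult_right_mono) auto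
      also have "\<dots> = X * (real B powr (1 / 4) * real B powr (- 1 / 4))" by simp
      also have "real B powr (1 / 4) * real B powr (- 1 / 4) = 1" using B by (simp flip: powr_add)
      also have "real B * real B powr (- 1 / 4) = real B powr 1 * real B powr (- 1 / 4)" using B by simp
      also have "\<dots> = real B powr (3 / 4)" by (simp only: powr_add[symmetric]) simp
      finally have X: "real B powr (3 / 4) \<le> X" by simp
      have "real B powr (1 + \<eta>) \<le> real B powr (3 / 4 + 3 / 4)" using B eta by (intro powr_mono) auto
      also have "\<dots> = real B powr (3 / 4) * real B powr (3 / 4)" by (rule powr_add)
      also have "\<dots> \<le> X * X" using X by (intro mult_mono) (auto intro: order_trans[OF powr_ge_zero])
      finally have "real B powr (1 + \<eta>) * real B powr (- \<eta>) \<le> X ^ 2 * real B powr (- \<eta>)"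
        by (intro mult_right_mono) (auto simp: power2_eq_square)
      also have "real B powr (1 + \<eta>) * real B powr (- \<eta>) = real B" using B by (simp flip: powr_add)
      finally have BX: "real B \<le> X ^ 2 * real B powr (- \<eta>)" .
      have triv: "real (card (solutions d N)) * real N powr (- \<Theta>) \<le> 2 * C4 * real B" if N: "1 \<le> N" "N \<le> 2 * B" for N
      proof -
        have "real (card (solutions d N)) * real N powr (- \<Theta>) \<le> (C4 * real N powr (\<Theta> + 1) * real d powr (- 3 / 2)) * real N powr (- \<Theta>)"
          using C4(2)[OF d N(1)] by (intro mult_right_mono) auto
        also have "\<dots> \<le> (C4 * real N powr (\<Theta> + 1) * 1) * real N powr (- \<Theta>)"
          using C4(1) d32 by (intro mult_right_mono mult_left_mono) auto
        also have "\<dots> = C4 * (real N powr (\<Theta> + 1) * real N powr (- \<Theta>))" by simp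
        also have "real N powr (\<Theta> + 1) * real N powr (- \<Theta>) = real N" using N by (simp flip: powr_add)
        also have "C4 * real N \<le> C4 * (2 * real B)" using N C4(1) by (intro mult_left_mono) linarith+
        finally show ?thesis by simp
      qed
      have ab: "\<bar>a - b\<bar> \<le> 2 * u" if "0 \<le> a" "0 \<le> b" "a \<le> u" "b \<le> u" for a b u :: real using that by linarith
      have "\<bar>real (card (solutions d B)) * real B powr (- \<Theta>) - real (card (solutions d B')) * real B' powr (- \<Theta>)\<bar> \<le> 2 * (2 * C4 * real B)"
        using B by (intro ab triv) auto
      also have "\<dots> = 4 * C4 * real B" by simp
      also have "\<dots> \<le> 4 * C4 * (X ^ 2 * real B powr (- \<eta>))" using BX C4(1) by (intro mult_left_mono) auto
      also have "\<dots> = 4 * C4 * X ^ 2 * real B powr (- \<eta>)" by simp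
      also have "\<dots> \<le> C * real B powr (- \<eta>)" using E0 C0 by (intro mult_right_mono) (auto simp: C_def)
      finally show ?thesis .
    next
      case True
      \<comment> \<open>A common multiple of all denominators up to \<open>p\<close>. However large
        it is, the number of arcs is proportional to \<open>L\<close>, and the final division by
        \<open>L\<close> cancels this.\<close>
      define R :: int where "R = fact (nat p)"
      have R: "R \<ge> 1" by (simp add: R_def)
      have dvd: "\<forall>q\<in>{1..p}. q dvd R"
      proof
        fix q assume q: "q \<in> {1..p}"
        then have "nat q dvd fact (nat p)" by (intro dvd_fact) auto
        then have "int (nat q) dvd int (fact (nat p))" by (simp only: of_nat_dvd_iff)
        then show "q dvd R" using q by (simp add: R_def)
      qed
      define A where "A N = (\<Sum>x\<in>arcs p R. \<Prod>i\<le>n. T d N R i (arc_point R (int N * csum) x))" for N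
      define L where "L = real_of_int (R * csum)"
      have L1: "L \<ge> 1"
      proof -
        have "1 * 1 \<le> R * csum" using R csum(4) by (intro mult_mono) auto
        then show ?thesis by (simp add: L_def flip: of_int_mult)
      qed
      have appr: "norm (of_real (real (card (solutions d N)) * real N powr (- \<Theta>)) - A N / of_real L) \<le> C3 * C2 * real B powr (- \<eta>)"
        if N: "B \<le> N" "N \<le> 2 * B" for N
      proof -
        have N1: "N \<ge> 1" using N B by simp
        have Np: "C3 * real N powr \<rho> \<le> real_of_int p"
        proof -
          have "C3 * real N powr \<rho> \<le> C3 * real (2 * B) powr \<rho>" using N C3 rho by (intro mult_left_mono powr_mono2) auto
          then show ?thesis using p_ge by simp
        qed
        have Qg: "csum * int N \<le> modulus R N"
        proof -
          have "1 * (int N * csum) \<le> R * (int N * csum)" using R csum(4) by (intro mult_right_mono) auto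
          then show ?thesis by (simp add: mult.commute)
        qed
        have "norm (of_real (real (card (solutions d N)) * real N powr (- \<Theta>)) - A N / of_int (R * csum)) \<le> C3 * C2 * real N powr (\<kappa> / 2 - \<kappa>)"
          unfolding A_def
        proof (rule solutions_major_arc_approx[OF k2 p1 _ R dvd d])
          show "2 * p ^ 3 < int N" using True N by linarith
          show "avg {0..<modulus R N} (\<lambda>r. \<Prod>i\<in>{..n} - {j}. norm (S d N (modulus R N) i r))
            \<le> C2 * real N powr ((\<Sum>i\<in>{..n} - {j}. 1 / real (m i)) - 1 + \<kappa> / 2)"
          proof (rule order_trans[OF C2(2)[OF d N1 Qg]])
            show "C2 * real N powr ((\<Sum>i\<in>{..n} - {j}. 1 / real (m i)) - 1 + \<kappa> / 2) * real d powr (- 3 / 4)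
              \<le> C2 * real N powr ((\<Sum>i\<in>{..n} - {j}. 1 / real (m i)) - 1 + \<kappa> / 2)"
              using d34 C2(1) by (intro mult_right_le_one_le) auto
          qed
        qed (use C2(1) C3 minor[OF d N1 R dvd Np] in auto)
        also have "\<kappa> / 2 - \<kappa> = - (\<kappa> / 2)" by simp
        also have "real N powr (- (\<kappa> / 2)) \<le> real B powr (- (\<kappa> / 2))" using N B kap by (intro powr_mono2') auto
        also have "real B powr (- (\<kappa> / 2)) \<le> real B powr (- \<eta>)" by (rule bmono) (rule eta)
        finally show ?thesis using C0(1) by (simp add: L_def mult_left_mono)
      qed
      have AA: "norm (A B - A B') \<le> E * real B powr (- \<eta>) * L"
      proof -
        have Tb: "norm (T d N R i r) \<le> C1" if "i \<le> n" "N \<ge> 1" for N i r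
        proof -
          have "norm (T d N R i r) \<le> real N powr (- (1 / real (m i))) * (C1 * real N powr (1 / real (m i)) * real d powr (- 3 / 4))"
            unfolding T_def norm_mult using C1(2)[OF that(1) d] by (simp add: mult_left_mono)
          also have "\<dots> \<le> real N powr (- (1 / real (m i))) * (C1 * real N powr (1 / real (m i)) * 1)"
            using d34 C1(1) by (intro mult_left_mono) auto
          also have "\<dots> = C1 * (real N powr (- (1 / real (m i))) * real N powr (1 / real (m i)))" by simp
          also have "real N powr (- (1 / real (m i))) * real N powr (1 / real (m i)) = 1" using that(2) by (simp flip: powr_add)
          finally show ?thesis by simp
        qed
        have "norm (A B - A B') \<le> (\<Sum>x\<in>arcs p R. C1 ^ n * (real (n + 1) * (K * real_of_int p ^ 2 * real B powr (- \<delta>))))"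
          unfolding A_def sum_subtractf[symmetric]
        proof (rule sum_norm_le)
          fix x assume x: "x \<in> arcs p R"
          define u where "u i = T d B R i (arc_point R (int B * csum) x)" for i
          define v where "v i = T d B' R i (arc_point R (int B' * csum) x)" for i
          \<comment> \<open>Division by \<open>C1\<close> brings all factors into the unit disc,
            where the difference of two products is at most the sum of the differences.\<close>
          have "(\<Prod>i\<le>n. u i) - (\<Prod>i\<le>n. v i) = of_real (C1 ^ (n + 1)) * ((\<Prod>i\<le>n. u i / of_real C1) - (\<Prod>i\<le>n. v i / of_real C1))"
            using C1(1) by (simp add: prod_dividef right_diff_distrib)
          then have "norm ((\<Prod>i\<le>n. u i) - (\<Prod>i\<le>n. v i)) = C1 ^ (n + 1) * norm ((\<Prod>i\<le>n. u i / of_real C1) - (\<Prod>i\<le>n. v i / of_real C1))"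
            using C1(1) by (simp add: norm_mult norm_power)
          also have "norm ((\<Prod>i\<le>n. u i / of_real C1) - (\<Prod>i\<le>n. v i / of_real C1)) \<le> (\<Sum>i\<le>n. norm (u i / of_real C1 - v i / of_real C1))"
            using Tb B C1(1) by (intro norm_prod_diff) (auto simp: norm_divide u_def v_def)
          also have "\<dots> \<le> (\<Sum>i\<le>n. K * real_of_int p ^ 2 * real B powr (- \<delta>) / C1)"
          proof (intro sum_mono)
            fix i assume "i \<in> {..n}"
            then have "norm (u i - v i) \<le> K * real_of_int p ^ 2 * real B powr (- \<delta>)"
              unfolding u_def v_def using major[OF _ d B(1,2) R dvd x] by simp
            then show "norm (u i / of_real C1 - v i / of_real C1) \<le> K * real_of_int p ^ 2 * real B powr (- \<delta>) / C1"
              using C1(1) by (simp add: norm_divide divide_right_mono flip: diff_divide_distrib)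
          qed
          also have "\<dots> = real (n + 1) * (K * real_of_int p ^ 2 * real B powr (- \<delta>)) / C1" by simp
          finally show "norm ((\<Prod>i\<le>n. u i) - (\<Prod>i\<le>n. v i)) \<le> C1 ^ n * (real (n + 1) * (K * real_of_int p ^ 2 * real B powr (- \<delta>)))"
            using C1(1) by (simp add: mult_left_mono)
        qed
        also have "\<dots> = real (card (arcs p R)) * (C1 ^ n * (real (n + 1) * (K * real_of_int p ^ 2 * real B powr (- \<delta>))))" by simp
        also have "real (card (arcs p R)) \<le> real_of_int p ^ 2 * (3 * real_of_int p * L)"
        proof -
          have U1: "1 \<le> p * R * csum"
          proof -
            have "1 * 1 * 1 \<le> p * R * csum" using p1 R csum(4) by (intro mult_mono) auto
            then show ?thesis by simp
          qed
          have "real (card {- u..u}) = 2 * real_of_int u + 1" if "u \<ge> 1" for u :: int using that by simp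
          from this[OF U1] have "real (card {- (p * R * csum)..p * R * csum}) = 2 * real_of_int (p * R * csum) + 1" .
          also have "\<dots> \<le> 3 * real_of_int (p * R * csum)" using U1 by linarith
          also have "\<dots> = 3 * real_of_int p * L" by (simp add: L_def)
          finally have "real (card {- (p * R * csum)..p * R * csum}) \<le> 3 * real_of_int p * L" .
          moreover have "real (card (arc_centres p R)) \<le> real_of_int p ^ 2" using p1 by (intro card_arc_centres_le) simp
          ultimately show ?thesis unfolding card_cartesian_product of_nat_mult by (intro mult_mono) auto
        qed
        also have "real_of_int p ^ 2 * (3 * real_of_int p * L) * (C1 ^ n * (real (n + 1) * (K * real_of_int p ^ 2 * real B powr (- \<delta>))))
            = 3 * C1 ^ n * real (n + 1) * K * L * real B powr (- \<delta>) * real_of_int p ^ 5"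
          by (simp add: eval_nat_numeral)
        also have "\<dots> \<le> 3 * C1 ^ n * real (n + 1) * K * L * real B powr (- \<delta>) * (G ^ 5 * real B powr (real 5 * \<rho>))"
          using pk[of 5] C1(1) K L1 by (intro mult_left_mono) auto
        also have "\<dots> = E * L * (real B powr (- \<delta>) * real B powr (real 5 * \<rho>))" by (simp add: E_def)
        also have "real B powr (- \<delta>) * real B powr (real 5 * \<rho>) = real B powr (- (7 * \<delta> / 12))"
          by (simp only: powr_add[symmetric]) (simp add: \<rho>_def)
        also have "\<dots> \<le> real B powr (- \<eta>)" using eta(2) del by (intro bmono) simp
        finally have "norm (A B - A B') \<le> E * L * real B powr (- \<eta>)" using E0 L1 C1(1) K by (simp add: mult_left_mono mult_right_mono)
        then show ?thesis by (simp add: mult_ac)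
      qed
      define f where "f N = real (card (solutions d N)) * real N powr (- \<Theta>)" for N
      have "\<bar>f B - f B'\<bar> = norm (of_real (f B) - of_real (f B') :: complex)" by (simp flip: of_real_diff)
      also have "of_real (f B) - of_real (f B') = (of_real (f B) - A B / of_real L) + ((A B - A B') / of_real L - (of_real (f B') - A B' / of_real L))"
        by (simp add: diff_divide_distrib)
      also have "norm \<dots> \<le> norm (of_real (f B) - A B / of_real L) + (norm ((A B - A B') / of_real L) + norm (of_real (f B') - A B' / of_real L))"
        by (intro order_trans[OF norm_triangle_ineq] add_left_mono norm_triangle_ineq4)
      also have "\<dots> \<le> C3 * C2 * real B powr (- \<eta>) + (E * real B powr (- \<eta>) + C3 * C2 * real B powr (- \<eta>))"
      proof (intro add_mono)
        show "norm (of_real (f B) - A B / of_real L) \<le> C3 * C2 * real B powr (- \<eta>)" unfolding f_def using B by (intro appr) auto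
        show "norm (of_real (f B') - A B' / of_real L) \<le> C3 * C2 * real B powr (- \<eta>)" unfolding f_def using B by (intro appr) auto
        show "norm ((A B - A B') / of_real L) \<le> E * real B powr (- \<eta>)" using AA L1 by (simp add: norm_divide pos_divide_le_eq)
      qed
      also have "\<dots> = (E + 2 * (C3 * C2)) * real B powr (- \<eta>)" by (simp add: algebra_simps)
      also have "\<dots> \<le> C * real B powr (- \<eta>)" using C0 by (intro mult_right_mono) (auto simp: C_def)
      finally show ?thesis by (simp only: f_def)
    qed
  qed
  moreover have "C \<ge> 0" using E0 C3 C2(1) C4(1) by (simp add: C_def)
  ultimately show ?thesis using eta(1) by blast
qed

end

section \<open>Primitive solutions and the asymptotic formula\<close>

text \<open>The signs are the values of the Moebius function. For \<open>g > 1\<close> with a prime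
  divisor \<open>p\<close>, multiplication by \<open>p\<close> pairs the square-free divisors prime
  to \<open>p\<close> with the others and flips the sign.\<close>

lemma sum_sign_squarefree_divisors:
  fixes g :: nat
  assumes g: "g > 0"
  shows "(\<Sum>d | d dvd g \<and> squarefree d. (- 1) ^ card (prime_factors d)) = (if g = 1 then 1 else 0 :: int)"
proof (cases "g = 1")
  case True
  have "{d. d dvd g \<and> squarefree d} = {1}" using True by auto
  then show ?thesis using True by simp
next
  case False
  obtain p where p: "prime p" "p dvd g" using False prime_factor_nat[of g] by auto
  define D0 where "D0 = {d. d dvd g \<and> squarefree d \<and> \<not> p dvd d}"
  define D1 where "D1 = {d. d dvd g \<and> squarefree d \<and> p dvd d}"
  have fin: "finite {d. d dvd g}" using g by simp
  have f: "finite D0" "finite D1" by (rule finite_subset[OF _ fin], auto simp: D0_def D1_def)+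
  have U: "{d. d dvd g \<and> squarefree d} = D0 \<union> D1" "D0 \<inter> D1 = {}" by (auto simp: D0_def D1_def)
  have D1: "D1 = (*) p ` D0"
  proof (intro equalityI subsetI)
    fix d assume "d \<in> D1"
    then obtain e where e: "d = p * e" "d dvd g" "squarefree d" by (auto simp: D1_def)
    have "\<not> p dvd e"
    proof
      assume "p dvd e"
      then have "p ^ 2 dvd d" by (simp add: e(1) power2_eq_square)
      then have "p dvd 1" using e(3) by (simp add: squarefree_def)
      then show False using p(1) by (simp add: prime_nat_iff)
    qed
    moreover have "squarefree e" using e(1,3) squarefree_multD(2) by blast
    moreover have "e dvd g" using e(1,2) dvd_mult_right by blast
    ultimately show "d \<in> (*) p ` D0" using e(1) by (auto simp: D0_def)
  next
    fix d assume "d \<in> (*) p ` D0"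
    then obtain e where e: "d = p * e" "e dvd g" "squarefree e" "\<not> p dvd e" by (auto simp: D0_def)
    have cop: "coprime p e" using e(4) p(1) prime_imp_coprime by blast
    have "squarefree d" unfolding e(1) using cop e(3) p(1) by (intro squarefree_mult_coprime) (auto intro: squarefree_prime)
    moreover have "d dvd g" unfolding e(1) using cop p(2) e(2) by (intro divides_mult) auto
    ultimately show "d \<in> D1" by (simp add: D1_def e(1))
  qed
  have s: "(- 1) ^ card (prime_factors (p * d)) = - ((- 1) ^ card (prime_factors d) :: int)" if "d \<in> D0" for d
  proof -
    have d: "d > 0" "\<not> p dvd d" using that g by (auto simp: D0_def intro!: gr0I)
    have "prime_factors (p * d) = insert p (prime_factors d)"
      using d p(1) by (subst prime_factors_product) (auto simp: prime_prime_factors)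
    moreover have "p \<notin> prime_factors d" using d by auto
    ultimately show ?thesis by simp
  qed
  have "(\<Sum>d\<in>D1. (- 1) ^ card (prime_factors d)) = (\<Sum>d\<in>D0. (- 1) ^ card (prime_factors (p * d)) :: int)"
    unfolding D1 using p(1) by (subst sum.reindex) (auto simp: inj_on_def)
  also have "\<dots> = - (\<Sum>d\<in>D0. (- 1) ^ card (prime_factors d))" using s by (simp add: sum_negf)
  finally show ?thesis unfolding U(1) using False f U(2) by (simp add: sum.union_disjoint)
qed

lemma mem_full_signed_iff: "x \<in> full_signed k d B \<longleftrightarrow> m_full k x \<and> int d dvd x \<and> \<bar>x\<bar> \<le> int B"
proof -
  have 1: "x \<in> full_signed k d B \<longleftrightarrow> nat \<bar>x\<bar> \<in> full_upto k d B"
    by (cases x rule: int_cases2) (auto simp: full_signed_def full_upto_def image_iff)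
  have 2: "(\<forall>p. prime p \<longrightarrow> p dvd nat \<bar>x\<bar> \<longrightarrow> p ^ k dvd nat \<bar>x\<bar>) \<longleftrightarrow> (\<forall>p::int. prime p \<longrightarrow> p dvd x \<longrightarrow> p ^ k dvd x)"
  proof safe
    fix p :: int assume h: "\<forall>p. prime p \<longrightarrow> p dvd nat \<bar>x\<bar> \<longrightarrow> p ^ k dvd nat \<bar>x\<bar>" "prime p" "p dvd x"
    have p0: "p \<ge> 0" using h(2) by (rule prime_ge_0_int)
    then obtain q where q: "p = int q" using nonneg_int_cases by blast
    have "prime q" "q dvd nat \<bar>x\<bar>" using h(2,3) by (simp_all add: q)
    then have "q ^ k dvd nat \<bar>x\<bar>" using h(1) by blast
    then have "int (q ^ k) dvd x" by (simp only: int_dvd_int_iff[symmetric]) simp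
    then show "p ^ k dvd x" by (simp add: q)
  next
    fix p :: nat assume h: "\<forall>p::int. prime p \<longrightarrow> p dvd x \<longrightarrow> p ^ k dvd x" "prime p" "p dvd nat \<bar>x\<bar>"
    have "prime (int p)" "int p dvd x" using h(2,3) by simp_all
    then have "int (p ^ k) dvd x" using h(1) by simp
    then have "int (p ^ k) dvd int (nat \<bar>x\<bar>)" by simp
    then show "p ^ k dvd nat \<bar>x\<bar>" by (simp only: of_nat_dvd_iff)
  qed
  have 3: "d dvd nat \<bar>x\<bar> \<longleftrightarrow> int d dvd x"
  proof -
    have "d dvd nat \<bar>x\<bar> \<longleftrightarrow> int d dvd int (nat \<bar>x\<bar>)" by (simp only: of_nat_dvd_iff)
    then show ?thesis by simp
  qed
  show ?thesis unfolding 1 unfolding full_upto_def mem_Collect_eq 2 3 m_full_def by auto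
qed

context diagonal_data
begin

lemma finite_solutions [simp]: "finite (solutions d B)"
proof (rule finite_subset)
  show "finite (PiE {..n} (\<lambda>i. full_signed (m i) d B))" by (intro finite_PiE) auto
qed (auto simp: solutions_def)

lemma mem_solutions_iff:
  "x \<in> solutions d B \<longleftrightarrow> x \<in> extensional {..n} \<and> (\<forall>i\<le>n. m_full (m i) (x i) \<and> int d dvd x i \<and> \<bar>x i\<bar> \<le> int B) \<and> (\<Sum>i\<le>n. c i * x i) = 0"
  by (auto simp: solutions_def PiE_iff mem_full_signed_iff)

text \<open>The gcd runs over the first \<open>n\<close> coordinates only, but since
  \<open>c n = - 1\<close> the equation makes every common divisor of them divide
  \<open>x n\<close>. The inversion therefore involves solutions with all coordinates divisible by
  \<open>d\<close>, as in \<open>solutions d B\<close>.\<close>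

lemma card_primitive_solutions:
  assumes cn: "c n = - 1" and n: "n \<ge> 1"
  shows "int (card {x \<in> solutions 1 B. Gcd (x ` {..<n}) = 1})
    = (\<Sum>d | d \<in> {1..B} \<and> squarefree d. (- 1) ^ card (prime_factors d) * int (card (solutions d B)))"
proof -
  define g where "g x = nat (Gcd (x ` {..<n}))" for x :: "nat \<Rightarrow> int"
  have g_int: "int (g x) = Gcd (x ` {..<n})" for x by (simp add: g_def)
  have g: "g x > 0" "g x \<le> B" if x: "x \<in> solutions 1 B" for x
  proof -
    have x0: "x 0 \<noteq> 0" "\<bar>x 0\<bar> \<le> int B" using x by (auto simp: mem_solutions_iff m_full_def)
    have dv: "Gcd (x ` {..<n}) dvd x 0" using n by (intro Gcd_dvd) auto
    then have "Gcd (x ` {..<n}) \<noteq> 0" using x0(1) by auto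
    then have "int (g x) \<noteq> 0" using g_int by simp
    then show "g x > 0" by simp
    have "\<bar>Gcd (x ` {..<n})\<bar> \<le> \<bar>x 0\<bar>" by (rule dvd_imp_le_int[OF x0(1) dv])
    then show "g x \<le> B" using x0(2) g_int[of x] by simp
  qed
  have dvd: "x \<in> solutions d B \<longleftrightarrow> x \<in> solutions 1 B \<and> d dvd g x" for x d
  proof -
    have eq: "d dvd g x \<longleftrightarrow> (\<forall>i<n. int d dvd x i)"
    proof -
      have "d dvd g x \<longleftrightarrow> int d dvd Gcd (x ` {..<n})" by (simp only: g_int[symmetric] of_nat_dvd_iff)
      then show ?thesis by (auto simp: dvd_Gcd_iff)
    qed
    have "int d dvd x n" if s: "(\<Sum>i\<le>n. c i * x i) = 0" and h: "\<forall>i<n. int d dvd x i"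
    proof -
      have "x n = (\<Sum>i<n. c i * x i)" using s cn by (simp add: lessThan_Suc_atMost[symmetric])
      also have "int d dvd \<dots>" using h by (intro dvd_sum) auto
      finally show ?thesis .
    qed
    then show ?thesis unfolding mem_solutions_iff eq by (auto simp: le_less)
  qed
  define s where "s d = ((- 1) ^ card (prime_factors d) :: int)" for d :: nat
  have "int (card {x \<in> solutions 1 B. Gcd (x ` {..<n}) = 1}) = (\<Sum>x\<in>solutions 1 B. if g x = 1 then 1 else 0)"
  proof -
    have "g x = 1 \<longleftrightarrow> Gcd (x ` {..<n}) = 1" for x using g_int[of x] by linarith
    then show ?thesis by (simp add: sum.If_cases Int_def)
  qed
  also have "\<dots> = (\<Sum>x\<in>solutions 1 B. \<Sum>d | d dvd g x \<and> squarefree d. s d)"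
    unfolding s_def using g by (intro sum.cong refl) (simp add: sum_sign_squarefree_divisors)
  also have "\<dots> = (\<Sum>x\<in>solutions 1 B. \<Sum>d | d \<in> {1..B} \<and> squarefree d. if d dvd g x then s d else 0)"
  proof (rule sum.cong[OF refl])
    fix x assume x: "x \<in> solutions 1 B"
    have "(\<Sum>d | d dvd g x \<and> squarefree d. s d) = (\<Sum>d\<in>{d. d \<in> {1..B} \<and> squarefree d} \<inter> {d. d dvd g x}. s d)"
    proof (intro sum.cong refl set_eqI iffI)
      fix d assume "d \<in> {d. d dvd g x \<and> squarefree d}"
      then have "d dvd g x" "squarefree d" by auto
      moreover have "d \<le> g x" "d > 0" using \<open>d dvd g x\<close> g[OF x] by (auto intro: dvd_imp_le dvd_pos_nat)
      ultimately show "d \<in> {d. d \<in> {1..B} \<and> squarefree d} \<inter> {d. d dvd g x}" using g(2)[OF x] by auto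
    qed auto
    then show "(\<Sum>d | d dvd g x \<and> squarefree d. s d) = (\<Sum>d | d \<in> {1..B} \<and> squarefree d. if d dvd g x then s d else 0)"
      by (simp add: sum.inter_restrict)
  qed
  also have "\<dots> = (\<Sum>d | d \<in> {1..B} \<and> squarefree d. \<Sum>x\<in>solutions 1 B. if d dvd g x then s d else 0)" by (rule sum.swap)
  also have "\<dots> = (\<Sum>d | d \<in> {1..B} \<and> squarefree d. s d * int (card (solutions d B)))"
  proof (intro sum.cong refl)
    fix d
    have "solutions d B = {x \<in> solutions 1 B. d dvd g x}" using dvd by blast
    then show "(\<Sum>x\<in>solutions 1 B. if d dvd g x then s d else 0) = s d * int (card (solutions d B))"
      by (simp add: sum.If_cases Int_def)
  qed
  finally show ?thesis by (simp only: s_def)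
qed

definition primitive_density :: "nat \<Rightarrow> real" where
  "primitive_density B = (\<Sum>d | d \<in> {1..B} \<and> squarefree d. (- 1) ^ card (prime_factors d) * (real (card (solutions d B)) * real B powr (- \<Theta>)))"

lemma primitive_density_compare:
  "\<exists>K \<eta>. \<eta> > 0 \<and> \<eta> \<le> 1 \<and> (\<forall>B B'. 1 \<le> B \<longrightarrow> B \<le> B' \<longrightarrow> B' \<le> 2 * B \<longrightarrow> \<bar>primitive_density B - primitive_density B'\<bar> \<le> K * real B powr (- \<eta>))"
proof -
  obtain C \<eta> where C: "C \<ge> 0" and eta: "\<eta> > 0" and cmp: "\<And>d B B'. squarefree d \<Longrightarrow> 1 \<le> B \<Longrightarrow> B \<le> B' \<Longrightarrow> B' \<le> 2 * B \<Longrightarrow>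
    \<bar>real (card (solutions d B)) * real B powr (- \<Theta>) - real (card (solutions d B')) * real B' powr (- \<Theta>)\<bar> \<le> C * real B powr (- \<eta>)"
    using solutions_compare by blast
  \<comment> \<open>For \<open>d\<close> up to \<open>B powr \<tau>\<close> the comparison loses at
    most the number of terms, which half of \<eta> pays for. Beyond that,
    \<open>d powr (- 1 / 4)\<close> saves \<open>B powr (- \<tau> / 4)\<close> against the loss
    \<open>B powr (\<tau> / 8)\<close>, and \<open>d powr (- 5 / 4)\<close> remains for
    convergence.\<close>
  define \<tau> where "\<tau> = min \<eta> 1 / 2"
  have tau: "\<tau> > 0" "2 * \<tau> \<le> \<eta>" "\<tau> \<le> 1 / 2" using eta by (auto simp: \<tau>_def min_def)
  obtain C4 where C4: "C4 \<ge> 1" "\<And>d B. squarefree d \<Longrightarrow> B \<ge> 1 \<Longrightarrow> real (card (solutions d B)) \<le> C4 * real B powr (\<Theta> + \<tau> / 8) * real d powr (- 3 / 2)"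
    using card_solutions_tail[of "\<tau> / 8"] tau(1) by auto
  define Z where "Z = (\<Sum>d. real d powr (- 5 / 4))"
  have sZ: "summable (\<lambda>d. real d powr (- 5 / 4))" by (simp add: summable_real_powr_iff)
  have Z0: "Z \<ge> 0" unfolding Z_def using sZ by (intro suminf_nonneg) auto
  define f where "f d N = real (card (solutions d N)) * real N powr (- \<Theta>)" for d N
  define s where "s d = ((- 1) ^ card (prime_factors d) :: real)" for d :: nat
  have s1: "\<bar>s d\<bar> = 1" for d by (simp add: s_def power_abs)
  have "\<bar>primitive_density B - primitive_density B'\<bar> \<le> (C + 4 * C4 * Z) * real B powr (- (\<tau> / 8))"
    if B: "1 \<le> B" "B \<le> B'" "B' \<le> 2 * B" for B B'
  proof -
    define F where "F = {d. squarefree d \<and> real d \<le> real B powr \<tau>}"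
    have "real B powr \<tau> \<le> real B powr 1" using B tau by (intro powr_mono) auto
    then have Btau: "real B powr \<tau> \<le> real B" using B by simp
    have F: "F \<subseteq> {d. d \<in> {1..N} \<and> squarefree d}" if "B \<le> N" for N
    proof
      fix d assume "d \<in> F"
      then have "squarefree d" "real d \<le> real B" using Btau by (auto simp: F_def)
      moreover have "d > 0" using \<open>squarefree d\<close> by (metis not_squarefree_0 gr0I)
      ultimately show "d \<in> {d. d \<in> {1..N} \<and> squarefree d}" using that by auto
    qed
    have finF: "finite F" using F[of B] by (rule finite_subset) (auto simp: finite_subset[of _ "{1..B}"])
    have cardF: "real (card F) \<le> real B powr \<tau>"
    proof -
      have "F \<subseteq> {1..nat \<lfloor>real B powr \<tau>\<rfloor>}"
      proof
        fix d assume d: "d \<in> F"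
        then have "d \<in> {1..B}" using F[of B] by auto
        moreover have "real d \<le> real B powr \<tau>" using d by (simp add: F_def)
        ultimately show "d \<in> {1..nat \<lfloor>real B powr \<tau>\<rfloor>}" by (auto simp: le_nat_floor)
      qed
      then have "card F \<le> card {1..nat \<lfloor>real B powr \<tau>\<rfloor>}" by (intro card_mono) auto
      then have "card F \<le> nat \<lfloor>real B powr \<tau>\<rfloor>" by (simp only: card_atLeastAtMost diff_Suc_1)
      then have "real (card F) \<le> real (nat \<lfloor>real B powr \<tau>\<rfloor>)" by (rule of_nat_mono)
      also have "\<dots> \<le> real B powr \<tau>" by (simp add: of_nat_floor)
      finally show ?thesis .
    qed
    have split: "\<bar>primitive_density N - (\<Sum>d\<in>F. s d * f d N)\<bar> \<le> 2 * C4 * Z * real B powr (- (\<tau> / 8))" if N: "B \<le> N" "N \<le> 2 * B" for N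
    proof -
      have fin: "finite {d. d \<in> {1..N} \<and> squarefree d}" by (rule finite_subset[of _ "{1..N}"]) auto
      define G where "G = {d. d \<in> {1..N} \<and> squarefree d} - F"
      have finG: "finite G" using fin by (simp add: G_def)
      have "primitive_density N = (\<Sum>d\<in>G. s d * f d N) + (\<Sum>d\<in>F. s d * f d N)"
        unfolding primitive_density_def G_def f_def s_def using F[OF N(1)] fin by (intro sum.subset_diff) auto
      then have "\<bar>primitive_density N - (\<Sum>d\<in>F. s d * f d N)\<bar> = \<bar>\<Sum>d\<in>G. s d * f d N\<bar>" by simp
      also have "\<dots> \<le> (\<Sum>d\<in>G. \<bar>s d * f d N\<bar>)" by (rule sum_abs)
      also have "\<dots> \<le> (\<Sum>d\<in>G. (2 * C4 * real B powr (- (\<tau> / 8))) * real d powr (- 5 / 4))"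
      proof (intro sum_mono)
        fix d assume d: "d \<in> G"
        then have d': "squarefree d" "d \<ge> 1" "real d > real B powr \<tau>" by (auto simp: G_def F_def)
        have N1: "N \<ge> 1" using N B by simp
        have "\<bar>s d * f d N\<bar> = f d N" by (simp add: abs_mult s1 f_def)
        also have "f d N \<le> (C4 * real N powr (\<Theta> + \<tau> / 8) * real d powr (- 3 / 2)) * real N powr (- \<Theta>)"
          unfolding f_def using C4(2)[OF d'(1) N1] by (intro mult_right_mono) auto
        also have "\<dots> = C4 * (real N powr (\<Theta> + \<tau> / 8) * real N powr (- \<Theta>)) * real d powr (- 3 / 2)" by simp
        also have "real N powr (\<Theta> + \<tau> / 8) * real N powr (- \<Theta>) = real N powr (\<tau> / 8)" by (simp only: powr_add[symmetric]) simp
        also have "real N powr (\<tau> / 8) \<le> 2 * real B powr (\<tau> / 8)"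
        proof -
          have "real N powr (\<tau> / 8) \<le> (2 * real B) powr (\<tau> / 8)" using N tau by (intro powr_mono2) auto
          also have "\<dots> = 2 powr (\<tau> / 8) * real B powr (\<tau> / 8)" by (simp add: powr_mult)
          also have "\<dots> \<le> 2 powr 1 * real B powr (\<tau> / 8)" using tau by (intro mult_right_mono powr_mono) auto
          finally show ?thesis by simp
        qed
        also have "real d powr (- 3 / 2) = real d powr (- 1 / 4) * real d powr (- 5 / 4)" by (simp only: powr_add[symmetric]) simp
        also have "real d powr (- 1 / 4) \<le> (real B powr \<tau>) powr (- 1 / 4)" using d' B by (intro powr_mono2') auto
        also have "(real B powr \<tau>) powr (- 1 / 4) = real B powr (- \<tau> / 4)" by (simp add: powr_powr)
        also have "C4 * (2 * real B powr (\<tau> / 8)) * (real B powr (- \<tau> / 4) * real d powr (- 5 / 4)) =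
            (2 * C4 * (real B powr (\<tau> / 8) * real B powr (- \<tau> / 4))) * real d powr (- 5 / 4)" by simp
        also have "real B powr (\<tau> / 8) * real B powr (- \<tau> / 4) = real B powr (- (\<tau> / 8))" by (simp only: powr_add[symmetric]) simp
        finally show "\<bar>s d * f d N\<bar> \<le> (2 * C4 * real B powr (- (\<tau> / 8))) * real d powr (- 5 / 4)"
          using C4(1) by (simp add: mult_left_mono mult_right_mono)
      qed
      also have "\<dots> = (2 * C4 * real B powr (- (\<tau> / 8))) * (\<Sum>d\<in>G. real d powr (- 5 / 4))" by (simp only: sum_distrib_left)
      also have "\<dots> \<le> (2 * C4 * real B powr (- (\<tau> / 8))) * Z"
        unfolding Z_def using C4(1) sZ finG by (intro mult_left_mono sum_le_suminf) auto
      finally show ?thesis by (simp add: mult_ac)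
    qed
    have main: "\<bar>(\<Sum>d\<in>F. s d * f d B) - (\<Sum>d\<in>F. s d * f d B')\<bar> \<le> C * real B powr (- (\<tau> / 8))"
    proof -
      have "(\<Sum>d\<in>F. s d * f d B) - (\<Sum>d\<in>F. s d * f d B') = (\<Sum>d\<in>F. s d * (f d B - f d B'))"
        by (simp add: sum_subtractf right_diff_distrib)
      also have "\<bar>\<dots>\<bar> \<le> (\<Sum>d\<in>F. \<bar>s d * (f d B - f d B')\<bar>)" by (rule sum_abs)
      also have "\<dots> \<le> (\<Sum>d\<in>F. C * real B powr (- \<eta>))"
      proof (intro sum_mono)
        fix d assume "d \<in> F"
        then show "\<bar>s d * (f d B - f d B')\<bar> \<le> C * real B powr (- \<eta>)"
          using cmp[of d B B'] B by (simp add: abs_mult s1 f_def F_def)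
      qed
      also have "\<dots> = real (card F) * (C * real B powr (- \<eta>))" by simp
      also have "\<dots> \<le> real B powr \<tau> * (C * real B powr (- \<eta>))" using cardF C by (intro mult_right_mono) auto
      also have "\<dots> = C * (real B powr \<tau> * real B powr (- \<eta>))" by simp
      also have "real B powr \<tau> * real B powr (- \<eta>) = real B powr (\<tau> - \<eta>)" by (simp only: powr_add[symmetric]) simp
      also have "real B powr (\<tau> - \<eta>) \<le> real B powr (- (\<tau> / 8))" using B tau by (intro powr_mono) auto
      finally show ?thesis using C by (simp add: mult_left_mono)
    qed
    have tri: "\<bar>a - b\<bar> \<le> u + 2 * v" if "\<bar>a - a'\<bar> \<le> v" "\<bar>b - b'\<bar> \<le> v" "\<bar>a' - b'\<bar> \<le> u" for a b a' b' u v :: real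
      using that by linarith
    have "\<bar>primitive_density B - primitive_density B'\<bar> \<le> C * real B powr (- (\<tau> / 8)) + 2 * (2 * C4 * Z * real B powr (- (\<tau> / 8)))"
      by (rule tri[OF split split main]) (use B in auto)
    then show ?thesis by (simp add: distrib_right)
  qed
  then show ?thesis using tau by (intro exI[of _ "C + 4 * C4 * Z"] exI[of _ "\<tau> / 8"]) auto
qed

end

section \<open>Passage to the limit and to real B\<close>

text \<open>Doubling \<open>B\<close> repeatedly gives a geometric series of errors; its sum
  \<open>K'\<close> satisfies \<open>K + K' * 2 powr (- \<eta>) = K'\<close>, which is the induction
  step.\<close>

lemma dyadic_limit_with_rate:
  fixes f :: "nat \<Rightarrow> real"
  assumes eta: "\<eta> > 0" and cmp: "\<And>B B'. 1 \<le> B \<Longrightarrow> B \<le> B' \<Longrightarrow> B' \<le> 2 * B \<Longrightarrow> \<bar>f B - f B'\<bar> \<le> K * real B powr (- \<eta>)"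
  obtains L K' where "f \<longlonglongrightarrow> L" "K' \<ge> 0" "\<And>B. B \<ge> 1 \<Longrightarrow> \<bar>f B - L\<bar> \<le> K' * real B powr (- \<eta>)"
proof -
  have K: "K \<ge> 0" using cmp[of 1 1] by simp
  have lt: "2 powr (- \<eta>) < (1 :: real)" using powr_less_mono[of "- \<eta>" 0 2] eta by simp
  define K' where "K' = K / (1 - 2 powr (- \<eta>))"
  have K': "K' \<ge> 0" "K + K' * 2 powr (- \<eta>) = K'" 
  proof -
    show "K' \<ge> 0" using K lt by (simp add: K'_def)
    have "K' * (1 - 2 powr (- \<eta>)) = K" using lt eta by (simp add: K'_def)
    then show "K + K' * 2 powr (- \<eta>) = K'" by (simp add: right_diff_distrib)
  qed
  have KK: "K \<le> K'"
  proof -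
    have "K' * 2 powr (- \<eta>) \<ge> 0" using K'(1) by simp
    then show ?thesis using K'(2) by linarith
  qed
  have far: "\<bar>f B - f B'\<bar> \<le> K' * real B powr (- \<eta>)" if "1 \<le> B" "B \<le> B'" for B B'
    using that
  proof (induction "B' - B" arbitrary: B rule: less_induct)
    case less
    show ?case
    proof (cases "B' \<le> 2 * B")
      case True
      have "\<bar>f B - f B'\<bar> \<le> K * real B powr (- \<eta>)" using cmp less.prems True by blast
      also have "\<dots> \<le> K' * real B powr (- \<eta>)" using KK by (intro mult_right_mono) auto
      finally show ?thesis .
    next
      case False
      have "\<bar>f (2 * B) - f B'\<bar> \<le> K' * real (2 * B) powr (- \<eta>)" using less.prems False by (intro less.hyps) auto
      also have "real (2 * B) powr (- \<eta>) = 2 powr (- \<eta>) * real B powr (- \<eta>)" by (simp add: powr_mult)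
      finally have "\<bar>f B - f B'\<bar> \<le> K * real B powr (- \<eta>) + K' * (2 powr (- \<eta>) * real B powr (- \<eta>))"
        using cmp[of B "2 * B"] less.prems by simp
      also have "\<dots> = (K + K' * 2 powr (- \<eta>)) * real B powr (- \<eta>)" by (simp add: distrib_right)
      finally show ?thesis using K'(2) by simp
    qed
  qed
  have lim0: "(\<lambda>B. K' * real B powr (- \<eta>)) \<longlonglongrightarrow> 0"
    using tendsto_mult_right_zero[OF tendsto_neg_powr[of "- \<eta>", OF _ filterlim_real_sequentially]] eta by simp
  have "Cauchy f"
  proof (rule metric_CauchyI)
    fix e :: real assume "e > 0"
    then have "eventually (\<lambda>B. K' * real B powr (- \<eta>) < e / 2) sequentially" using order_tendstoD(2)[OF lim0, of "e / 2"] by simp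
    then obtain M0 where M0: "\<And>B. B \<ge> M0 \<Longrightarrow> K' * real B powr (- \<eta>) < e / 2" by (auto simp: eventually_sequentially)
    define M where "M = max M0 1"
    have M: "\<bar>f M - f B\<bar> < e / 2" if "B \<ge> M" for B using far[of M B] M0[of M] that by (simp add: M_def)
    show "\<exists>M. \<forall>p\<ge>M. \<forall>q\<ge>M. dist (f p) (f q) < e"
    proof (intro exI[of _ M] allI impI)
      fix p q assume "p \<ge> M" "q \<ge> M"
      then show "dist (f p) (f q) < e" using M[of p] M[of q] unfolding dist_real_def by linarith
    qed
  qed
  then obtain L where L: "f \<longlonglongrightarrow> L" using Cauchy_convergent convergent_def by blast
  have "\<bar>f B - L\<bar> \<le> K' * real B powr (- \<eta>)" if B: "B \<ge> 1" for B
  proof (rule LIMSEQ_le_const2)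
    show "(\<lambda>B'. \<bar>f B - f B'\<bar>) \<longlonglongrightarrow> \<bar>f B - L\<bar>" by (intro tendsto_intros L)
    show "\<exists>M. \<forall>B'\<ge>M. \<bar>f B - f B'\<bar> \<le> K' * real B powr (- \<eta>)" using far[OF B] by blast
  qed
  then show ?thesis using that L K'(1) by blast
qed

lemma campana_vectors_eq_primitive_solutions:
  assumes "diagonal_data n (c(n := - 1)) m j" and n: "n \<ge> 1" and B: "B \<ge> 1"
  shows "campana_vectors n c m B = {x \<in> diagonal_data.solutions n (c(n := - 1)) m 1 (nat \<lfloor>B\<rfloor>). Gcd (x ` {..<n}) = 1}"
proof -
  interpret diagonal_data n "c(n := - 1)" m j by fact
  have eq: "(\<Sum>i\<le>n. (c(n := - 1)) i * x i) = 0 \<longleftrightarrow> (\<Sum>i<n. c i * x i) = x n" for x :: "nat \<Rightarrow> int"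
    by (simp add: lessThan_Suc_atMost[symmetric])
  have mx: "real_of_int (max_abs n x) \<le> B \<longleftrightarrow> (\<forall>i\<le>n. \<bar>x i\<bar> \<le> int (nat \<lfloor>B\<rfloor>))" for x
  proof -
    have "real_of_int (max_abs n x) \<le> B \<longleftrightarrow> max_abs n x \<le> \<lfloor>B\<rfloor>" by linarith
    also have "\<dots> \<longleftrightarrow> (\<forall>i\<le>n. \<bar>x i\<bar> \<le> \<lfloor>B\<rfloor>)" unfolding max_abs_def by (subst Max_le_iff) auto
    also have "\<lfloor>B\<rfloor> = int (nat \<lfloor>B\<rfloor>)" using B by simp
    finally show ?thesis .
  qed
  show ?thesis
    unfolding campana_vectors_def mem_solutions_iff eq mx set_eq_iff mem_Collect_eq
    by (auto simp: PiE_iff m_full_def)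
qed

text \<open>Bernoulli's inequality for a natural exponent \<open>k\<close> above \<theta>. It
  controls the replacement of the integer part by \<open>B\<close> itself in the main term, at a
  loss of a full power of \<open>B\<close>.\<close>

lemma powr_diff_le:
  fixes b B :: real
  assumes "1 \<le> b" "b \<le> B" "B \<le> b + 1" "\<theta> \<le> real k" "k \<ge> 1"
  shows "B powr \<theta> - b powr \<theta> \<le> real k * B powr (\<theta> - 1)"
proof -
  have B: "B \<ge> 1" using assms by simp
  have q: "0 < b / B" "b / B \<le> 1" using assms B by auto
  have d: "1 - b / B \<le> 1 / B" using divide_right_mono[of B "b + 1" B] assms B by (simp add: add_divide_distrib)
  have "1 - real k / B \<le> 1 + real k * (b / B - 1)"
  proof -
    have "real k * (1 - b / B) \<le> real k * (1 / B)" using d by (intro mult_left_mono) auto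
    then show ?thesis by (simp add: algebra_simps)
  qed
  also have "\<dots> \<le> (1 + (b / B - 1)) ^ k" using q by (intro Bernoulli_inequality) simp
  also have "\<dots> = (b / B) powr real k" using q(1) by (simp add: powr_realpow)
  also have "\<dots> \<le> (b / B) powr \<theta>" using q assms by (intro powr_mono') auto
  finally have "1 - (b / B) powr \<theta> \<le> real k / B" by simp
  then have "B powr \<theta> * (1 - (b / B) powr \<theta>) \<le> B powr \<theta> * (real k / B)" by (intro mult_left_mono) auto
  moreover have "B powr \<theta> * (b / B) powr \<theta> = b powr \<theta>"
  proof -
    have "(B * (b / B)) powr \<theta> = B powr \<theta> * (b / B) powr \<theta>" by (rule powr_mult)
    then show ?thesis using B by simp
  qed
  moreover have "B powr \<theta> * (real k / B) = real k * B powr (\<theta> - 1)" using B by (simp add: powr_diff)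
  ultimately show ?thesis by (simp add: right_diff_distrib)
qed

theorem theorem1p1:
  fixes n :: nat and c :: "nat \<Rightarrow> int" and m :: "nat \<Rightarrow> nat"
  assumes "n \<ge> 1"
    and "\<And>i. i < n \<Longrightarrow> c i \<noteq> 0"
    and "\<And>i. i \<le> n \<Longrightarrow> m i \<ge> 2"
    and "\<exists>j\<le>n. (\<Sum>i\<in>{..n} - {j}. 1 / (real (m i) * (real (m i) + 1))) \<ge> 1"
  shows "\<exists>C \<eta> :: real. C \<ge> 0 \<and> \<eta> > 0 \<and>
    (\<exists>K::real. \<forall>B::real. B \<ge> 1 \<longrightarrow>
      \<bar>N_campana n c m B - C * B powr ((\<Sum>i\<le>n. 1 / real (m i)) - 1)\<bar>
        \<le> K * B powr ((\<Sum>i\<le>n. 1 / real (m i)) - 1 - \<eta>))"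
proof -
  \<comment> \<open>The index \<open>j\<close> left out by the hypothesis is the one whose sum is
    estimated by Weyl's inequality on the minor arcs; it may be \<open>n\<close>.\<close>
  obtain j where jj: "j \<le> n" "(\<Sum>i\<in>{..n} - {j}. 1 / (real (m i) * (real (m i) + 1))) \<ge> 1"
    using assms(4) by blast
  define c' where "c' = c(n := - 1)"
  have cn: "c' n = - 1" by (simp add: c'_def)
  interpret diagonal_data n c' m j
    by unfold_locales (use assms(2,3) jj in \<open>auto simp: c'_def\<close>)
  have data: "diagonal_data n (c(n := - 1)) m j" unfolding c'_def[symmetric] by unfold_locales
  have Th: "\<Theta> \<ge> 0"
  proof -
    have "1 \<le> (\<Sum>i\<in>{..n} - {j}. 1 / (real (m i) * (real (m i) + 1)))" by (rule jj(2))
    also have "\<dots> \<le> (\<Sum>i\<in>{..n} - {j}. 1 / real (m i))"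
    proof (intro sum_mono)
      fix i assume "i \<in> {..n} - {j}"
      then have "real (m i) > 0" using assms(3)[of i] by auto
      then show "1 / (real (m i) * (real (m i) + 1)) \<le> 1 / real (m i)" by (intro divide_left_mono) (auto simp: distrib_left intro!: mult_pos_pos add_pos_pos)
    qed
    also have "\<dots> \<le> (\<Sum>i\<le>n. 1 / real (m i))" by (intro sum_mono2) auto
    finally show ?thesis by (simp add: \<Theta>_def)
  qed
  obtain K \<eta> where eta: "\<eta> > 0" "\<eta> \<le> 1" and cmp: "\<And>B B'. 1 \<le> B \<Longrightarrow> B \<le> B' \<Longrightarrow> B' \<le> 2 * B \<Longrightarrow>
    \<bar>primitive_density B - primitive_density B'\<bar> \<le> K * real B powr (- \<eta>)"
    using primitive_density_compare by blast
  obtain L K' where L: "primitive_density \<longlonglongrightarrow> L" and K': "K' \<ge> 0" "\<And>B. B \<ge> 1 \<Longrightarrow> \<bar>primitive_density B - L\<bar> \<le> K' * real B powr (- \<eta>)"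
  proof (rule dyadic_limit_with_rate[OF eta(1)])
    show "\<bar>primitive_density B - primitive_density B'\<bar> \<le> K * real B powr (- \<eta>)" if "1 \<le> B" "B \<le> B'" "B' \<le> 2 * B" for B B'
      using that by (rule cmp)
  qed blast
  have card: "real (card (campana_vectors n c m B)) = primitive_density (nat \<lfloor>B\<rfloor>) * real (nat \<lfloor>B\<rfloor>) powr \<Theta>" if B: "B \<ge> 1" for B
  proof -
    define b where "b = nat \<lfloor>B\<rfloor>"
    have "real_of_int (int (card (campana_vectors n c m B))) = (\<Sum>d | d \<in> {1..b} \<and> squarefree d. (- 1) ^ card (prime_factors d) * real (card (solutions d b)))"
      unfolding campana_vectors_eq_primitive_solutions[OF data assms(1) B] b_def[symmetric] c'_def[symmetric]
        card_primitive_solutions[OF cn assms(1)] by simp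
    moreover have "real b powr (- \<Theta>) * real b powr \<Theta> = 1"
    proof -
      have "b \<ge> 1" using B by (simp add: b_def le_nat_floor)
      then show ?thesis by (simp flip: powr_add)
    qed
    ultimately show ?thesis
      unfolding b_def[symmetric] primitive_density_def sum_distrib_right by (simp add: mult.assoc)
  qed
  have L0: "L \<ge> 0"
  proof (rule LIMSEQ_le_const[OF L])
    have "primitive_density b \<ge> 0" if b: "b \<ge> 1" for b
    proof -
      have "primitive_density b * real b powr \<Theta> \<ge> 0" using card[of "real b"] b by (metis of_nat_0_le_iff of_nat_1 of_nat_le_iff floor_of_nat nat_int)
      then show ?thesis using b by (simp add: zero_le_mult_iff)
    qed
    then show "\<exists>M. \<forall>b\<ge>M. 0 \<le> primitive_density b" by blast
  qed
  define k where "k = nat \<lceil>\<Theta>\<rceil> + 1"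
  have k: "\<Theta> \<le> real k" "k \<ge> 1" unfolding k_def by linarith+
  have "\<bar>N_campana n c m B - (L / 2) * B powr \<Theta>\<bar> \<le> (K' + L * real k / 2) * B powr (\<Theta> - \<eta>)" if B: "B \<ge> 1" for B
  proof -
    define b where "b = nat \<lfloor>B\<rfloor>"
    have b: "1 \<le> b" "real b \<le> B" "B \<le> real b + 1" using B by (auto simp: b_def le_nat_floor)
    have "N_campana n c m B - (L / 2) * B powr \<Theta> = (1 / 2) * ((primitive_density b - L) * real b powr \<Theta> - L * (B powr \<Theta> - real b powr \<Theta>))"
      unfolding N_campana_def card[OF B] b_def[symmetric] by (simp add: algebra_simps)
    also have "\<bar>\<dots>\<bar> \<le> (1 / 2) * (\<bar>(primitive_density b - L) * real b powr \<Theta>\<bar> + \<bar>L * (B powr \<Theta> - real b powr \<Theta>)\<bar>)"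
      unfolding abs_mult[of "1 / 2"] by (intro mult_mono abs_triangle_ineq4) auto
    also have "\<dots> \<le> (1 / 2) * (2 * K' * B powr (\<Theta> - \<eta>) + L * real k * B powr (\<Theta> - \<eta>))"
    proof (intro mult_left_mono add_mono)
      have "\<bar>(primitive_density b - L) * real b powr \<Theta>\<bar> = \<bar>primitive_density b - L\<bar> * real b powr \<Theta>" by (simp add: abs_mult)
      also have "\<dots> \<le> (K' * real b powr (- \<eta>)) * B powr \<Theta>"
        using K' b Th by (intro mult_mono powr_mono2) auto
      \<comment> \<open>Since \<open>b \<ge> 1\<close> and \<open>B \<le> b + 1\<close>, the integer
        part is at least \<open>B / 2\<close>.\<close>
      also have "real b powr (- \<eta>) \<le> (B / 2) powr (- \<eta>)" using b B eta by (intro powr_mono2') auto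
      also have "(B / 2) powr (- \<eta>) = B powr (- \<eta>) * 2 powr \<eta>" using B by (simp add: powr_divide powr_minus field_simps)
      also have "2 powr \<eta> \<le> 2 powr (1 :: real)" using eta by (intro powr_mono) auto
      also have "K' * (B powr (- \<eta>) * 2 powr 1) * B powr \<Theta> = 2 * K' * (B powr \<Theta> * B powr (- \<eta>))" by simp
      also have "B powr \<Theta> * B powr (- \<eta>) = B powr (\<Theta> - \<eta>)" by (simp only: powr_add[symmetric]) simp
      finally show "\<bar>(primitive_density b - L) * real b powr \<Theta>\<bar> \<le> 2 * K' * B powr (\<Theta> - \<eta>)"
        using K'(1) by (simp add: mult_left_mono mult_right_mono)
    next
      have "real b powr \<Theta> \<le> B powr \<Theta>" using b Th by (intro powr_mono2) auto
      then have "\<bar>L * (B powr \<Theta> - real b powr \<Theta>)\<bar> = L * (B powr \<Theta> - real b powr \<Theta>)" using L0 by simp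
      also have "\<dots> \<le> L * (real k * B powr (\<Theta> - 1))" using L0 b k by (intro mult_left_mono powr_diff_le) auto
      also have "\<dots> \<le> L * (real k * B powr (\<Theta> - \<eta>))" using L0 B eta by (intro mult_left_mono powr_mono) auto
      finally show "\<bar>L * (B powr \<Theta> - real b powr \<Theta>)\<bar> \<le> L * real k * B powr (\<Theta> - \<eta>)" by simp
    qed simp
    also have "\<dots> = (K' + L * real k / 2) * B powr (\<Theta> - \<eta>)" by (simp add: algebra_simps)
    finally show ?thesis .
  qed
  then show ?thesis using L0 eta(1) unfolding \<Theta>_def
    by (intro exI[of _ "L / 2"] exI[of _ \<eta>]) auto
qed

end
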